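(* Let $q$ be an odd prime power and let $0\le s\le\frac12$ be arbitrary. Let $\varphi\in\mathcal F(A_{q^2})$ and $\psi\in\widetilde{\mathcal F}(B_{q^2})$ be positive harmonic functionals. Then the functional $\varphi\star_s\psi:B_{q^2}\to\mathbb R$ belongs to $\widetilde{\mathcal F}(B_{q^2})$. Moreover, if $\varphi\in\mathcal F_0(A_{q^2})$ and $\psi\in\widetilde{\mathcal F}_0(B_{q^2})$, then $\varphi\star_s\psi$ belongs to $\widetilde{\mathcal F}_0(B_{q^2})$.
   Context: Notation. For a matrix $A=(a_{rs})$ over $\mathbb F_{q^2}$, $A^*$ is the transpose of $(a_{rs}^q)$. $J_m$ is the $m\times m$ matrix with $1$'s on the antidiagonal and $0$ elsewhere. $\mathrm U(2n,\mathbb F_{q^2})=\{g\in\mathrm{GL}(2n,\mathbb F_{q^2}):g^*J_{2n}g=J_{2n}\}$ and $\mathfrak u(2n,\mathbb F_{q^2})=\{X\in\mathfrak{gl}(2n,\mathbb F_{q^2}):X^*J_{2n}+J_{2n}X=0\}$. $\mathcal C(\cdot)$ denotes the real vector space of real-valued functions on a matrix Lie algebra invariant under conjugation by the corresponding group ($\mathrm{GL}(n,\mathbb F_{q^2})$ for $\mathfrak{gl}(n,\mathbb F_{q^2})$, $\mathrm U(2n,\mathbb F_{q^2})$ for $\mathfrak u(2n,\mathbb F_{q^2})$); for $n=0$ it is $\mathbb R$. $A_{q^2}=\bigoplus_{n\ge0}\mathcal C(\mathfrak{gl}(n,\mathbb F_{q^2}))$ and $B_{q^2}=\bigoplus_{n\ge0}\mathcal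 C(\mathfrak u(2n,\mathbb F_{q^2}))$, with the $n$-th summands being the $n$-th graded parts (degree $n$). Parabolic restriction and induction. For a finite matrix group $G$ with Lie algebra $\mathcal G$ and a parabolic subgroup $P=LU$ with Lie algebra $\mathcal P=\mathcal L\oplus\mathcal U$ (Levi part, nilradical): $(\downarrow^{\mathcal G}_{\mathcal L}\Psi)(Y)=|\mathcal U|^{-1}\sum_{Z\in\mathcal U}\Psi(Y+Z)$ for $\Psi\in\mathcal C(\mathcal G)$, $Y\in\mathcal L$; and $(\uparrow^{\mathcal G}_{\mathcal L}\Phi)(X)=\sum_{g\in[G/P]}\Phi'(g^{-1}Xg)$ for $\Phi\in\mathcal C(\mathcal L)$, $X\in\mathcal G$, where the sum is over representatives of left cosets, $\Phi'$ equals $\Phi$ composed with the projection $\mathcal P\to\mathcal L$ on $\mathcal P$, and $\Phi'=0$ outside $\mathcal P$. The product $\nabla$ on $A_{q^2}$. For $i+j=n$, $i,j\ge0$, take $G=\mathrm{GL}(n,\mathbb F_{q^2})$ and $P_{i,j}$ = invertible block upper triangular matrices with respect to $n=i+j$, with Levi Lie algebra $\{\mathrm{diag}(A,B)\}\cong\mathfrak{gl}(i,\mathbb F_{q^2})\oplus\mathfrak{gl}(j,\mathbb F_{q^2})$ and nilradical the strictly block upper triangular matrices. $\nabla:A_{q^2}\otimes A_{q^2}\to A_{q^2}$ is the sum of the resulting parabolic inductions $\mathcal C(\mathfrak{gl}(i,\mathbb F_{q^2}))\otimes\mathcal C(\mathfrak{gl}(j,\mathbb F_{q^2}))\to\mathcal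 C(\mathfrak{gl}(i+j,\mathbb F_{q^2}))$. The maps $\widetilde\nabla$, $\widetilde\Delta$. For $i+j=n$, $i,j\ge0$, take $G=\mathrm U(2n,\mathbb F_{q^2})$ and $\widetilde P_{i,j}$ = the subgroup of matrices in $\mathrm U(2n,\mathbb F_{q^2})$ that are block upper triangular with respect to $2n=i+2j+i$. Its Levi subgroup is $\{\mathrm{diag}(A,B,J_i(A^* )^{-1}J_i):A\in\mathrm{GL}(i,\mathbb F_{q^2}),B\in\mathrm U(2j,\mathbb F_{q^2})\}$, with Lie algebra $\{\mathrm{diag}(A,B,-J_iA^*J_i)\}\cong\mathfrak{gl}(i,\mathbb F_{q^2})\oplus\mathfrak u(2j,\mathbb F_{q^2})$ via $(A,B)$; the nilradical is the set of strictly block upper triangular matrices in $\mathfrak u(2n,\mathbb F_{q^2})$. $\widetilde\nabla:A_{q^2}\otimes B_{q^2}\to B_{q^2}$ is the sum of the parabolic inductions $\mathcal C(\mathfrak{gl}(i,\mathbb F_{q^2}))\otimes\mathcal C(\mathfrak u(2j,\mathbb F_{q^2}))\to\mathcal C(\mathfrak u(2(i+j),\mathbb F_{q^2}))$, and $\widetilde\Delta:B_{q^2}\to A_{q^2}\otimes B_{q^2}$ restricted to degree $n$ is the sum over $i+j=n$ of the parabolic restrictions. The cones of functionals. Let $\mathcal X_A\subset A_{q^2}$ be the set of indicator functions of $\mathrm{GL}(n,\mathbb F_{q^2})$-orbits in $\mathfrak{gl}(n,\mathbb F_{q^2})$, $n\ge0$, and $\mathcal X_B\subset B_{q^2}$ the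 set of indicator functions of $\mathrm U(2n,\mathbb F_{q^2})$-orbits in $\mathfrak u(2n,\mathbb F_{q^2})$, $n\ge0$. Let $\widetilde x_1\in\mathcal C(\mathfrak{gl}(1,\mathbb F_{q^2}))\subset A_{q^2}$ be the indicator function of the $1\times1$ zero matrix. - $\mathcal F(A_{q^2})$ is the convex cone of linear functionals $\varphi:A_{q^2}\to\mathbb R$ with $\varphi(x)\ge0$ for all $x\in\mathcal X_A$ and $\varphi(a)=\varphi(\nabla(\widetilde x_1\otimes a))$ for all $a\in A_{q^2}$; $\mathcal F_0(A_{q^2})$ is the subcone of those $\varphi$ vanishing on the indicator functions of all non-nilpotent orbits. - $\widetilde{\mathcal F}(B_{q^2})$ is the convex cone of linear functionals $\psi:B_{q^2}\to\mathbb R$ with $\psi(x)\ge0$ for all $x\in\mathcal X_B$ and $\psi(b)=\psi(\widetilde\nabla(\widetilde x_1\otimes b))$ for all $b\in B_{q^2}$; $\widetilde{\mathcal F}_0(B_{q^2})$ is the subcone of those $\psi$ vanishing on the indicator functions of all non-nilpotent orbits. Mixing construction. For linear functionals $\varphi:A_{q^2}\to\mathbb R$, $\psi:B_{q^2}\to\mathbb R$ and $s\in\mathbb R$, the linear functional $\varphi\star_s\psi:B_{q^2}\to\mathbb R$ is defined on homogeneous $b'\in B_{q^2}$ by $$(\varphi\star_s\psi)(b')=\sum_{a,b}s^{\deg a}(1-2s)^{\deg b}\,\varphi(a)\psi(b),$$ where $\widetilde\Delta(b')=\sum_{a,b}a\otimes b$ is any expansion with homogeneous $a\in A_{q^2}$,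 $b\in B_{q^2}$, and $0^0=1$. *)

theory Defs
  imports
    Complex_Main
    "HOL-Library.Indicator_Function"
    "HOL-Number_Theory.Prime_Powers"
    "Jordan_Normal_Form.Matrix"
    "Jordan_Normal_Form.Gauss_Jordan_Elimination"
begin

(* Throughout, the type 'a is the field with q^2 elements, so x |-> x^q is the involution of 'a. *)

section \<open>Matrix groups and their Lie algebras\<close>

definition conj_transpose :: "nat \<Rightarrow> 'a::field mat \<Rightarrow> 'a mat" where
  "conj_transpose q A = transpose_mat (map_mat (\<lambda>x. x ^ q) A)"

definition antidiag :: "nat \<Rightarrow> 'a::field mat" where
  "antidiag m = mat m m (\<lambda>(r, c). if r + c + 1 = m then 1 else 0)"

abbreviation minv :: "'a::field mat \<Rightarrow> 'a mat" where
  "minv g \<equiv> the (mat_inverse g)"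

definition GL :: "nat \<Rightarrow> 'a::field mat set" where
  "GL n = {g \<in> carrier_mat n n. invertible_mat g}"

definition gl :: "nat \<Rightarrow> 'a::field mat set" where
  "gl n = carrier_mat n n"

definition unitary_group :: "nat \<Rightarrow> nat \<Rightarrow> 'a::field mat set" where
  "unitary_group q m = {g \<in> GL m. conj_transpose q g * antidiag m * g = antidiag m}"

definition unitary_algebra :: "nat \<Rightarrow> nat \<Rightarrow> 'a::field mat set" where
  "unitary_algebra q m = {X \<in> gl m. conj_transpose q X * antidiag m + antidiag m * X = 0\<^sub>m m m}"

definition orbit :: "'a::field mat set \<Rightarrow> 'a mat \<Rightarrow> 'a mat set" where
  "orbit G X = {g * X * minv g | g. g \<in> G}"

definition nilpotent_mat :: "'a::field mat \<Rightarrow> bool" where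
  "nilpotent_mat X \<longleftrightarrow> (\<exists>k. X ^\<^sub>m k = 0\<^sub>m (dim_row X) (dim_row X))"

section \<open>Invariant functions and the graded spaces\<close>

(* A function on the Lie algebra is represented by its extension by zero to all matrices. *)
definition invariant_funs :: "'a::field mat set \<Rightarrow> 'a mat set \<Rightarrow> ('a mat \<Rightarrow> real) set" where
  "invariant_funs G \<G> = {f. (\<forall>X. X \<notin> \<G> \<longrightarrow> f X = 0) \<and> (\<forall>g\<in>G. \<forall>X\<in>\<G>. f (g * X * minv g) = f X)}"

definition C_gl :: "nat \<Rightarrow> ('a::field mat \<Rightarrow> real) set" where
  "C_gl n = invariant_funs (GL n) (gl n)"

definition C_u :: "nat \<Rightarrow> nat \<Rightarrow> ('a::field mat \<Rightarrow> real) set" where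
  "C_u q n = invariant_funs (unitary_group q (2 * n)) (unitary_algebra q (2 * n))"

type_synonym 'a graded = "nat \<Rightarrow> 'a mat \<Rightarrow> real"

definition direct_sum :: "(nat \<Rightarrow> ('a mat \<Rightarrow> real) set) \<Rightarrow> 'a graded set" where
  "direct_sum C = {a. (\<forall>n. a n \<in> C n) \<and> finite {n. a n \<noteq> (\<lambda>_. 0)}}"

definition A_space :: "'a::field graded set" where
  "A_space = direct_sum C_gl"

definition B_space :: "nat \<Rightarrow> 'a::field graded set" where
  "B_space q = direct_sum (C_u q)"

definition in_degree :: "nat \<Rightarrow> ('a mat \<Rightarrow> real) \<Rightarrow> 'a graded" where
  "in_degree n f = (\<lambda>k. if k = n then f else (\<lambda>_. 0))"

(* A tensor product of graded function spaces is represented by bigraded functions of two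
   arguments: the (i,j) component of a tensor b is the function (X,Y) |-> a_i(X) * b_j(Y). *)
type_synonym 'a bigraded = "nat \<Rightarrow> nat \<Rightarrow> 'a mat \<Rightarrow> 'a mat \<Rightarrow> real"

definition tensor :: "'a graded \<Rightarrow> 'a graded \<Rightarrow> 'a bigraded" where
  "tensor a b = (\<lambda>i j X Y. a i X * b j Y)"

section \<open>Parabolic induction and restriction\<close>

(* Block sizes are given as a list; sum_list (take b ks) is the first index of block b. *)
definition block_upper :: "nat list \<Rightarrow> 'a::zero mat \<Rightarrow> bool" where
  "block_upper ks X \<longleftrightarrow> (\<forall>b<length ks. \<forall>r<dim_row X. \<forall>c<dim_col X.
     sum_list (take b ks) \<le> r \<and> c < sum_list (take b ks) \<longrightarrow> X $$ (r, c) = 0)"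

definition strictly_block_upper :: "nat list \<Rightarrow> 'a::zero mat \<Rightarrow> bool" where
  "strictly_block_upper ks X \<longleftrightarrow> (\<forall>b<length ks. \<forall>r<dim_row X. \<forall>c<dim_col X.
     sum_list (take b ks) \<le> r \<and> c < sum_list (take (Suc b) ks) \<longrightarrow> X $$ (r, c) = 0)"

definition diag_part :: "nat list \<Rightarrow> nat \<Rightarrow> 'a mat \<Rightarrow> 'a mat" where
  "diag_part ks b X =
     (let d = sum_list (take b ks) in mat (ks ! b) (ks ! b) (\<lambda>(r, c). X $$ (d + r, d + c)))"

definition left_cosets :: "'a::field mat set \<Rightarrow> 'a mat set \<Rightarrow> 'a mat set set" where
  "left_cosets G P = (\<lambda>g. (\<lambda>p. g * p) ` P) ` G"

(* Both Levi algebras below are identified with spaces of pairs (A,B), the first two diagonal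
   blocks, so the projection onto the Levi part is reading off these two blocks. *)
definition parabolic_ind :: "nat list \<Rightarrow> 'a::field mat set \<Rightarrow> 'a mat set \<Rightarrow>
    ('a mat \<Rightarrow> 'a mat \<Rightarrow> real) \<Rightarrow> 'a mat \<Rightarrow> real" where
  "parabolic_ind ks G \<G> \<Phi> X =
     (let P = {g \<in> G. block_upper ks g};
          \<P> = {Y \<in> \<G>. block_upper ks Y};
          \<Phi>' = (\<lambda>Y. if Y \<in> \<P> then \<Phi> (diag_part ks 0 Y) (diag_part ks 1 Y) else 0)
      in if X \<in> \<G>
         then \<Sum>K\<in>left_cosets G P. let g = (SOME g. g \<in> K) in \<Phi>' (minv g * X * g)
         else 0)"

definition nabla :: "'a::field bigraded \<Rightarrow> 'a graded" where
  "nabla t = (\<lambda>n X. \<Sum>i\<le>n. parabolic_ind [i, n - i] (GL n) (gl n) (t i (n - i)) X)"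

definition nabla_tilde :: "nat \<Rightarrow> 'a::field bigraded \<Rightarrow> 'a graded" where
  "nabla_tilde q t = (\<lambda>n X. \<Sum>i\<le>n.
     parabolic_ind [i, 2 * (n - i), i] (unitary_group q (2 * n)) (unitary_algebra q (2 * n)) (t i (n - i)) X)"

definition delta_tilde :: "nat \<Rightarrow> 'a::field graded \<Rightarrow> 'a bigraded" where
  "delta_tilde q b = (\<lambda>i j A B.
     if A \<in> gl i \<and> B \<in> unitary_algebra q (2 * j) then
       (let N = {Z \<in> unitary_algebra q (2 * (i + j)). strictly_block_upper [i, 2 * j, i] Z}
        in (\<Sum>Z\<in>N. b (i + j)
              (diag_block_mat [A, B, - (antidiag i * conj_transpose q A * antidiag i)] + Z))
           / real (card N))
     else 0)"

section \<open>Positive harmonic functionals\<close>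

(* Functionals are total HOL functions; only their values on V matter. *)
definition linear_functional_on :: "'a graded set \<Rightarrow> ('a graded \<Rightarrow> real) \<Rightarrow> bool" where
  "linear_functional_on V \<phi> \<longleftrightarrow>
     (\<forall>a\<in>V. \<forall>b\<in>V. \<phi> (\<lambda>n X. a n X + b n X) = \<phi> a + \<phi> b) \<and>
     (\<forall>c. \<forall>a\<in>V. \<phi> (\<lambda>n X. c * a n X) = c * \<phi> a)"

definition gl_orbit_indicator :: "nat \<Rightarrow> 'a::field mat \<Rightarrow> 'a graded" where
  "gl_orbit_indicator n X = in_degree n (indicator (orbit (GL n) X))"

definition u_orbit_indicator :: "nat \<Rightarrow> nat \<Rightarrow> 'a::field mat \<Rightarrow> 'a graded" where
  "u_orbit_indicator q n X = in_degree n (indicator (orbit (unitary_group q (2 * n)) X))"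

definition x1_tilde :: "'a::field graded" where
  "x1_tilde = in_degree 1 (indicator {0\<^sub>m 1 1})"

definition F_A :: "('a::field graded \<Rightarrow> real) set" where
  "F_A = {\<phi>. linear_functional_on A_space \<phi> \<and>
     (\<forall>n. \<forall>X\<in>gl n. \<phi> (gl_orbit_indicator n X) \<ge> 0) \<and>
     (\<forall>a\<in>A_space. \<phi> a = \<phi> (nabla (tensor x1_tilde a)))}"

definition F0_A :: "('a::field graded \<Rightarrow> real) set" where
  "F0_A = {\<phi> \<in> F_A. \<forall>n. \<forall>X\<in>gl n. \<not> nilpotent_mat X \<longrightarrow> \<phi> (gl_orbit_indicator n X) = 0}"

definition F_B :: "nat \<Rightarrow> ('a::field graded \<Rightarrow> real) set" where
  "F_B q = {\<psi>. linear_functional_on (B_space q) \<psi> \<and>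
     (\<forall>n. \<forall>X\<in>unitary_algebra q (2 * n). \<psi> (u_orbit_indicator q n X) \<ge> 0) \<and>
     (\<forall>b\<in>B_space q. \<psi> b = \<psi> (nabla_tilde q (tensor x1_tilde b)))}"

definition F0_B :: "nat \<Rightarrow> ('a::field graded \<Rightarrow> real) set" where
  "F0_B q = {\<psi> \<in> F_B q.
     \<forall>n. \<forall>X\<in>unitary_algebra q (2 * n). \<not> nilpotent_mat X \<longrightarrow> \<psi> (u_orbit_indicator q n X) = 0}"

section \<open>Mixing\<close>

(* An expansion is a list of entries (i, f, j, g), standing for the homogeneous tensors
   in_degree i f \<otimes> in_degree j g of bidegree (i, j), whose sum is t. *)
type_synonym 'a expansion = "(nat \<times> ('a mat \<Rightarrow> real) \<times> nat \<times> ('a mat \<Rightarrow> real)) list"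

definition is_expansion :: "nat \<Rightarrow> 'a::field bigraded \<Rightarrow> 'a expansion \<Rightarrow> bool" where
  "is_expansion q t es \<longleftrightarrow>
     (\<forall>(i, f, j, g)\<in>set es. f \<in> C_gl i \<and> g \<in> C_u q j) \<and>
     t = (\<lambda>k l X Y. \<Sum>(i, f, j, g)\<leftarrow>es. tensor (in_degree i f) (in_degree j g) k l X Y)"

definition expansion_value :: "real \<Rightarrow> ('a graded \<Rightarrow> real) \<Rightarrow> ('a graded \<Rightarrow> real) \<Rightarrow>
    'a expansion \<Rightarrow> real" where
  "expansion_value s \<phi> \<psi> es =
     (\<Sum>(i, f, j, g)\<leftarrow>es. s ^ i * (1 - 2 * s) ^ j * \<phi> (in_degree i f) * \<psi> (in_degree j g))"

(* The choice of the expansion is immaterial: see expansion_value_unique below. *)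
definition mix_homogeneous :: "nat \<Rightarrow> real \<Rightarrow> ('a::field graded \<Rightarrow> real) \<Rightarrow>
    ('a graded \<Rightarrow> real) \<Rightarrow> 'a graded \<Rightarrow> real" where
  "mix_homogeneous q s \<phi> \<psi> b =
     expansion_value s \<phi> \<psi> (SOME es. is_expansion q (delta_tilde q b) es)"

definition mix :: "nat \<Rightarrow> real \<Rightarrow> ('a::field graded \<Rightarrow> real) \<Rightarrow>
    ('a graded \<Rightarrow> real) \<Rightarrow> 'a graded \<Rightarrow> real" where
  "mix q s \<phi> \<psi> b = (\<Sum>n\<in>{n. b n \<noteq> (\<lambda>_. 0)}. mix_homogeneous q s \<phi> \<psi> (in_degree n (b n)))"

lemma invariant_funs_zero: "(\<lambda>_. 0) \<in> invariant_funs G L"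
  by (simp add: invariant_funs_def)

lemma direct_sum_lincomb:
  assumes C: "\<And>n. \<exists>G L. C n = invariant_funs G L" and a: "a \<in> direct_sum C" and b: "b \<in> direct_sum C"
  shows "(\<lambda>n X. c n * a n X + d n * b n X) \<in> direct_sum C"
proof -
  have "{n. (\<lambda>X. c n * a n X + d n * b n X) \<noteq> (\<lambda>_. 0)} \<subseteq> {n. a n \<noteq> (\<lambda>_. 0)} \<union> {n. b n \<noteq> (\<lambda>_. 0)}"
    by auto
  moreover have "(\<lambda>X. c n * a n X + d n * b n X) \<in> C n" for n
  proof -
    obtain G L where "C n = invariant_funs G L" using C by blast
    moreover have "a n \<in> C n" "b n \<in> C n" using a b by (auto simp: direct_sum_def)
    ultimately show ?thesis by (auto simp: invariant_funs_def)
  qed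
  ultimately show ?thesis using a b
    by (auto simp: direct_sum_def intro: finite_subset[OF _ finite_UnI])
qed

lemma in_degree_direct_sum:
  assumes C: "\<And>n. \<exists>G L. C n = invariant_funs G L" and f: "f \<in> C n"
  shows "in_degree n f \<in> direct_sum C"
proof -
  have "in_degree n f k \<in> C k" for k
    using C[of k] f invariant_funs_zero by (auto simp: in_degree_def)
  moreover have "{k. in_degree n f k \<noteq> (\<lambda>_. 0)} \<subseteq> {n}" by (auto simp: in_degree_def)
  ultimately show ?thesis by (auto simp: direct_sum_def intro: finite_subset)
qed

lemma graded_A: "\<exists>G L. C_gl n = invariant_funs G L"
  and graded_B: "\<exists>G L. C_u q n = invariant_funs G L"
  by (auto simp: C_gl_def C_u_def)

lemma expansion_value_eq:
  fixes \<phi> \<psi> :: "'a::field graded \<Rightarrow> real"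
  assumes \<phi>: "linear_functional_on A_space \<phi>" and \<psi>: "linear_functional_on (B_space q) \<psi>"
    and t: "is_expansion q t es"
  shows "expansion_value s \<phi> \<psi> es =
    \<phi> (\<lambda>k X. s ^ k * \<psi> (\<lambda>l Y. (1 - 2 * s) ^ l * t k l X Y))"
proof -
  have zero: "(\<lambda>n X. 0) \<in> A_space" "(\<lambda>n X. 0) \<in> B_space q"
    by (auto simp: A_space_def B_space_def direct_sum_def C_gl_def C_u_def invariant_funs_zero)
  have \<phi>0: "\<phi> (\<lambda>n X. 0) = 0"
    using conjunct2[OF \<phi>[unfolded linear_functional_on_def], THEN spec[of _ 0]] zero(1) by auto
  have \<psi>0: "\<psi> (\<lambda>n X. 0) = 0"
    using conjunct2[OF \<psi>[unfolded linear_functional_on_def], THEN spec[of _ 0]] zero(2) by auto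
  let ?S = "\<lambda>es k l X Y. \<Sum>(i, f, j, g)\<leftarrow>es. tensor (in_degree i f) (in_degree j g) k l X Y"
  let ?b = "\<lambda>es k X l Y. (1 - 2 * s) ^ l * ?S es k l X Y"
  let ?a = "\<lambda>es k X. s ^ k * \<psi> (?b es k X)"
  have "(\<forall>k X. ?b es k X \<in> B_space q) \<and> ?a es \<in> A_space \<and> expansion_value s \<phi> \<psi> es = \<phi> (?a es)"
    if "\<forall>(i, f, j, g)\<in>set es. f \<in> C_gl i \<and> g \<in> C_u q j" for es
    using that
  proof (induction es)
    case Nil
    show ?case using zero by (simp add: expansion_value_def \<phi>0 \<psi>0)
  next
    case (Cons e es)
    obtain i f j g where e: "e = (i, f, j, g)" by (cases e)
    have f: "in_degree i f \<in> A_space" and g: "in_degree j g \<in> B_space q"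
      using Cons.prems graded_A graded_B
      by (auto simp: e A_space_def B_space_def intro!: in_degree_direct_sum)
    have IH: "\<And>k X. ?b es k X \<in> B_space q" "?a es \<in> A_space"
      "expansion_value s \<phi> \<psi> es = \<phi> (?a es)"
      using Cons by auto
    have b: "?b (e # es) k X = (\<lambda>l Y. (((1 - 2 * s) ^ j * in_degree i f k X) * in_degree j g l Y) + ?b es k X l Y)"
      for k X
      by (auto simp: e tensor_def in_degree_def fun_eq_iff algebra_simps)
    have scaleB: "(\<lambda>l Y. c * in_degree j g l Y) \<in> B_space q" for c
      using direct_sum_lincomb[OF graded_B g[unfolded B_space_def] g[unfolded B_space_def],
          where c = "\<lambda>_. c" and d = "\<lambda>_. 0"]
      by (simp add: B_space_def)
    have "?b (e # es) k X \<in> B_space q" for k X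
      unfolding b using direct_sum_lincomb[OF graded_B scaleB[unfolded B_space_def] IH(1)[unfolded B_space_def],
          where c = "\<lambda>_. 1" and d = "\<lambda>_. 1"]
      by (simp add: B_space_def)
    moreover have \<psi>b: "\<psi> (?b (e # es) k X) = (1 - 2 * s) ^ j * in_degree i f k X * \<psi> (in_degree j g) + \<psi> (?b es k X)"
      for k X
      unfolding b using \<psi> g scaleB IH(1) by (simp add: linear_functional_on_def)
    let ?c = "s ^ i * (1 - 2 * s) ^ j * \<psi> (in_degree j g)"
    have a: "?a (e # es) = (\<lambda>k X. ?c * in_degree i f k X + ?a es k X)"
      unfolding \<psi>b by (auto simp: in_degree_def fun_eq_iff algebra_simps)
    have scaleA: "(\<lambda>k X. c * in_degree i f k X) \<in> A_space" for c
      using direct_sum_lincomb[OF graded_A f[unfolded A_space_def] f[unfolded A_space_def],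
          where c = "\<lambda>_. c" and d = "\<lambda>_. 0"]
      by (simp add: A_space_def)
    have "?a (e # es) \<in> A_space"
      unfolding a using direct_sum_lincomb[OF graded_A scaleA[unfolded A_space_def] IH(2)[unfolded A_space_def],
          where c = "\<lambda>_. 1" and d = "\<lambda>_. 1"]
      by (simp add: A_space_def)
    moreover have "\<phi> (?a (e # es)) = ?c * \<phi> (in_degree i f) + \<phi> (?a es)"
      unfolding a using \<phi> f scaleA IH(2) by (simp add: linear_functional_on_def)
    then have "expansion_value s \<phi> \<psi> (e # es) = \<phi> (?a (e # es))"
      using IH(3) by (simp add: expansion_value_def e algebra_simps)
    ultimately show ?case by blast
  qed
  with t show ?thesis unfolding is_expansion_def by blast
qed

lemma expansion_value_unique:
  fixes \<phi> \<psi> :: "'a::field graded \<Rightarrow> real"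
  assumes "linear_functional_on A_space \<phi>" "linear_functional_on (B_space q) \<psi>"
    and "is_expansion q t es" "is_expansion q t es'"
  shows "expansion_value s \<phi> \<psi> es = expansion_value s \<phi> \<psi> es'"
  using assms by (simp add: expansion_value_eq)

end

theory Submission
  imports Defs "Jordan_Normal_Form.Jordan_Normal_Form_Existence" "HOL-Number_Theory.Residues"
begin

text \<open>
  Independently of expansions, \<open>\<phi> \<star>\<^sub>s \<psi>\<close> maps \<open>b\<close> to \<open>\<phi>(s\<^sup>k \<psi>((1 - 2s)\<^sup>l \<Delta>\<^sub>k\<^sub>l(b)))\<close>, where
  \<open>\<psi>\<close> acts on the second argument of the component \<open>\<Delta>\<^sub>k\<^sub>l(b)\<close> of the restriction of \<open>b\<close> and \<open>\<phi>\<close> on the first.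
  Restriction preserves pointwise nonnegativity and supports in
  non-nilpotent elements, so positivity and the statement on nilpotent supports are inherited. Harmonicity follows from
  the Mackey formula \<open>\<Delta>(x\<^sub>1 b) = 2 (x\<^sub>1 \<otimes> 1) \<Delta>(b) + (1 \<otimes> x\<^sub>1) \<Delta>(b)\<close>: the two terms contribute the factors
  \<open>2s\<close> and \<open>1 - 2s\<close>. For the Mackey formula, induction by \<open>x\<^sub>1\<close> is written as a sum over the lines
  (isotropic lines in the unitary case) in the kernel of a matrix; a line splits off by an element of the
  group moving it to the first basis vector, and averaging over the nilradical is done for each line separately.
\<close>

section \<open>Matrix groups and cosets\<close>

text \<open>Let W be the isotropic span of the first k basis vectors, the subspace that defines the
  restriction. The obstacle: the contribution of an individual line to the average over the
  nilradical does not resemble a restriction of b. Isotropic vectors are therefore grouped into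
  cells, by their coordinates at the highest of the levels W, W^perp / W, V / W^perp at which they
  do not vanish. A cell is a Levi translate of the orbit of one basis vector under the unipotent
  radical. The average is invariant under unipotent conjugation, so the cell contributes its size
  times the term of the basis vector. This size is the index in the nilradical of the matrices
  killing that vector, exactly the factor that turns their sum into an average over the smaller
  nilradical; no power of the field size survives. That the radical sweeps out a whole cell rests on
  a truncated exponential, hence on 2 being invertible. The coefficient 2 comes from the lines in W
  and those outside W^perp. The latter produce hyperplanes of W; trading these for lines uses that
  nilpotent matrices are similar to their transposes.\<close>

lemma finite_carrier_vec: "finite (carrier_vec n :: 'a::finite vec set)"
proof -
  have "carrier_vec n \<subseteq> vec_of_list ` {xs :: 'a list. set xs \<subseteq> UNIV \<and> length xs = n}"
  proof
    fix v :: "'a vec" assume "v \<in> carrier_vec n"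
    then have "v = vec_of_list (list_of_vec v)" "length (list_of_vec v) = n"
      by (auto simp: vec_list)
    then show "v \<in> vec_of_list ` {xs :: 'a list. set xs \<subseteq> UNIV \<and> length xs = n}" by blast
  qed
  then show ?thesis
    using finite_lists_length_eq[of "UNIV :: 'a set" n] by (meson finite finite_imageI finite_subset)
qed

lemma finite_carrier_mat: "finite (carrier_mat m n :: 'a::finite mat set)"
proof -
  let ?I = "{..<m} \<times> {..<n}"
  have "carrier_mat m n \<subseteq> mat m n ` (?I \<rightarrow>\<^sub>E (UNIV :: 'a set))"
  proof
    fix A :: "'a mat" assume "A \<in> carrier_mat m n"
    then have "A = mat m n (restrict (\<lambda>ij. A $$ ij) ?I)" by (intro eq_matI) simp_all
    moreover have "restrict (\<lambda>ij. A $$ ij) ?I \<in> ?I \<rightarrow>\<^sub>E (UNIV :: 'a set)" by simp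
    ultimately show "A \<in> mat m n ` (?I \<rightarrow>\<^sub>E (UNIV :: 'a set))" by (rule image_eqI)
  qed
  moreover have "finite (?I \<rightarrow>\<^sub>E (UNIV :: 'a set))" by (intro finite_PiE) auto
  ultimately show ?thesis by (meson finite_imageI finite_subset)
qed

lemma GL_carrier: "g \<in> GL n \<Longrightarrow> g \<in> carrier_mat n n"
  by (simp add: GL_def)

text \<open>A one-sided inverse of a square matrix over a field is two-sided. The second part is how
  every later \<open>minv\<close> is evaluated: the inverse is exhibited, and
  \<open>mat_inverse\<close> is never computed.\<close>

lemma GL_intro:
  assumes "g \<in> carrier_mat n n" "h \<in> carrier_mat n n" "g * h = 1\<^sub>m n"
  shows "g \<in> GL n" "minv g = h"
proof -
  have hg: "h * g = 1\<^sub>m n" using mat_mult_left_right_inverse[OF assms] .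
  show "g \<in> GL n"
    using assms hg by (auto simp: GL_def invertible_mat_def inverts_mat_def)
  have "g \<in> Units (ring_mat TYPE('a) n ())"
    using assms hg by (auto simp: Units_def ring_mat_def)
  then obtain B where B: "mat_inverse g = Some B"
    using mat_inverse(1)[OF assms(1), of "()"] by fastforce
  from mat_inverse(2)[OF assms(1) B] have b: "B * g = 1\<^sub>m n" "B \<in> carrier_mat n n" by auto
  have "B = B * (g * h)" using assms(3) b by simp
  also have "\<dots> = B * g * h" by (rule assoc_mult_mat[symmetric]) (use b assms in auto)
  finally have "B = h" using b(1) assms(2) by simp
  with B show "minv g = h" by simp
qed

lemma GL_minv:
  assumes "g \<in> GL n"
  shows "minv g \<in> carrier_mat n n" "g * minv g = 1\<^sub>m n" "minv g * g = 1\<^sub>m n" "minv g \<in> GL n"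
    "minv (minv g) = g"
proof -
  have g: "g \<in> carrier_mat n n" using assms by (rule GL_carrier)
  obtain h where h: "g * h = 1\<^sub>m n" "h * g = 1\<^sub>m (dim_row h)"
    using assms g by (auto simp: GL_def invertible_mat_def inverts_mat_def)
  then have hc: "h \<in> carrier_mat n n"
    using g by (metis carrier_matD(2) carrier_matI index_mult_mat(3) index_one_mat(3))
  have hi: "minv g = h" using GL_intro(2)[OF g hc h(1)] .
  have hg: "h * g = 1\<^sub>m n" using h(2) hc by simp
  show "minv g \<in> carrier_mat n n" "g * minv g = 1\<^sub>m n" "minv g * g = 1\<^sub>m n"
    using hc h hg hi by auto
  show "minv g \<in> GL n" "minv (minv g) = g" using GL_intro[OF hc g hg] hi by auto
qed

lemma sq_assoc:
  fixes A B C :: "'a::semiring_0 mat"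
  assumes "A \<in> carrier_mat n n" "B \<in> carrier_mat n n" "C \<in> carrier_mat n n"
  shows "A * B * C = A * (B * C)"
  using assms by (rule assoc_mult_mat)

lemma cancel_minv:
  assumes "g \<in> GL n" "X \<in> carrier_mat n n"
  shows "minv g * (g * X) = X" "g * (minv g * X) = X" "X * g * minv g = X" "X * minv g * g = X"
proof -
  note c = GL_minv(1)[OF assms(1)] GL_carrier[OF assms(1)] assms(2)
  note i = GL_minv(2,3)[OF assms(1)]
  show "minv g * (g * X) = X" "g * (minv g * X) = X" "X * g * minv g = X" "X * minv g * g = X"
    using sq_assoc[OF c(1,2,3)] sq_assoc[OF c(2,1,3)] sq_assoc[OF c(3,2,1)] sq_assoc[OF c(3,1,2)] i c(3)
    by auto
qed

lemma cancel_minv_vec: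
  assumes "g \<in> GL n" "v \<in> carrier_vec n"
  shows "minv g *\<^sub>v (g *\<^sub>v v) = v" "g *\<^sub>v (minv g *\<^sub>v v) = v"
  using assoc_mult_mat_vec[OF GL_minv(1)[OF assms(1)] GL_carrier[OF assms(1)] assms(2)]
    assoc_mult_mat_vec[OF GL_carrier[OF assms(1)] GL_minv(1)[OF assms(1)] assms(2)]
    GL_minv(2,3)[OF assms(1)] assms(2)
  by auto

lemma GL_mult:
  assumes "g \<in> GL n" "h \<in> GL n"
  shows "g * h \<in> GL n" "minv (g * h) = minv h * minv g"
proof -
  note c = GL_carrier[OF assms(1)] GL_carrier[OF assms(2)] GL_minv(1)[OF assms(1)] GL_minv(1)[OF assms(2)]
  have "g * h * (minv h * minv g) = g * (h * (minv h * minv g))"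
    by (rule sq_assoc[of _ n]) (use c in auto)
  also have "\<dots> = 1\<^sub>m n" using cancel_minv(2)[OF assms(2) c(3)] GL_minv(2)[OF assms(1)] by simp
  finally show "g * h \<in> GL n" "minv (g * h) = minv h * minv g"
    using GL_intro[of "g * h" n "minv h * minv g"] c by auto
qed

lemma GL_one: "1\<^sub>m n \<in> GL n" "minv (1\<^sub>m n) = 1\<^sub>m n"
  using GL_intro[of "1\<^sub>m n" n "1\<^sub>m n"] by auto

lemma finite_GL: "finite (GL n :: 'a::{field,finite} mat set)"
  by (rule finite_subset[OF _ finite_carrier_mat[of n n]]) (auto simp: GL_def)

text \<open>Closure conditions relative to an ambient \<open>GL n\<close>, so that the coset and
  descent arguments are carried out once for the general linear and the unitary group and for their
  line stabilisers.\<close>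

definition mat_group :: "nat \<Rightarrow> 'a::field mat set \<Rightarrow> bool" where
  "mat_group n G \<longleftrightarrow> G \<subseteq> GL n \<and> 1\<^sub>m n \<in> G \<and> (\<forall>g\<in>G. \<forall>h\<in>G. g * h \<in> G) \<and> (\<forall>g\<in>G. minv g \<in> G)"

lemma mat_group_GL: "mat_group n (GL n)"
  by (simp add: mat_group_def GL_mult GL_one GL_minv)

lemma mat_groupD:
  assumes "mat_group n G"
  shows "g \<in> G \<Longrightarrow> g \<in> GL n" "1\<^sub>m n \<in> G" "g \<in> G \<Longrightarrow> h \<in> G \<Longrightarrow> g * h \<in> G" "g \<in> G \<Longrightarrow> minv g \<in> G"
    "g \<in> G \<Longrightarrow> g \<in> carrier_mat n n" "g \<in> G \<Longrightarrow> minv g \<in> carrier_mat n n"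
  using assms GL_carrier GL_minv(1) unfolding mat_group_def by blast+

lemma mat_group_finite: "mat_group n (G :: 'a::{field,finite} mat set) \<Longrightarrow> finite G"
  using finite_GL finite_subset unfolding mat_group_def by blast

lemma bij_betw_mult_left:
  assumes "mat_group n G" "h \<in> G"
  shows "bij_betw ((*) h) G G"
proof (rule bij_betw_byWitness[of _ "(*) (minv h)"])
  note G = mat_groupD[OF assms(1)]
  show "\<forall>g\<in>G. minv h * (h * g) = g" "\<forall>g\<in>G. h * (minv h * g) = g"
    using cancel_minv[of h n] G assms(2) by auto
  show "(*) h ` G \<subseteq> G" "(*) (minv h) ` G \<subseteq> G" using G assms(2) by auto
qed

text \<open>Each coset has \<open>card P\<close> elements and \<open>f\<close> is constant on it, so
  the representative picked by \<open>SOME\<close> does not matter. This links the coset sum in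
  \<open>parabolic_ind\<close> to sums over the whole group.\<close>

lemma sum_left_cosets:
  fixes f :: "'a::{field,finite} mat \<Rightarrow> real"
  assumes G: "mat_group n G" and P: "mat_group n P" "P \<subseteq> G"
    and f: "\<And>g p. g \<in> G \<Longrightarrow> p \<in> P \<Longrightarrow> f (g * p) = f g"
  shows "(\<Sum>K\<in>left_cosets G P. f (SOME g. g \<in> K)) * real (card P) = (\<Sum>g\<in>G. f g)"
proof -
  note GD = mat_groupD[OF G] and PD = mat_groupD[OF P(1)]
  define c where "c g = (\<lambda>p. g * p) ` P" for g :: "'a mat"
  have fin: "finite G" "finite P" using mat_group_finite G P by auto
  have self: "g \<in> c g" if "g \<in> G" for g
    unfolding c_def by (rule image_eqI[OF _ PD(2)]) (use GD(5)[OF that] in simp)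
  have c_eq: "c h = c g" if "g \<in> G" "h \<in> c g" for g h
  proof -
    obtain p where p: "p \<in> P" "h = g * p" using \<open>h \<in> c g\<close> by (auto simp: c_def)
    have "c h = (\<lambda>p'. g * (p * p')) ` P"
      unfolding c_def p(2) using p(1) that(1) GD PD by (intro image_cong refl sq_assoc[of _ n]) auto
    also have "\<dots> = (\<lambda>x. g * x) ` ((*) p ` P)" by (simp add: image_image)
    also have "(*) p ` P = P" using bij_betw_mult_left[OF P(1) p(1)] by (simp add: bij_betw_def)
    finally show ?thesis by (simp add: c_def)
  qed
  have sub: "c g \<subseteq> G" if "g \<in> G" for g using that GD P(2) by (auto simp: c_def)
  have fc: "f h = f g" if "g \<in> G" "h \<in> c g" for g h using that f by (auto simp: c_def)
  have card_c: "card (c g) = card P" if "g \<in> G" for g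
    unfolding c_def
  proof (rule card_image, rule inj_onI)
    fix x y assume x: "x \<in> P" and y: "y \<in> P" and xy: "g * x = g * y"
    show "x = y"
      using cancel_minv(1)[OF GD(1)[OF that] PD(5)[OF x]] cancel_minv(1)[OF GD(1)[OF that] PD(5)[OF y]]
      unfolding xy by (rule trans[OF sym])
  qed
  have lc: "left_cosets G P = c ` G" by (simp add: left_cosets_def c_def)
  have "(\<Sum>g\<in>G. f g) = (\<Sum>K\<in>c ` G. \<Sum>g\<in>{g \<in> G. c g = K}. f g)"
    using fin by (intro sum.group[symmetric]) auto
  also have "\<dots> = (\<Sum>K\<in>c ` G. f (SOME g. g \<in> K) * real (card P))"
  proof (rule sum.cong[OF refl])
    fix K assume "K \<in> c ` G"
    then obtain h where h: "h \<in> G" "K = c h" by auto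
    have K: "{g \<in> G. c g = K} = K" using c_eq[OF h(1)] self sub[OF h(1)] h(2) by blast
    have "(SOME g. g \<in> K) \<in> K" using self[OF h(1)] h(2) by (metis someI)
    then have "\<And>g. g \<in> K \<Longrightarrow> f g = f (SOME g. g \<in> K)" using fc[OF h(1)] h(2) by simp
    then have "(\<Sum>g\<in>K. f g) = (\<Sum>g\<in>K. f (SOME g. g \<in> K))" by (rule sum.cong[OF refl])
    then show "(\<Sum>g\<in>{g \<in> G. c g = K}. f g) = f (SOME g. g \<in> K) * real (card P)"
      unfolding K using card_c[OF h(1)] h(2) by simp
  qed
  finally show ?thesis by (simp add: lc sum_distrib_right)
qed

section \<open>Cosets of a line stabiliser as vectors of an orbit\<close>

abbreviation e0 :: "nat \<Rightarrow> 'a::field vec" where "e0 n \<equiv> unit_vec n 0"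

definition vec_orbit :: "nat \<Rightarrow> 'a::field mat set \<Rightarrow> 'a vec set" where
  "vec_orbit n G = (\<lambda>g. g *\<^sub>v e0 n) ` G"

definition line_stab :: "nat \<Rightarrow> 'a::field mat set \<Rightarrow> 'a mat set" where
  "line_stab n G = {g \<in> G. \<exists>c. g *\<^sub>v e0 n = c \<cdot>\<^sub>v e0 n}"

lemma e0_nonzero: "0 < n \<Longrightarrow> e0 n \<noteq> (0\<^sub>v n :: 'a::field vec)"
  by (auto simp: vec_eq_iff intro!: exI[of _ 0])

lemma mult_GL_vec_nonzero:
  assumes "g \<in> GL n" "v \<in> carrier_vec n" "v \<noteq> 0\<^sub>v n"
  shows "g *\<^sub>v v \<noteq> 0\<^sub>v n"
proof
  assume "g *\<^sub>v v = 0\<^sub>v n"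
  then have "minv g *\<^sub>v (g *\<^sub>v v) = 0\<^sub>v n" using GL_minv(1)[OF assms(1)] by auto
  then show False using cancel_minv_vec(1)[OF assms(1,2)] assms(3) by simp
qed

lemma line_stab_scalar:
  assumes "0 < n" "mat_group n G" "g \<in> G" "g *\<^sub>v e0 n = c \<cdot>\<^sub>v e0 n"
  shows "c \<noteq> 0"
  using mult_GL_vec_nonzero[of g n "e0 n"] mat_groupD(1)[OF assms(2)] assms e0_nonzero by fastforce

lemma mat_group_line_stab:
  assumes n: "0 < n" and G: "mat_group n G"
  shows "mat_group n (line_stab n G)"
proof -
  note GD = mat_groupD[OF G]
  have "1\<^sub>m n *\<^sub>v e0 n = (1 :: 'a) \<cdot>\<^sub>v e0 n" by simp
  then have 1: "1\<^sub>m n \<in> line_stab n G" using GD(2) unfolding line_stab_def by blast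
  have 2: "g * h \<in> line_stab n G" if "g \<in> line_stab n G" "h \<in> line_stab n G" for g h
  proof -
    obtain c d where g: "g \<in> G" "g *\<^sub>v e0 n = c \<cdot>\<^sub>v e0 n" and h: "h \<in> G" "h *\<^sub>v e0 n = d \<cdot>\<^sub>v e0 n"
      using \<open>g \<in> line_stab n G\<close> \<open>h \<in> line_stab n G\<close> by (auto simp: line_stab_def)
    have "g * h *\<^sub>v e0 n = g *\<^sub>v (h *\<^sub>v e0 n)"
      by (rule assoc_mult_mat_vec[OF GD(5)[OF g(1)] GD(5)[OF h(1)]]) simp
    also have "\<dots> = d \<cdot>\<^sub>v (g *\<^sub>v e0 n)"
      unfolding h(2) by (rule mult_mat_vec[OF GD(5)[OF g(1)]]) simp
    finally have "g * h *\<^sub>v e0 n = (d * c) \<cdot>\<^sub>v e0 n" unfolding g(2) by (simp add: smult_smult_assoc)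
    then show ?thesis using GD(3)[OF g(1) h(1)] unfolding line_stab_def by blast
  qed
  have 3: "minv g \<in> line_stab n G" if "g \<in> line_stab n G" for g
  proof -
    obtain c where g: "g \<in> G" "g *\<^sub>v e0 n = c \<cdot>\<^sub>v e0 n"
      using \<open>g \<in> line_stab n G\<close> by (auto simp: line_stab_def)
    have c: "c \<noteq> 0" using line_stab_scalar[OF n G g] .
    have "e0 n = minv g *\<^sub>v (c \<cdot>\<^sub>v e0 n)"
      using cancel_minv_vec(1)[OF GD(1)[OF g(1)], of "e0 n"] g(2) by simp
    also have "\<dots> = c \<cdot>\<^sub>v (minv g *\<^sub>v e0 n)" by (rule mult_mat_vec[OF GD(6)[OF g(1)]]) simp
    finally have "(1 / c) \<cdot>\<^sub>v e0 n = (1 / c) \<cdot>\<^sub>v (c \<cdot>\<^sub>v (minv g *\<^sub>v e0 n))" by (rule arg_cong)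
    also have "\<dots> = minv g *\<^sub>v e0 n" using c by (simp add: smult_smult_assoc)
    finally have "(1 / c) \<cdot>\<^sub>v e0 n = minv g *\<^sub>v e0 n" .
    from this[symmetric] show ?thesis using GD(4)[OF g(1)] unfolding line_stab_def by blast
  qed
  show ?thesis using 1 2 3 GD(1) unfolding mat_group_def by (auto simp: line_stab_def)
qed

text \<open>Left multiplication by \<open>g\<close> carries the stabiliser of \<open>e0 n\<close>
  onto the set of group elements that move \<open>e0 n\<close> to the same vector as
  \<open>g\<close>.\<close>

lemma card_fibre:
  assumes G: "mat_group n (G :: 'a::{field,finite} mat set)" and g: "g \<in> G"
  shows "card {h \<in> G. h *\<^sub>v e0 n = g *\<^sub>v e0 n} = card {h \<in> G. h *\<^sub>v e0 n = e0 n}"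
proof -
  note GD = mat_groupD[OF G]
  have m: "g * h *\<^sub>v e0 n = g *\<^sub>v (h *\<^sub>v e0 n)" "minv g * h *\<^sub>v e0 n = minv g *\<^sub>v (h *\<^sub>v e0 n)" if "h \<in> G" for h
    using assoc_mult_mat_vec[OF GD(5)[OF g] GD(5)[OF that], of "e0 n"]
      assoc_mult_mat_vec[OF GD(6)[OF g] GD(5)[OF that], of "e0 n"] by auto
  have "bij_betw ((*) g) {h \<in> G. h *\<^sub>v e0 n = e0 n} {h \<in> G. h *\<^sub>v e0 n = g *\<^sub>v e0 n}"
  proof (rule bij_betw_byWitness[of _ "(*) (minv g)"])
    show "\<forall>a\<in>{h \<in> G. h *\<^sub>v e0 n = e0 n}. minv g * (g * a) = a"
      "\<forall>a'\<in>{h \<in> G. h *\<^sub>v e0 n = g *\<^sub>v e0 n}. g * (minv g * a') = a'"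
      using cancel_minv(1,2)[OF GD(1)[OF g] GD(5)] by auto
    show "(*) g ` {h \<in> G. h *\<^sub>v e0 n = e0 n} \<subseteq> {h \<in> G. h *\<^sub>v e0 n = g *\<^sub>v e0 n}"
      using GD(3)[OF g] m(1) by auto
    show "(*) (minv g) ` {h \<in> G. h *\<^sub>v e0 n = g *\<^sub>v e0 n} \<subseteq> {h \<in> G. h *\<^sub>v e0 n = e0 n}"
      using GD(3)[OF GD(4)[OF g]] m(2) cancel_minv_vec(1)[OF GD(1)[OF g], of "e0 n"] by auto
  qed
  from bij_betw_same_card[OF this] show ?thesis by (rule sym)
qed

text \<open>By \<open>scal\<close> every nonzero scalar is realised on the line of
  \<open>e0 n\<close>, and the elements realising one scalar form a fibre as in
  \<open>card_fibre\<close>.\<close>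

lemma card_line_stab:
  assumes n: "0 < n" and G: "mat_group n (G :: 'a::{field,finite} mat set)"
    and scal: "\<And>c. c \<noteq> 0 \<Longrightarrow> c \<cdot>\<^sub>v e0 n \<in> vec_orbit n G"
  shows "card (line_stab n G) = (card (UNIV :: 'a set) - 1) * card {h \<in> G. h *\<^sub>v e0 n = e0 n}"
proof -
  have fin: "finite G" using mat_group_finite[OF G] .
  have "line_stab n G = (\<Union>c\<in>UNIV - {0}. {g \<in> G. g *\<^sub>v e0 n = c \<cdot>\<^sub>v e0 n})"
    using line_stab_scalar[OF n G] by (auto simp: line_stab_def)
  also have "card \<dots> = (\<Sum>c\<in>UNIV - {0}. card {g \<in> G. g *\<^sub>v e0 n = c \<cdot>\<^sub>v e0 n})"
  proof (rule card_UN_disjoint)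
    show "\<forall>i\<in>UNIV - {0}. \<forall>j\<in>UNIV - {0}. i \<noteq> j \<longrightarrow>
       {g \<in> G. g *\<^sub>v e0 n = i \<cdot>\<^sub>v e0 n} \<inter> {g \<in> G. g *\<^sub>v e0 n = j \<cdot>\<^sub>v e0 n} = {}"
    proof (intro ballI impI, rule ccontr)
      fix i j :: 'a assume "i \<noteq> j" "{g \<in> G. g *\<^sub>v e0 n = i \<cdot>\<^sub>v e0 n} \<inter> {g \<in> G. g *\<^sub>v e0 n = j \<cdot>\<^sub>v e0 n} \<noteq> {}"
      then have "i \<cdot>\<^sub>v e0 n = j \<cdot>\<^sub>v e0 n" by auto
      then have "(i \<cdot>\<^sub>v e0 n) $ 0 = (j \<cdot>\<^sub>v e0 n) $ 0" by simp
      then show False using n \<open>i \<noteq> j\<close> by simp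
    qed
  qed (use fin in auto)
  also have "\<dots> = (\<Sum>c\<in>UNIV - {0::'a}. card {h \<in> G. h *\<^sub>v e0 n = e0 n})"
  proof (rule sum.cong[OF refl])
    fix c :: 'a assume "c \<in> UNIV - {0}"
    then obtain g where "g \<in> G" "g *\<^sub>v e0 n = c \<cdot>\<^sub>v e0 n" using scal[of c] by (force simp: vec_orbit_def)
    then show "card {g \<in> G. g *\<^sub>v e0 n = c \<cdot>\<^sub>v e0 n} = card {h \<in> G. h *\<^sub>v e0 n = e0 n}"
      using card_fibre[OF G, of g] by simp
  qed
  also have "\<dots> = (card (UNIV :: 'a set) - 1) * card {h \<in> G. h *\<^sub>v e0 n = e0 n}"
    by (simp add: card_Diff_singleton)
  finally show ?thesis .
qed

text \<open>A coset of \<open>line_stab\<close> is a line of the orbit, and a line has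
  \<open>card UNIV - 1\<close> nonzero vectors. Summing over vectors costs this constant factor but
  spares a choice of representatives of lines.\<close>

lemma sum_over_orbit:
  fixes F :: "'a::{field,finite} mat \<Rightarrow> real"
  assumes n: "0 < n" and G: "mat_group n G"
    and scal: "\<And>c. c \<noteq> 0 \<Longrightarrow> c \<cdot>\<^sub>v e0 n \<in> vec_orbit n G"
    and F: "\<And>g p. g \<in> G \<Longrightarrow> p \<in> line_stab n G \<Longrightarrow> F (g * p) = F g"
  shows "(\<Sum>K\<in>left_cosets G (line_stab n G). F (SOME g. g \<in> K)) =
    (\<Sum>v\<in>vec_orbit n G. F (SOME g. g \<in> G \<and> g *\<^sub>v e0 n = v)) / (real (card (UNIV :: 'a set)) - 1)"
proof -
  note GD = mat_groupD[OF G]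
  let ?s = "card {h \<in> G. h *\<^sub>v e0 n = e0 n}"
  have fin: "finite G" using mat_group_finite[OF G] .
  have s0: "?s > 0" using fin GD(2) by (auto simp: card_gt_0_iff intro!: exI[of _ "1\<^sub>m n"])
  have C: "card (UNIV :: 'a set) \<ge> 2" using card_mono[of UNIV "{0,1::'a}"] by simp
  have "(\<Sum>g\<in>G. F g) = (\<Sum>v\<in>vec_orbit n G. \<Sum>g\<in>{g \<in> G. g *\<^sub>v e0 n = v}. F g)"
    unfolding vec_orbit_def using fin by (intro sum.group[symmetric]) auto
  also have "\<dots> = (\<Sum>v\<in>vec_orbit n G. F (SOME g. g \<in> G \<and> g *\<^sub>v e0 n = v) * ?s)"
  proof (rule sum.cong[OF refl])
    fix v :: "'a vec" assume "v \<in> vec_orbit n G"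
    then obtain h where h: "h \<in> G \<and> h *\<^sub>v e0 n = v" by (auto simp: vec_orbit_def)
    define g where "g = (SOME g. g \<in> G \<and> g *\<^sub>v e0 n = v)"
    have g: "g \<in> G" "g *\<^sub>v e0 n = v" using someI[of "\<lambda>g. g \<in> G \<and> g *\<^sub>v e0 n = v", OF h] by (auto simp: g_def)
    have "F h = F g" if h: "h \<in> G" "h *\<^sub>v e0 n = v" for h
    proof -
      have "(minv g * h) *\<^sub>v e0 n = minv g *\<^sub>v (g *\<^sub>v e0 n)"
        using assoc_mult_mat_vec[OF GD(6)[OF g(1)] GD(5)[OF h(1)], of "e0 n"] g(2) h(2) by simp
      then have "(minv g * h) *\<^sub>v e0 n = 1 \<cdot>\<^sub>v e0 n"
        using cancel_minv_vec(1)[OF GD(1)[OF g(1)], of "e0 n"] by simp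
      then have "minv g * h \<in> line_stab n G"
        using GD(3)[OF GD(4)[OF g(1)] h(1)] unfolding line_stab_def by blast
      from F[OF g(1) this] show ?thesis
        using cancel_minv(2)[OF GD(1)[OF g(1)] GD(5)[OF h(1)]] by simp
    qed
    then have "(\<Sum>g\<in>{g \<in> G. g *\<^sub>v e0 n = v}. F g) = F g * card {g \<in> G. g *\<^sub>v e0 n = v}" by simp
    then show "(\<Sum>g\<in>{g \<in> G. g *\<^sub>v e0 n = v}. F g) = F (SOME g. g \<in> G \<and> g *\<^sub>v e0 n = v) * ?s"
      using card_fibre[OF G g(1)] g by (simp add: g_def)
  qed
  finally have eq: "(\<Sum>g\<in>G. F g) = (\<Sum>v\<in>vec_orbit n G. F (SOME g. g \<in> G \<and> g *\<^sub>v e0 n = v)) * ?s"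
    by (simp add: sum_distrib_right)
  \<comment> \<open>The sum over \<open>G\<close> is computed through cosets and through vectors;
    the order \<open>?s\<close> of the vector stabiliser is a common factor.\<close>
  have "(\<Sum>K\<in>left_cosets G (line_stab n G). F (SOME g. g \<in> K)) * real ((card (UNIV :: 'a set) - 1) * ?s) = (\<Sum>g\<in>G. F g)"
    using sum_left_cosets[OF G mat_group_line_stab[OF n G] _ F] card_line_stab[OF n G scal]
    by (auto simp: line_stab_def)
  with eq have "(\<Sum>K\<in>left_cosets G (line_stab n G). F (SOME g. g \<in> K)) * (real (card (UNIV :: 'a set)) - 1) * ?s =
    (\<Sum>v\<in>vec_orbit n G. F (SOME g. g \<in> G \<and> g *\<^sub>v e0 n = v)) * ?s"
    using C by (simp add: of_nat_diff mult.assoc)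
  then have "(\<Sum>K\<in>left_cosets G (line_stab n G). F (SOME g. g \<in> K)) * (real (card (UNIV :: 'a set)) - 1) =
    (\<Sum>v\<in>vec_orbit n G. F (SOME g. g \<in> G \<and> g *\<^sub>v e0 n = v))"
    using s0 by simp
  then show ?thesis using C by (simp add: eq_divide_eq)
qed

section \<open>Parabolic induction by a one-dimensional factor\<close>

text \<open>Compression to the rows and columns 1 to \<open>m\<close>. For a map preserving the line
  of \<open>e0 n\<close>, the choice \<open>m = n - 1\<close> gives the induced map on the quotient
  by the line. In the unitary case \<open>m = n - 2\<close> gives the induced map on the orthogonal
  complement of the line modulo the line.\<close>

definition defl :: "nat \<Rightarrow> 'a mat \<Rightarrow> 'a mat" where
  "defl m X = mat m m (\<lambda>(i, j). X $$ (Suc i, Suc j))"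

lemma defl_carrier [simp]: "defl m X \<in> carrier_mat m m"
  by (simp add: defl_def)

lemma defl_dim [simp]: "dim_row (defl m X) = m" "dim_col (defl m X) = m"
  by (simp_all add: defl_def)

lemma defl_index [simp]: "i < m \<Longrightarrow> j < m \<Longrightarrow> defl m X $$ (i, j) = X $$ (Suc i, Suc j)"
  by (simp add: defl_def)

definition frame :: "nat \<Rightarrow> 'a::field mat set \<Rightarrow> 'a vec \<Rightarrow> 'a mat" where
  "frame n G v = (SOME g. g \<in> G \<and> g *\<^sub>v e0 n = v)"

text \<open>The inverse stands on the left, as in \<open>parabolic_ind\<close>. This is a right
  action, and \<open>conjg g X\<close> kills \<open>v\<close> exactly when \<open>X\<close> kills
  \<open>g v\<close>.\<close>

definition conjg :: "'a::field mat \<Rightarrow> 'a mat \<Rightarrow> 'a mat" where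
  "conjg g X = minv g * X * g"

lemma conjg_carrier: "g \<in> GL n \<Longrightarrow> X \<in> carrier_mat n n \<Longrightarrow> conjg g X \<in> carrier_mat n n"
  using GL_minv(1) GL_carrier unfolding conjg_def by (metis mult_carrier_mat)

lemma conjg_mult:
  assumes "g \<in> GL n" "h \<in> GL n" "X \<in> carrier_mat n n"
  shows "conjg (g * h) X = conjg h (conjg g X)"
proof -
  note c = GL_carrier[OF assms(1)] GL_carrier[OF assms(2)] GL_minv(1)[OF assms(1)] GL_minv(1)[OF assms(2)] assms(3)
  have "conjg (g * h) X = minv h * minv g * X * (g * h)" by (simp add: conjg_def GL_mult(2)[OF assms(1,2)])
  also have "\<dots> = minv h * (minv g * X) * (g * h)" using sq_assoc[OF c(4,3,5)] by simp
  also have "\<dots> = minv h * (minv g * X) * g * h" using c by (intro sq_assoc[symmetric, of _ n]) auto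
  also have "minv h * (minv g * X) * g = minv h * (minv g * X * g)" using c by (intro sq_assoc[of _ n]) auto
  finally show ?thesis by (simp add: conjg_def)
qed

lemma conjg_inverse:
  assumes "g \<in> GL n" "X \<in> carrier_mat n n"
  shows "conjg g (conjg (minv g) X) = X" "conjg (minv g) (conjg g X) = X"
proof -
  have "conjg g (conjg (minv g) X) = conjg (minv g * g) X"
    using conjg_mult[OF GL_minv(4)[OF assms(1)] assms(1,2)] by simp
  then show "conjg g (conjg (minv g) X) = X"
    using GL_minv(3)[OF assms(1)] assms(2) by (simp add: conjg_def GL_one)
  have "conjg (minv g) (conjg g X) = conjg (g * minv g) X"
    using conjg_mult[OF assms(1) GL_minv(4)[OF assms(1)] assms(2)] by simp
  then show "conjg (minv g) (conjg g X) = X"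
    using GL_minv(2)[OF assms(1)] assms(2) by (simp add: conjg_def GL_one)
qed

lemma conjg_vec_zero:
  assumes "g \<in> GL n" "X \<in> carrier_mat n n" "v \<in> carrier_vec n"
  shows "conjg g X *\<^sub>v v = 0\<^sub>v n \<longleftrightarrow> X *\<^sub>v (g *\<^sub>v v) = 0\<^sub>v n"
proof -
  note c = GL_carrier[OF assms(1)] GL_minv(1)[OF assms(1)]
  have gv: "g *\<^sub>v v \<in> carrier_vec n" using c assms(3) by simp
  have "conjg g X *\<^sub>v v = minv g * X *\<^sub>v (g *\<^sub>v v)"
    unfolding conjg_def by (rule assoc_mult_mat_vec[of _ n n]) (use c assms in auto)
  also have "\<dots> = minv g *\<^sub>v (X *\<^sub>v (g *\<^sub>v v))"
    by (rule assoc_mult_mat_vec[OF c(2) assms(2) gv])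
  finally have eq: "conjg g X *\<^sub>v v = minv g *\<^sub>v (X *\<^sub>v (g *\<^sub>v v))" .
  have Xgv: "X *\<^sub>v (g *\<^sub>v v) \<in> carrier_vec n" using assms(2) gv by simp
  have "minv g *\<^sub>v 0\<^sub>v n = 0\<^sub>v n" using c(2) by auto
  then show ?thesis
    using mult_GL_vec_nonzero[OF GL_minv(4)[OF assms(1)] Xgv] unfolding eq by auto
qed

text \<open>Up to the number of nonzero vectors on a line, this is induction by
  \<open>x1_tilde\<close>: a line counts only if \<open>X\<close> acts on it as zero, which is what
  the indicator of the zero matrix tests.\<close>

definition ker_sum :: "nat \<Rightarrow> nat \<Rightarrow> 'a::field mat set \<Rightarrow> ('a mat \<Rightarrow> real) \<Rightarrow> 'a mat \<Rightarrow> real" where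
  "ker_sum n m G b X = (\<Sum>v\<in>{v \<in> vec_orbit n G. X *\<^sub>v v = 0\<^sub>v n}. b (defl m (conjg (frame n G v) X)))"

lemma frame:
  assumes "v \<in> vec_orbit n G"
  shows "frame n G v \<in> G" "frame n G v *\<^sub>v e0 n = v"
proof -
  obtain g where "g \<in> G \<and> g *\<^sub>v e0 n = v" using assms by (auto simp: vec_orbit_def)
  from someI[of "\<lambda>g. g \<in> G \<and> g *\<^sub>v e0 n = v", OF this]
  show "frame n G v \<in> G" "frame n G v *\<^sub>v e0 n = v" by (auto simp: frame_def)
qed

text \<open>Common ground of \<open>GL n\<close> with \<open>m = n - 1\<close> and of the unitary
  group with \<open>m = n - 2\<close>. The assumption \<open>invariant\<close> makes the value of
  \<open>b\<close> on a compression depend on the line alone, not on the frame or on the vector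
  spanning the line.\<close>

locale descent =
  fixes n m :: nat and G L :: "'a::{field,finite} mat set" and b :: "'a mat \<Rightarrow> real"
  assumes n: "0 < n" and G: "mat_group n G" and L: "L \<subseteq> carrier_mat n n"
    and conj_L: "\<And>g X. g \<in> G \<Longrightarrow> X \<in> L \<Longrightarrow> conjg g X \<in> L"
    and scal: "\<And>c. c \<noteq> 0 \<Longrightarrow> c \<cdot>\<^sub>v e0 n \<in> vec_orbit n G"
    and invariant: "\<And>p Y. p \<in> line_stab n G \<Longrightarrow> Y \<in> L \<Longrightarrow> Y *\<^sub>v e0 n = 0\<^sub>v n \<Longrightarrow>
      b (defl m (conjg p Y)) = b (defl m Y)"
begin

lemmas GD = mat_groupD[OF G]

lemma orbit_carrier: "v \<in> vec_orbit n G \<Longrightarrow> v \<in> carrier_vec n"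
  unfolding vec_orbit_def using mult_mat_vec_carrier[OF GD(5), of _ "e0 n"] by auto

lemma line_stab_kernel:
  assumes X: "X \<in> carrier_mat n n" and g: "g \<in> G" and p: "p \<in> line_stab n G"
  shows "X *\<^sub>v (g * p *\<^sub>v e0 n) = 0\<^sub>v n \<longleftrightarrow> X *\<^sub>v (g *\<^sub>v e0 n) = 0\<^sub>v n"
proof -
  obtain c where p: "p \<in> G" "p *\<^sub>v e0 n = c \<cdot>\<^sub>v e0 n" using assms by (auto simp: line_stab_def)
  have c: "c \<noteq> 0" by (rule line_stab_scalar[OF n G p])
  have gv: "g *\<^sub>v e0 n \<in> carrier_vec n" using GD(5)[OF g] by simp
  have "g * p *\<^sub>v e0 n = g *\<^sub>v (p *\<^sub>v e0 n)"
    by (rule assoc_mult_mat_vec[OF GD(5)[OF g] GD(5)[OF p(1)]]) simp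
  also have "\<dots> = c \<cdot>\<^sub>v (g *\<^sub>v e0 n)" unfolding p(2) by (rule mult_mat_vec[OF GD(5)[OF g]]) simp
  finally have "X *\<^sub>v (g * p *\<^sub>v e0 n) = c \<cdot>\<^sub>v (X *\<^sub>v (g *\<^sub>v e0 n))"
    using mult_mat_vec[OF X gv] by simp
  moreover have "c \<cdot>\<^sub>v w = 0\<^sub>v n \<longleftrightarrow> w = 0\<^sub>v n" if "w \<in> carrier_vec n" for w
    using that c by (auto simp: vec_eq_iff)
  moreover have "X *\<^sub>v (g *\<^sub>v e0 n) \<in> carrier_vec n" using X gv by simp
  ultimately show ?thesis by simp
qed

lemma conjg_line_stab:
  assumes X: "X \<in> L" and g: "g \<in> G" "X *\<^sub>v (g *\<^sub>v e0 n) = 0\<^sub>v n" and p: "p \<in> line_stab n G"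
  shows "b (defl m (conjg (g * p) X)) = b (defl m (conjg g X))"
proof -
  have p': "p \<in> G" using p by (simp add: line_stab_def)
  have Xc: "X \<in> carrier_mat n n" using X L by auto
  have "conjg (g * p) X = conjg p (conjg g X)" by (rule conjg_mult[OF GD(1)[OF g(1)] GD(1)[OF p'] Xc])
  moreover have "conjg g X *\<^sub>v e0 n = 0\<^sub>v n" using conjg_vec_zero[OF GD(1)[OF g(1)] Xc] g(2) by simp
  ultimately show ?thesis using invariant[OF p conj_L[OF g(1) X]] by simp
qed

text \<open>Two group elements moving \<open>e0 n\<close> to the same vector differ by an element of
  the line stabiliser, so the frame chosen by \<open>SOME\<close> can be replaced by any convenient
  one. The later computations with block diagonal and permutation matrices rest on this.\<close>

lemma descend_eq:
  assumes X: "X \<in> L" and g: "g \<in> G" "X *\<^sub>v (g *\<^sub>v e0 n) = 0\<^sub>v n"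
  shows "b (defl m (conjg (frame n G (g *\<^sub>v e0 n)) X)) = b (defl m (conjg g X))"
proof -
  let ?f = "frame n G (g *\<^sub>v e0 n)"
  have f: "?f \<in> G" "?f *\<^sub>v e0 n = g *\<^sub>v e0 n"
    using frame[of "g *\<^sub>v e0 n" n G] g(1) by (auto simp: vec_orbit_def)
  have p: "minv g * ?f \<in> G" using GD(3)[OF GD(4)[OF g(1)] f(1)] .
  have "(minv g * ?f) *\<^sub>v e0 n = minv g *\<^sub>v (g *\<^sub>v e0 n)"
    using assoc_mult_mat_vec[OF GD(6)[OF g(1)] GD(5)[OF f(1)], of "e0 n"] f(2) by simp
  then have "(minv g * ?f) *\<^sub>v e0 n = 1 \<cdot>\<^sub>v e0 n"
    using cancel_minv_vec(1)[OF GD(1)[OF g(1)], of "e0 n"] by simp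
  then have "minv g * ?f \<in> line_stab n G" using p unfolding line_stab_def by blast
  from conjg_line_stab[OF X g this] show ?thesis
    using cancel_minv(2)[OF GD(1)[OF g(1)] GD(5)[OF f(1)]] by simp
qed

lemma sum_cosets_eq:
  assumes X: "X \<in> L"
  shows "(\<Sum>K\<in>left_cosets G (line_stab n G). let g = SOME g. g \<in> K in
      if X *\<^sub>v (g *\<^sub>v e0 n) = 0\<^sub>v n then b (defl m (conjg g X)) else 0) =
    ker_sum n m G b X / (real (card (UNIV :: 'a set)) - 1)"
proof -
  define F where "F g = (if X *\<^sub>v (g *\<^sub>v e0 n) = 0\<^sub>v n then b (defl m (conjg g X)) else 0)" for g
  have Xc: "X \<in> carrier_mat n n" using X L by auto
  have inv: "F (g * p) = F g" if "g \<in> G" "p \<in> line_stab n G" for g p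
    using line_stab_kernel[OF Xc that] conjg_line_stab[OF X that(1) _ that(2)] unfolding F_def by simp
  have fin: "finite (vec_orbit n G)" using mat_group_finite[OF G] by (simp add: vec_orbit_def)
  have "(\<Sum>v\<in>vec_orbit n G. F (SOME g. g \<in> G \<and> g *\<^sub>v e0 n = v)) =
    (\<Sum>v\<in>vec_orbit n G. if X *\<^sub>v v = 0\<^sub>v n then b (defl m (conjg (frame n G v) X)) else 0)"
    by (rule sum.cong[OF refl]) (simp add: F_def frame(2) flip: frame_def)
  also have "\<dots> = ker_sum n m G b X"
    using fin by (simp add: ker_sum_def sum.inter_filter)
  finally show ?thesis
    using sum_over_orbit[where F = F, OF n G scal inv] by (simp add: F_def Let_def)
qed

text \<open>The assumption \<open>P\<close> says that the block upper triangular subgroup is the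
  stabiliser of a line. The assumption on \<open>\<Phi>\<close> says that lying in the parabolic
  subalgebra with a zero corner means killing \<open>e0 n\<close>.\<close>

lemma parabolic_ind_eq:
  assumes P: "{g \<in> G. block_upper ks g} = line_stab n G"
    and \<Phi>: "\<And>Y. Y \<in> L \<Longrightarrow> (if block_upper ks Y then \<Phi> (diag_part ks 0 Y) (diag_part ks 1 Y) else 0) =
      (if Y *\<^sub>v e0 n = 0\<^sub>v n then b (defl m Y) else 0)"
  shows "parabolic_ind ks G L \<Phi> X =
    (if X \<in> L then ker_sum n m G b X / (real (card (UNIV :: 'a set)) - 1) else 0)"
proof (cases "X \<in> L")
  case X: True
  then have Xc: "X \<in> carrier_mat n n" using L by auto
  have "parabolic_ind ks G L \<Phi> X = (\<Sum>K\<in>left_cosets G (line_stab n G). let g = SOME g. g \<in> K in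
      if X *\<^sub>v (g *\<^sub>v e0 n) = 0\<^sub>v n then b (defl m (conjg g X)) else 0)"
    unfolding parabolic_ind_def P Let_def if_P[OF X]
  proof (rule sum.cong[OF refl])
    fix K assume "K \<in> left_cosets G (line_stab n G)"
    then obtain h where h: "h \<in> G" "K = (\<lambda>p. h * p) ` line_stab n G" by (auto simp: left_cosets_def)
    define g where "g = (SOME g. g \<in> K)"
    have "\<exists>g. g \<in> K" using mat_groupD(2)[OF mat_group_line_stab[OF n G]] h(2) by blast
    then have "g \<in> K" unfolding g_def by (rule someI_ex)
    then have g: "g \<in> G" using h GD(3) by (auto simp: line_stab_def)
    have Y: "conjg g X \<in> L" by (rule conj_L[OF g X])
    have "conjg g X *\<^sub>v e0 n = 0\<^sub>v n \<longleftrightarrow> X *\<^sub>v (g *\<^sub>v e0 n) = 0\<^sub>v n"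
      by (rule conjg_vec_zero[OF GD(1)[OF g] Xc]) simp
    then have "(if conjg g X \<in> {Y \<in> L. block_upper ks Y}
        then \<Phi> (diag_part ks 0 (conjg g X)) (diag_part ks 1 (conjg g X)) else 0) =
      (if X *\<^sub>v (g *\<^sub>v e0 n) = 0\<^sub>v n then b (defl m (conjg g X)) else 0)"
      using \<Phi>[OF Y] Y by simp
    then show "(if minv (SOME g. g \<in> K) * X * (SOME g. g \<in> K) \<in> {Y \<in> L. block_upper ks Y}
        then \<Phi> (diag_part ks 0 (minv (SOME g. g \<in> K) * X * (SOME g. g \<in> K)))
          (diag_part ks 1 (minv (SOME g. g \<in> K) * X * (SOME g. g \<in> K))) else 0) =
      (if X *\<^sub>v ((SOME g. g \<in> K) *\<^sub>v e0 n) = 0\<^sub>v n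
        then b (defl m (conjg (SOME g. g \<in> K) X)) else 0)"
      unfolding conjg_def g_def .
  qed
  also have "\<dots> = ker_sum n m G b X / (real (card (UNIV :: 'a set)) - 1)" by (rule sum_cosets_eq[OF X])
  finally show ?thesis using X by simp
qed (simp add: parabolic_ind_def Let_def)

text \<open>The substitution of \<open>h v\<close> for \<open>v\<close> matches the kernel vectors
  of \<open>conjg h X\<close> with those of \<open>X\<close>; \<open>h\<close> times a frame of
  \<open>v\<close> serves as a frame of \<open>h v\<close>.\<close>

lemma ker_sum_conj:
  assumes X: "X \<in> L" and h: "h \<in> G"
  shows "ker_sum n m G b (conjg h X) = ker_sum n m G b X"
proof -
  have Xc: "X \<in> carrier_mat n n" using X L by auto
  have hc: "h \<in> GL n" using GD(1)[OF h] .
  have orb: "g *\<^sub>v v \<in> vec_orbit n G" if gv: "g \<in> G" "v \<in> vec_orbit n G" for g v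
  proof -
    obtain k where k: "k \<in> G" "v = k *\<^sub>v e0 n" using gv(2) unfolding vec_orbit_def by blast
    have "g * k *\<^sub>v e0 n = g *\<^sub>v v"
      unfolding k(2) by (rule assoc_mult_mat_vec[OF GD(5)[OF gv(1)] GD(5)[OF k(1)]]) simp
    then show ?thesis using imageI[OF GD(3)[OF gv(1) k(1)], of "\<lambda>g. g *\<^sub>v e0 n"] unfolding vec_orbit_def by simp
  qed
  have tm: "b (defl m (conjg (frame n G v) (conjg h X))) = b (defl m (conjg (frame n G (h *\<^sub>v v)) X))"
    if v: "v \<in> vec_orbit n G" "X *\<^sub>v (h *\<^sub>v v) = 0\<^sub>v n" for v
  proof -
    let ?g = "frame n G v"
    have g: "?g \<in> G" "?g *\<^sub>v e0 n = v" using frame[OF v(1)] by auto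
    have hg: "h * ?g *\<^sub>v e0 n = h *\<^sub>v v"
      using assoc_mult_mat_vec[OF GD(5)[OF h] GD(5)[OF g(1)], of "e0 n"] g(2) by simp
    have "conjg ?g (conjg h X) = conjg (h * ?g) X"
      by (rule conjg_mult[OF hc GD(1)[OF g(1)] Xc, symmetric])
    then show ?thesis using descend_eq[OF X GD(3)[OF h g(1)]] v(2) unfolding hg by simp
  qed
  show ?thesis unfolding ker_sum_def
  proof (rule sum.reindex_bij_witness[of _ "\<lambda>v. minv h *\<^sub>v v" "\<lambda>v. h *\<^sub>v v"])
    fix v assume "v \<in> {v \<in> vec_orbit n G. conjg h X *\<^sub>v v = 0\<^sub>v n}"
    then have v: "v \<in> vec_orbit n G" "X *\<^sub>v (h *\<^sub>v v) = 0\<^sub>v n"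
      using conjg_vec_zero[OF hc Xc] orbit_carrier by auto
    show "minv h *\<^sub>v (h *\<^sub>v v) = v" using cancel_minv_vec[OF hc orbit_carrier[OF v(1)]] by simp
    show "h *\<^sub>v v \<in> {v \<in> vec_orbit n G. X *\<^sub>v v = 0\<^sub>v n}" using orb[OF h v(1)] v(2) by simp
    show "b (defl m (conjg (frame n G (h *\<^sub>v v)) X)) = b (defl m (conjg (frame n G v) (conjg h X)))"
      using tm[OF v] by simp
  next
    fix v assume v: "v \<in> {v \<in> vec_orbit n G. X *\<^sub>v v = 0\<^sub>v n}"
    then show *: "h *\<^sub>v (minv h *\<^sub>v v) = v" using cancel_minv_vec[OF hc orbit_carrier, of v] by simp
    have "minv h *\<^sub>v v \<in> vec_orbit n G" using orb[OF GD(4)[OF h]] v by simp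
    then show "minv h *\<^sub>v v \<in> {v \<in> vec_orbit n G. conjg h X *\<^sub>v v = 0\<^sub>v n}"
      using conjg_vec_zero[OF hc Xc orbit_carrier] * v by simp
  qed
qed

end

section \<open>Descent for the general linear group\<close>

lemma mat_unit_vec: "(A :: 'a::semiring_1 mat) \<in> carrier_mat m n \<Longrightarrow> j < n \<Longrightarrow> A *\<^sub>v unit_vec n j = col A j"
  by (intro eq_vecI) (auto simp: scalar_prod_right_unit[of j n])

lemma mult_e0_zero_iff:
  assumes "A \<in> carrier_mat n n" "0 < n"
  shows "A *\<^sub>v e0 n = 0\<^sub>v n \<longleftrightarrow> (\<forall>i<n. A $$ (i, 0) = 0)"
  unfolding mat_unit_vec[OF assms] using assms by (auto simp: vec_eq_iff)

lemma mult_e0_line_iff: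
  assumes "A \<in> carrier_mat n n" "0 < n"
  shows "(\<exists>c. A *\<^sub>v e0 n = c \<cdot>\<^sub>v e0 n) \<longleftrightarrow> (\<forall>i<n. 0 < i \<longrightarrow> A $$ (i, 0) = 0)"
  unfolding mat_unit_vec[OF assms] using assms by (auto simp: vec_eq_iff intro!: exI[of _ "A $$ (0, 0)"])

lemma mult_index_sum:
  assumes "A \<in> carrier_mat n k" "B \<in> carrier_mat k m" "i < n" "j < m"
  shows "(A * B) $$ (i, j) = (\<Sum>r<k. A $$ (i, r) * B $$ (r, j))"
  using assms by (simp add: scalar_prod_def atLeast0LessThan)

lemma GL_kernel:
  fixes g :: "'a::field mat"
  assumes "g \<in> carrier_mat n n" "\<And>x. x \<in> carrier_vec n \<Longrightarrow> g *\<^sub>v x = 0\<^sub>v n \<Longrightarrow> x = 0\<^sub>v n"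
  shows "g \<in> GL n"
proof -
  have "det g \<noteq> 0" using det_0_iff_vec_prod_zero_field[OF assms(1)] assms(2) by blast
  from det_non_zero_imp_unit[OF assms(1) this, of "()"]
  obtain h where "h \<in> carrier_mat n n" "g * h = 1\<^sub>m n" by (auto simp: Units_def ring_mat_def)
  then show ?thesis using GL_intro(1)[OF assms(1)] by blast
qed

lemma vec_orbit_GL:
  assumes n: "0 < n"
  shows "vec_orbit n (GL n) = {v \<in> carrier_vec n. v \<noteq> (0\<^sub>v n :: 'a::field vec)}"
proof (intro equalityI subsetI)
  fix v :: "'a vec" assume "v \<in> vec_orbit n (GL n)"
  then obtain g where g: "g \<in> GL n" "v = g *\<^sub>v e0 n" by (auto simp: vec_orbit_def)
  then show "v \<in> {v \<in> carrier_vec n. v \<noteq> 0\<^sub>v n}"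
    using GL_carrier[OF g(1)] mult_GL_vec_nonzero[OF g(1)] e0_nonzero[OF n] by auto
next
  fix v :: "'a vec" assume "v \<in> {v \<in> carrier_vec n. v \<noteq> 0\<^sub>v n}"
  then obtain i where v: "v \<in> carrier_vec n" "i < n" "v $ i \<noteq> 0" by (auto simp: vec_eq_iff)
  \<comment> \<open>The columns of \<open>g\<close> are \<open>v\<close> and all unit vectors except
    the one with index \<open>i\<close>; if \<open>i\<close> is not 0, column \<open>i\<close>
    receives the unit vector that \<open>v\<close> has displaced. Row \<open>i\<close> of
    \<open>g x = 0\<close> then forces \<open>x $ 0 = 0\<close>.\<close>
  define \<pi> where "\<pi> c = (if c = i then 0 else c)" for c
  define g where "g = mat n n (\<lambda>(r, c). if c = 0 then v $ r else if r = \<pi> c then 1 else 0)"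
  have g: "g \<in> carrier_mat n n" by (simp add: g_def)
  have "g \<in> GL n"
  proof (rule GL_kernel[OF g])
    fix x :: "'a vec" assume x: "x \<in> carrier_vec n" and gx: "g *\<^sub>v x = 0\<^sub>v n"
    have gx': "v $ r * x $ 0 + (\<Sum>c\<in>{1..<n}. if r = \<pi> c then x $ c else 0) = 0" if "r < n" for r
    proof -
      have "(g *\<^sub>v x) $ r = (\<Sum>c\<in>{0..<n}. (if c = 0 then v $ r else if r = \<pi> c then 1 else 0) * x $ c)"
        using that x by (simp add: g_def scalar_prod_def)
      also have "\<dots> = v $ r * x $ 0 + (\<Sum>c\<in>{1..<n}. (if c = 0 then v $ r else if r = \<pi> c then 1 else 0) * x $ c)"
        using n by (simp add: sum.atLeast_Suc_lessThan)
      also have "(\<Sum>c\<in>{1..<n}. (if c = 0 then v $ r else if r = \<pi> c then 1 else 0) * x $ c) =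
        (\<Sum>c\<in>{1..<n}. if r = \<pi> c then x $ c else 0)"
        by (intro sum.cong) auto
      finally show ?thesis using gx that by simp
    qed
    have "(\<Sum>c\<in>{1..<n}. if i = \<pi> c then x $ c else 0) = 0"
      by (intro sum.neutral) (auto simp: \<pi>_def)
    with gx'[OF v(2)] v(3) have x0: "x $ 0 = 0" by simp
    have "x $ c = 0" if c: "c < n" "0 < c" for c
    proof -
      have "\<pi> c < n" using c n by (simp add: \<pi>_def)
      moreover have "(\<Sum>d\<in>{1..<n}. if \<pi> c = \<pi> d then x $ d else 0) = (\<Sum>d\<in>{1..<n}. if d = c then x $ d else 0)"
        using c by (intro sum.cong) (auto simp: \<pi>_def)
      ultimately show ?thesis using gx'[of "\<pi> c"] x0 c by simp
    qed
    then have "x $ c = 0" if "c < n" for c using that x0 by (cases "c = 0") auto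
    then show "x = 0\<^sub>v n" using x by (auto simp: vec_eq_iff)
  qed
  moreover have "g *\<^sub>v e0 n = v"
    unfolding mat_unit_vec[OF g n] using v(1) n by (intro eq_vecI) (auto simp: g_def)
  ultimately show "v \<in> vec_orbit n (GL n)" by (force simp: vec_orbit_def)
qed

text \<open>Compression is multiplicative as soon as no product passes through an index outside the
  block, which \<open>z\<close> states entrywise.\<close>

lemma defl_mult:
  fixes A B :: "'a::semiring_0 mat"
  assumes A: "A \<in> carrier_mat n n" and B: "B \<in> carrier_mat n n" and m: "m < n"
    and z: "\<And>i j r. i < m \<Longrightarrow> j < m \<Longrightarrow> r < n \<Longrightarrow> r = 0 \<or> Suc m \<le> r \<Longrightarrow>
      A $$ (Suc i, r) * B $$ (r, Suc j) = 0"
  shows "defl m (A * B) = defl m A * defl m B"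
proof (intro eq_matI)
  fix i j assume "i < dim_row (defl m A * defl m B)" "j < dim_col (defl m A * defl m B)"
  then have ij: "i < m" "j < m" by (auto simp: defl_def)
  have "(A * B) $$ (Suc i, Suc j) = (\<Sum>r<n. A $$ (Suc i, r) * B $$ (r, Suc j))"
    using ij m by (intro mult_index_sum[OF A B]) auto
  also have "\<dots> = (\<Sum>r\<in>{Suc 0..<Suc m}. A $$ (Suc i, r) * B $$ (r, Suc j))"
    using m z[OF ij] by (intro sum.mono_neutral_right) force+
  also have "\<dots> = (\<Sum>r\<in>{0..<m}. A $$ (Suc i, Suc r) * B $$ (Suc r, Suc j))"
    by (rule sum.shift_bounds_Suc_ivl)
  also have "\<dots> = (\<Sum>r<m. defl m A $$ (i, r) * defl m B $$ (r, j))"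
    using ij by (simp add: atLeast0LessThan)
  also have "\<dots> = (defl m A * defl m B) $$ (i, j)"
    by (rule mult_index_sum[symmetric]) (use ij in auto)
  finally show "defl m (A * B) $$ (i, j) = (defl m A * defl m B) $$ (i, j)" using ij by simp
qed (auto simp: defl_def)

lemma defl_one: "m < n \<Longrightarrow> defl m (1\<^sub>m n) = 1\<^sub>m m"
  by (intro eq_matI) auto

lemma line_stab_index:
  assumes "mat_group n G" "p \<in> line_stab n G" "i < n" "0 < i"
  shows "p $$ (i, 0) = 0"
  using mult_e0_line_iff[of p n] mat_groupD(5)[OF assms(1), of p] assms(2-4) by (auto simp: line_stab_def)

lemma defl_line_stab_GL:
  assumes n: "0 < n" and p: "p \<in> line_stab n (GL n)" and Y: "Y \<in> carrier_mat n n"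
    and Y0: "\<forall>i<n. 0 < i \<longrightarrow> Y $$ (i, 0) = 0"
  shows "defl (n - 1) p \<in> GL (n - 1)" "minv (defl (n - 1) p) = defl (n - 1) (minv p)"
    "defl (n - 1) (conjg p Y) = conjg (defl (n - 1) p) (defl (n - 1) Y)"
proof -
  note H = mat_group_line_stab[OF n mat_group_GL]
  have pc: "p \<in> GL n" "p \<in> carrier_mat n n" "minv p \<in> carrier_mat n n" using mat_groupD[OF H] p by auto
  have z: "p $$ (i, 0) = 0" "minv p $$ (i, 0) = 0" if "i < n" "0 < i" for i
    using line_stab_index[OF mat_group_GL _ that] p mat_groupD(4)[OF H p] by auto
  have m: "n - 1 < n" using n by simp
  have "defl (n - 1) (p * minv p) = defl (n - 1) p * defl (n - 1) (minv p)"
    by (rule defl_mult[OF pc(2,3) m]) (use z in auto)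
  then have "defl (n - 1) p * defl (n - 1) (minv p) = 1\<^sub>m (n - 1)"
    unfolding GL_minv(2)[OF pc(1)] defl_one[OF m] by (rule sym)
  from GL_intro[OF _ _ this]
  show inv: "defl (n - 1) p \<in> GL (n - 1)" "minv (defl (n - 1) p) = defl (n - 1) (minv p)" by auto
  have mY: "minv p * Y \<in> carrier_mat n n" using pc Y by auto
  have "(minv p * Y) $$ (Suc i, 0) = 0" if "Suc i < n" for i
  proof -
    have "(minv p * Y) $$ (Suc i, 0) = (\<Sum>r<n. minv p $$ (Suc i, r) * Y $$ (r, 0))"
      by (rule mult_index_sum[OF pc(3) Y]) (use that in auto)
    also have "\<dots> = 0"
    proof (rule sum.neutral, rule ballI)
      fix r assume "r \<in> {..<n}"
      then show "minv p $$ (Suc i, r) * Y $$ (r, 0) = 0"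
        using z(2)[OF that] Y0 by (cases "r = 0") auto
    qed
    finally show ?thesis .
  qed
  then have "defl (n - 1) (conjg p Y) = defl (n - 1) (minv p * Y) * defl (n - 1) p"
    unfolding conjg_def by (intro defl_mult[OF mY pc(2) m]) auto
  also have "defl (n - 1) (minv p * Y) = defl (n - 1) (minv p) * defl (n - 1) Y"
    by (rule defl_mult[OF pc(3) Y m]) (use z in auto)
  finally show "defl (n - 1) (conjg p Y) = conjg (defl (n - 1) p) (defl (n - 1) Y)"
    by (simp add: conjg_def inv(2) del: One_nat_def)
qed

lemma invariant_funs_conjg:
  assumes "f \<in> invariant_funs G L" "mat_group n G" "g \<in> G" "X \<in> L"
  shows "f (conjg g X) = f X"
proof -
  have "f (minv g * X * minv (minv g)) = f X"
    using assms mat_groupD(4)[OF assms(2,3)] by (auto simp: invariant_funs_def)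
  then show ?thesis using GL_minv(5)[OF mat_groupD(1)[OF assms(2,3)]] by (simp add: conjg_def)
qed

lemma descent_GL:
  assumes n: "0 < n" and b: "b \<in> C_gl (n - 1)"
  shows "descent n (n - 1) (GL n) (gl n) (b :: 'a::{field,finite} mat \<Rightarrow> real)"
proof
  fix c :: 'a assume "c \<noteq> 0"
  then show "c \<cdot>\<^sub>v e0 n \<in> vec_orbit n (GL n)"
    using n by (auto simp: vec_orbit_GL[OF n] vec_eq_iff intro!: exI[of _ 0])
next
  fix p Y :: "'a mat" assume p: "p \<in> line_stab n (GL n)" and Y: "Y \<in> gl n" "Y *\<^sub>v e0 n = 0\<^sub>v n"
  have Yc: "Y \<in> carrier_mat n n" using Y by (simp add: gl_def)
  have "\<forall>i<n. 0 < i \<longrightarrow> Y $$ (i, 0) = 0" using mult_e0_zero_iff[OF Yc n] Y(2) by simp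
  from defl_line_stab_GL[OF n p Yc this]
  show "b (defl (n - 1) (conjg p Y)) = b (defl (n - 1) Y)"
    using invariant_funs_conjg[OF b[unfolded C_gl_def] mat_group_GL] by (simp add: gl_def)
qed (use n mat_group_GL conjg_carrier in \<open>auto simp: gl_def\<close>)

abbreviation kerGL :: "nat \<Rightarrow> ('a::field mat \<Rightarrow> real) \<Rightarrow> 'a mat \<Rightarrow> real" where
  "kerGL n \<equiv> ker_sum n (n - 1) (GL n)"

lemma block_upper_line:
  assumes "g \<in> carrier_mat n n" "0 < n"
  shows "block_upper [1, n - 1] g \<longleftrightarrow> (\<exists>c. g *\<^sub>v e0 n = c \<cdot>\<^sub>v e0 n)"
  unfolding mult_e0_line_iff[OF assms] using assms
  by (auto simp: block_upper_def less_Suc_eq)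

lemma x1_tilde_diag:
  assumes "0 < length ks" "ks ! 0 = 1"
  shows "x1_tilde 1 (diag_part ks 0 Y) = (if Y $$ (0, 0) = 0 then 1 else (0 :: real))"
proof -
  have "diag_part ks 0 Y = 0\<^sub>m 1 1 \<longleftrightarrow> Y $$ (0, 0) = 0"
    using assms by (auto simp: diag_part_def mat_eq_iff)
  then show ?thesis by (simp add: x1_tilde_def in_degree_def)
qed

lemma parabolic_ind_x1_other:
  assumes "i \<noteq> 1"
  shows "parabolic_ind ks G L (tensor x1_tilde a i j) X = 0"
  using assms by (simp add: parabolic_ind_def tensor_def x1_tilde_def in_degree_def Let_def)

text \<open>Since \<open>x1_tilde\<close> lives in degree 1, only the blocks
  \<open>[1, n - 1]\<close> contribute; in degree 0 nothing does.\<close>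

lemma nabla_x1:
  fixes a :: "'a::{field,finite} graded"
  assumes a: "a (n - 1) \<in> C_gl (n - 1)"
  shows "nabla (tensor x1_tilde a) n X = (if 0 < n \<and> X \<in> gl n
    then kerGL n (a (n - 1)) X / (real (card (UNIV :: 'a set)) - 1) else 0)"
proof (cases "0 < n")
  case n: True
  interpret descent n "n - 1" "GL n" "gl n" "a (n - 1)" by (rule descent_GL[OF n a])
  have P: "{g \<in> GL n. block_upper [1, n - 1] g} = line_stab n (GL n :: 'a mat set)"
    using block_upper_line[OF GL_carrier n] by (auto simp: line_stab_def)
  have "nabla (tensor x1_tilde a) n X =
    parabolic_ind [1, n - 1] (GL n) (gl n) (tensor x1_tilde a 1 (n - 1)) X"
    unfolding nabla_def using n by (subst sum.mono_neutral_right[of _ "{1}"]) (auto simp: parabolic_ind_x1_other)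
  also have "\<dots> = (if X \<in> gl n then kerGL n (a (n - 1)) X / (real (card (UNIV :: 'a set)) - 1) else 0)"
  proof (rule parabolic_ind_eq[OF P])
    fix Y :: "'a mat" assume "Y \<in> gl n"
    then have Y: "Y \<in> carrier_mat n n" by (simp add: gl_def)
    have "diag_part [1, n - 1] 1 Y = defl (n - 1) Y"
      by (intro eq_matI) (auto simp: diag_part_def)
    moreover have "(Y *\<^sub>v e0 n = 0\<^sub>v n) = (block_upper [1, n - 1] Y \<and> Y $$ (0, 0) = 0)"
      unfolding block_upper_line[OF Y n] mult_e0_line_iff[OF Y n] mult_e0_zero_iff[OF Y n]
      using n by (metis gr0I)
    ultimately show "(if block_upper [1, n - 1] Y
        then tensor x1_tilde a 1 (n - 1) (diag_part [1, n - 1] 0 Y) (diag_part [1, n - 1] 1 Y) else 0) =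
      (if Y *\<^sub>v e0 n = 0\<^sub>v n then a (n - 1) (defl (n - 1) Y) else 0)"
      by (auto simp: tensor_def x1_tilde_diag simp del: One_nat_def)
  qed
  finally show ?thesis using n by simp
qed (simp add: nabla_def parabolic_ind_x1_other)

section \<open>Commutativity of the product by a one-dimensional factor\<close>

definition diag2 :: "'a::zero mat \<Rightarrow> 'a mat \<Rightarrow> 'a mat" where
  "diag2 A B = four_block_mat A (0\<^sub>m (dim_row A) (dim_col B)) (0\<^sub>m (dim_row B) (dim_col A)) B"

lemma diag2_eq:
  assumes "A \<in> carrier_mat n n" "B \<in> carrier_mat m m"
  shows "diag2 A B = four_block_mat A (0\<^sub>m n m) (0\<^sub>m m n) B"
  using assms by (simp add: diag2_def)

lemma diag2_carrier: "A \<in> carrier_mat n n \<Longrightarrow> B \<in> carrier_mat m m \<Longrightarrow> diag2 A B \<in> carrier_mat (n + m) (n + m)"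
  by (simp add: diag2_def)

lemma diag2_mult:
  fixes A B C D :: "'a::semiring_0 mat"
  assumes A: "A \<in> carrier_mat n n" "A' \<in> carrier_mat n n" and B: "B \<in> carrier_mat m m" "B' \<in> carrier_mat m m"
  shows "diag2 A B * diag2 A' B' = diag2 (A * A') (B * B')"
proof -
  have "diag2 A B * diag2 A' B' = four_block_mat (A * A' + 0\<^sub>m n m * 0\<^sub>m m n) (A * 0\<^sub>m n m + 0\<^sub>m n m * B')
      (0\<^sub>m m n * A' + B * 0\<^sub>m m n) (0\<^sub>m m n * 0\<^sub>m n m + B * B')"
    unfolding diag2_eq[OF A(1) B(1)] diag2_eq[OF A(2) B(2)]
    by (rule mult_four_block_mat) (use A B in auto)
  also have "\<dots> = four_block_mat (A * A') (0\<^sub>m n m) (0\<^sub>m m n) (B * B')"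
    using A B by simp
  also have "\<dots> = diag2 (A * A') (B * B')"
    by (rule diag2_eq[symmetric]) (use A B in auto)
  finally show ?thesis .
qed

lemma diag2_one: "diag2 (1\<^sub>m n) (1\<^sub>m m) = (1\<^sub>m (n + m) :: 'a::semiring_1 mat)"
  by (simp add: diag2_def)

lemma diag2_GL:
  assumes "A \<in> GL n" "B \<in> GL m"
  shows "diag2 A B \<in> GL (n + m)" "minv (diag2 A B) = diag2 (minv A) (minv B)"
proof -
  note c = GL_carrier[OF assms(1)] GL_carrier[OF assms(2)] GL_minv(1)[OF assms(1)] GL_minv(1)[OF assms(2)]
  have "diag2 A B * diag2 (minv A) (minv B) = 1\<^sub>m (n + m)"
    using diag2_mult[OF c(1,3,2,4)] GL_minv(2)[OF assms(1)] GL_minv(2)[OF assms(2)] diag2_one[of n m] by simp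
  from GL_intro[OF diag2_carrier[OF c(1,2)] diag2_carrier[OF c(3,4)] this]
  show "diag2 A B \<in> GL (n + m)" "minv (diag2 A B) = diag2 (minv A) (minv B)" by auto
qed

lemma conjg_diag2:
  assumes "g \<in> GL n" "h \<in> GL m" "A \<in> carrier_mat n n" "B \<in> carrier_mat m m"
  shows "conjg (diag2 g h) (diag2 A B) = diag2 (conjg g A) (conjg h B)"
proof -
  note c = GL_carrier[OF assms(1)] GL_carrier[OF assms(2)] GL_minv(1)[OF assms(1)] GL_minv(1)[OF assms(2)]
  have mA: "minv g * A \<in> carrier_mat n n" and mB: "minv h * B \<in> carrier_mat m m" using c assms(3,4) by auto
  show ?thesis unfolding conjg_def diag2_GL(2)[OF assms(1,2)]
      diag2_mult[OF c(3) assms(3) c(4) assms(4)] diag2_mult[OF mA c(1) mB c(2)] by (rule refl)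
qed

lemma conjg_one: "A \<in> carrier_mat n n \<Longrightarrow> conjg (1\<^sub>m n) A = A"
  by (simp add: conjg_def GL_one)

lemma transpose_diag2:
  "A \<in> carrier_mat n n \<Longrightarrow> B \<in> carrier_mat m m \<Longrightarrow> transpose_mat (diag2 A B) = diag2 (transpose_mat A) (transpose_mat B)"
  by (simp add: diag2_eq[of _ n _ m] transpose_four_block_mat[of _ n n _ m _ m])

lemma transpose_GL:
  assumes "g \<in> GL n"
  shows "transpose_mat g \<in> GL n" "minv (transpose_mat g) = transpose_mat (minv g)"
proof -
  have "transpose_mat g * transpose_mat (minv g) = transpose_mat (minv g * g)"
    by (rule transpose_mult[symmetric, OF GL_minv(1)[OF assms] GL_carrier[OF assms]])
  then have "transpose_mat g * transpose_mat (minv g) = 1\<^sub>m n"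
    using GL_minv(3)[OF assms] by simp
  from GL_intro[OF _ _ this] show "transpose_mat g \<in> GL n" "minv (transpose_mat g) = transpose_mat (minv g)"
    using GL_carrier[OF assms] GL_minv(1)[OF assms] by auto
qed

lemma conjg_transpose:
  assumes "g \<in> GL n" "A \<in> carrier_mat n n"
  shows "transpose_mat (conjg g A) = conjg (transpose_mat (minv g)) (transpose_mat A)"
proof -
  note c = GL_carrier[OF assms(1)] GL_minv(1)[OF assms(1)]
  have mA: "minv g * A \<in> carrier_mat n n" using c assms by auto
  have "transpose_mat (conjg g A) = transpose_mat g * (transpose_mat A * transpose_mat (minv g))"
    unfolding conjg_def transpose_mult[OF mA c(1)] transpose_mult[OF c(2) assms(2)] by (rule refl)
  also have "\<dots> = transpose_mat g * transpose_mat A * transpose_mat (minv g)"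
    by (rule sq_assoc[symmetric, of _ n]) (use c assms in auto)
  finally show ?thesis
    unfolding conjg_def transpose_GL(2)[OF GL_minv(4)[OF assms(1)]] GL_minv(5)[OF assms(1)] .
qed

lemma similar_conjg:
  assumes "A \<in> carrier_mat n n" "similar_mat A B"
  shows "\<exists>g\<in>GL n. B = conjg g A"
proof -
  obtain P Q where w: "similar_mat_wit B A P Q"
    using similar_mat_sym[OF assms(2)] by (auto simp: similar_mat_def)
  have d: "dim_row B = n"
    using similar_matD[OF assms(2)] assms(1) by auto
  from similar_mat_witD[OF d[symmetric] w]
  have PQ: "P \<in> carrier_mat n n" "Q \<in> carrier_mat n n" "P * Q = 1\<^sub>m n" "Q * P = 1\<^sub>m n" "B = P * A * Q" by auto
  from GL_intro[OF PQ(2,1,4)] have "Q \<in> GL n" "B = conjg Q A" using PQ(5) by (auto simp: conjg_def)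
  then show ?thesis by blast
qed

lemma conjg_similar:
  assumes "A \<in> carrier_mat n n" "g \<in> GL n"
  shows "similar_mat (conjg g A) A"
  by (rule similar_matI[of _ _ "minv g" g n])
    (use assms GL_minv[OF assms(2)] GL_carrier[OF assms(2)] conjg_carrier[OF assms(2,1)] in \<open>auto simp: conjg_def\<close>)

lemma similar_transpose:
  fixes A :: "'a::field mat"
  assumes "A \<in> carrier_mat n n" "similar_mat A B"
  shows "similar_mat (transpose_mat A) (transpose_mat B)"
proof -
  obtain g where g: "g \<in> GL n" "B = conjg g A" using similar_conjg[OF assms] by blast
  have "transpose_mat B = conjg (transpose_mat (minv g)) (transpose_mat A)"
    unfolding g(2) by (rule conjg_transpose[OF g(1) assms(1)])
  moreover have "transpose_mat (minv g) \<in> GL n" using transpose_GL(1)[OF GL_minv(4)[OF g(1)]] .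
  ultimately show ?thesis
    using similar_mat_sym[OF conjg_similar[of "transpose_mat A" n "transpose_mat (minv g)"]] assms(1) by simp
qed

section \<open>Fitting decomposition into a nilpotent and an invertible block\<close>

definition strict_upper :: "'a::zero mat \<Rightarrow> bool" where
  "strict_upper A \<longleftrightarrow> (\<forall>i<dim_row A. \<forall>j\<le>i. A $$ (i, j) = 0)"

lemma strict_upper_nilpotent:
  fixes A :: "'a::field mat"
  assumes A: "A \<in> carrier_mat n n" and u: "strict_upper A"
  shows "nilpotent_mat A"
proof -
  have "\<forall>i<n. \<forall>j<n. j < i + k \<longrightarrow> (A ^\<^sub>m k) $$ (i, j) = 0" for k
  proof (induction k)
    case 0 then show ?case using A by auto
  next
    case (Suc k)
    show ?case
    proof (intro allI impI)
      fix i j assume ij: "i < n" "j < n" "j < i + Suc k"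
      have Ak: "A ^\<^sub>m k \<in> carrier_mat n n" using A by (rule pow_carrier_mat)
      have "(A ^\<^sub>m Suc k) $$ (i, j) = (\<Sum>r<n. (A ^\<^sub>m k) $$ (i, r) * A $$ (r, j))"
        using mult_index_sum[OF Ak A ij(1,2)] by simp
      also have "\<dots> = 0"
      proof (rule sum.neutral, rule ballI)
        fix r assume r: "r \<in> {..<n}"
        show "(A ^\<^sub>m k) $$ (i, r) * A $$ (r, j) = 0"
        proof (cases "r < i + k")
          case True then show ?thesis using Suc r ij by simp
        next
          case False
          then have "j \<le> r" using ij by simp
          then show ?thesis using u A r by (simp add: strict_upper_def)
        qed
      qed
      finally show "(A ^\<^sub>m Suc k) $$ (i, j) = 0" .
    qed
  qed
  have "A ^\<^sub>m n = 0\<^sub>m n n"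
  proof (rule eq_matI)
    fix i j assume "i < dim_row (0\<^sub>m n n :: 'a mat)" "j < dim_col (0\<^sub>m n n :: 'a mat)"
    then show "(A ^\<^sub>m n) $$ (i, j) = 0\<^sub>m n n $$ (i, j)"
      using \<open>\<And>k. \<forall>i<n. \<forall>j<n. j < i + k \<longrightarrow> (A ^\<^sub>m k) $$ (i, j) = 0\<close>[of n] by simp
  qed (use pow_carrier_mat[OF A, of n] in auto)
  then show ?thesis using A by (auto simp: nilpotent_mat_def)
qed

lemma nilpotent_similar:
  fixes A :: "'a::field mat"
  assumes "A \<in> carrier_mat n n" "similar_mat A B" "nilpotent_mat A"
  shows "nilpotent_mat B"
proof -
  obtain P Q where w: "similar_mat_wit B A P Q"
    using similar_mat_sym[OF assms(2)] by (auto simp: similar_mat_def)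
  have d: "dim_row B = n"
    using similar_matD[OF assms(2)] assms(1) by auto
  from similar_mat_witD[OF d[symmetric] w]
  have PQ: "P \<in> carrier_mat n n" "Q \<in> carrier_mat n n" by auto
  obtain k where "A ^\<^sub>m k = 0\<^sub>m n n" using assms by (auto simp: nilpotent_mat_def)
  then have "B ^\<^sub>m k = 0\<^sub>m n n" using similar_mat_wit_pow_id[OF w, of k] PQ by simp
  then show ?thesis using d by (auto simp: nilpotent_mat_def)
qed

lemma nilpotent_diag2:
  fixes A :: "'a::field mat"
  assumes "A \<in> carrier_mat n n" "B \<in> GL m" "nilpotent_mat (diag2 A B)"
  shows "m = 0"
proof (rule ccontr)
  assume "m \<noteq> 0"
  have B: "B \<in> carrier_mat m m" using assms(2) by (rule GL_carrier)
  obtain k where k: "diag2 A B ^\<^sub>m k = 0\<^sub>m (n + m) (n + m)"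
    using assms(3) diag2_carrier[OF assms(1) B] by (auto simp: nilpotent_mat_def)
  have Bk: "B ^\<^sub>m k \<in> GL m"
    by (induction k) (use B in \<open>auto simp: GL_one GL_mult(1) assms(2)\<close>)
  have Ac: "A ^\<^sub>m k \<in> carrier_mat n n" "B ^\<^sub>m k \<in> carrier_mat m m" using assms(1) B by auto
  have "diag2 A B ^\<^sub>m k = four_block_mat (A ^\<^sub>m k) (0\<^sub>m n m) (0\<^sub>m m n) (B ^\<^sub>m k)"
    unfolding diag2_eq[OF assms(1) B] by (rule pow_four_block_mat[OF assms(1) B])
  then have eq: "four_block_mat (A ^\<^sub>m k) (0\<^sub>m n m) (0\<^sub>m m n) (B ^\<^sub>m k) = 0\<^sub>m (n + m) (n + m)" using k by simp
  have "B ^\<^sub>m k = 0\<^sub>m m m"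
  proof (rule eq_matI)
    fix i j assume ij: "i < dim_row (0\<^sub>m m m)" "j < dim_col (0\<^sub>m m m)"
    have "four_block_mat (A ^\<^sub>m k) (0\<^sub>m n m) (0\<^sub>m m n) (B ^\<^sub>m k) $$ (n + i, n + j) = (B ^\<^sub>m k) $$ (i, j)"
      using ij Ac assms(1) B by (subst index_mat_four_block) auto
    then show "(B ^\<^sub>m k) $$ (i, j) = 0\<^sub>m m m $$ (i, j)" unfolding eq using ij by simp
  qed (use Ac in auto)
  then have "0\<^sub>m m m *\<^sub>v e0 m \<noteq> (0\<^sub>v m :: 'a vec)"
    using mult_GL_vec_nonzero[OF Bk, of "e0 m"] e0_nonzero[of m] \<open>m \<noteq> 0\<close> by auto
  then show False by auto
qed

text \<open>Conjugating \<open>diag2 N B\<close> by the unipotent matrix with corner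
  \<open>W = Z * minv B\<close> creates the corner \<open>W * B - N * W\<close>. As
  \<open>N * W = 0\<close>, this is exactly \<open>Z\<close>, and no Sylvester equation has to be
  solved.\<close>

lemma similar_kill_corner:
  fixes N Z B :: "'a::field mat"
  assumes N: "N \<in> carrier_mat n n" and Z: "Z \<in> carrier_mat n m" and B: "B \<in> GL m"
    and NZ: "N * Z = 0\<^sub>m n m"
  shows "similar_mat (four_block_mat N Z (0\<^sub>m m n) B) (diag2 N B)"
proof -
  have Bc: "B \<in> carrier_mat m m" "minv B \<in> carrier_mat m m" using GL_carrier[OF B] GL_minv(1)[OF B] .
  define W where "W = Z * minv B"
  have W: "W \<in> carrier_mat n m" using Z Bc by (simp add: W_def)
  have NW: "N * W = 0\<^sub>m n m"
  proof -
    have "N * W = N * Z * minv B" unfolding W_def by (rule assoc_mult_mat[symmetric, OF N Z Bc(2)])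
    then show ?thesis using NZ Bc by simp
  qed
  have WB: "W * B = Z"
  proof -
    have "W * B = Z * (minv B * B)" unfolding W_def by (rule assoc_mult_mat[OF Z Bc(2,1)])
    then show ?thesis using GL_minv(3)[OF B] Z by simp
  qed
  let ?P = "four_block_mat (1\<^sub>m n) W (0\<^sub>m m n) (1\<^sub>m m)"
  let ?Q = "four_block_mat (1\<^sub>m n) (- W) (0\<^sub>m m n) (1\<^sub>m m)"
  have WW: "- W + W = 0\<^sub>m n m" "W + - W = 0\<^sub>m n m" using W by (auto intro!: eq_matI)
  have u0: "- 0\<^sub>m m m = (0\<^sub>m m m :: 'a mat)" by (rule eq_matI) auto
  have PQ: "?P * ?Q = 1\<^sub>m (n + m)"
    by (subst mult_four_block_mat[of _ n n _ m _ m _ _ n _ m]) (use W WW u0 in auto)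
  have QP: "?Q * ?P = 1\<^sub>m (n + m)"
    by (subst mult_four_block_mat[of _ n n _ m _ m _ _ n _ m]) (use W WW u0 in auto)
  have "?P * diag2 N B = four_block_mat N Z (0\<^sub>m m n) B"
    unfolding diag2_eq[OF N Bc(1)]
    by (subst mult_four_block_mat[of _ n n _ m _ m _ _ n _ m]) (use W N Bc WB Z in auto)
  then have "?P * diag2 N B * ?Q = four_block_mat N Z (0\<^sub>m m n) B * ?Q" by simp
  also have "\<dots> = four_block_mat N Z (0\<^sub>m m n) B"
  proof -
    have mW: "- W \<in> carrier_mat n m" using W by simp
    have "N * (- W) = - (N * W)" using N W by simp
    then have "N * (- W) = 0\<^sub>m n m" using NW by (auto intro!: eq_matI)
    then show ?thesis
      by (subst mult_four_block_mat[of _ n n _ m _ m _ _ n _ m]) (use W N Bc Z mW in auto)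
  qed
  finally have eq: "four_block_mat N Z (0\<^sub>m m n) B = ?P * diag2 N B * ?Q" by simp
  show ?thesis
    by (rule similar_matI[OF _ PQ QP eq]) (use N Bc W diag2_carrier[OF N Bc(1)] in auto)
qed

text \<open>A kernel vector of a singular matrix is moved to the first position. The induction
  hypothesis for the compression yields \<open>N\<close> and \<open>B\<close>, and the row above
  them is divided between the enlarged nilpotent block and a removable corner.\<close>

lemma fitting:
  fixes A :: "'a::{field,finite} mat"
  assumes "A \<in> carrier_mat n n"
  shows "\<exists>m r N B. m + r = n \<and> N \<in> carrier_mat m m \<and> strict_upper N \<and> B \<in> GL r \<and> similar_mat A (diag2 N B)"
  using assms
proof (induction n arbitrary: A)
  case 0
  have "similar_mat A (diag2 (0\<^sub>m 0 0) A)"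
    using 0 by (auto simp: diag2_def four_block_mat_def Let_def intro!: similar_matI[of _ _ A A 0])
  moreover have "A \<in> GL 0" using 0 by (auto intro!: GL_intro(1)[of _ 0 A])
  ultimately show ?case by (intro exI[of _ 0] exI[of _ "0\<^sub>m 0 0"] exI[of _ A]) (auto simp: strict_upper_def)
next
  case (Suc n)
  note A = Suc.prems
  show ?case
  proof (cases "A \<in> GL (Suc n)")
    case True
    have "diag2 (0\<^sub>m 0 0) A = A" using A by (intro eq_matI) (auto simp: diag2_def)
    then have "similar_mat A (diag2 (0\<^sub>m 0 0) A)" using similar_mat_refl[OF A] by simp
    with True show ?thesis
      by (intro exI[of _ 0] exI[of _ "Suc n"] exI[of _ "0\<^sub>m 0 0"] exI[of _ A]) (auto simp: strict_upper_def)
  next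
    case False
    then obtain v where v: "v \<in> carrier_vec (Suc n)" "A *\<^sub>v v = 0\<^sub>v (Suc n)" "v \<noteq> 0\<^sub>v (Suc n)"
      using GL_kernel[OF A] by blast
    then have "v \<in> vec_orbit (Suc n) (GL (Suc n))" by (simp add: vec_orbit_GL)
    from frame[OF this] obtain g where g: "g \<in> GL (Suc n)" "g *\<^sub>v e0 (Suc n) = v" by blast
    define A' where "A' = conjg g A"
    have A': "A' \<in> carrier_mat (Suc n) (Suc n)" unfolding A'_def by (rule conjg_carrier[OF g(1) A])
    have "A' *\<^sub>v e0 (Suc n) = 0\<^sub>v (Suc n)"
      unfolding A'_def using conjg_vec_zero[OF g(1) A, of "e0 (Suc n)"] g(2) v(2) by simp
    then have A'0: "\<forall>i<Suc n. A' $$ (i, 0) = 0" using mult_e0_zero_iff[OF A'] by simp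
    define z where "z = mat 1 n (\<lambda>(i, j). A' $$ (0, Suc j))"
    have A'_eq: "A' = four_block_mat (0\<^sub>m 1 1) z (0\<^sub>m n 1) (defl n A')"
    proof (rule eq_matI)
      fix i j assume ij: "i < dim_row (four_block_mat (0\<^sub>m 1 1) z (0\<^sub>m n 1) (defl n A'))"
        "j < dim_col (four_block_mat (0\<^sub>m 1 1) z (0\<^sub>m n 1) (defl n A'))"
      then show "A' $$ (i, j) = four_block_mat (0\<^sub>m 1 1) z (0\<^sub>m n 1) (defl n A') $$ (i, j)"
        using A'0 by (cases i; cases j) (auto simp: z_def)
    qed (use A' in \<open>auto simp: z_def\<close>)
    obtain m r N B where IH: "m + r = n" "N \<in> carrier_mat m m" "strict_upper N" "B \<in> GL r"
      "similar_mat (defl n A') (diag2 N B)" using Suc.IH[OF defl_carrier] by blast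
    have Bc: "B \<in> carrier_mat r r" using IH(4) by (rule GL_carrier)
    have zc: "z \<in> carrier_mat 1 n" by (simp add: z_def)
    obtain y where y: "y \<in> carrier_mat 1 n" "similar_mat A' (four_block_mat (0\<^sub>m 1 1) y (0\<^sub>m n 1) (diag2 N B))"
      using similar_mat_four_block_0_ex[OF similar_mat_refl[of "0\<^sub>m 1 1" 1] IH(5) zc _ defl_carrier] A'_eq by auto
    \<comment> \<open>The surviving first row \<open>y\<close> is cut after \<open>m\<close>
      entries: its head completes \<open>N\<close> to a larger strictly upper triangular block, its
      tail is the only nonzero row of \<open>Z\<close>.\<close>
    define N' where "N' = mat (Suc m) (Suc m) (\<lambda>(i, j). if j = 0 then 0 else if i = 0 then y $$ (0, j - 1) else N $$ (i - 1, j - 1))"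
    define Z where "Z = mat (Suc m) r (\<lambda>(i, j). if i = 0 then y $$ (0, m + j) else 0)"
    have N': "N' \<in> carrier_mat (Suc m) (Suc m)" and Z: "Z \<in> carrier_mat (Suc m) r" by (auto simp: N'_def Z_def)
    have "four_block_mat (0\<^sub>m 1 1) y (0\<^sub>m n 1) (diag2 N B) = four_block_mat N' Z (0\<^sub>m r (Suc m)) B"
    proof (rule eq_matI)
      fix i j assume "i < dim_row (four_block_mat N' Z (0\<^sub>m r (Suc m)) B)"
        "j < dim_col (four_block_mat N' Z (0\<^sub>m r (Suc m)) B)"
      then show "four_block_mat (0\<^sub>m 1 1) y (0\<^sub>m n 1) (diag2 N B) $$ (i, j) =
        four_block_mat N' Z (0\<^sub>m r (Suc m)) B $$ (i, j)"
        using IH(1,2) Bc y(1) by (cases i; cases j) (auto simp: N'_def Z_def diag2_def)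
    qed (use IH(1,2) Bc in \<open>auto simp: N'_def diag2_def\<close>)
    \<comment> \<open>The only nonzero row of \<open>Z\<close> meets the zero first column of
      \<open>N'\<close>.\<close>
    moreover have "N' * Z = 0\<^sub>m (Suc m) r"
    proof (rule eq_matI)
      fix i j assume "i < dim_row (0\<^sub>m (Suc m) r)" "j < dim_col (0\<^sub>m (Suc m) r)"
      then have ij: "i < Suc m" "j < r" by auto
      have "(N' * Z) $$ (i, j) = (\<Sum>k<Suc m. N' $$ (i, k) * Z $$ (k, j))" by (rule mult_index_sum[OF N' Z ij])
      also have "\<dots> = 0" using ij by (intro sum.neutral) (auto simp: N'_def Z_def)
      finally show "(N' * Z) $$ (i, j) = 0\<^sub>m (Suc m) r $$ (i, j)" using ij by simp
    qed (use N' Z in auto)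
    ultimately have "similar_mat A' (diag2 N' B)"
      using similar_mat_trans[OF y(2)] similar_kill_corner[OF N' Z IH(4)] by simp
    moreover have "similar_mat A A'"
      unfolding A'_def by (rule similar_mat_sym[OF conjg_similar[OF A g(1)]])
    ultimately have "similar_mat A (diag2 N' B)" using similar_mat_trans by blast
    moreover have "strict_upper N'"
      using IH(2,3) unfolding strict_upper_def N'_def by auto
    ultimately show ?thesis using N' IH(1,4) by (intro exI[of _ "Suc m"] exI[of _ r] exI[of _ N'] exI[of _ B]) auto
  qed
qed

section \<open>Nilpotent matrices and their transposes\<close>

lemma antidiag_carrier [simp]: "antidiag n \<in> carrier_mat n n"
  by (simp add: antidiag_def)

lemma antidiag_dim [simp]: "dim_row (antidiag n) = n" "dim_col (antidiag n) = n"
  by (simp_all add: antidiag_def)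

lemma antidiag_mult_left:
  assumes "M \<in> carrier_mat n m" "i < n" "j < m"
  shows "(antidiag n * M) $$ (i, j) = M $$ (n - Suc i, j)"
proof -
  have "(antidiag n * M) $$ (i, j) = (\<Sum>r<n. antidiag n $$ (i, r) * M $$ (r, j))"
    by (rule mult_index_sum[OF antidiag_carrier assms])
  also have "\<dots> = (\<Sum>r<n. if r = n - Suc i then M $$ (r, j) else 0)"
    using assms by (intro sum.cong) (auto simp: antidiag_def)
  finally show ?thesis using assms by simp
qed

lemma antidiag_mult_right:
  assumes "M \<in> carrier_mat m n" "i < m" "j < n"
  shows "(M * antidiag n) $$ (i, j) = M $$ (i, n - Suc j)"
proof -
  have "(M * antidiag n) $$ (i, j) = (\<Sum>r<n. M $$ (i, r) * antidiag n $$ (r, j))"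
    by (rule mult_index_sum[OF assms(1) antidiag_carrier assms(2,3)])
  also have "\<dots> = (\<Sum>r<n. if r = n - Suc j then M $$ (i, r) else 0)"
    using assms by (intro sum.cong) (auto simp: antidiag_def)
  finally show ?thesis using assms by simp
qed

lemma antidiag_conj:
  assumes "M \<in> carrier_mat n n" "i < n" "j < n"
  shows "(antidiag n * M * antidiag n) $$ (i, j) = M $$ (n - Suc i, n - Suc j)"
proof -
  have "antidiag n * M \<in> carrier_mat n n" by (rule mult_carrier_mat[OF antidiag_carrier assms(1)])
  then show ?thesis using antidiag_mult_right[of "antidiag n * M" n n i j] antidiag_mult_left[of M n n i "n - Suc j"] assms by simp
qed

lemma antidiag_square: "antidiag n * antidiag n = 1\<^sub>m n"
proof (rule eq_matI)
  fix i j assume "i < dim_row (1\<^sub>m n)" "j < dim_col (1\<^sub>m n)"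
  then show "(antidiag n * antidiag n) $$ (i, j) = 1\<^sub>m n $$ (i, j)"
    by (subst antidiag_mult_left[of _ n n]) (auto simp: antidiag_def)
qed auto

text \<open>Reversing the order of the basis turns a Jordan block into its transpose.\<close>

lemma similar_jordan_block_transpose:
  "similar_mat (jordan_block n (a :: 'a::field)) (transpose_mat (jordan_block n a))"
proof (rule similar_matI[of _ _ "antidiag n" "antidiag n" n])
  show "jordan_block n a = antidiag n * transpose_mat (jordan_block n a) * antidiag n"
    by (rule eq_matI) (auto simp: antidiag_conj simp del: index_mult_mat(1))
qed (auto simp: antidiag_square)

lemma transpose_diag_block_mat:
  "transpose_mat (diag_block_mat As) = diag_block_mat (map transpose_mat (As :: 'a::zero mat list))"
proof (induction As)
  case (Cons A As)
  show ?case
  proof (rule eq_matI)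
    let ?T = "diag_block_mat (map transpose_mat As)"
    have d: "dim_row ?T = dim_col (diag_block_mat As)" "dim_col ?T = dim_row (diag_block_mat As)"
      unfolding Cons[symmetric] by auto
    show "dim_row (transpose_mat (diag_block_mat (A # As))) = dim_row (diag_block_mat (map transpose_mat (A # As)))"
      "dim_col (transpose_mat (diag_block_mat (A # As))) = dim_col (diag_block_mat (map transpose_mat (A # As)))"
      using d by (auto simp: Let_def)
    have t: "?T $$ (i, j) = diag_block_mat As $$ (j, i)"
      if "i < dim_col (diag_block_mat As)" "j < dim_row (diag_block_mat As)" for i j
      unfolding Cons[symmetric] using that by simp
    fix i j assume "i < dim_row (diag_block_mat (map transpose_mat (A # As)))"
      "j < dim_col (diag_block_mat (map transpose_mat (A # As)))"
    then show "transpose_mat (diag_block_mat (A # As)) $$ (i, j) = diag_block_mat (map transpose_mat (A # As)) $$ (i, j)"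
      using d t by (auto simp: Let_def)
  qed
qed simp

text \<open>The Jordan form of a triangular matrix exists over the field itself, since its
  eigenvalues stand on the diagonal; each Jordan block is similar to its transpose.\<close>

lemma similar_transpose_strict_upper:
  fixes N :: "'a::field mat"
  assumes N: "N \<in> carrier_mat n n" and u: "strict_upper N"
  shows "similar_mat (transpose_mat N) N"
proof -
  have "upper_triangular N" using u N by (auto simp: strict_upper_def)
  from triangular_to_jnf_vector[OF N this] obtain js where js: "similar_mat N (jordan_matrix js)"
    by (auto simp: jordan_nf_def)
  let ?Ms = "map (\<lambda>(n, a). (jordan_block n a, transpose_mat (jordan_block n a))) js"
  have "similar_mat (diag_block_mat (map fst ?Ms)) (diag_block_mat (map snd ?Ms))"
    by (rule similar_diag_mat_block_mat) (auto simp: similar_jordan_block_transpose)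
  moreover have "map fst ?Ms = map (\<lambda>(n, a). jordan_block n a) js"
    "map snd ?Ms = map transpose_mat (map (\<lambda>(n, a). jordan_block n a) js)" by auto
  ultimately have "similar_mat (jordan_matrix js) (transpose_mat (jordan_matrix js))"
    unfolding jordan_matrix_def transpose_diag_block_mat by (simp only:)
  then have "similar_mat N (transpose_mat (jordan_matrix js))" using similar_mat_trans[OF js] by blast
  moreover have "similar_mat (transpose_mat (jordan_matrix js)) (transpose_mat N)"
    using similar_mat_sym[OF similar_transpose[OF N js]] .
  ultimately show ?thesis using similar_mat_trans similar_mat_sym by blast
qed

text \<open>Fitting's decomposition brings a nilpotent matrix to strictly triangular shape, because
  the invertible block must be empty.\<close>

lemma similar_transpose_nilpotent:
  fixes A :: "'a::{field,finite} mat"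
  assumes A: "A \<in> carrier_mat n n" and nil: "nilpotent_mat A"
  shows "similar_mat (transpose_mat A) A"
proof -
  obtain m r N B where f: "m + r = n" "N \<in> carrier_mat m m" "strict_upper N" "B \<in> GL r" "similar_mat A (diag2 N B)"
    using fitting[OF A] by blast
  have "nilpotent_mat (diag2 N B)" by (rule nilpotent_similar[OF A f(5) nil])
  from nilpotent_diag2[OF f(2,4) this] have r: "r = 0" .
  have "B \<in> carrier_mat 0 0" using GL_carrier[OF f(4)] r by simp
  then have "diag2 N B = N" using f(2) by (intro eq_matI) (auto simp: diag2_def)
  then have s: "similar_mat A N" using f(5) by simp
  have "similar_mat (transpose_mat N) N"
    using similar_transpose_strict_upper[OF f(2,3)] .
  then show ?thesis
    using similar_mat_trans[OF similar_transpose[OF A s]] similar_mat_trans similar_mat_sym[OF s] by blast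
qed

text \<open>With a zero first column, compression commutes with taking powers.\<close>

lemma nilpotent_defl:
  fixes Y :: "'a::field mat"
  assumes Y: "Y \<in> carrier_mat n n" and n: "0 < n" and Y0: "\<forall>i<n. Y $$ (i, 0) = 0" and nil: "nilpotent_mat Y"
  shows "nilpotent_mat (defl (n - 1) Y)"
proof -
  obtain k where k: "Y ^\<^sub>m k = 0\<^sub>m n n" using nil Y by (auto simp: nilpotent_mat_def)
  have z: "(Y ^\<^sub>m k) $$ (Suc i, 0) = 0" if "Suc i < n" for i k
  proof (cases k)
    case 0 then show ?thesis using that Y by auto
  next
    case (Suc k')
    have "(Y ^\<^sub>m Suc k') $$ (Suc i, 0) = (\<Sum>r<n. (Y ^\<^sub>m k') $$ (Suc i, r) * Y $$ (r, 0))"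
      using mult_index_sum[OF pow_carrier_mat[OF Y] Y that n] by simp
    then show ?thesis using Y0 Suc by simp
  qed
  have "defl (n - 1) (Y ^\<^sub>m k) = defl (n - 1) Y ^\<^sub>m k" for k
  proof (induction k)
    case 0 then show ?case using Y n defl_one[of "n - 1" n] by simp
  next
    case (Suc k)
    have "defl (n - 1) (Y ^\<^sub>m Suc k) = defl (n - 1) (Y ^\<^sub>m k) * defl (n - 1) Y"
      unfolding pow_mat.simps by (rule defl_mult[OF pow_carrier_mat[OF Y] Y]) (use n z in auto)
    then show ?case using Suc by simp
  qed
  from this[of k] have "defl (n - 1) Y ^\<^sub>m k = defl (n - 1) (0\<^sub>m n n)" unfolding k by (rule sym)
  also have "\<dots> = 0\<^sub>m (n - 1) (n - 1)" by (rule eq_matI) auto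
  finally show ?thesis unfolding nilpotent_mat_def by (intro exI[of _ k]) simp
qed

section \<open>Transposition in kernel sums\<close>

lemma GL_kernel_zero:
  assumes "A \<in> GL n" "v \<in> carrier_vec n" "A *\<^sub>v v = 0\<^sub>v n"
  shows "v = 0\<^sub>v n"
  using mult_GL_vec_nonzero[OF assms(1,2)] assms(3) by blast

lemma append_vec_eq_zero:
  fixes a :: "'a::zero vec"
  assumes "a \<in> carrier_vec n" "b \<in> carrier_vec m"
  shows "a @\<^sub>v b = 0\<^sub>v (n + m) \<longleftrightarrow> a = 0\<^sub>v n \<and> b = 0\<^sub>v m"
proof -
  have "0\<^sub>v (n + m) = 0\<^sub>v n @\<^sub>v (0\<^sub>v m :: 'a vec)" by (rule eq_vecI) auto
  then show ?thesis using append_vec_eq[OF assms(1), of "0\<^sub>v n"] by simp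
qed

lemma diag2_mult_vec:
  fixes A :: "'a::ring_1 mat"
  assumes "A \<in> carrier_mat n n" "B \<in> carrier_mat m m" "a \<in> carrier_vec n" "b \<in> carrier_vec m"
  shows "diag2 A B *\<^sub>v (a @\<^sub>v b) = (A *\<^sub>v a) @\<^sub>v (B *\<^sub>v b)"
proof -
  have "diag2 A B *\<^sub>v (a @\<^sub>v b) = (A *\<^sub>v a + 0\<^sub>m n m *\<^sub>v b) @\<^sub>v (0\<^sub>m m n *\<^sub>v a + B *\<^sub>v b)"
    unfolding diag2_eq[OF assms(1,2)] by (rule four_block_mat_mult_vec) (use assms in auto)
  moreover have "0\<^sub>m n m *\<^sub>v b = 0\<^sub>v n" "0\<^sub>m m n *\<^sub>v a = 0\<^sub>v m"
    using assms by (auto intro!: eq_vecI)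
  ultimately show ?thesis using assms by simp
qed

text \<open>The invertible block \<open>B\<close> is frozen as a parameter. The value 0 outside the
  square matrices of size \<open>m\<close> keeps the result in \<open>C_gl m\<close>.\<close>

definition pad_diag :: "nat \<Rightarrow> ('a::field mat \<Rightarrow> real) \<Rightarrow> 'a mat \<Rightarrow> 'a mat \<Rightarrow> real" where
  "pad_diag m f B Y = (if Y \<in> carrier_mat m m then f (diag2 Y B) else 0)"

lemma C_glD:
  assumes "f \<in> C_gl n" "g \<in> GL n" "X \<in> carrier_mat n n"
  shows "f (conjg g X) = f X"
  using invariant_funs_conjg[OF assms(1)[unfolded C_gl_def] mat_group_GL assms(2)] assms(3) by (simp add: gl_def)

lemma C_gl_similar:
  assumes "f \<in> C_gl n" "X \<in> carrier_mat n n" "similar_mat X Y"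
  shows "f Y = f X"
  using similar_conjg[OF assms(2,3)] C_glD[OF assms(1) _ assms(2)] by auto

lemma C_glI:
  assumes "\<And>X. X \<notin> carrier_mat n n \<Longrightarrow> f X = 0"
    and "\<And>g X. g \<in> GL n \<Longrightarrow> X \<in> carrier_mat n n \<Longrightarrow> f (conjg g X) = f X"
  shows "f \<in> C_gl n"
proof -
  have "f (g * X * minv g) = f X" if "g \<in> GL n" "X \<in> carrier_mat n n" for g X
    using assms(2)[OF GL_minv(4)[OF that(1)] that(2)] GL_minv(5)[OF that(1)] by (simp add: conjg_def)
  then show ?thesis using assms(1) by (auto simp: C_gl_def invariant_funs_def gl_def)
qed

lemma pad_diag_C_gl:
  assumes f: "f \<in> C_gl (n + m)" and B: "B \<in> carrier_mat m m"
  shows "pad_diag n f B \<in> C_gl n"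
proof (rule C_glI)
  fix g X :: "'a mat" assume g: "g \<in> GL n" and X: "X \<in> carrier_mat n n"
  have "conjg (diag2 g (1\<^sub>m m)) (diag2 X B) = diag2 (conjg g X) B"
    using conjg_diag2[OF g GL_one(1) X B] conjg_one[OF B] by simp
  then have "f (diag2 (conjg g X) B) = f (diag2 X B)"
    using C_glD[OF f diag2_GL(1)[OF g GL_one(1)] diag2_carrier[OF X B]] by simp
  then show "pad_diag n f B (conjg g X) = pad_diag n f B X"
    using conjg_carrier[OF g X] X by (simp add: pad_diag_def)
qed (simp add: pad_diag_def)

text \<open>An invertible block has no kernel, so all kernel vectors of the direct sum come from
  \<open>N\<close> by padding with zeros, and \<open>B\<close> survives every compression
  unchanged.\<close>

lemma kerGL_diag2:
  fixes N B :: "'a::{field,finite} mat"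
  assumes m: "0 < m" and N: "N \<in> carrier_mat m m" and B: "B \<in> GL r" and f: "f \<in> C_gl (m - 1 + r)"
  shows "kerGL (m + r) f (diag2 N B) = kerGL m (pad_diag (m - 1) f B) N"
proof -
  have Bc: "B \<in> carrier_mat r r" using B by (rule GL_carrier)
  have mr: "m + r - 1 = m - 1 + r" "0 < m + r" using m by auto
  interpret D: descent "m + r" "m - 1 + r" "GL (m + r)" "gl (m + r)" f
    using descent_GL[of "m + r" f] f mr by simp
  have NB: "diag2 N B \<in> gl (m + r)" using diag2_carrier[OF N Bc] by (simp add: gl_def)
  note orb = vec_orbit_GL[OF m] vec_orbit_GL[OF mr(2)]
  show ?thesis unfolding ker_sum_def mr(1)
  proof (rule sum.reindex_bij_witness[of _ "\<lambda>v. v @\<^sub>v 0\<^sub>v r" "\<lambda>v. vec_first v m"])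
    fix v assume "v \<in> {v \<in> vec_orbit (m + r) (GL (m + r)). diag2 N B *\<^sub>v v = 0\<^sub>v (m + r)}"
    then have v: "v \<in> carrier_vec (m + r)" "v \<noteq> 0\<^sub>v (m + r)" "diag2 N B *\<^sub>v v = 0\<^sub>v (m + r)"
      by (auto simp: orb)
    let ?a = "vec_first v m" and ?b = "vec_last v r"
    have ab: "?a \<in> carrier_vec m" "?b \<in> carrier_vec r" by auto
    have v_eq: "v = ?a @\<^sub>v ?b" using v(1) by simp
    have "(N *\<^sub>v ?a) @\<^sub>v (B *\<^sub>v ?b) = 0\<^sub>v (m + r)"
      using diag2_mult_vec[OF N Bc ab] v(3) v_eq by simp
    then have z: "N *\<^sub>v ?a = 0\<^sub>v m" "B *\<^sub>v ?b = 0\<^sub>v r"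
      using append_vec_eq_zero[of "N *\<^sub>v ?a" m "B *\<^sub>v ?b" r] N Bc ab by auto
    have b0: "?b = 0\<^sub>v r" by (rule GL_kernel_zero[OF B ab(2) z(2)])
    show *: "?a @\<^sub>v 0\<^sub>v r = v" using v_eq b0 by simp
    have "?a \<noteq> 0\<^sub>v m" using v(2) * append_vec_eq_zero[OF ab(1), of "0\<^sub>v r" r] by auto
    then show a: "?a \<in> {v \<in> vec_orbit m (GL m). N *\<^sub>v v = 0\<^sub>v m}" using ab z by (auto simp: orb)
    let ?h = "frame m (GL m) ?a"
    have h: "?h \<in> GL m" "?h *\<^sub>v e0 m = ?a" using frame[of ?a m "GL m"] a by auto
    \<comment> \<open>The frame of \<open>?a\<close> padded by the identity is an admissible frame
      of \<open>v\<close>.\<close>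
    let ?g = "diag2 ?h (1\<^sub>m r)"
    have g: "?g \<in> GL (m + r)" by (rule diag2_GL(1)[OF h(1) GL_one(1)])
    have e: "e0 (m + r) = e0 m @\<^sub>v (0\<^sub>v r :: 'a vec)" using m by (intro eq_vecI) auto
    have ge: "?g *\<^sub>v e0 (m + r) = v"
      unfolding e using diag2_mult_vec[OF GL_carrier[OF h(1)] one_carrier_mat, of "e0 m" "0\<^sub>v r" r] h(2) * by simp
    have "f (defl (m - 1 + r) (conjg (frame (m + r) (GL (m + r)) v) (diag2 N B))) =
      f (defl (m - 1 + r) (conjg ?g (diag2 N B)))"
      using D.descend_eq[OF NB g] v(3) unfolding ge by simp
    also have "conjg ?g (diag2 N B) = diag2 (conjg ?h N) B"
      using conjg_diag2[OF h(1) GL_one(1) N Bc] conjg_one[OF Bc] by simp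
    also have "defl (m - 1 + r) (diag2 (conjg ?h N) B) = diag2 (defl (m - 1) (conjg ?h N)) B"
    proof (rule eq_matI)
      note hN = conjg_carrier[OF h(1) N]
      fix i j assume "i < dim_row (diag2 (defl (m - 1) (conjg ?h N)) B)" "j < dim_col (diag2 (defl (m - 1) (conjg ?h N)) B)"
      then have ij: "i < m - 1 + r" "j < m - 1 + r" using Bc by (auto simp: diag2_def)
      show "defl (m - 1 + r) (diag2 (conjg ?h N) B) $$ (i, j) = diag2 (defl (m - 1) (conjg ?h N)) B $$ (i, j)"
        using ij hN Bc m by (cases m) (auto simp: diag2_def)
    qed (use Bc in \<open>auto simp: diag2_def\<close>)
    finally show "pad_diag (m - 1) f B (defl (m - 1) (conjg (frame m (GL m) ?a) N)) =
      f (defl (m - 1 + r) (conjg (frame (m + r) (GL (m + r)) v) (diag2 N B)))"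
      by (simp add: pad_diag_def)
  next
    fix v assume "v \<in> {v \<in> vec_orbit m (GL m). N *\<^sub>v v = 0\<^sub>v m}"
    then have v: "v \<in> carrier_vec m" "v \<noteq> 0\<^sub>v m" "N *\<^sub>v v = 0\<^sub>v m" by (auto simp: orb)
    show "vec_first (v @\<^sub>v 0\<^sub>v r) m = v" using v(1) by (intro eq_vecI) (auto simp: vec_first_def)
    have "B *\<^sub>v 0\<^sub>v r = 0\<^sub>v r" using Bc by (intro eq_vecI) auto
    then have "diag2 N B *\<^sub>v (v @\<^sub>v 0\<^sub>v r) = 0\<^sub>v m @\<^sub>v 0\<^sub>v r"
      using diag2_mult_vec[OF N Bc v(1), of "0\<^sub>v r"] v(3) by simp
    also have "0\<^sub>v m @\<^sub>v 0\<^sub>v r = (0\<^sub>v (m + r) :: 'a vec)" by (rule eq_vecI) auto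
    finally show "v @\<^sub>v 0\<^sub>v r \<in> {v \<in> vec_orbit (m + r) (GL (m + r)). diag2 N B *\<^sub>v v = 0\<^sub>v (m + r)}"
      using v append_vec_eq_zero[OF v(1), of "0\<^sub>v r" r] by (auto simp: orb)
  qed
qed

lemma kerGL_similar:
  fixes A B :: "'a::{field,finite} mat"
  assumes n: "0 < n" and A: "A \<in> carrier_mat n n" and s: "similar_mat A B" and f: "f \<in> C_gl (n - 1)"
  shows "kerGL n f A = kerGL n f B"
proof -
  interpret D: descent n "n - 1" "GL n" "gl n" f by (rule descent_GL[OF n f])
  obtain g where "g \<in> GL n" "B = conjg g A" using similar_conjg[OF A s] by blast
  then show ?thesis using D.ker_sum_conj[of A g] A by (simp add: gl_def)
qed

lemma transpose_C_gl:
  assumes "f \<in> C_gl n"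
  shows "(\<lambda>X. f (transpose_mat X)) \<in> C_gl n"
proof (rule C_glI)
  fix X :: "'a mat" assume "X \<notin> carrier_mat n n"
  then show "f (transpose_mat X) = 0" using assms by (auto simp: C_gl_def invariant_funs_def gl_def)
next
  fix g X :: "'a mat" assume g: "g \<in> GL n" and X: "X \<in> carrier_mat n n"
  show "f (transpose_mat (conjg g X)) = f (transpose_mat X)"
    unfolding conjg_transpose[OF g X]
    using C_glD[OF assms transpose_GL(1)[OF GL_minv(4)[OF g]], of "transpose_mat X"] X by simp
qed

text \<open>Similarity to the transpose is used twice: for \<open>N\<close> itself, and for each
  compression, which is again nilpotent. After the first use the two sums agree term by
  term.\<close>

lemma kerGL_transpose_nilpotent:
  fixes N :: "'a::{field,finite} mat"
  assumes n: "0 < n" and N: "N \<in> carrier_mat n n" and u: "strict_upper N" and f: "f \<in> C_gl (n - 1)"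
  shows "kerGL n (\<lambda>X. f (transpose_mat X)) (transpose_mat N) = kerGL n f N"
proof -
  have "kerGL n (\<lambda>X. f (transpose_mat X)) (transpose_mat N) = kerGL n (\<lambda>X. f (transpose_mat X)) N"
    by (rule kerGL_similar[OF n _ similar_transpose_strict_upper[OF N u] transpose_C_gl[OF f]])
      (use N in simp)
  also have "\<dots> = kerGL n f N"
    unfolding ker_sum_def
  proof (rule sum.cong[OF refl])
    fix v assume "v \<in> {v \<in> vec_orbit n (GL n). N *\<^sub>v v = 0\<^sub>v n}"
    then have v: "v \<in> vec_orbit n (GL n)" "N *\<^sub>v v = 0\<^sub>v n" by auto
    let ?g = "frame n (GL n) v"
    have g: "?g \<in> GL n" "?g *\<^sub>v e0 n = v" using frame[OF v(1)] by auto
    have Y: "conjg ?g N \<in> carrier_mat n n" by (rule conjg_carrier[OF g(1) N])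
    have "conjg ?g N *\<^sub>v e0 n = 0\<^sub>v n" using conjg_vec_zero[OF g(1) N, of "e0 n"] g(2) v(2) by simp
    then have Y0: "\<forall>i<n. conjg ?g N $$ (i, 0) = 0" using mult_e0_zero_iff[OF Y n] by simp
    have "nilpotent_mat (conjg ?g N)"
      by (rule nilpotent_similar[OF N similar_mat_sym[OF conjg_similar[OF N g(1)]] strict_upper_nilpotent[OF N u]])
    from nilpotent_defl[OF Y n Y0 this]
    have s: "similar_mat (transpose_mat (defl (n - 1) (conjg ?g N))) (defl (n - 1) (conjg ?g N))"
      by (rule similar_transpose_nilpotent[OF defl_carrier])
    show "f (transpose_mat (defl (n - 1) (conjg ?g N))) = f (defl (n - 1) (conjg ?g N))"
      by (rule C_gl_similar[OF f _ s, symmetric]) simp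
  qed
  finally show ?thesis .
qed

text \<open>This amounts to \<open>\<nabla>(x\<^sub>1 \<otimes> f) = \<nabla>(f \<otimes> x\<^sub>1)\<close>: transposition exchanges the
  lines in the kernel of a matrix with the hyperplanes containing its image. By Fitting's lemma
  only the nilpotent part of the matrix matters, and nilpotent matrices are similar to their transposes.\<close>
lemma kerGL_transpose:
  fixes A :: "'a::{field,finite} mat"
  assumes n: "0 < n" and A: "A \<in> carrier_mat n n" and f: "f \<in> C_gl (n - 1)"
  shows "kerGL n (\<lambda>X. f (transpose_mat X)) (transpose_mat A) = kerGL n f A"
proof -
  obtain m r N B where F: "m + r = n" "N \<in> carrier_mat m m" "strict_upper N" "B \<in> GL r" "similar_mat A (diag2 N B)"
    using fitting[OF A] by blast
  have Bc: "B \<in> carrier_mat r r" using F(4) by (rule GL_carrier)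
  let ?f = "\<lambda>X. f (transpose_mat X)"
  note fT = transpose_C_gl[OF f]
  show ?thesis
  proof (cases "m = 0")
    \<comment> \<open>Without nilpotent part \<open>A\<close> is invertible, and both kernel sums
      are empty.\<close>
    case True
    then have "diag2 N B = B" using F(2) Bc by (intro eq_matI) (auto simp: diag2_def)
    then have AB: "similar_mat A B" and r: "r = n" using F True by auto
    have zero: "kerGL n h C = 0" if "C \<in> GL n" for h and C :: "'a mat"
    proof -
      have "{v \<in> vec_orbit n (GL n). C *\<^sub>v v = 0\<^sub>v n} = {}"
        using GL_kernel_zero[OF that] by (auto simp: vec_orbit_GL[OF n])
      then show ?thesis by (simp only: ker_sum_def sum.empty)
    qed
    have "kerGL n ?f (transpose_mat A) = kerGL n ?f (transpose_mat B)"
      by (rule kerGL_similar[OF n _ similar_transpose[OF A AB] fT]) (use A in simp)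
    moreover have "kerGL n f A = kerGL n f B" by (rule kerGL_similar[OF n A AB f])
    ultimately show ?thesis using zero F(4) transpose_GL(1)[OF F(4)] r by simp
  next
    case False
    then have m: "0 < m" and mr: "n - 1 = m - 1 + r" using F(1) by auto
    have f': "f \<in> C_gl (m - 1 + r)" "?f \<in> C_gl (m - 1 + r)" using f fT mr by auto
    have pad: "pad_diag (m - 1) ?f (transpose_mat B) = (\<lambda>Y. pad_diag (m - 1) f B (transpose_mat Y))"
    proof
      fix Y show "pad_diag (m - 1) ?f (transpose_mat B) Y = pad_diag (m - 1) f B (transpose_mat Y)"
        using Bc transpose_diag2[of Y "m - 1" "transpose_mat B" r] by (auto simp: pad_diag_def)
    qed
    have "kerGL n ?f (transpose_mat A) = kerGL n ?f (diag2 (transpose_mat N) (transpose_mat B))"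
      using kerGL_similar[OF n _ similar_transpose[OF A F(5)] fT] A transpose_diag2[OF F(2) Bc] by simp
    also have "\<dots> = kerGL m (\<lambda>Y. pad_diag (m - 1) f B (transpose_mat Y)) (transpose_mat N)"
      using kerGL_diag2[OF m _ transpose_GL(1)[OF F(4)] f'(2), of "transpose_mat N"] F(1,2) pad by simp
    also have "\<dots> = kerGL m (pad_diag (m - 1) f B) N"
      by (rule kerGL_transpose_nilpotent[OF m F(2,3) pad_diag_C_gl[OF f'(1) Bc]])
    also have "\<dots> = kerGL n f (diag2 N B)"
      using kerGL_diag2[OF m F(2,4) f'(1)] F(1) by simp
    also have "\<dots> = kerGL n f A" by (rule kerGL_similar[OF n A F(5) f, symmetric])
    finally show ?thesis .
  qed
qed

section \<open>The unitary group\<close>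

text \<open>The facts about the field with q^2 elements on which the unitary part rests: the power
  map is an additive involution, and 2 is invertible. The parameter \<open>ty\<close> fixes the
  field.\<close>

locale hermitian =
  fixes q :: nat and ty :: "'a::{field,finite} itself"
  assumes cj_add: "\<And>x y :: 'a. (x + y) ^ q = x ^ q + y ^ q"
    and cj_cj: "\<And>x :: 'a. (x ^ q) ^ q = x"
    and two: "(2 :: 'a) \<noteq> 0"
    and q: "0 < q"
begin

lemma cj_0 [simp]: "(0 :: 'a) ^ q = 0"
  using q by simp

lemma cj_eq_0 [simp]: "(x :: 'a) ^ q = 0 \<longleftrightarrow> x = 0"
  using q by simp

lemma cj_minus: "(- x :: 'a) ^ q = - (x ^ q)"
proof -
  have "(- x + x) ^ q = (- x) ^ q + x ^ q" by (rule cj_add)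
  then show ?thesis by (simp add: eq_neg_iff_add_eq_0)
qed

lemma cj_sum: "(sum f I :: 'a) ^ q = (\<Sum>i\<in>I. f i ^ q)"
  by (induction I rule: infinite_finite_induct) (auto simp: cj_add)

lemma cj_half: "(x / 2 :: 'a) ^ q = x ^ q / 2"
proof -
  have "(2 :: 'a) ^ q = 2" using cj_add[of 1 1] by simp
  then show ?thesis by (simp add: power_divide)
qed

text \<open>For square \<open>M\<close> this is J M^* J, the adjoint with respect to
  \<open>form\<close>: reflection in the antidiagonal with the involution applied entrywise. In
  these terms the unitary group is given by \<open>adj N g * g = 1\<close> and its Lie algebra by
  \<open>adj N X = - X\<close>.\<close>

definition adj :: "nat \<Rightarrow> 'a mat \<Rightarrow> 'a mat" where
  "adj N M = mat N N (\<lambda>(i, j). (M $$ (N - Suc j, N - Suc i)) ^ q)"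

lemma adj_carrier [simp]: "adj N M \<in> carrier_mat N N"
  by (simp add: adj_def)

lemma adj_dim [simp]: "dim_row (adj N M) = N" "dim_col (adj N M) = N"
  by (simp_all add: adj_def)

lemma adj_index [simp]: "i < N \<Longrightarrow> j < N \<Longrightarrow> adj N M $$ (i, j) = (M $$ (N - Suc j, N - Suc i)) ^ q"
  by (simp add: adj_def)

lemma adj_conj_transpose:
  assumes "M \<in> carrier_mat N N"
  shows "antidiag N * conj_transpose q M * antidiag N = adj N M"
proof (rule eq_matI)
  have c: "conj_transpose q M \<in> carrier_mat N N" using assms by (simp add: conj_transpose_def)
  fix i j assume "i < dim_row (adj N M)" "j < dim_col (adj N M)"
  then have ij: "i < N" "j < N" by auto
  then show "(antidiag N * conj_transpose q M * antidiag N) $$ (i, j) = adj N M $$ (i, j)"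
    using antidiag_conj[OF c ij] assms by (simp add: conj_transpose_def)
qed auto

lemma adj_adj: "M \<in> carrier_mat N N \<Longrightarrow> adj N (adj N M) = M"
  by (intro eq_matI) (auto simp: cj_cj)

lemma adj_one: "adj N (1\<^sub>m N) = 1\<^sub>m N"
proof (rule eq_matI)
  fix i j assume "i < dim_row (1\<^sub>m N :: 'a mat)" "j < dim_col (1\<^sub>m N :: 'a mat)"
  then show "adj N (1\<^sub>m N) $$ (i, j) = 1\<^sub>m N $$ (i, j)" using q by auto
qed auto

lemma adj_add: "A \<in> carrier_mat N N \<Longrightarrow> B \<in> carrier_mat N N \<Longrightarrow> adj N (A + B) = adj N A + adj N B"
  by (intro eq_matI) (auto simp: cj_add)

lemma adj_uminus: "A \<in> carrier_mat N N \<Longrightarrow> adj N (- A) = - adj N A"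
  by (intro eq_matI) (auto simp: cj_minus)

lemma sum_rev: "(\<Sum>r<N. f (N - Suc r)) = (\<Sum>r<N. f r)"
  by (rule sum.nat_diff_reindex)

lemma adj_mult:
  assumes A: "A \<in> carrier_mat N N" and B: "B \<in> carrier_mat N N"
  shows "adj N (A * B) = adj N B * adj N A"
proof (rule eq_matI)
  fix i j assume "i < dim_row (adj N B * adj N A)" "j < dim_col (adj N B * adj N A)"
  then have ij: "i < N" "j < N" by auto
  have "adj N (A * B) $$ (i, j) = (\<Sum>r<N. A $$ (N - Suc j, r) * B $$ (r, N - Suc i)) ^ q"
    using ij mult_index_sum[OF A B, of "N - Suc j" "N - Suc i"] by simp
  also have "\<dots> = (\<Sum>r<N. adj N B $$ (i, N - Suc r) * adj N A $$ (N - Suc r, j))"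
    unfolding cj_sum using ij by (intro sum.cong) (auto simp: power_mult_distrib mult.commute)
  also have "\<dots> = (\<Sum>r<N. adj N B $$ (i, r) * adj N A $$ (r, j))" by (rule sum_rev)
  also have "\<dots> = (adj N B * adj N A) $$ (i, j)" by (rule mult_index_sum[symmetric]) (use ij in auto)
  finally show "adj N (A * B) $$ (i, j) = (adj N B * adj N A) $$ (i, j)" .
qed auto

abbreviation U :: "nat \<Rightarrow> 'a mat set" where "U N \<equiv> unitary_group q N"
abbreviation ualg :: "nat \<Rightarrow> 'a mat set" where "ualg N \<equiv> unitary_algebra q N"

lemma u_iff: "X \<in> ualg N \<longleftrightarrow> X \<in> carrier_mat N N \<and> adj N X = - X"
proof (cases "X \<in> carrier_mat N N")
  case X: True
  let ?J = "antidiag N :: 'a mat"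
  have c: "conj_transpose q X \<in> carrier_mat N N" using X by (simp add: conj_transpose_def)
  have e: "(conj_transpose q X * ?J + ?J * X) $$ (i, j) = (X $$ (N - Suc j, i)) ^ q + X $$ (N - Suc i, j)"
    if "i < N" "j < N" for i j
  proof -
    have "(conj_transpose q X * ?J) $$ (i, j) = (X $$ (N - Suc j, i)) ^ q"
      using antidiag_mult_right[OF c that] that X by (simp add: conj_transpose_def)
    moreover have "(?J * X) $$ (i, j) = X $$ (N - Suc i, j)" by (rule antidiag_mult_left[OF X that])
    ultimately show ?thesis using that X c by (subst index_add_mat) auto
  qed
  have "conj_transpose q X * ?J + ?J * X = 0\<^sub>m N N \<longleftrightarrow>
    (\<forall>i<N. \<forall>j<N. (X $$ (N - Suc j, i)) ^ q + X $$ (N - Suc i, j) = 0)"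
  proof
    assume z: "conj_transpose q X * ?J + ?J * X = 0\<^sub>m N N"
    show "\<forall>i<N. \<forall>j<N. (X $$ (N - Suc j, i)) ^ q + X $$ (N - Suc i, j) = 0"
      using e unfolding z by simp
  next
    assume z: "\<forall>i<N. \<forall>j<N. (X $$ (N - Suc j, i)) ^ q + X $$ (N - Suc i, j) = 0"
    show "conj_transpose q X * ?J + ?J * X = 0\<^sub>m N N"
    proof (rule eq_matI)
      fix i j assume "i < dim_row (0\<^sub>m N N :: 'a mat)" "j < dim_col (0\<^sub>m N N :: 'a mat)"
      then have ij: "i < N" "j < N" by auto
      show "(conj_transpose q X * ?J + ?J * X) $$ (i, j) = 0\<^sub>m N N $$ (i, j)"
        unfolding e[OF ij] using z ij by simp
    qed (use X in auto)
  qed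
  also have "\<dots> \<longleftrightarrow> (\<forall>i<N. \<forall>j<N. adj N X $$ (i, j) = - X $$ (i, j))"
  proof
    assume z: "\<forall>i<N. \<forall>j<N. (X $$ (N - Suc j, i)) ^ q + X $$ (N - Suc i, j) = 0"
    show "\<forall>i<N. \<forall>j<N. adj N X $$ (i, j) = - X $$ (i, j)"
    proof (intro allI impI)
      fix i j assume ij: "i < N" "j < N"
      have "(X $$ (N - Suc j, N - Suc i)) ^ q + X $$ (N - Suc (N - Suc i), j) = 0"
        using z ij by (metis diff_Suc_less gr_zeroI not_less_zero)
      then show "adj N X $$ (i, j) = - X $$ (i, j)"
        using ij by (simp add: eq_neg_iff_add_eq_0)
    qed
  next
    assume z: "\<forall>i<N. \<forall>j<N. adj N X $$ (i, j) = - X $$ (i, j)"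
    show "\<forall>i<N. \<forall>j<N. (X $$ (N - Suc j, i)) ^ q + X $$ (N - Suc i, j) = 0"
    proof (intro allI impI)
      fix i j assume ij: "i < N" "j < N"
      then have "N - Suc i < N" by simp
      then have "adj N X $$ (N - Suc i, j) = - X $$ (N - Suc i, j)" using z ij by blast
      then show "(X $$ (N - Suc j, i)) ^ q + X $$ (N - Suc i, j) = 0"
        using ij by (simp add: eq_neg_iff_add_eq_0)
    qed
  qed
  also have "\<dots> \<longleftrightarrow> adj N X = - X" using X by (auto simp: mat_eq_iff)
  finally show ?thesis using X by (simp add: unitary_algebra_def gl_def)
qed (simp add: unitary_algebra_def gl_def)

lemma uD:
  assumes "X \<in> ualg N"
  shows "X \<in> carrier_mat N N" "adj N X = - X"
    "i < N \<Longrightarrow> j < N \<Longrightarrow> X $$ (i, j) = - ((X $$ (N - Suc j, N - Suc i)) ^ q)"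
proof -
  show X: "X \<in> carrier_mat N N" and a: "adj N X = - X" using assms by (auto simp: u_iff)
  assume ij: "i < N" "j < N"
  then have "adj N X $$ (i, j) = - X $$ (i, j)" unfolding a using X by simp
  then show "X $$ (i, j) = - ((X $$ (N - Suc j, N - Suc i)) ^ q)"
    using ij by (simp add: minus_equation_iff)
qed

lemma uI:
  assumes "X \<in> carrier_mat N N" "\<And>i j. i < N \<Longrightarrow> j < N \<Longrightarrow> X $$ (i, j) = - ((X $$ (N - Suc j, N - Suc i)) ^ q)"
  shows "X \<in> ualg N"
  unfolding u_iff
proof (intro conjI eq_matI)
  fix i j assume "i < dim_row (- X)" "j < dim_col (- X)"
  then have ij: "i < N" "j < N" using assms(1) by auto
  show "adj N X $$ (i, j) = (- X) $$ (i, j)" using assms(2)[OF ij] ij assms(1) by simp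
qed (use assms(1) in auto)

lemma U_iff: "g \<in> U N \<longleftrightarrow> g \<in> carrier_mat N N \<and> adj N g * g = 1\<^sub>m N"
proof -
  let ?J = "antidiag N :: 'a mat"
  have "conj_transpose q g * ?J * g = ?J \<longleftrightarrow> adj N g * g = 1\<^sub>m N" if g: "g \<in> carrier_mat N N"
  proof -
    let ?C = "conj_transpose q g"
    have c: "?C \<in> carrier_mat N N" using g by (simp add: conj_transpose_def)
    have "?J * (?C * ?J * g) = ?J * (?C * (?J * g))" using sq_assoc[OF c antidiag_carrier g] by simp
    also have "\<dots> = ?J * ?C * (?J * g)"
      by (rule sq_assoc[symmetric, OF antidiag_carrier c]) (use g mult_carrier_mat[OF antidiag_carrier] in blast)
    also have "\<dots> = ?J * ?C * ?J * g"
      by (rule sq_assoc[symmetric, of _ N]) (use g c mult_carrier_mat[OF antidiag_carrier c] in auto)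
    also have "\<dots> = adj N g * g" using adj_conj_transpose[OF g] by simp
    finally have eq: "?J * (?C * ?J * g) = adj N g * g" .
    have CJg: "?C * ?J * g \<in> carrier_mat N N" using c g by (metis antidiag_carrier mult_carrier_mat)
    show ?thesis
    proof
      assume "?C * ?J * g = ?J" then show "adj N g * g = 1\<^sub>m N" using eq antidiag_square by metis
    next
      assume "adj N g * g = 1\<^sub>m N"
      then have "?J * (?J * (?C * ?J * g)) = ?J * 1\<^sub>m N" using eq by simp
      also have "?J * (?J * (?C * ?J * g)) = ?J * ?J * (?C * ?J * g)"
        by (rule sq_assoc[symmetric, OF antidiag_carrier antidiag_carrier CJg])
      finally show "?C * ?J * g = ?J" using left_mult_one_mat[OF CJg] by (simp add: antidiag_square)
    qed
  qed
  moreover have "g \<in> GL N" if "g \<in> carrier_mat N N" "adj N g * g = 1\<^sub>m N"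
    using GL_intro(1)[OF that(1) adj_carrier mat_mult_left_right_inverse[OF adj_carrier that]] .
  ultimately show ?thesis using GL_carrier by (auto simp: unitary_group_def)
qed

lemma U_D:
  assumes "g \<in> U N"
  shows "g \<in> GL N" "g \<in> carrier_mat N N" "minv g = adj N g" "adj N g * g = 1\<^sub>m N" "g * adj N g = 1\<^sub>m N"
proof -
  show "g \<in> GL N" using assms by (simp add: unitary_group_def)
  show g: "g \<in> carrier_mat N N" "adj N g * g = 1\<^sub>m N" using assms by (auto simp: U_iff)
  show "g * adj N g = 1\<^sub>m N" using mat_mult_left_right_inverse[OF adj_carrier g] .
  from GL_intro(2)[OF g(1) adj_carrier this] show "minv g = adj N g" .
qed

lemma mat_group_U: "mat_group N (U N)"
  unfolding mat_group_def
proof (intro conjI ballI subsetI)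
  fix g assume "g \<in> U N" then show "g \<in> GL N" by (rule U_D)
next
  show "1\<^sub>m N \<in> U N" by (simp add: U_iff adj_one)
next
  fix g h assume g: "g \<in> U N" and h: "h \<in> U N"
  note c = U_D(2)[OF g] U_D(2)[OF h]
  have gh: "g * h \<in> carrier_mat N N" using c by auto
  have "adj N (g * h) * (g * h) = adj N h * (adj N g * (g * h))"
    unfolding adj_mult[OF c] by (rule sq_assoc[OF adj_carrier adj_carrier gh])
  also have "adj N g * (g * h) = adj N g * g * h" by (rule sq_assoc[symmetric, OF adj_carrier c])
  finally have "adj N (g * h) * (g * h) = 1\<^sub>m N" using U_D(4)[OF g] U_D(4)[OF h] c by simp
  with gh show "g * h \<in> U N" by (simp add: U_iff)
next
  fix g assume g: "g \<in> U N"
  show "minv g \<in> U N" unfolding U_D(3)[OF g] U_iff using U_D(5)[OF g] adj_adj[OF U_D(2)[OF g]] by simp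
qed

lemmas U_mult = mat_groupD(3)[OF mat_group_U] and U_one = mat_groupD(2)[OF mat_group_U]
  and U_minv = mat_groupD(4)[OF mat_group_U]

lemma conjg_u:
  assumes g: "g \<in> U N" and X: "X \<in> ualg N"
  shows "conjg g X \<in> ualg N"
proof -
  note c = U_D(2)[OF g] uD(1)[OF X]
  have aX: "adj N g * X \<in> carrier_mat N N" using c by (metis adj_carrier mult_carrier_mat)
  have "adj N (conjg g X) = adj N g * adj N (adj N g * X)"
    unfolding conjg_def U_D(3)[OF g] by (rule adj_mult[OF aX c(1)])
  also have "\<dots> = adj N g * (- X * g)"
    using adj_mult[OF adj_carrier c(2), of g] adj_adj[OF c(1)] uD(2)[OF X] by simp
  also have "\<dots> = - (adj N g * (X * g))" using c by simp
  also have "adj N g * (X * g) = conjg g X"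
    unfolding conjg_def U_D(3)[OF g] by (rule sq_assoc[symmetric, OF adj_carrier c(2,1)])
  finally show ?thesis using conjg_carrier[OF U_D(1)[OF g] c(2)] by (simp add: u_iff)
qed

text \<open>The Hermitian form u^* J v, conjugate linear in the first argument.\<close>

definition form :: "nat \<Rightarrow> 'a vec \<Rightarrow> 'a vec \<Rightarrow> 'a" where
  "form N u v = (\<Sum>r<N. (u $ r) ^ q * v $ (N - Suc r))"

definition isotropic :: "nat \<Rightarrow> 'a vec set" where
  "isotropic N = {v \<in> carrier_vec N. v \<noteq> 0\<^sub>v N \<and> form N v v = 0}"

lemma form_adj:
  assumes M: "M \<in> carrier_mat N N" and u: "u \<in> carrier_vec N" and v: "v \<in> carrier_vec N"
  shows "form N u (M *\<^sub>v v) = form N (adj N M *\<^sub>v u) v"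
proof -
  have "form N u (M *\<^sub>v v) = (\<Sum>r<N. \<Sum>s<N. (u $ r) ^ q * (M $$ (N - Suc r, s) * v $ s))"
    unfolding form_def using M v
    by (intro sum.cong) (auto simp: scalar_prod_def sum_distrib_left atLeast0LessThan)
  also have "\<dots> = (\<Sum>s<N. \<Sum>r<N. (u $ r) ^ q * (M $$ (N - Suc r, s) * v $ s))" by (rule sum.swap)
  also have "\<dots> = (\<Sum>s<N. \<Sum>r<N. (u $ r) ^ q * (M $$ (N - Suc r, N - Suc s) * v $ (N - Suc s)))"
    by (rule sum_rev[symmetric, of "\<lambda>s. \<Sum>r<N. (u $ r) ^ q * (M $$ (N - Suc r, s) * v $ s)"])
  also have "\<dots> = (\<Sum>s<N. ((adj N M *\<^sub>v u) $ s) ^ q * v $ (N - Suc s))"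
  proof (rule sum.cong[OF refl])
    fix s assume s: "s \<in> {..<N}"
    have "((adj N M *\<^sub>v u) $ s) ^ q = (\<Sum>r<N. (adj N M $$ (s, r) * u $ r)) ^ q"
      using s u by (simp add: scalar_prod_def atLeast0LessThan)
    also have "\<dots> = (\<Sum>r<N. M $$ (N - Suc r, N - Suc s) * (u $ r) ^ q)"
      unfolding cj_sum using s by (intro sum.cong) (auto simp: power_mult_distrib cj_cj)
    finally show "(\<Sum>r<N. (u $ r) ^ q * (M $$ (N - Suc r, N - Suc s) * v $ (N - Suc s))) =
      ((adj N M *\<^sub>v u) $ s) ^ q * v $ (N - Suc s)"
      by (simp add: sum_distrib_right mult.assoc mult.left_commute)
  qed
  finally show ?thesis by (simp add: form_def)
qed

lemma form_U:
  assumes g: "g \<in> U N" and u: "u \<in> carrier_vec N" and v: "v \<in> carrier_vec N"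
  shows "form N (g *\<^sub>v u) (g *\<^sub>v v) = form N u v"
proof -
  have "form N (g *\<^sub>v u) (g *\<^sub>v v) = form N (adj N g *\<^sub>v (g *\<^sub>v u)) v"
    by (rule form_adj[OF U_D(2)[OF g] _ v]) (use U_D(2)[OF g] u in simp)
  also have "adj N g *\<^sub>v (g *\<^sub>v u) = u"
    using cancel_minv_vec(1)[OF U_D(1)[OF g] u] unfolding U_D(3)[OF g] .
  finally show ?thesis .
qed

lemma isotropic_U: "g \<in> U N \<Longrightarrow> v \<in> isotropic N \<Longrightarrow> g *\<^sub>v v \<in> isotropic N"
  using form_U mult_GL_vec_nonzero[OF U_D(1)] mult_mat_vec_carrier[OF U_D(2)] by (auto simp: isotropic_def)

lemma form_cj: "(form N u v) ^ q = form N v u"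
proof -
  have "(form N u v) ^ q = (\<Sum>r<N. (v $ (N - Suc r)) ^ q * u $ (N - Suc (N - Suc r)))"
    unfolding form_def cj_sum by (intro sum.cong) (auto simp: power_mult_distrib cj_cj mult.commute)
  also have "\<dots> = form N v u"
    unfolding form_def by (rule sum_rev[of "\<lambda>r. (v $ r) ^ q * u $ (N - Suc r)"])
  finally show ?thesis .
qed

text \<open>The Lie algebra element \<open>Z\<close> is exponentiated to \<open>1 + Z + Z\<^sup>2 / 2\<close>; this needs odd \<open>q\<close>.\<close>
definition expm :: "nat \<Rightarrow> 'a mat \<Rightarrow> 'a mat" where
  "expm N Z = 1\<^sub>m N + Z + (1 / 2) \<cdot>\<^sub>m (Z * Z)"

lemma expm_U:
  assumes Z: "Z \<in> ualg N" and Z3: "Z * Z * Z = 0\<^sub>m N N"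
  shows "expm N Z \<in> U N"
proof -
  have c: "Z \<in> carrier_mat N N" by (rule uD(1)[OF Z])
  have ZZ: "Z * Z \<in> carrier_mat N N" using c by simp
  define W where "W = (1 / 2) \<cdot>\<^sub>m (Z * Z)"
  have W: "W \<in> carrier_mat N N" using ZZ by (simp add: W_def)
  have Wi: "W $$ (i, j) = (Z * Z) $$ (i, j) / 2" if "i < N" "j < N" for i j
    using that c by (simp add: W_def del: index_mult_mat(1))
  \<comment> \<open>Every product of \<open>W\<close> with \<open>Z\<close> or with itself contains
    the cube of \<open>Z\<close>.\<close>
  have WZ: "W * Z = 0\<^sub>m N N" unfolding W_def using mult_smult_assoc_mat[OF ZZ c] Z3 by simp
  have ZW: "Z * W = 0\<^sub>m N N"
    unfolding W_def using mult_smult_distrib[OF c ZZ] Z3 sq_assoc[OF c c c] by simp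
  have WW: "W * W = 0\<^sub>m N N"
  proof -
    have "W * W = (1 / 2) \<cdot>\<^sub>m (W * (Z * Z))" unfolding W_def[of ] using mult_smult_distrib[OF W ZZ] by (simp add: W_def)
    also have "W * (Z * Z) = W * Z * Z" by (rule sq_assoc[symmetric, OF W c c])
    finally show ?thesis using WZ c by simp
  qed
  have aW: "adj N W = W"
  proof (rule eq_matI)
    fix i j assume "i < dim_row W" "j < dim_col W"
    then have ij: "i < N" "j < N" using W by auto
    have "adj N (Z * Z) = Z * Z" unfolding adj_mult[OF c c] uD(2)[OF Z] using c by simp
    then have "adj N (Z * Z) $$ (i, j) = (Z * Z) $$ (i, j)" by simp
    then show "adj N W $$ (i, j) = W $$ (i, j)"
      using ij by (simp add: Wi cj_half del: index_mult_mat(1))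
  qed (use W in auto)
  let ?u = "1\<^sub>m N + Z + W" and ?v = "1\<^sub>m N + (- Z) + W"
  have v: "?v \<in> carrier_mat N N" and ZN: "- Z \<in> carrier_mat N N" using c W by auto
  have "adj N ?u = ?v"
    using c W by (simp add: adj_add[of _ N] aW adj_one uD(2)[OF Z])
  moreover have "?v * ?u = 1\<^sub>m N"
  proof -
    have vZ: "?v * Z = Z + (- (Z * Z)) + 0\<^sub>m N N"
      using c W ZN WZ by (simp add: add_mult_distrib_mat[of _ N N])
    have vW: "?v * W = W + (- 0\<^sub>m N N) + 0\<^sub>m N N"
      using c W ZN WW ZW by (simp add: add_mult_distrib_mat[of _ N N])
    have "?v * ?u = ?v * (1\<^sub>m N + Z) + ?v * W"
      by (rule mult_add_distrib_mat[OF v _ W]) (use c in auto)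
    also have "?v * (1\<^sub>m N + Z) = ?v * 1\<^sub>m N + ?v * Z" by (rule mult_add_distrib_mat[OF v _ c]) auto
    also have "?v * 1\<^sub>m N = ?v" by (rule right_mult_one_mat[OF v])
    finally have eq: "?v * ?u = ?v + (Z + (- (Z * Z)) + 0\<^sub>m N N) + (W + (- 0\<^sub>m N N) + 0\<^sub>m N N)"
      unfolding vZ vW .
    show ?thesis unfolding eq
    proof (rule eq_matI)
      fix i j assume "i < dim_row (1\<^sub>m N :: 'a mat)" "j < dim_col (1\<^sub>m N :: 'a mat)"
      then have ij: "i < N" "j < N" by auto
      \<comment> \<open>Here 2 must be invertible: the two copies of \<open>W\<close> have to cancel
        the product of \<open>- Z\<close> and \<open>Z\<close>.\<close>
      have "W $$ (i, j) + W $$ (i, j) = (Z * Z) $$ (i, j)"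
        using ij two by (simp add: Wi del: index_mult_mat(1))
      then show "(?v + (Z + (- (Z * Z)) + 0\<^sub>m N N) + (W + (- 0\<^sub>m N N) + 0\<^sub>m N N)) $$ (i, j) = 1\<^sub>m N $$ (i, j)"
        using ij c W ZZ by (simp del: index_mult_mat(1) add: algebra_simps)
    qed (use c W in auto)
  qed
  moreover have "?u \<in> carrier_mat N N" using c W by auto
  ultimately show ?thesis unfolding expm_def U_iff W_def[symmetric] by simp
qed

end

text \<open>Multiplication by a nonzero \<open>x\<close> permutes the nonzero elements and so
  preserves their product.\<close>

lemma finite_field_power_card:
  fixes x :: "'a::{field,finite}"
  shows "x ^ card (UNIV :: 'a set) = x"
proof (cases "x = 0")
  case True
  then show ?thesis by (simp add: card_gt_0_iff)
next
  case False
  have "(\<Prod>y\<in>UNIV - {0}. x * y) = (\<Prod>y\<in>UNIV - {0}. y)"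
    by (rule prod.reindex_bij_witness[of _ "\<lambda>y. y / x" "\<lambda>y. x * y"]) (use False in auto)
  then have "x ^ card (UNIV - {0 :: 'a}) * (\<Prod>y\<in>UNIV - {0}. y) = (\<Prod>y\<in>UNIV - {0}. y)"
    by (simp add: prod.distrib)
  then have "x ^ card (UNIV - {0 :: 'a}) = 1" by simp
  moreover have "card (UNIV :: 'a set) = Suc (card (UNIV - {0 :: 'a}))"
    using card_Suc_Diff1[of UNIV "0 :: 'a"] by simp
  ultimately show ?thesis by (simp only: power_Suc mult_1_right)
qed

text \<open>The characteristic divides the cardinality and hence is the prime below
  \<open>q\<close>. So raising to the power \<open>q\<close> is an iterate of Frobenius, its square
  is the identity by the cardinality, and odd \<open>q\<close> makes 2 invertible.\<close>

lemma hermitian_finite_field: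
  assumes "primepow q" "odd q" "card (UNIV :: 'a::{field,finite} set) = q ^ 2"
  shows "hermitian TYPE('a) q"
proof -
  obtain p m where p: "prime p" "0 < m" "q = p ^ m" using assms(1) by (auto simp: primepow_def)
  have pc: "prime CHAR('a)"
    by (rule prime_CHAR_semidom) (simp add: finite_imp_CHAR_pos)
  have "CHAR('a) dvd q ^ 2" using CHAR_dvd_CARD[where 'a = 'a] assms(3) by simp
  then have "CHAR('a) dvd q" by (rule prime_dvd_power[OF pc])
  then have "CHAR('a) dvd p" using p(3) prime_dvd_power[OF pc] by blast
  then have char: "CHAR('a) = p" using p(1) pc primes_dvd_imp_eq by blast
  show ?thesis
  proof
    fix x y :: 'a
    show "(x + y) ^ q = x ^ q + y ^ q" by (rule freshmans_dream'[OF pc]) (simp add: char p(3))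
    have "(x ^ q) ^ q = x ^ (q ^ 2)" by (simp add: power_mult[symmetric] power2_eq_square)
    then show "(x ^ q) ^ q = x" using finite_field_power_card[of x] assms(3) by simp
    show "(2 :: 'a) \<noteq> 0"
    proof
      assume "(2 :: 'a) = 0"
      then have "of_nat 2 = (0 :: 'a)" by simp
      then have "p dvd 2" unfolding of_nat_eq_0_iff_char_dvd char .
      then have "p = 2" using p(1) primes_dvd_imp_eq two_is_prime_nat by blast
      then show False using assms(2) p by simp
    qed
    show "0 < q" using assms(2) by (simp add: odd_pos)
  qed
qed

subsection \<open>Unipotent elements\<close>

text \<open>Position of a basis vector in the flag 0 < W < W^perp < V, with W spanned by the first
  \<open>k\<close> basis vectors. Block triangularity is expressed by comparing levels, so that
  products can be computed without block decompositions.\<close>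

definition lev :: "nat \<Rightarrow> nat \<Rightarrow> nat \<Rightarrow> nat" where
  "lev k N i = (if i < k then 0 else if i < N - k then 1 else 2)"

text \<open>The form pairs coordinate \<open>i\<close> with \<open>N - Suc i\<close>, and duality
  exchanges W with V / W^perp.\<close>

lemma lev_dual: "2 * k \<le> N \<Longrightarrow> i < N \<Longrightarrow> lev k N (N - Suc i) = 2 - lev k N i"
  by (auto simp: lev_def)

lemma lev_le_2: "lev k N i \<le> 2"
  by (simp add: lev_def)

definition strict :: "nat \<Rightarrow> nat \<Rightarrow> 'a::zero mat \<Rightarrow> bool" where
  "strict k N Z \<longleftrightarrow> (\<forall>i<N. \<forall>j<N. lev k N j \<le> lev k N i \<longrightarrow> Z $$ (i, j) = 0)"

definition unipotent :: "nat \<Rightarrow> nat \<Rightarrow> 'a::{zero,one} mat \<Rightarrow> bool" where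
  "unipotent k N u \<longleftrightarrow> (\<forall>i<N. \<forall>j<N. lev k N j \<le> lev k N i \<longrightarrow> u $$ (i, j) = (if i = j then 1 else 0))"

lemma strictD: "strict k N Z \<Longrightarrow> i < N \<Longrightarrow> j < N \<Longrightarrow> lev k N j \<le> lev k N i \<Longrightarrow> Z $$ (i, j) = 0"
  by (auto simp: strict_def)

text \<open>A strict factor raises the level by at least one, so a square reaches only the entries
  from level 0 to level 2.\<close>

lemma strict_square:
  fixes Z :: "'a::semiring_0 mat"
  assumes Z: "Z \<in> carrier_mat N N" "strict k N Z" and ij: "i < N" "j < N" "lev k N j \<le> Suc (lev k N i)"
  shows "(Z * Z) $$ (i, j) = 0"
proof -
  have "(Z * Z) $$ (i, j) = (\<Sum>r<N. Z $$ (i, r) * Z $$ (r, j))" by (rule mult_index_sum[OF Z(1,1) ij(1,2)])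
  also have "\<dots> = 0"
  proof (rule sum.neutral, rule ballI)
    fix r assume "r \<in> {..<N}"
    then show "Z $$ (i, r) * Z $$ (r, j) = 0"
      using strictD[OF Z(2) ij(1), of r] strictD[OF Z(2) _ ij(2), of r] ij(3)
      by (cases "lev k N r \<le> lev k N i") auto
  qed
  finally show ?thesis .
qed

text \<open>Three strict steps do not fit into three levels; this is why the exponential may stop at
  the square.\<close>

lemma strict_cube:
  fixes Z :: "'a::semiring_0 mat"
  assumes Z: "Z \<in> carrier_mat N N" "strict k N Z"
  shows "Z * Z * Z = 0\<^sub>m N N"
proof (rule eq_matI)
  have ZZ: "Z * Z \<in> carrier_mat N N" using Z by simp
  fix i j assume "i < dim_row (0\<^sub>m N N :: 'a mat)" "j < dim_col (0\<^sub>m N N :: 'a mat)"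
  then have ij: "i < N" "j < N" by auto
  have "(Z * Z * Z) $$ (i, j) = (\<Sum>r<N. (Z * Z) $$ (i, r) * Z $$ (r, j))" by (rule mult_index_sum[OF ZZ Z(1) ij])
  also have "\<dots> = 0"
  proof (rule sum.neutral, rule ballI)
    fix r assume r: "r \<in> {..<N}"
    show "(Z * Z) $$ (i, r) * Z $$ (r, j) = 0"
    proof (cases "lev k N r \<le> Suc (lev k N i)")
      case True then show ?thesis using strict_square[OF Z ij(1), of r] r by simp
    next
      case False
      then have "lev k N j \<le> lev k N r" using lev_le_2[of k N j] by linarith
      then show ?thesis using strictD[OF Z(2) _ ij(2), of r] r by simp
    qed
  qed
  finally show "(Z * Z * Z) $$ (i, j) = 0\<^sub>m N N $$ (i, j)" using ij by simp
qed (use Z in auto)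

lemma sum_uniform_fibres:
  fixes F :: "'b \<Rightarrow> real"
  assumes "finite S" "\<And>x. x \<in> S \<Longrightarrow> card {y \<in> S. h y = h x} = c"
  shows "(\<Sum>x\<in>S. F (h x)) = real c * (\<Sum>y\<in>h ` S. F y)"
proof -
  have "(\<Sum>x\<in>S. F (h x)) = (\<Sum>y\<in>h ` S. \<Sum>x\<in>{x \<in> S. h x = y}. F (h x))"
    using assms(1) by (intro sum.group[symmetric]) auto
  also have "\<dots> = (\<Sum>y\<in>h ` S. real c * F y)"
  proof (rule sum.cong[OF refl])
    fix y assume "y \<in> h ` S"
    then obtain x where "x \<in> S" "y = h x" by auto
    then show "(\<Sum>x\<in>{x \<in> S. h x = y}. F (h x)) = real c * F y" using assms(2)[of x] by simp
  qed
  finally show ?thesis by (simp add: sum_distrib_left)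
qed

lemma card_uniform_fibres:
  assumes "finite S" "\<And>x. x \<in> S \<Longrightarrow> card {y \<in> S. h y = h x} = c"
  shows "card S = c * card (h ` S)"
proof -
  have "real (card S) = real (c * card (h ` S))"
    using sum_uniform_fibres[OF assms, where F = "\<lambda>_. 1"] by simp
  then show ?thesis using of_nat_eq_iff by blast
qed

text \<open>The predicate \<open>P\<close> describes the kernel of the additive map
  \<open>h\<close>, whose fibres are translates of that kernel.\<close>

lemma card_additive_fibre:
  fixes S :: "'a::ab_group_add mat set"
  assumes S: "S \<subseteq> carrier_mat m n" "\<And>A B. A \<in> S \<Longrightarrow> B \<in> S \<Longrightarrow> A + B \<in> S" "\<And>A B. A \<in> S \<Longrightarrow> B \<in> S \<Longrightarrow> A - B \<in> S"
    and h: "\<And>A B. A \<in> S \<Longrightarrow> B \<in> S \<Longrightarrow> h A = h B \<longleftrightarrow> P (A - B)" and X: "X \<in> S"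
  shows "card {Y \<in> S. h Y = h X} = card {K \<in> S. P K}"
proof -
  have e: "A + B - B = A" "A - B + B = A" if "A \<in> S" "B \<in> S" for A B :: "'a mat"
  proof -
    have "A \<in> carrier_mat m n" "B \<in> carrier_mat m n" using that S(1) by auto
    then show "A + B - B = A" "A - B + B = A" by (auto intro!: eq_matI)
  qed
  have "bij_betw (\<lambda>K. K + X) {K \<in> S. P K} {Y \<in> S. h Y = h X}"
  proof (rule bij_betw_byWitness[of _ "\<lambda>Y. Y - X"])
    show "\<forall>K\<in>{K \<in> S. P K}. K + X - X = K" "\<forall>Y\<in>{Y \<in> S. h Y = h X}. Y - X + X = Y" using e X by auto
    show "(\<lambda>K. K + X) ` {K \<in> S. P K} \<subseteq> {Y \<in> S. h Y = h X}" using h[OF S(2) X] e X S(2) by auto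
    show "(\<lambda>Y. Y - X) ` {Y \<in> S. h Y = h X} \<subseteq> {K \<in> S. P K}" using h[OF _ X] X S(3) by auto
  qed
  from bij_betw_same_card[OF this] show ?thesis by (rule sym)
qed

context hermitian
begin

definition nil :: "nat \<Rightarrow> nat \<Rightarrow> 'a mat set" where
  "nil k N = {Z \<in> ualg N. strict k N Z}"

lemma nilD: "Z \<in> nil k N \<Longrightarrow> Z \<in> ualg N" "Z \<in> nil k N \<Longrightarrow> strict k N Z" "Z \<in> nil k N \<Longrightarrow> Z \<in> carrier_mat N N"
  using uD(1) by (auto simp: nil_def)

lemma u_add: "A \<in> ualg N \<Longrightarrow> B \<in> ualg N \<Longrightarrow> A + B \<in> ualg N"
proof (rule uI)
  fix i j assume A: "A \<in> ualg N" and B: "B \<in> ualg N" and ij: "i < N" "j < N"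
  show "(A + B) $$ (i, j) = - (((A + B) $$ (N - Suc j, N - Suc i)) ^ q)"
    using uD(3)[OF A ij] uD(3)[OF B ij] uD(1)[OF A] uD(1)[OF B] ij by (simp add: cj_add)
qed (use uD(1) in auto)

lemma u_uminus: "A \<in> ualg N \<Longrightarrow> - A \<in> ualg N"
proof (rule uI)
  fix i j assume A: "A \<in> ualg N" and ij: "i < N" "j < N"
  show "(- A) $$ (i, j) = - (((- A) $$ (N - Suc j, N - Suc i)) ^ q)"
    using uD(3)[OF A ij] uD(1)[OF A] ij by (simp add: cj_minus)
qed (use uD(1) in auto)

lemma u_minus:
  assumes "A \<in> ualg N" "B \<in> ualg N"
  shows "A - B \<in> ualg N"
proof -
  have "A - B = A + - B" using uD(1)[OF assms(1)] uD(1)[OF assms(2)] by (intro eq_matI) auto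
  then show ?thesis using u_add[OF assms(1) u_uminus[OF assms(2)]] by simp
qed

lemma nil_add: "A \<in> nil k N \<Longrightarrow> B \<in> nil k N \<Longrightarrow> A + B \<in> nil k N"
  using u_add[of A N B] uD(1)[of A N] uD(1)[of B N] by (auto simp: nil_def strict_def)

lemma nil_minus: "A \<in> nil k N \<Longrightarrow> B \<in> nil k N \<Longrightarrow> A - B \<in> nil k N"
  using u_minus[of A N B] uD(1)[of A N] uD(1)[of B N] by (auto simp: nil_def strict_def)

lemma nil_zero: "0\<^sub>m N N \<in> nil k N"
  using q by (auto simp: nil_def strict_def intro!: uI)

lemma finite_u: "finite (ualg N)"
  by (rule finite_subset[OF _ finite_carrier_mat[of N N]]) (use uD(1) in auto)

lemma finite_nil: "finite (nil k N)"
  using finite_u by (simp add: nil_def)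

lemma form_add_left: "u \<in> carrier_vec N \<Longrightarrow> v \<in> carrier_vec N \<Longrightarrow> form N (u + v) w = form N u w + form N v w"
  by (simp add: form_def cj_add distrib_right sum.distrib)

lemma form_add_right:
  assumes "v \<in> carrier_vec N" "w \<in> carrier_vec N"
  shows "form N u (v + w) = form N u v + form N u w"
proof -
  have "(u $ r) ^ q * (v + w) $ (N - Suc r) = (u $ r) ^ q * v $ (N - Suc r) + (u $ r) ^ q * w $ (N - Suc r)"
    if "r \<in> {..<N}" for r using that assms by (simp add: distrib_left)
  then show ?thesis by (simp add: form_def sum.distrib)
qed

lemma form_unit_left:
  assumes "p < N"
  shows "form N (c \<cdot>\<^sub>v unit_vec N p) w = c ^ q * w $ (N - Suc p)"
proof -
  have "form N (c \<cdot>\<^sub>v unit_vec N p) w = (\<Sum>r<N. if r = p then c ^ q * w $ (N - Suc r) else 0)"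
    unfolding form_def using assms by (intro sum.cong) auto
  then show ?thesis using assms by simp
qed

lemma form_unit_right:
  assumes "p < N"
  shows "form N w (c \<cdot>\<^sub>v unit_vec N p) = (w $ (N - Suc p)) ^ q * c"
proof -
  have "form N w (c \<cdot>\<^sub>v unit_vec N p) = (\<Sum>r<N. if r = N - Suc p then (w $ r) ^ q * c else 0)"
    unfolding form_def
  proof (rule sum.cong[OF refl])
    fix r assume "r \<in> {..<N}"
    then have "(N - Suc r = p) = (r = N - Suc p)" "N - Suc r < N" using assms by auto
    then show "(w $ r) ^ q * (c \<cdot>\<^sub>v unit_vec N p) $ (N - Suc r) = (if r = N - Suc p then (w $ r) ^ q * c else 0)"
      using assms by simp
  qed
  then show ?thesis using assms by simp
qed

text \<open>The image of the basis vector \<open>p\<close> under the exponential of a skew matrix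
  with column \<open>w\<close>, see \<open>expm_cross\<close>. The last term restores
  isotropy.\<close>

definition lift_vec :: "nat \<Rightarrow> nat \<Rightarrow> 'a vec \<Rightarrow> 'a vec" where
  "lift_vec N p w = vec N (\<lambda>i. (if i = p then 1 else 0) + w $ i - (if i = N - Suc p then form N w w / 2 else 0))"

text \<open>Only column \<open>p\<close> and its mirror image, row \<open>N - Suc p\<close>, are
  kept. The result is still skew, and its exponential moves the basis vector \<open>p\<close> in a
  way that depends on column \<open>p\<close> alone.\<close>

definition cross :: "nat \<Rightarrow> nat \<Rightarrow> 'a mat \<Rightarrow> 'a mat" where
  "cross N p Z = mat N N (\<lambda>(i, j). if j = p \<or> i = N - Suc p then Z $$ (i, j) else 0)"

lemma cross_nil:
  assumes "Z \<in> nil k N" "p < N"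
  shows "cross N p Z \<in> nil k N"
proof -
  have "cross N p Z \<in> ualg N"
  proof (rule uI)
    fix i j assume ij: "i < N" "j < N"
    have "(j = p \<or> i = N - Suc p) = (N - Suc i = p \<or> N - Suc j = N - Suc p)" using ij assms(2) by auto
    then show "cross N p Z $$ (i, j) = - ((cross N p Z $$ (N - Suc j, N - Suc i)) ^ q)"
      using ij uD(3)[OF nilD(1)[OF assms(1)] ij] by (simp add: cross_def)
  qed (simp add: cross_def)
  moreover have "strict k N (cross N p Z)"
    using nilD(2)[OF assms(1)] by (auto simp: strict_def cross_def)
  ultimately show ?thesis by (simp add: nil_def)
qed

lemma expm_unipotent:
  assumes "Z \<in> nil k N"
  shows "expm N Z \<in> U N" "unipotent k N (expm N Z)"
proof -
  note Z = nilD[OF assms]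
  show "expm N Z \<in> U N" by (rule expm_U[OF Z(1) strict_cube[OF Z(3,2)]])
  show "unipotent k N (expm N Z)"
    unfolding unipotent_def
  proof (intro allI impI)
    fix i j assume ij: "i < N" "j < N" "lev k N j \<le> lev k N i"
    have "(Z * Z) $$ (i, j) = 0" by (rule strict_square[OF Z(3,2) ij(1,2)]) (use ij in simp)
    then show "expm N Z $$ (i, j) = (if i = j then 1 else 0)"
      using ij Z(3) strictD[OF Z(2) ij] by (simp add: expm_def del: index_mult_mat(1))
  qed
qed

lemma expm_cross:
  assumes Z: "Z \<in> nil k N" and p: "p < N"
  shows "expm N (cross N p Z) *\<^sub>v unit_vec N p = lift_vec N p (col Z p)"
proof -
  let ?Z = "cross N p Z" and ?w = "col Z p"
  have c: "?Z \<in> carrier_mat N N" by (simp add: cross_def)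
  have Zc: "Z \<in> carrier_mat N N" using nilD(3)[OF Z] .
  have ZZ: "?Z * ?Z \<in> carrier_mat N N" using c by (rule mult_carrier_mat[OF _ c])
  have e: "expm N ?Z \<in> carrier_mat N N" using U_D(2)[OF expm_unipotent(1)[OF cross_nil[OF Z p]]] .
  show ?thesis unfolding mat_unit_vec[OF e p]
  proof (rule eq_vecI)
    fix i assume "i < dim_vec (lift_vec N p ?w)"
    then have i: "i < N" by (simp add: lift_vec_def)
    have "(?Z * ?Z) $$ (i, p) = (\<Sum>j<N. ?Z $$ (i, j) * Z $$ (j, p))"
      using mult_index_sum[OF c c i p] p by (simp add: cross_def)
    \<comment> \<open>Skewness expresses row \<open>N - Suc p\<close> through column
      \<open>p\<close>, so the square sends the basis vector \<open>p\<close> to its mirror with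
      coefficient \<open>- form N ?w ?w\<close>. In the other rows only the zero entry of
      \<open>Z\<close> at \<open>(p, p)\<close> is met.\<close>
    also have "\<dots> = (if i = N - Suc p then - form N ?w ?w else 0)"
    proof (cases "i = N - Suc p")
      case True
      have "(\<Sum>j<N. ?Z $$ (i, j) * Z $$ (j, p)) = (\<Sum>j<N. - ((?w $ (N - Suc j)) ^ q * ?w $ (N - Suc (N - Suc j))))"
      proof (rule sum.cong[OF refl])
        fix j assume "j \<in> {..<N}"
        then have j: "j < N" by simp
        have "Z $$ (N - Suc p, j) = - ((Z $$ (N - Suc j, p)) ^ q)"
          using uD(3)[OF nilD(1)[OF Z], of "N - Suc p" j] j p by simp
        then show "?Z $$ (i, j) * Z $$ (j, p) = - ((?w $ (N - Suc j)) ^ q * ?w $ (N - Suc (N - Suc j)))"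
          using True i j p Zc by (simp add: cross_def)
      qed
      also have "\<dots> = - form N ?w ?w"
        unfolding form_def sum_negf by (subst sum_rev[of "\<lambda>j. (?w $ j) ^ q * ?w $ (N - Suc j)"]) simp
      finally show ?thesis using True by simp
    next
      case False
      have "Z $$ (p, p) = 0" using strictD[OF nilD(2)[OF Z] p p] by simp
      then have "(\<Sum>j<N. ?Z $$ (i, j) * Z $$ (j, p)) = 0"
        using False i by (intro sum.neutral) (auto simp: cross_def)
      then show ?thesis using False by simp
    qed
    finally show "col (expm N ?Z) p $ i = lift_vec N p ?w $ i"
      using i p c Zc by (simp add: expm_def lift_vec_def cross_def del: index_mult_mat(1))
  qed (use e in \<open>simp add: lift_vec_def\<close>)
qed

text \<open>The base cell of the Mackey computation. For \<open>p\<close> different from its mirror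
  index it is the orbit of the basis vector \<open>p\<close> under the unipotent radical, see
  \<open>unipotent_lead_set\<close> and \<open>lead_set_unipotent\<close>.\<close>

definition lead_set :: "nat \<Rightarrow> nat \<Rightarrow> nat \<Rightarrow> 'a vec set" where
  "lead_set k N p = {v \<in> carrier_vec N. (\<forall>i<N. lev k N p \<le> lev k N i \<longrightarrow> v $ i = (if i = p then 1 else 0)) \<and> form N v v = 0}"

lemma unipotent_lead_set:
  assumes p: "p < N" "p \<noteq> N - Suc p" and u: "u \<in> U N" "unipotent k N u"
  shows "u *\<^sub>v unit_vec N p \<in> lead_set k N p"
proof -
  have "form N (1 \<cdot>\<^sub>v unit_vec N p) (unit_vec N p) = 0"
    unfolding form_unit_left[OF p(1)] using p by simp
  then have "form N (u *\<^sub>v unit_vec N p) (u *\<^sub>v unit_vec N p) = 0"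
    using form_U[OF u(1), of "unit_vec N p" "unit_vec N p"] by simp
  then show ?thesis
    using u(2) p(1) U_D(2)[OF u(1)] by (auto simp: lead_set_def mat_unit_vec unipotent_def)
qed

text \<open>Subtracting the basis vector \<open>p\<close> from \<open>v\<close> leaves
  \<open>x\<close>. Isotropy of \<open>v\<close> says by how much, namely \<open>c\<close>, the
  mirror coordinate of \<open>x\<close> fails to be skew. Adding half of \<open>c\<close> makes it
  skew, so that it can be an entry of a matrix in \<open>nil\<close>, and \<open>lift_vec\<close>
  subtracts the same half again.\<close>

lemma lead_set_surj:
  assumes N: "2 * k \<le> N" and p: "p < N" "p \<noteq> N - Suc p" and v: "v \<in> lead_set k N p"
  shows "\<exists>Z\<in>nil k N. v = lift_vec N p (col Z p)"
proof -
  let ?p = "N - Suc p"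
  have p': "?p < N" "N - Suc ?p = p" using p by auto
  have vc: "v \<in> carrier_vec N" and vl: "\<And>i. i < N \<Longrightarrow> lev k N p \<le> lev k N i \<Longrightarrow> v $ i = (if i = p then 1 else 0)"
    and vv: "form N v v = 0" using v by (auto simp: lead_set_def)
  define x where "x = vec N (\<lambda>i. v $ i - (if i = p then 1 else 0))"
  define c where "c = form N x x"
  have x: "x \<in> carrier_vec N" by (simp add: x_def)
  have xl: "x $ i = 0" if "i < N" "lev k N p \<le> lev k N i" for i using vl that by (simp add: x_def)
  have cc: "c ^ q = c" unfolding c_def by (rule form_cj)
  have "v = 1 \<cdot>\<^sub>v unit_vec N p + x" using vc p by (intro eq_vecI) (auto simp: x_def)
  then have "form N v v = form N (1 \<cdot>\<^sub>v unit_vec N p) (1 \<cdot>\<^sub>v unit_vec N p) + form N x (1 \<cdot>\<^sub>v unit_vec N p)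
    + (form N (1 \<cdot>\<^sub>v unit_vec N p) x + form N x x)"
    using x by (simp only: form_add_left form_add_right smult_carrier_vec unit_vec_carrier add_carrier_vec)
  then have sk: "x $ ?p + (x $ ?p) ^ q + c = 0"
    unfolding form_unit_left[OF p(1)] form_unit_right[OF p(1)] using vv p by (simp add: c_def algebra_simps)
  have xp: "x $ p = 0" using xl p by simp
  \<comment> \<open>If the mirror index lies at the level of \<open>p\<close> or above, the
    correction would disturb a prescribed coordinate and must vanish. In this case one factor of
    every summand of \<open>c\<close> is prescribed to be zero.\<close>
  have c0: "c = 0" if "lev k N p \<le> lev k N ?p"
  proof -
    have l1: "lev k N p \<le> 1" using that lev_dual[OF N p(1)] by simp
    have "(x $ r) ^ q * x $ (N - Suc r) = 0" if "r < N" for r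
    proof (cases "lev k N p \<le> lev k N r")
      case False
      then have "lev k N r = 0" using l1 by simp
      then have "lev k N p \<le> lev k N (N - Suc r)" using lev_dual[OF N that] lev_le_2[of k N p] by simp
      then show ?thesis using xl[of "N - Suc r"] that by simp
    qed (use xl that in simp)
    then show ?thesis unfolding c_def form_def by (intro sum.neutral) auto
  qed
  define w where "w = x + (c / 2) \<cdot>\<^sub>v unit_vec N ?p"
  have w: "w \<in> carrier_vec N" using x by (simp add: w_def)
  have wi: "w $ i = x $ i + (if i = ?p then c / 2 else 0)" if "i < N" for i using that x p'(1) by (auto simp: w_def)
  have wl: "w $ i = 0" if "i < N" "lev k N p \<le> lev k N i" for i
    using wi[OF that(1)] xl[OF that] c0 that by auto
  have wsk: "w $ ?p = - ((w $ ?p) ^ q)"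
  proof -
    have wq: "(w $ ?p) ^ q = (x $ ?p) ^ q + c / 2" using wi[OF p'(1)] by (simp add: cj_add cj_half cc)
    have c2: "c / 2 + c / 2 = c" using two by (simp flip: mult_2)
    have "w $ ?p + (w $ ?p) ^ q = x $ ?p + c / 2 + ((x $ ?p) ^ q + c / 2)"
      unfolding wq using wi[OF p'(1)] by simp
    also have "\<dots> = x $ ?p + (x $ ?p) ^ q + (c / 2 + c / 2)" by (simp only: ac_simps)
    also have "\<dots> = 0" unfolding c2 by (rule sk)
    finally show ?thesis by (simp add: eq_neg_iff_add_eq_0)
  qed
  \<comment> \<open>The form pairs the correction only with coordinate \<open>p\<close>, where both
    \<open>x\<close> and the correction itself are 0.\<close>
  have ww: "form N w w = c"
  proof -
    let ?e = "(c / 2) \<cdot>\<^sub>v unit_vec N ?p"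
    have "form N w w = form N x x + form N ?e x + (form N x ?e + form N ?e ?e)"
      unfolding w_def using x by (simp only: form_add_left form_add_right smult_carrier_vec unit_vec_carrier add_carrier_vec)
    then show ?thesis
      unfolding form_unit_left[OF p'(1)] form_unit_right[OF p'(1)] using p p' xp by (simp add: c_def)
  qed
  \<comment> \<open>Column \<open>p\<close> is \<open>w\<close>, and row \<open>?p\<close> is the
    mirror row that skewness then demands.\<close>
  define Z where "Z = mat N N (\<lambda>(i, j). if j = p then w $ i else if i = ?p then - ((w $ (N - Suc j)) ^ q) else 0)"
  have "Z \<in> ualg N"
  proof (rule uI)
    fix i j assume ij: "i < N" "j < N"
    have "Z $$ (i, j) = - ((Z $$ (N - Suc j, N - Suc i)) ^ q)"
    proof (cases "j = p")
      case True
      then show ?thesis using ij wsk p' p by (cases "i = ?p") (auto simp: Z_def cj_minus cj_cj)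
    next
      case False
      then have "N - Suc j \<noteq> ?p" using ij p by auto
      then show ?thesis using False ij p q by (auto simp: Z_def)
    qed
    then show "Z $$ (i, j) = - ((Z $$ (N - Suc j, N - Suc i)) ^ q)" .
  qed (simp add: Z_def)
  moreover have "strict k N Z"
    unfolding strict_def
  proof (intro allI impI)
    fix i j assume ij: "i < N" "j < N" "lev k N j \<le> lev k N i"
    show "Z $$ (i, j) = 0"
    proof (cases "j = p")
      case True then show ?thesis using ij wl by (simp add: Z_def)
    next
      case False
      have "w $ (N - Suc j) = 0" if "i = ?p"
      proof (rule wl)
        show "N - Suc j < N" using ij by simp
        have "lev k N j \<le> 2 - lev k N p" using ij that lev_dual[OF N p(1)] by simp
        then show "lev k N p \<le> lev k N (N - Suc j)" using lev_dual[OF N ij(2)] lev_le_2[of k N p] by simp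
      qed
      then show ?thesis using False ij by (simp add: Z_def)
    qed
  qed
  ultimately have "Z \<in> nil k N" by (simp add: nil_def)
  moreover have cZ: "col Z p = w" using w p by (intro eq_vecI) (auto simp: Z_def)
  have "v = lift_vec N p (col Z p)"
    unfolding cZ
  proof (rule eq_vecI)
    fix i assume "i < dim_vec (lift_vec N p w)"
    then have i: "i < N" by (simp add: lift_vec_def)
    then show "v $ i = lift_vec N p w $ i" using wi[OF i] by (simp add: lift_vec_def ww x_def)
  qed (use vc in \<open>simp add: lift_vec_def\<close>)
  ultimately show ?thesis by blast
qed

lemma lead_set_unipotent:
  assumes "2 * k \<le> N" "p < N" "p \<noteq> N - Suc p" "v \<in> lead_set k N p"
  shows "\<exists>u\<in>U N. unipotent k N u \<and> u *\<^sub>v unit_vec N p = v"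
proof -
  obtain Z where Z: "Z \<in> nil k N" "v = lift_vec N p (col Z p)" using lead_set_surj[OF assms] by blast
  then show ?thesis using expm_cross[OF Z(1) assms(2)] expm_unipotent[OF cross_nil[OF Z(1) assms(2)]] by blast
qed

text \<open>The fibres of taking column \<open>p\<close> are translates of its kernel, and the
  columns correspond bijectively to \<open>lead_set\<close> under \<open>lift_vec\<close>. This
  index formula later converts sums over the nilradical into averages over a smaller one.\<close>

lemma card_lead_set:
  assumes N: "2 * k \<le> N" and p: "p < N" "p \<noteq> N - Suc p"
  shows "card (nil k N) = card {Z \<in> nil k N. col Z p = 0\<^sub>v N} * card (lead_set k N p)"
proof -
  have "card (nil k N) = card {Z \<in> nil k N. col Z p = 0\<^sub>v N} * card ((\<lambda>Z. col Z p) ` nil k N)"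
  proof (rule card_uniform_fibres[OF finite_nil])
    fix X assume X: "X \<in> nil k N"
    show "card {Y \<in> nil k N. col Y p = col X p} = card {Z \<in> nil k N. col Z p = 0\<^sub>v N}"
    proof (rule card_additive_fibre[OF _ nil_add nil_minus _ X])
      fix A B assume "A \<in> nil k N" "B \<in> nil k N"
      then have "A \<in> carrier_mat N N" "B \<in> carrier_mat N N" by (auto dest: nilD)
      then show "col A p = col B p \<longleftrightarrow> col (A - B) p = 0\<^sub>v N" using p by (auto simp: vec_eq_iff)
    qed (use nilD(3) in auto)
  qed
  also have "card ((\<lambda>Z. col Z p) ` nil k N) = card (lead_set k N p)"
  proof (rule bij_betw_same_card[of "lift_vec N p"], unfold bij_betw_def, intro conjI)
    show "inj_on (lift_vec N p) ((\<lambda>Z. col Z p) ` nil k N)"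
    proof (intro inj_onI)
      fix w x assume "w \<in> (\<lambda>Z. col Z p) ` nil k N" "x \<in> (\<lambda>Z. col Z p) ` nil k N"
        and eq: "lift_vec N p w = lift_vec N p x"
      then obtain A B where AB: "A \<in> nil k N" "B \<in> nil k N" "w = col A p" "x = col B p" by auto
      then have wx: "w \<in> carrier_vec N" "x \<in> carrier_vec N"
        using nilD(3)[OF AB(1)] nilD(3)[OF AB(2)] p by auto
      have wp: "w $ p = 0" "x $ p = 0"
        using AB p strictD[OF nilD(2), of _ k N p p] nilD(3)[OF AB(1)] nilD(3)[OF AB(2)] by auto
      have e: "lift_vec N p w $ i = lift_vec N p x $ i" for i using eq by simp
      have ne: "w $ i = x $ i" if "i < N" "i \<noteq> N - Suc p" for i using e[of i] that by (simp add: lift_vec_def)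
      \<comment> \<open>The only coordinate in which \<open>w\<close> and \<open>x\<close> might
        still differ, \<open>N - Suc p\<close>, is paired with coordinate \<open>p\<close>, where
        both vanish.\<close>
      have "form N w w = form N x x"
        unfolding form_def
      proof (rule sum.cong[OF refl])
        fix r assume "r \<in> {..<N}"
        then have r: "r < N" "N - Suc r < N" by auto
        show "(w $ r) ^ q * w $ (N - Suc r) = (x $ r) ^ q * x $ (N - Suc r)"
        proof (cases "r = p \<or> r = N - Suc p")
          case True then show ?thesis using wp p by auto
        next
          case False
          then have "N - Suc r \<noteq> N - Suc p" using r p by auto
          then show ?thesis using ne r False by simp
        qed
      qed
      then have "w $ i = x $ i" if "i < N" for i
        using e[of i] that by (cases "i = N - Suc p") (auto simp: lift_vec_def)
      then show "w = x" using wx by (intro eq_vecI) auto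
    qed
    show "lift_vec N p ` (\<lambda>Z. col Z p) ` nil k N = lead_set k N p"
    proof (intro equalityI subsetI)
      fix v assume "v \<in> lift_vec N p ` (\<lambda>Z. col Z p) ` nil k N"
      then obtain Z where Z: "Z \<in> nil k N" "v = lift_vec N p (col Z p)" by auto
      show "v \<in> lead_set k N p"
        using unipotent_lead_set[OF p expm_unipotent[OF cross_nil[OF Z(1) p(1)]]] expm_cross[OF Z(1) p(1)] Z(2) by simp
    next
      fix v assume "v \<in> lead_set k N p"
      from lead_set_surj[OF N p this] show "v \<in> lift_vec N p ` (\<lambda>Z. col Z p) ` nil k N" by blast
    qed
  qed
  finally show ?thesis .
qed

end

subsection \<open>Transitivity on isotropic vectors\<close>

definition perm_mat :: "nat \<Rightarrow> (nat \<Rightarrow> nat) \<Rightarrow> 'a::{zero,one} mat" where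
  "perm_mat N \<pi> = mat N N (\<lambda>(r, c). if r = \<pi> c then 1 else 0)"

lemma perm_mat_carrier [simp]: "perm_mat N \<pi> \<in> carrier_mat N N"
  by (simp add: perm_mat_def)

lemma perm_mat_dim [simp]: "dim_row (perm_mat N \<pi>) = N" "dim_col (perm_mat N \<pi>) = N"
  by (simp_all add: perm_mat_def)

lemma vec_orbit_closed:
  assumes G: "mat_group n G" and g: "g \<in> G" and v: "v \<in> vec_orbit n G"
  shows "g *\<^sub>v v \<in> vec_orbit n G"
proof -
  note GD = mat_groupD[OF G]
  obtain k where k: "k \<in> G" "v = k *\<^sub>v e0 n" using v unfolding vec_orbit_def by blast
  have "g * k *\<^sub>v e0 n = g *\<^sub>v v"
    unfolding k(2) by (rule assoc_mult_mat_vec[OF GD(5)[OF g] GD(5)[OF k(1)]]) simp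
  then show ?thesis using imageI[OF GD(3)[OF g k(1)], of "\<lambda>g. g *\<^sub>v e0 n"] unfolding vec_orbit_def by simp
qed

context hermitian
begin

context
  fixes N :: nat and \<pi> :: "nat \<Rightarrow> nat"
  assumes \<pi>: "\<And>i. i < N \<Longrightarrow> \<pi> i < N" "inj_on \<pi> {..<N}" "\<And>i. i < N \<Longrightarrow> \<pi> (N - Suc i) = N - Suc (\<pi> i)"
begin

lemma perm_mat_unit_vec: "c < N \<Longrightarrow> (perm_mat N \<pi> :: 'a mat) *\<^sub>v unit_vec N c = unit_vec N (\<pi> c)"
  unfolding mat_unit_vec[OF perm_mat_carrier] using \<pi>(1) by (intro eq_vecI) (auto simp: perm_mat_def)

text \<open>A permutation commuting with the reflection of \<open>i\<close> to
  \<open>N - Suc i\<close> preserves the form.\<close>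

lemma perm_mat_U: "perm_mat N \<pi> \<in> U N"
  unfolding U_iff
proof (intro conjI eq_matI)
  let ?P = "perm_mat N \<pi> :: 'a mat"
  fix i j assume "i < dim_row (1\<^sub>m N :: 'a mat)" "j < dim_col (1\<^sub>m N :: 'a mat)"
  then have ij: "i < N" "j < N" by auto
  have "(adj N ?P * ?P) $$ (i, j) = (\<Sum>r<N. adj N ?P $$ (i, r) * ?P $$ (r, j))"
    by (rule mult_index_sum[OF adj_carrier perm_mat_carrier ij])
  also have "\<dots> = (\<Sum>r<N. if r = \<pi> j then (if i = j then 1 else 0) else 0)"
  proof (rule sum.cong[OF refl])
    fix r assume "r \<in> {..<N}"
    then have r: "r < N" by simp
    have "\<pi> i < N" using \<pi>(1) ij by simp
    then have "(N - Suc r = N - Suc (\<pi> i)) = (r = \<pi> i)" using r by auto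
    moreover have "(\<pi> j = \<pi> i) = (i = j)" using inj_onD[OF \<pi>(2), of j i] ij by auto
    ultimately show "adj N ?P $$ (i, r) * ?P $$ (r, j) = (if r = \<pi> j then (if i = j then 1 else 0) else 0)"
      using r ij \<pi>(3)[OF ij(1)] by (simp add: perm_mat_def)
  qed
  also have "\<dots> = 1\<^sub>m N $$ (i, j)" using ij \<pi>(1)[OF ij(2)] by simp
  finally show "(adj N ?P * ?P) $$ (i, j) = 1\<^sub>m N $$ (i, j)" .
qed auto

lemma perm_surj:
  assumes "r < N"
  shows "\<exists>s<N. r = \<pi> s"
proof -
  have "\<pi> ` {..<N} = {..<N}" by (rule endo_inj_surj[OF _ _ \<pi>(2)]) (use \<pi>(1) in auto)
  then have "r \<in> \<pi> ` {..<N}" using assms by simp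
  then show ?thesis by auto
qed

lemma conjg_perm_mat:
  assumes X: "X \<in> carrier_mat N N" and ij: "i < N" "j < N"
  shows "conjg (perm_mat N \<pi> :: 'a mat) X $$ (i, j) = X $$ (\<pi> i, \<pi> j)"
proof -
  let ?P = "perm_mat N \<pi> :: 'a mat"
  define M where "M = mat N N (\<lambda>(i, j). X $$ (\<pi> i, \<pi> j))"
  have M: "M \<in> carrier_mat N N" by (simp add: M_def)
  have "?P * M = X * ?P"
  proof (rule eq_matI)
    fix r c assume "r < dim_row (X * ?P)" "c < dim_col (X * ?P)"
    then have rc: "r < N" "c < N" using X by (auto simp: perm_mat_def)
    obtain s0 where s0: "s0 < N" "r = \<pi> s0" using perm_surj[OF rc(1)] by blast
    have "(?P * M) $$ (r, c) = (\<Sum>s<N. ?P $$ (r, s) * M $$ (s, c))"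
      by (rule mult_index_sum[OF perm_mat_carrier M rc])
    also have "\<dots> = (\<Sum>s<N. if s = s0 then X $$ (r, \<pi> c) else 0)"
    proof (rule sum.cong[OF refl])
      fix s assume "s \<in> {..<N}"
      then have s: "s < N" by simp
      have "(\<pi> s0 = \<pi> s) = (s = s0)" using inj_onD[OF \<pi>(2), of s0 s] s0 s by auto
      then show "?P $$ (r, s) * M $$ (s, c) = (if s = s0 then X $$ (r, \<pi> c) else 0)"
        using rc s s0 by (simp add: perm_mat_def M_def)
    qed
    also have "\<dots> = X $$ (r, \<pi> c)" using s0 by simp
    also have "\<dots> = (\<Sum>s<N. if s = \<pi> c then X $$ (r, s) else 0)" using \<pi>(1)[OF rc(2)] by simp
    also have "\<dots> = (\<Sum>s<N. X $$ (r, s) * ?P $$ (s, c))"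
      using rc by (intro sum.cong) (auto simp: perm_mat_def)
    also have "\<dots> = (X * ?P) $$ (r, c)" by (rule mult_index_sum[symmetric, OF X perm_mat_carrier rc])
    finally show "(?P * M) $$ (r, c) = (X * ?P) $$ (r, c)" .
  qed (use X in \<open>auto simp: perm_mat_def M_def\<close>)
  moreover have "conjg ?P X = minv ?P * (X * ?P)"
    unfolding conjg_def by (rule sq_assoc[OF GL_minv(1)[OF U_D(1)[OF perm_mat_U]] X perm_mat_carrier])
  ultimately have "conjg ?P X = M" using cancel_minv(1)[OF U_D(1)[OF perm_mat_U] M] by simp
  then show ?thesis using ij by (simp add: M_def)
qed

end

text \<open>A diagonal element scaling the last coordinate by \<open>c\<close>; unitarity forces the
  entry at index 0, which is paired with the last one.\<close>

definition torus :: "nat \<Rightarrow> 'a \<Rightarrow> 'a mat" where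
  "torus N c = mat N N (\<lambda>(r, s). if r = s then if r = N - 1 then c else if r = 0 then 1 / c ^ q else 1 else 0)"

lemma torus_U:
  assumes "c \<noteq> 0" "2 \<le> N"
  shows "torus N c \<in> U N"
  unfolding U_iff
proof (intro conjI eq_matI)
  let ?T = "torus N c"
  show c: "?T \<in> carrier_mat N N" by (simp add: torus_def)
  fix i j assume "i < dim_row (1\<^sub>m N :: 'a mat)" "j < dim_col (1\<^sub>m N :: 'a mat)"
  then have ij: "i < N" "j < N" by auto
  have dual: "(N - Suc i = N - Suc 0) = (i = 0)" "(N - Suc i = 0) = (i = N - Suc 0)" using ij assms(2) by auto
  have "(adj N ?T * ?T) $$ (i, j) = (\<Sum>r<N. adj N ?T $$ (i, r) * ?T $$ (r, j))"
    by (rule mult_index_sum[OF adj_carrier c ij])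
  also have "\<dots> = (\<Sum>r<N. if r = i then adj N ?T $$ (i, i) * ?T $$ (i, j) else 0)"
  proof (rule sum.cong[OF refl])
    fix r assume "r \<in> {..<N}"
    then have r: "r < N" by simp
    then have "(N - Suc r = N - Suc i) = (r = i)" using ij by auto
    then show "adj N ?T $$ (i, r) * ?T $$ (r, j) = (if r = i then adj N ?T $$ (i, i) * ?T $$ (i, j) else 0)"
      using r ij q by (auto simp: torus_def)
  qed
  also have "\<dots> = adj N ?T $$ (i, i) * ?T $$ (i, j)" using ij by simp
  also have "\<dots> = 1\<^sub>m N $$ (i, j)"
    using ij assms dual by (auto simp: torus_def power_divide cj_cj)
  finally show "(adj N ?T * ?T) $$ (i, j) = 1\<^sub>m N $$ (i, j)" .
qed (auto simp: torus_def)

lemma torus_last: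
  assumes "v \<in> carrier_vec N" "0 < N"
  shows "(torus N c *\<^sub>v v) $ (N - 1) = c * v $ (N - 1)"
proof -
  have "(torus N c *\<^sub>v v) $ (N - 1) = (\<Sum>r\<in>{0..<N}. torus N c $$ (N - 1, r) * v $ r)"
    using assms by (simp add: torus_def scalar_prod_def)
  also have "\<dots> = (\<Sum>r\<in>{0..<N}. if r = N - 1 then c * v $ (N - 1) else 0)"
    using assms by (intro sum.cong) (auto simp: torus_def)
  finally show ?thesis using assms by simp
qed

text \<open>Witt's theorem for isotropic vectors. A permutation and a torus element normalise the
  last coordinate to 1; the vector then lies in the cell of the last basis vector, which the
  unipotent radical sweeps out.\<close>

lemma vec_orbit_U:
  assumes N: "even N" "0 < N"
  shows "vec_orbit N (U N) = isotropic N"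
proof (intro equalityI subsetI)
  have N2: "2 \<le> N" using N by presburger
  fix v assume "v \<in> vec_orbit N (U N)"
  then obtain g where g: "g \<in> U N" "v = g *\<^sub>v e0 N" by (auto simp: vec_orbit_def)
  have "form N (1 \<cdot>\<^sub>v e0 N) (e0 N) = 0" unfolding form_unit_left[OF N(2)] using N2 by simp
  then have "e0 N \<in> isotropic N" using e0_nonzero[OF N(2)] by (simp add: isotropic_def)
  then show "v \<in> isotropic N" unfolding g(2) by (rule isotropic_U[OF g(1)])
next
  have N2: "2 \<le> N" using N by presburger
  have last: "N - 1 < N" "N - 1 \<noteq> N - Suc (N - 1)" using N2 by auto
  fix v assume v: "v \<in> isotropic N"
  then obtain i where i: "i < N" "v $ i \<noteq> 0" by (auto simp: isotropic_def vec_eq_iff)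
  have i': "N - Suc i \<noteq> i" using N(1) i(1) by presburger
  \<comment> \<open>Exchanges \<open>i\<close> with the last index and, to respect the reflection,
    \<open>N - Suc i\<close> with 0. Evenness of \<open>N\<close> keeps \<open>i\<close> apart from
    its mirror index.\<close>
  define \<pi> where "\<pi> x = (if x = i then N - 1 else if x = N - 1 then i else if x = N - Suc i then 0
    else if x = 0 then N - Suc i else x)" for x
  have \<pi>1: "\<pi> x < N" if "x < N" for x using that i N2 by (auto simp: \<pi>_def)
  have \<pi>\<pi>: "\<pi> (\<pi> x) = x" if "x < N" for x using that i i' N2 by (auto simp: \<pi>_def)
  have \<pi>2: "inj_on \<pi> {..<N}" by (rule inj_on_inverseI[of _ \<pi>]) (use \<pi>\<pi> in auto)
  have \<pi>3: "\<pi> (N - Suc x) = N - Suc (\<pi> x)" if "x < N" for x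
  proof -
    have n: "N - Suc x = i \<longleftrightarrow> x = N - Suc i" "N - Suc x = N - 1 \<longleftrightarrow> x = 0"
      "N - Suc x = N - Suc i \<longleftrightarrow> x = i" "N - Suc x = 0 \<longleftrightarrow> x = N - 1"
      using that i N2 by auto
    consider "x = i" | "x \<noteq> i" "x = N - 1" | "x \<noteq> i" "x \<noteq> N - 1" "x = N - Suc i"
      | "x \<noteq> i" "x \<noteq> N - 1" "x \<noteq> N - Suc i" by blast
    then show ?thesis
    proof cases
      case 1 then show ?thesis unfolding \<pi>_def n using i' N2 i by auto
    next
      case 2 then show ?thesis unfolding \<pi>_def n using i' N2 i by auto
    next
      case 3 then show ?thesis unfolding \<pi>_def n using i' N2 i by auto
    next
      case 4 then show ?thesis unfolding \<pi>_def n using i' N2 i by auto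
    qed
  qed
  let ?P = "perm_mat N \<pi> :: 'a mat"
  have P: "?P \<in> U N" by (rule perm_mat_U[OF \<pi>1 \<pi>2 \<pi>3])
  define w where "w = ?P *\<^sub>v v"
  have w: "w \<in> isotropic N" unfolding w_def by (rule isotropic_U[OF P v])
  have wc: "w \<in> carrier_vec N" and vc: "v \<in> carrier_vec N" using w v by (auto simp: isotropic_def)
  have "w $ (N - 1) = (\<Sum>r\<in>{0..<N}. ?P $$ (N - 1, r) * v $ r)"
    using vc N by (simp add: w_def perm_mat_def scalar_prod_def)
  also have "\<dots> = (\<Sum>r\<in>{0..<N}. if r = i then v $ i else 0)"
  proof (rule sum.cong[OF refl])
    fix r assume "r \<in> {0..<N}"
    then have r: "r < N" by simp
    have "(N - 1 = \<pi> r) = (r = i)" using \<pi>\<pi>[OF r] \<pi>\<pi>[OF i(1)] by (metis \<pi>_def)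
    then show "?P $$ (N - 1, r) * v $ r = (if r = i then v $ i else 0)"
      using r N by (simp add: perm_mat_def)
  qed
  finally have wl: "w $ (N - 1) \<noteq> 0" using i by simp
  let ?T = "torus N (1 / w $ (N - 1))"
  have T: "?T \<in> U N" by (rule torus_U) (use wl N2 in auto)
  define x where "x = ?T *\<^sub>v w"
  have x: "x \<in> isotropic N" unfolding x_def by (rule isotropic_U[OF T w])
  have xl: "x $ (N - 1) = 1" unfolding x_def torus_last[OF wc N(2)] using wl by simp
  \<comment> \<open>For \<open>k = 1\<close> the last index alone has the top level, so no other
    coordinate is prescribed.\<close>
  have "x \<in> lead_set 1 N (N - 1)"
  proof -
    have "x $ i = (if i = N - 1 then 1 else 0)" if "i < N" "lev 1 N (N - 1) \<le> lev 1 N i" for i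
    proof -
      have "i = N - 1" using that N2 by (auto simp: lev_def split: if_splits)
      then show ?thesis using xl by simp
    qed
    then show ?thesis using x by (auto simp: lead_set_def isotropic_def)
  qed
  from lead_set_unipotent[OF _ last this] N2 obtain u where u: "u \<in> U N" "u *\<^sub>v unit_vec N (N - 1) = x" by auto
  \<comment> \<open>Exchanging the two end indices links \<open>e0 N\<close> to the last basis
    vector.\<close>
  define \<sigma> where "\<sigma> y = (if y = 0 then N - 1 else if y = N - 1 then 0 else y)" for y
  have \<sigma>\<sigma>: "\<sigma> (\<sigma> y) = y" if "y < N" for y using that by (auto simp: \<sigma>_def)
  have \<sigma>: "\<And>y. y < N \<Longrightarrow> \<sigma> y < N" "inj_on \<sigma> {..<N}" "\<And>y. y < N \<Longrightarrow> \<sigma> (N - Suc y) = N - Suc (\<sigma> y)"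
    using N2 \<sigma>\<sigma> by (auto simp: \<sigma>_def intro: inj_on_inverseI[of _ \<sigma>])
  have \<sigma>0: "(perm_mat N \<sigma> :: 'a mat) *\<^sub>v e0 N = unit_vec N (N - 1)"
  proof -
    have 0: "\<sigma> 0 = N - 1" by (simp add: \<sigma>_def)
    have "(perm_mat N \<sigma> :: 'a mat) *\<^sub>v e0 N = unit_vec N (\<sigma> 0)"
      by (rule perm_mat_unit_vec[OF \<sigma> N(2)])
    then show ?thesis unfolding 0 .
  qed
  have "unit_vec N (N - 1) \<in> vec_orbit N (U N)"
    using imageI[OF perm_mat_U[OF \<sigma>], of "\<lambda>g. g *\<^sub>v e0 N"] unfolding vec_orbit_def \<sigma>0 .
  from vec_orbit_closed[OF mat_group_U u(1) this] have "x \<in> vec_orbit N (U N)" unfolding u(2) .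
  from vec_orbit_closed[OF mat_group_U U_minv[OF T] this]
  have "w \<in> vec_orbit N (U N)" unfolding x_def cancel_minv_vec(1)[OF U_D(1)[OF T] wc] .
  from vec_orbit_closed[OF mat_group_U U_minv[OF P] this]
  show "v \<in> vec_orbit N (U N)" unfolding w_def cancel_minv_vec(1)[OF U_D(1)[OF P] vc] .
qed

section \<open>Descent for the unitary group\<close>

lemma adj_defl: "adj (N - 2) (defl (N - 2) A) = defl (N - 2) (adj N A)" if "2 \<le> N"
proof (rule eq_matI)
  fix i j assume "i < dim_row (defl (N - 2) (adj N A))" "j < dim_col (defl (N - 2) (adj N A))"
  then have ij: "i < N - 2" "j < N - 2" by auto
  then have "Suc (N - 2 - Suc j) = N - Suc (Suc j)" "Suc (N - 2 - Suc i) = N - Suc (Suc i)" by auto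
  then show "adj (N - 2) (defl (N - 2) A) $$ (i, j) = defl (N - 2) (adj N A) $$ (i, j)"
    using ij by simp
qed auto

lemma defl_u:
  assumes "2 \<le> N" "Y \<in> ualg N"
  shows "defl (N - 2) Y \<in> ualg (N - 2)"
proof -
  have Y: "Y \<in> carrier_mat N N" using uD(1)[OF assms(2)] .
  have "adj (N - 2) (defl (N - 2) Y) = defl (N - 2) (- Y)"
    unfolding adj_defl[OF assms(1)] uD(2)[OF assms(2)] by (rule refl)
  also have "\<dots> = - defl (N - 2) Y"
  proof (rule eq_matI)
    fix i j assume "i < dim_row (- defl (N - 2) Y)" "j < dim_col (- defl (N - 2) Y)"
    then show "defl (N - 2) (- Y) $$ (i, j) = (- defl (N - 2) Y) $$ (i, j)" using Y by simp
  qed auto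
  finally show ?thesis by (simp add: u_iff)
qed

text \<open>A unitary element preserving an isotropic line preserves its orthogonal complement. In
  coordinates: the inverse is the adjoint and preserves the line too, and its first column is the
  mirror image of the last row of \<open>p\<close>.\<close>

lemma line_stab_U_index:
  assumes N: "2 \<le> N" and p: "p \<in> line_stab N (U N)" and i: "i < N"
  shows "0 < i \<Longrightarrow> p $$ (i, 0) = 0" "i < N - 1 \<Longrightarrow> p $$ (N - 1, i) = 0"
proof -
  show "0 < i \<Longrightarrow> p $$ (i, 0) = 0" using line_stab_index[OF mat_group_U p i] .
  assume i1: "i < N - 1"
  have "minv p \<in> line_stab N (U N)"
    using mat_groupD(4)[OF mat_group_line_stab[OF _ mat_group_U] p] N by simp
  from line_stab_index[OF mat_group_U this, of "N - Suc i"]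
  have "minv p $$ (N - Suc i, 0) = 0" using i1 by simp
  moreover have "p \<in> U N" using p by (simp add: line_stab_def)
  ultimately show "p $$ (N - 1, i) = 0" using U_D(3)[of p N] i N by simp
qed

text \<open>Compression is multiplicative because nothing passes through the two end indices: for
  \<open>p\<close> by \<open>line_stab_U_index\<close>, for \<open>Y\<close> because skewness makes
  the last row vanish together with the first column.\<close>

lemma defl_line_stab_U:
  assumes N: "2 \<le> N" and p: "p \<in> line_stab N (U N)" and Y: "Y \<in> ualg N" and Y0: "Y *\<^sub>v e0 N = 0\<^sub>v N"
  shows "defl (N - 2) p \<in> U (N - 2)"
    "defl (N - 2) (conjg p Y) = conjg (defl (N - 2) p) (defl (N - 2) Y)"
proof -
  have N0: "0 < N" using N by simp
  have pU: "p \<in> U N" using p by (simp add: line_stab_def)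
  note pc = U_D(2)[OF pU] and Yc = uD(1)[OF Y]
  have mp: "minv p \<in> line_stab N (U N)"
    using mat_groupD(4)[OF mat_group_line_stab[OF N0 mat_group_U] p] .
  note mpc = GL_minv(1)[OF U_D(1)[OF pU]]
  note z = line_stab_U_index[OF N p] line_stab_U_index[OF N mp]
  have Yz: "Y $$ (i, 0) = 0" if "i < N" for i using mult_e0_zero_iff[OF Yc N0] Y0 that by simp
  have Yr: "Y $$ (N - 1, i) = 0" if "i < N" for i
    using uD(3)[OF Y, of "N - 1" i] Yz[of "N - Suc i"] that N by simp
  have m: "N - 2 < N" using N by simp
  have r: "r = N - 1" if "r < N" "Suc (N - 2) \<le> r" for r using that by simp
  have "defl (N - 2) (minv p * p) = defl (N - 2) (minv p) * defl (N - 2) p"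
    by (rule defl_mult[OF mpc pc m]) (use z r in force)
  from this[symmetric] have "adj (N - 2) (defl (N - 2) p) * defl (N - 2) p = 1\<^sub>m (N - 2)"
    unfolding adj_defl[OF N] U_D(3)[OF pU] U_D(4)[OF pU] defl_one[OF m] .
  then show dU: "defl (N - 2) p \<in> U (N - 2)" by (simp add: U_iff)
  have mY: "minv p * Y \<in> carrier_mat N N" using mpc Yc by (rule mult_carrier_mat)
  have mYz: "(minv p * Y) $$ (i, 0) = 0" if "i < N" for i
    using mult_index_sum[OF mpc Yc that N0] Yz by simp
  have "defl (N - 2) (conjg p Y) = defl (N - 2) (minv p * Y) * defl (N - 2) p"
    unfolding conjg_def by (rule defl_mult[OF mY pc m]) (use z r mYz in force)
  also have "defl (N - 2) (minv p * Y) = defl (N - 2) (minv p) * defl (N - 2) Y"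
    by (rule defl_mult[OF mpc Yc m]) (use z r Yr in force)
  also have "defl (N - 2) (minv p) = minv (defl (N - 2) p)"
    unfolding U_D(3)[OF pU] U_D(3)[OF dU] adj_defl[OF N] by (rule refl)
  finally show "defl (N - 2) (conjg p Y) = conjg (defl (N - 2) p) (defl (N - 2) Y)" by (simp add: conjg_def)
qed

lemma descent_U:
  assumes N: "even N" "0 < N" and b: "b \<in> invariant_funs (U (N - 2)) (ualg (N - 2))"
  shows "descent N (N - 2) (U N) (ualg N) b"
proof
  have N2: "2 \<le> N" using N by presburger
  show "c \<cdot>\<^sub>v e0 N \<in> vec_orbit N (U N)" if "c \<noteq> 0" for c :: 'a
  proof -
    have "form N (c \<cdot>\<^sub>v e0 N) (c \<cdot>\<^sub>v e0 N) = 0" unfolding form_unit_left[OF N(2)] using N2 by simp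
    moreover have "c \<cdot>\<^sub>v e0 N \<noteq> (0\<^sub>v N :: 'a vec)" using that N(2) by (auto simp: vec_eq_iff intro!: exI[of _ 0])
    ultimately show ?thesis unfolding vec_orbit_U[OF N] by (simp add: isotropic_def)
  qed
  fix p Y assume "p \<in> line_stab N (U N)" "Y \<in> ualg N" "Y *\<^sub>v e0 N = 0\<^sub>v N"
  then show "b (defl (N - 2) (conjg p Y)) = b (defl (N - 2) Y)"
    using defl_line_stab_U[OF N2] invariant_funs_conjg[OF b mat_group_U _ defl_u[OF N2]] by simp
qed (use N mat_group_U conjg_u uD(1) in auto)

abbreviation kerU :: "nat \<Rightarrow> ('a mat \<Rightarrow> real) \<Rightarrow> 'a mat \<Rightarrow> real" where
  "kerU N \<equiv> ker_sum N (N - 2) (U N)"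

lemma nabla_tilde_x1:
  assumes b: "b (n - 1) \<in> C_u q (n - 1)"
  shows "nabla_tilde q (tensor x1_tilde b) n X = (if 0 < n \<and> X \<in> ualg (2 * n)
    then kerU (2 * n) (b (n - 1)) X / (real (card (UNIV :: 'a set)) - 1) else 0)"
proof (cases "0 < n")
  case n: True
  define N where "N = 2 * n"
  have N: "even N" "0 < N" "2 \<le> N" and Nm: "2 * (n - 1) = N - 2" using n by (auto simp: N_def)
  have b': "b (n - 1) \<in> invariant_funs (U (N - 2)) (ualg (N - 2))" using b by (simp add: C_u_def Nm del: One_nat_def)
  interpret descent N "N - 2" "U N" "ualg N" "b (n - 1)" by (rule descent_U[OF N(1,2) b'])
  let ?ks = "[1, N - 2, 1]"
  have bu: "block_upper ?ks g \<longleftrightarrow> (\<forall>i<N. 0 < i \<longrightarrow> g $$ (i, 0) = 0) \<and> (\<forall>i<N - 1. g $$ (N - 1, i) = 0)"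
    if g: "g \<in> carrier_mat N N" for g :: "'a mat"
  proof -
    have "block_upper ?ks g \<longleftrightarrow> (\<forall>r<N. \<forall>c<N. 1 \<le> r \<and> c < 1 \<longrightarrow> g $$ (r, c) = 0) \<and>
      (\<forall>r<N. \<forall>c<N. N - 1 \<le> r \<and> c < N - 1 \<longrightarrow> g $$ (r, c) = 0)"
      using g N(3) by (auto simp: block_upper_def less_Suc_eq numeral_3_eq_3 Suc_diff_Suc numeral_2_eq_2)
    moreover have "(\<forall>r<N. \<forall>c<N. N - 1 \<le> r \<and> c < N - 1 \<longrightarrow> g $$ (r, c) = 0) \<longleftrightarrow> (\<forall>i<N - 1. g $$ (N - 1, i) = 0)"
    proof
      assume "\<forall>i<N - 1. g $$ (N - 1, i) = 0"
      moreover have "r = N - 1" if "r < N" "N - 1 \<le> r" for r using that by simp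
      ultimately show "\<forall>r<N. \<forall>c<N. N - 1 \<le> r \<and> c < N - 1 \<longrightarrow> g $$ (r, c) = 0" by blast
    next
      assume *: "\<forall>r<N. \<forall>c<N. N - 1 \<le> r \<and> c < N - 1 \<longrightarrow> g $$ (r, c) = 0"
      show "\<forall>i<N - 1. g $$ (N - 1, i) = 0" using *[rule_format, of "N - 1"] N(2) by simp
    qed
    ultimately show ?thesis using N(2) by auto
  qed
  \<comment> \<open>For group elements the condition on the last row follows from the one on the
    first column.\<close>
  have P: "{g \<in> U N. block_upper ?ks g} = line_stab N (U N)"
  proof (intro equalityI subsetI)
    fix g assume "g \<in> {g \<in> U N. block_upper ?ks g}"
    then show "g \<in> line_stab N (U N)"
      using bu[OF U_D(2), of g] mult_e0_line_iff[OF U_D(2) N(2), of g] by (auto simp: line_stab_def)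
  next
    fix g assume g: "g \<in> line_stab N (U N)"
    then show "g \<in> {g \<in> U N. block_upper ?ks g}"
      using bu[OF U_D(2), of g] line_stab_U_index[OF N(3) g] by (auto simp: line_stab_def)
  qed
  have "nabla_tilde q (tensor x1_tilde b) n X =
    parabolic_ind ?ks (U N) (ualg N) (tensor x1_tilde b 1 (n - 1)) X"
    unfolding nabla_tilde_def using n Nm
    by (subst sum.mono_neutral_right[of _ "{1}"]) (auto simp: parabolic_ind_x1_other N_def)
  also have "\<dots> = (if X \<in> ualg N then kerU N (b (n - 1)) X / (real (card (UNIV :: 'a set)) - 1) else 0)"
  proof (rule parabolic_ind_eq[OF P])
    fix Y assume Yu: "Y \<in> ualg N"
    note Y = uD(1)[OF Yu]
    have "diag_part ?ks 1 Y = defl (N - 2) Y"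
      by (intro eq_matI) (auto simp: diag_part_def)
    moreover have "(Y *\<^sub>v e0 N = 0\<^sub>v N) = (block_upper ?ks Y \<and> Y $$ (0, 0) = 0)"
    proof
      assume "Y *\<^sub>v e0 N = 0\<^sub>v N"
      then have Yz: "Y $$ (i, 0) = 0" if "i < N" for i using mult_e0_zero_iff[OF Y N(2)] that by simp
      then show "block_upper ?ks Y \<and> Y $$ (0, 0) = 0"
        unfolding bu[OF Y] using uD(3)[OF Yu, of "N - 1"] N(2) by auto
    next
      assume "block_upper ?ks Y \<and> Y $$ (0, 0) = 0"
      then show "Y *\<^sub>v e0 N = 0\<^sub>v N"
        unfolding bu[OF Y] mult_e0_zero_iff[OF Y N(2)] by (metis gr0I)
    qed
    ultimately show "(if block_upper ?ks Y
        then tensor x1_tilde b 1 (n - 1) (diag_part ?ks 0 Y) (diag_part ?ks 1 Y) else 0) =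
      (if Y *\<^sub>v e0 N = 0\<^sub>v N then b (n - 1) (defl (N - 2) Y) else 0)"
      by (auto simp: tensor_def x1_tilde_diag simp del: One_nat_def)
  qed
  finally show ?thesis using n by (simp add: N_def)
qed (simp add: nabla_tilde_def parabolic_ind_x1_other)

end

section \<open>The Mackey formula\<close>

definition upper :: "nat \<Rightarrow> nat \<Rightarrow> 'a::zero mat \<Rightarrow> bool" where
  "upper k N X \<longleftrightarrow> (\<forall>i<N. \<forall>j<N. lev k N j < lev k N i \<longrightarrow> X $$ (i, j) = 0)"

lemma upperD: "upper k N X \<Longrightarrow> i < N \<Longrightarrow> j < N \<Longrightarrow> lev k N j < lev k N i \<Longrightarrow> X $$ (i, j) = 0"
  by (auto simp: upper_def)

lemma unipotent_upper: "unipotent k N X \<Longrightarrow> upper k N X"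
  by (force simp: unipotent_def upper_def)

text \<open>The strict matrices form an ideal in the block upper triangular ones.\<close>

lemma strict_mult:
  fixes A Z :: "'a::semiring_0 mat"
  assumes A: "A \<in> carrier_mat N N" "upper k N A" and Z: "Z \<in> carrier_mat N N" "strict k N Z"
  shows "strict k N (A * Z)" "strict k N (Z * A)"
proof -
  have s: "r < N \<Longrightarrow> lev k N r < lev k N i \<or> lev k N i \<le> lev k N r" for r i by auto
  show "strict k N (A * Z)"
    unfolding strict_def
  proof (intro allI impI)
    fix i j assume ij: "i < N" "j < N" "lev k N j \<le> lev k N i"
    have "(A * Z) $$ (i, j) = (\<Sum>r<N. A $$ (i, r) * Z $$ (r, j))" by (rule mult_index_sum[OF A(1) Z(1) ij(1,2)])
    also have "\<dots> = 0"
    proof (rule sum.neutral, rule ballI)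
      fix r assume "r \<in> {..<N}"
      then show "A $$ (i, r) * Z $$ (r, j) = 0"
        using upperD[OF A(2) ij(1), of r] strictD[OF Z(2) _ ij(2), of r] ij(3)
        by (cases "lev k N r < lev k N i") auto
    qed
    finally show "(A * Z) $$ (i, j) = 0" .
  qed
  show "strict k N (Z * A)"
    unfolding strict_def
  proof (intro allI impI)
    fix i j assume ij: "i < N" "j < N" "lev k N j \<le> lev k N i"
    have "(Z * A) $$ (i, j) = (\<Sum>r<N. Z $$ (i, r) * A $$ (r, j))" by (rule mult_index_sum[OF Z(1) A(1) ij(1,2)])
    also have "\<dots> = 0"
    proof (rule sum.neutral, rule ballI)
      fix r assume "r \<in> {..<N}"
      then show "Z $$ (i, r) * A $$ (r, j) = 0"
        using upperD[OF A(2) _ ij(2), of r] strictD[OF Z(2) ij(1), of r] ij(3)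
        by (cases "lev k N j < lev k N r") auto
    qed
    finally show "(Z * A) $$ (i, j) = 0" .
  qed
qed

lemma upper_mult:
  fixes A B :: "'a::semiring_0 mat"
  assumes A: "A \<in> carrier_mat N N" "upper k N A" and B: "B \<in> carrier_mat N N" "upper k N B"
  shows "upper k N (A * B)"
  unfolding upper_def
proof (intro allI impI)
  fix i j assume ij: "i < N" "j < N" "lev k N j < lev k N i"
  have "(A * B) $$ (i, j) = (\<Sum>r<N. A $$ (i, r) * B $$ (r, j))" by (rule mult_index_sum[OF A(1) B(1) ij(1,2)])
  also have "\<dots> = 0"
  proof (rule sum.neutral, rule ballI)
    fix r assume "r \<in> {..<N}"
    then show "A $$ (i, r) * B $$ (r, j) = 0"
      using upperD[OF A(2) ij(1), of r] upperD[OF B(2) _ ij(2), of r] ij(3)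
      by (cases "lev k N r < lev k N i") auto
  qed
  finally show "(A * B) $$ (i, j) = 0" .
qed

text \<open>A unipotent factor is the identity on the diagonal blocks, so it disturbs only entries
  strictly above them.\<close>

lemma unipotent_mult:
  fixes X u :: "'a::semiring_1 mat"
  assumes X: "X \<in> carrier_mat N N" "upper k N X" and u: "u \<in> carrier_mat N N" "unipotent k N u"
    and ij: "i < N" "j < N" "lev k N j \<le> lev k N i"
  shows "(X * u) $$ (i, j) = X $$ (i, j)" "(u * X) $$ (i, j) = X $$ (i, j)"
proof -
  have U: "u $$ (r, s) = (if r = s then 1 else 0)" if "r < N" "s < N" "lev k N s \<le> lev k N r" for r s
    using u(2) that by (auto simp: unipotent_def)
  have "(X * u) $$ (i, j) = (\<Sum>r<N. X $$ (i, r) * u $$ (r, j))" by (rule mult_index_sum[OF X(1) u(1) ij(1,2)])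
  also have "\<dots> = (\<Sum>r<N. if r = j then X $$ (i, j) else 0)"
  proof (rule sum.cong[OF refl])
    fix r assume "r \<in> {..<N}"
    then show "X $$ (i, r) * u $$ (r, j) = (if r = j then X $$ (i, j) else 0)"
      using upperD[OF X(2) ij(1), of r] U[of r j] ij by (cases "lev k N r < lev k N i") auto
  qed
  finally show "(X * u) $$ (i, j) = X $$ (i, j)" using ij by simp
  have "(u * X) $$ (i, j) = (\<Sum>r<N. u $$ (i, r) * X $$ (r, j))" by (rule mult_index_sum[OF u(1) X(1) ij(1,2)])
  also have "\<dots> = (\<Sum>r<N. if r = i then X $$ (i, j) else 0)"
  proof (rule sum.cong[OF refl])
    fix r assume "r \<in> {..<N}"
    then show "u $$ (i, r) * X $$ (r, j) = (if r = i then X $$ (i, j) else 0)"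
      using upperD[OF X(2) _ ij(2), of r] U[of i r] ij by (cases "lev k N j < lev k N r") auto
  qed
  finally show "(u * X) $$ (i, j) = X $$ (i, j)" using ij by simp
qed

lemma conjg_add:
  assumes g: "g \<in> GL n" and X: "X \<in> carrier_mat n n" and Y: "Y \<in> carrier_mat n n"
  shows "conjg g (X + Y) = conjg g X + conjg g Y"
proof -
  note c = GL_carrier[OF g] GL_minv(1)[OF g]
  have m: "minv g * X \<in> carrier_mat n n" "minv g * Y \<in> carrier_mat n n" using c X Y by auto
  show ?thesis unfolding conjg_def mult_add_distrib_mat[OF c(2) X Y] by (rule add_mult_distrib_mat[OF m c(1)])
qed

lemma conjg_inj:
  assumes "g \<in> GL n" "X \<in> carrier_mat n n" "Y \<in> carrier_mat n n" "conjg g X = conjg g Y"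
  shows "X = Y"
  using conjg_inverse(2)[OF assms(1,2)] conjg_inverse(2)[OF assms(1,3)]
  unfolding assms(4) by (rule trans[OF sym])

context hermitian
begin

declare q [simp]

lemma upper_adj:
  assumes N: "2 * k \<le> N" and g: "upper k N g"
  shows "upper k N (adj N g)"
  unfolding upper_def
proof (intro allI impI)
  fix i j assume ij: "i < N" "j < N" "lev k N j < lev k N i"
  have "lev k N (N - Suc i) < lev k N (N - Suc j)"
    using lev_dual[OF N ij(1)] lev_dual[OF N ij(2)] ij(3) lev_le_2[of k N i] by simp
  then have "g $$ (N - Suc j, N - Suc i) = 0" using upperD[OF g, of "N - Suc j" "N - Suc i"] ij by simp
  then show "adj N g $$ (i, j) = 0" using ij by simp
qed

lemma unipotent_adj:
  assumes N: "2 * k \<le> N" and g: "unipotent k N g"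
  shows "unipotent k N (adj N g)"
  unfolding unipotent_def
proof (intro allI impI)
  fix i j assume ij: "i < N" "j < N" "lev k N j \<le> lev k N i"
  have "lev k N (N - Suc i) \<le> lev k N (N - Suc j)"
    using lev_dual[OF N ij(1)] lev_dual[OF N ij(2)] ij(3) by simp
  then have "g $$ (N - Suc j, N - Suc i) = (if N - Suc j = N - Suc i then 1 else 0)"
    using g ij by (auto simp: unipotent_def)
  then show "adj N g $$ (i, j) = (if i = j then 1 else 0)" using ij by auto
qed

lemma nil_conjg:
  assumes N: "2 * k \<le> N" and g: "g \<in> U N" "upper k N g" and Z: "Z \<in> nil k N"
  shows "conjg g Z \<in> nil k N"
proof -
  note c = U_D(2)[OF g(1)] nilD(3)[OF Z]
  have "strict k N (adj N g * Z)" by (rule strict_mult(1)[OF adj_carrier upper_adj[OF N g(2)] c(2) nilD(2)[OF Z]])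
  moreover have "adj N g * Z \<in> carrier_mat N N" by (rule mult_carrier_mat[OF adj_carrier c(2)])
  ultimately have "strict k N (conjg g Z)"
    unfolding conjg_def U_D(3)[OF g(1)] using strict_mult(2)[OF c(1) g(2)] by blast
  then show ?thesis using conjg_u[OF g(1) nilD(1)[OF Z]] by (simp add: nil_def)
qed

section \<open>Levi elements and sums over the nilradical\<close>

definition levi_alg :: "nat \<Rightarrow> 'a mat \<Rightarrow> 'a mat \<Rightarrow> 'a mat" where
  "levi_alg k A B = diag2 A (diag2 B (- adj k A))"

text \<open>Unitarity couples the two outer blocks and forces the last one to be the inverse adjoint
  of the first.\<close>

definition levi_grp :: "nat \<Rightarrow> 'a mat \<Rightarrow> 'a mat \<Rightarrow> 'a mat" where
  "levi_grp k m h = diag2 m (diag2 h (adj k (minv m)))"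

lemma diag3_carrier:
  assumes "A \<in> carrier_mat k k" "B \<in> carrier_mat (2 * l) (2 * l)" "C \<in> carrier_mat k k"
  shows "diag2 A (diag2 B C) \<in> carrier_mat (2 * (k + l)) (2 * (k + l))"
proof -
  have "diag2 A (diag2 B C) \<in> carrier_mat (k + (2 * l + k)) (k + (2 * l + k))"
    by (intro diag2_carrier assms)
  moreover have "k + (2 * l + k) = 2 * (k + l)" by simp
  ultimately show ?thesis by simp
qed

lemma diag3_index:
  assumes "A \<in> carrier_mat k k" "B \<in> carrier_mat (2 * l) (2 * l)" "C \<in> carrier_mat k k"
    and "i < 2 * (k + l)" "j < 2 * (k + l)"
  shows "diag2 A (diag2 B C) $$ (i, j) =
    (if i < k then if j < k then A $$ (i, j) else 0
     else if i < k + 2 * l then if k \<le> j \<and> j < k + 2 * l then B $$ (i - k, j - k) else 0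
     else if k + 2 * l \<le> j then C $$ (i - (k + 2 * l), j - (k + 2 * l)) else 0)"
  using assms by (auto simp: diag2_def)

text \<open>Reflection in the antidiagonal reverses the order of the blocks; the proof is index
  arithmetic with the mirrored indices \<open>I\<close> and \<open>J\<close>.\<close>

lemma adj_diag3:
  assumes A: "A \<in> carrier_mat k k" and B: "B \<in> carrier_mat (2 * l) (2 * l)" and C: "C \<in> carrier_mat k k"
  shows "adj (2 * (k + l)) (diag2 A (diag2 B C)) = diag2 (adj k C) (diag2 (adj (2 * l) B) (adj k A))"
proof (rule eq_matI)
  let ?N = "2 * (k + l)"
  note R = diag3_carrier[OF adj_carrier[of k C] adj_carrier[of "2 * l" B] adj_carrier[of k A]]
  show "dim_row (adj ?N (diag2 A (diag2 B C))) = dim_row (diag2 (adj k C) (diag2 (adj (2 * l) B) (adj k A)))"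
    "dim_col (adj ?N (diag2 A (diag2 B C))) = dim_col (diag2 (adj k C) (diag2 (adj (2 * l) B) (adj k A)))"
    using R by auto
  fix i j assume "i < dim_row (diag2 (adj k C) (diag2 (adj (2 * l) B) (adj k A)))"
    "j < dim_col (diag2 (adj k C) (diag2 (adj (2 * l) B) (adj k A)))"
  then have ij: "i < ?N" "j < ?N" using R by auto
  define I J where "I = ?N - Suc j" and "J = ?N - Suc i"
  \<comment> \<open>Stated as sums, so that the case distinctions below need not unfold truncated
    subtraction.\<close>
  have IJ: "I + Suc j = 2 * k + 2 * l" "J + Suc i = 2 * k + 2 * l" using ij by (auto simp: I_def J_def)
  then have IJ': "I < ?N" "J < ?N" by auto
  have L: "adj ?N (diag2 A (diag2 B C)) $$ (i, j) = (diag2 A (diag2 B C) $$ (I, J)) ^ q"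
    using ij by (simp add: I_def J_def)
  consider "i < k" | "k \<le> i" "i < k + 2 * l" | "k + 2 * l \<le> i" by linarith
  then show "adj ?N (diag2 A (diag2 B C)) $$ (i, j) = diag2 (adj k C) (diag2 (adj (2 * l) B) (adj k A)) $$ (i, j)"
    unfolding L diag3_index[OF A B C IJ'] diag3_index[OF adj_carrier adj_carrier adj_carrier ij]
  proof cases
    case 1
    have "J - (k + 2 * l) = k - Suc i" "\<not> J < k + 2 * l" "k + 2 * l \<le> J" "k \<le> J" using 1 IJ by arith+
    moreover have "I - (k + 2 * l) = k - Suc j" "\<not> I < k" "\<not> I < k + 2 * l" if "j < k" using that IJ by arith+
    moreover have "I < k + 2 * l" if "\<not> j < k" using that IJ by arith
    ultimately show "(if I < k then if J < k then A $$ (I, J) else 0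
      else if I < k + 2 * l then if k \<le> J \<and> J < k + 2 * l then B $$ (I - k, J - k) else 0
      else if k + 2 * l \<le> J then C $$ (I - (k + 2 * l), J - (k + 2 * l)) else 0) ^ q =
      (if i < k then if j < k then adj k C $$ (i, j) else 0
      else if i < k + 2 * l then if k \<le> j \<and> j < k + 2 * l then adj (2 * l) B $$ (i - k, j - k) else 0
      else if k + 2 * l \<le> j then adj k A $$ (i - (k + 2 * l), j - (k + 2 * l)) else 0)"
      using 1 by (cases "j < k") simp_all
  next
    case 2
    have "J - k = 2 * l - Suc (i - k)" "J < k + 2 * l" "k \<le> J" "\<not> J < k" "\<not> i < k" "i - k < 2 * l" using 2 IJ by arith+
    moreover have "I - k = 2 * l - Suc (j - k)" "\<not> I < k" "I < k + 2 * l" "j - k < 2 * l" if "k \<le> j" "j < k + 2 * l"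
      using that IJ by arith+
    moreover have "I < k \<or> \<not> I < k + 2 * l" if "\<not> (k \<le> j \<and> j < k + 2 * l)" using that IJ by arith
    ultimately show "(if I < k then if J < k then A $$ (I, J) else 0
      else if I < k + 2 * l then if k \<le> J \<and> J < k + 2 * l then B $$ (I - k, J - k) else 0
      else if k + 2 * l \<le> J then C $$ (I - (k + 2 * l), J - (k + 2 * l)) else 0) ^ q =
      (if i < k then if j < k then adj k C $$ (i, j) else 0
      else if i < k + 2 * l then if k \<le> j \<and> j < k + 2 * l then adj (2 * l) B $$ (i - k, j - k) else 0
      else if k + 2 * l \<le> j then adj k A $$ (i - (k + 2 * l), j - (k + 2 * l)) else 0)"
      using 2 by (cases "k \<le> j \<and> j < k + 2 * l") auto
  next
    case 3
    have "J = k - Suc (i - (k + 2 * l))" "J < k" "i - (k + 2 * l) < k" "\<not> i < k" "\<not> i < k + 2 * l" "\<not> k \<le> J" "\<not> k + 2 * l \<le> J"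
      using 3 IJ by arith+
    moreover have "I = k - Suc (j - (k + 2 * l))" "I < k" "j - (k + 2 * l) < k" if "k + 2 * l \<le> j" using that IJ by arith+
    moreover have "\<not> I < k" if "\<not> k + 2 * l \<le> j" using that IJ by arith
    ultimately show "(if I < k then if J < k then A $$ (I, J) else 0
      else if I < k + 2 * l then if k \<le> J \<and> J < k + 2 * l then B $$ (I - k, J - k) else 0
      else if k + 2 * l \<le> J then C $$ (I - (k + 2 * l), J - (k + 2 * l)) else 0) ^ q =
      (if i < k then if j < k then adj k C $$ (i, j) else 0
      else if i < k + 2 * l then if k \<le> j \<and> j < k + 2 * l then adj (2 * l) B $$ (i - k, j - k) else 0
      else if k + 2 * l \<le> j then adj k A $$ (i - (k + 2 * l), j - (k + 2 * l)) else 0)"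
      by (cases "k + 2 * l \<le> j") simp_all
  qed
qed

lemma uminus_diag2: "A \<in> carrier_mat n n \<Longrightarrow> B \<in> carrier_mat m m \<Longrightarrow> - diag2 A B = diag2 (- A) (- B :: 'a mat)"
  by (rule eq_matI) (auto simp: diag2_def)

lemma levi_alg_u:
  assumes A: "A \<in> carrier_mat k k" and B: "B \<in> ualg (2 * l)"
  shows "levi_alg k A B \<in> ualg (2 * (k + l))"
proof -
  note Bc = uD(1)[OF B]
  have aA: "- adj k A \<in> carrier_mat k k" by simp
  have "adj k (- adj k A) = - A" using adj_uminus[OF adj_carrier] adj_adj[OF A] by simp
  then have "adj (2 * (k + l)) (levi_alg k A B) = diag2 (- A) (diag2 (- B) (adj k A))"
    unfolding levi_alg_def adj_diag3[OF A Bc aA] uD(2)[OF B] by simp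
  also have "\<dots> = - levi_alg k A B"
    unfolding levi_alg_def uminus_diag2[OF A diag2_carrier[OF Bc aA]] uminus_diag2[OF Bc aA] by simp
  finally show ?thesis using diag3_carrier[OF A Bc aA] by (simp add: u_iff levi_alg_def)
qed

lemma adj_GL:
  assumes m: "m \<in> GL k"
  shows "adj k m \<in> GL k" "minv (adj k m) = adj k (minv m)"
proof -
  have "adj k m * adj k (minv m) = adj k (minv m * m)" using adj_mult[OF GL_minv(1)[OF m] GL_carrier[OF m]] by simp
  also have "\<dots> = 1\<^sub>m k" unfolding GL_minv(3)[OF m] by (rule adj_one)
  finally have "adj k m * adj k (minv m) = 1\<^sub>m k" .
  from GL_intro[OF adj_carrier adj_carrier this] show "adj k m \<in> GL k" "minv (adj k m) = adj k (minv m)" by auto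
qed

lemma levi_grp_GL:
  assumes m: "m \<in> GL k" and h: "h \<in> U (2 * l)"
  shows "levi_grp k m h \<in> GL (2 * (k + l))"
    "minv (levi_grp k m h) = diag2 (minv m) (diag2 (minv h) (adj k m))"
    "levi_grp k m h \<in> U (2 * (k + l))"
proof -
  have e: "k + (2 * l + k) = 2 * (k + l)" by simp
  have m3: "adj k (minv m) \<in> GL k" "minv (adj k (minv m)) = adj k m"
    using adj_GL[OF GL_minv(4)[OF m]] GL_minv(5)[OF m] by auto
  note hm = diag2_GL[OF U_D(1)[OF h] m3(1)]
  show g: "levi_grp k m h \<in> GL (2 * (k + l))"
    using diag2_GL(1)[OF m hm(1)] unfolding levi_grp_def e .
  show mi: "minv (levi_grp k m h) = diag2 (minv m) (diag2 (minv h) (adj k m))"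
    unfolding levi_grp_def diag2_GL(2)[OF m hm(1)] hm(2) m3(2) by (rule refl)
  have "adj (2 * (k + l)) (levi_grp k m h) = diag2 (minv m) (diag2 (minv h) (adj k m))"
    unfolding levi_grp_def adj_diag3[OF GL_carrier[OF m] U_D(2)[OF h] adj_carrier]
      adj_adj[OF GL_minv(1)[OF m]] U_D(3)[OF h] by (rule refl)
  then have "adj (2 * (k + l)) (levi_grp k m h) = minv (levi_grp k m h)" using mi by simp
  then show "levi_grp k m h \<in> U (2 * (k + l))"
    using GL_minv(3)[OF g] GL_carrier[OF g] by (simp add: U_iff)
qed

lemma conjg_levi:
  assumes m: "m \<in> GL k" and h: "h \<in> U (2 * l)" and A: "A \<in> carrier_mat k k" and B: "B \<in> carrier_mat (2 * l) (2 * l)"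
  shows "conjg (levi_grp k m h) (levi_alg k A B) = levi_alg k (conjg m A) (conjg h B)"
proof -
  have m3: "adj k (minv m) \<in> GL k" "minv (adj k (minv m)) = adj k m"
    using adj_GL[OF GL_minv(4)[OF m]] GL_minv(5)[OF m] by auto
  note mc = GL_carrier[OF m] GL_minv(1)[OF m]
  have aA: "- adj k A \<in> carrier_mat k k" by simp
  have mA: "minv m * A \<in> carrier_mat k k" by (rule mult_carrier_mat[OF mc(2) A])
  have "conjg (adj k (minv m)) (- adj k A) = adj k m * (- adj k A) * adj k (minv m)"
    unfolding conjg_def m3(2) by (rule refl)
  also have "\<dots> = - (adj k m * adj k A * adj k (minv m))"
    using mult_carrier_mat[OF adj_carrier[of k m] adj_carrier[of k A]] by simp
  also have "adj k m * adj k A * adj k (minv m) = adj k m * (adj k A * adj k (minv m))"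
    by (rule sq_assoc[OF adj_carrier adj_carrier adj_carrier])
  also have "\<dots> = adj k (conjg m A)"
    unfolding conjg_def adj_mult[OF mA mc(1)] adj_mult[OF mc(2) A] by (rule refl)
  finally have c3: "conjg (adj k (minv m)) (- adj k A) = - adj k (conjg m A)" .
  show ?thesis
    unfolding levi_grp_def levi_alg_def conjg_diag2[OF m diag2_GL(1)[OF U_D(1)[OF h] m3(1)] A diag2_carrier[OF B aA]]
      conjg_diag2[OF U_D(1)[OF h] m3(1) B aA] c3 by (rule refl)
qed

lemma lev_values:
  "i < 2 * (k + l) \<Longrightarrow> lev k (2 * (k + l)) i = (if i < k then 0 else if i < k + 2 * l then 1 else 2)"
  by (auto simp: lev_def)

lemma diag3_lev:
  assumes "A \<in> carrier_mat k k" "B \<in> carrier_mat (2 * l) (2 * l)" "C \<in> carrier_mat k k"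
    and "i < 2 * (k + l)" "j < 2 * (k + l)" "lev k (2 * (k + l)) i \<noteq> lev k (2 * (k + l)) j"
  shows "diag2 A (diag2 B C) $$ (i, j) = 0"
  unfolding diag3_index[OF assms(1-5)]
  using assms(6)[unfolded lev_values[OF assms(4)] lev_values[OF assms(5)]] by (auto split: if_splits)

lemma levi_grp_upper:
  assumes "m \<in> GL k" "h \<in> U (2 * l)"
  shows "upper k (2 * (k + l)) (levi_grp k m h)"
  unfolding upper_def levi_grp_def
  using diag3_lev[OF GL_carrier[OF assms(1)] U_D(2)[OF assms(2)] adj_carrier] by (metis less_irrefl)

lemma levi_alg_lev:
  assumes "A \<in> carrier_mat k k" "B \<in> carrier_mat (2 * l) (2 * l)"
    and "i < 2 * (k + l)" "j < 2 * (k + l)" "lev k (2 * (k + l)) i \<noteq> lev k (2 * (k + l)) j"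
  shows "levi_alg k A B $$ (i, j) = 0"
  unfolding levi_alg_def by (rule diag3_lev[OF assms(1,2) _ assms(3-5)]) simp

text \<open>Restriction without its normalising factor, which postpones division until the
  cardinalities of two nilradicals can be compared.\<close>

definition delta_gen :: "nat \<Rightarrow> nat \<Rightarrow> ('a mat \<Rightarrow> real) \<Rightarrow> 'a mat \<Rightarrow> real" where
  "delta_gen k N f D = (\<Sum>Z\<in>nil k N. f (D + Z))"

text \<open>An injective self-map of the finite nilradical is a permutation, so for a given
  conjugation only the inclusion \<open>m\<close> has to be checked.\<close>

lemma delta_gen_conjg:
  assumes g: "g \<in> U N" and D: "D \<in> carrier_mat N N" "D' \<in> carrier_mat N N"
    and m: "\<And>Z. Z \<in> nil k N \<Longrightarrow> conjg g (D + Z) - D' \<in> nil k N"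
  shows "delta_gen k N (\<lambda>X. f (conjg g X)) D = delta_gen k N f D'"
proof -
  let ?h = "\<lambda>Z. conjg g (D + Z) - D'"
  note gl = U_D(1)[OF g]
  have c: "conjg g (D + Z) \<in> carrier_mat N N" "D + Z \<in> carrier_mat N N" if "Z \<in> nil k N" for Z
    using conjg_carrier[OF gl] nilD(3)[OF that] D by auto
  have e: "D' + ?h Z = conjg g (D + Z)" if "Z \<in> nil k N" for Z
    using c[OF that] D by (intro eq_matI) auto
  have inj: "inj_on ?h (nil k N)"
  proof (rule inj_onI)
    fix Z W assume Z: "Z \<in> nil k N" and W: "W \<in> nil k N" and eq: "?h Z = ?h W"
    have "conjg g (D + Z) = conjg g (D + W)" using e[OF Z] e[OF W] eq by metis
    then have "D + Z = D + W" by (rule conjg_inj[OF gl c(2)[OF Z] c(2)[OF W]])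
    then have "\<And>i j. i < N \<Longrightarrow> j < N \<Longrightarrow> (D + Z) $$ (i, j) = (D + W) $$ (i, j)" by simp
    then show "Z = W" using D nilD(3)[OF Z] nilD(3)[OF W] by (intro eq_matI) auto
  qed
  have "?h ` nil k N = nil k N" by (rule endo_inj_surj[OF finite_nil _ inj]) (use m in auto)
  then have "bij_betw ?h (nil k N) (nil k N)" using inj by (simp add: bij_betw_def)
  from sum.reindex_bij_betw[OF this, of "\<lambda>Z. f (D' + Z)"]
  show ?thesis unfolding delta_gen_def using e by simp
qed

text \<open>Unipotent conjugation changes an upper triangular element only above the diagonal
  blocks, hence permutes the coset of \<open>D\<close> modulo the nilradical.\<close>

lemma delta_gen_unipotent:
  assumes N: "2 * k \<le> N" and u: "u \<in> U N" "unipotent k N u" and D: "D \<in> ualg N" "upper k N D"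
  shows "delta_gen k N (\<lambda>X. f (conjg u X)) D = delta_gen k N f D"
proof (rule delta_gen_conjg[OF u(1) uD(1)[OF D(1)] uD(1)[OF D(1)]])
  fix Z assume Z: "Z \<in> nil k N"
  note c = U_D(2)[OF u(1)] uD(1)[OF D(1)] nilD(3)[OF Z]
  have X: "D + Z \<in> carrier_mat N N" "D + Z \<in> ualg N" using c u_add[OF D(1) nilD(1)[OF Z]] by auto
  have Xu: "upper k N (D + Z)" using D(2) nilD(2)[OF Z] c by (auto simp: upper_def strict_def)
  have aX: "adj N u * (D + Z) \<in> carrier_mat N N" by (rule mult_carrier_mat[OF adj_carrier X(1)])
  have aXu: "upper k N (adj N u * (D + Z))"
    by (rule upper_mult[OF adj_carrier unipotent_upper[OF unipotent_adj[OF N u(2)]] X(1) Xu])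
  have "conjg u (D + Z) $$ (i, j) = (D + Z) $$ (i, j)" if "i < N" "j < N" "lev k N j \<le> lev k N i" for i j
    unfolding conjg_def U_D(3)[OF u(1)] unipotent_mult(1)[OF aX aXu c(1) u(2) that]
    by (rule unipotent_mult(2)[OF X(1) Xu adj_carrier unipotent_adj[OF N u(2)] that])
  then have "strict k N (conjg u (D + Z) - D)"
    using c nilD(2)[OF Z] conjg_carrier[OF U_D(1)[OF u(1)] X(1)] by (auto simp: strict_def)
  then show "conjg u (D + Z) - D \<in> nil k N"
    using u_minus[OF conjg_u[OF u(1) X(2)] D(1)] by (simp add: nil_def)
qed

text \<open>Levi elements normalise the nilradical, so conjugating by one changes only the Levi part
  of the point of evaluation.\<close>

lemma delta_gen_levi:
  assumes m: "m \<in> GL k" and h: "h \<in> U (2 * l)" and A: "A \<in> carrier_mat k k" and B: "B \<in> ualg (2 * l)"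
  shows "delta_gen k (2 * (k + l)) (\<lambda>X. f (conjg (levi_grp k m h) X)) (levi_alg k A B) =
    delta_gen k (2 * (k + l)) f (levi_alg k (conjg m A) (conjg h B))"
proof (rule delta_gen_conjg[OF levi_grp_GL(3)[OF m h]])
  let ?N = "2 * (k + l)" and ?g = "levi_grp k m h"
  note D = uD(1)[OF levi_alg_u[OF A B]]
  show "levi_alg k A B \<in> carrier_mat ?N ?N" by (rule D)
  have D': "levi_alg k (conjg m A) (conjg h B) \<in> carrier_mat ?N ?N"
    by (rule uD(1)[OF levi_alg_u[OF conjg_carrier[OF m A] conjg_u[OF h B]]])
  then show "levi_alg k (conjg m A) (conjg h B) \<in> carrier_mat ?N ?N" .
  fix Z assume Z: "Z \<in> nil k ?N"
  have gZ: "conjg ?g Z \<in> nil k ?N" by (rule nil_conjg[OF _ levi_grp_GL(3)[OF m h] levi_grp_upper[OF m h] Z]) simp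
  have "conjg ?g (levi_alg k A B + Z) = levi_alg k (conjg m A) (conjg h B) + conjg ?g Z"
    unfolding conjg_add[OF levi_grp_GL(1)[OF m h] D nilD(3)[OF Z]] conjg_levi[OF m h A uD(1)[OF B]] by (rule refl)
  moreover have "levi_alg k (conjg m A) (conjg h B) + conjg ?g Z - levi_alg k (conjg m A) (conjg h B) = conjg ?g Z"
    using D' nilD(3)[OF gZ] by (intro eq_matI) auto
  ultimately show "conjg ?g (levi_alg k A B + Z) - levi_alg k (conjg m A) (conjg h B) \<in> nil k ?N" using gZ by simp
qed

end

section \<open>Contribution of one cell of isotropic vectors\<close>

definition reindex_mat :: "nat \<Rightarrow> (nat \<Rightarrow> nat) \<Rightarrow> 'a mat \<Rightarrow> 'a mat" where
  "reindex_mat N \<iota> X = mat (N - 2) (N - 2) (\<lambda>(i, j). X $$ (\<iota> i, \<iota> j))"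

context hermitian
begin

text \<open>One summand of \<open>kerU\<close>, with the kernel condition moved inside so that the
  index set \<open>isotropic N\<close> does not depend on \<open>X\<close>. Only then can the sum
  over vectors be exchanged with the sum over the nilradical.\<close>

definition kerterm :: "nat \<Rightarrow> ('a mat \<Rightarrow> real) \<Rightarrow> 'a mat \<Rightarrow> 'a vec \<Rightarrow> real" where
  "kerterm N b X v = (if X *\<^sub>v v = 0\<^sub>v N then b (defl (N - 2) (conjg (frame N (U N) v) X)) else 0)"

lemma finite_isotropic: "finite (isotropic N)"
  by (rule finite_subset[OF _ finite_carrier_vec[of N]]) (auto simp: isotropic_def)

lemma kerU_kerterm:
  assumes "even N" "0 < N"
  shows "kerU N b X = (\<Sum>v\<in>isotropic N. kerterm N b X v)"
  unfolding ker_sum_def vec_orbit_U[OF assms] kerterm_def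
  using finite_isotropic by (simp add: sum.inter_filter)

lemma kerterm_conjg:
  assumes N: "even N" "0 < N" and b: "b \<in> invariant_funs (U (N - 2)) (ualg (N - 2))"
    and g: "g \<in> U N" and X: "X \<in> ualg N" and v: "v \<in> isotropic N"
  shows "kerterm N b (conjg g X) v = kerterm N b X (g *\<^sub>v v)"
proof -
  interpret descent N "N - 2" "U N" "ualg N" b by (rule descent_U[OF N b])
  have vo: "v \<in> vec_orbit N (U N)" unfolding vec_orbit_U[OF N] by (rule v)
  have vc: "v \<in> carrier_vec N" using v by (simp add: isotropic_def)
  note Xc = uD(1)[OF X] and gl = U_D(1)[OF g]
  let ?f = "frame N (U N) v"
  have f: "?f \<in> U N" "?f *\<^sub>v e0 N = v" using frame[OF vo] by auto
  have gf: "g * ?f *\<^sub>v e0 N = g *\<^sub>v v"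
    using assoc_mult_mat_vec[OF U_D(2)[OF g] U_D(2)[OF f(1)], of "e0 N"] f(2) by simp
  have zero: "conjg g X *\<^sub>v v = 0\<^sub>v N \<longleftrightarrow> X *\<^sub>v (g *\<^sub>v v) = 0\<^sub>v N" by (rule conjg_vec_zero[OF gl Xc vc])
  show ?thesis
  proof (cases "X *\<^sub>v (g *\<^sub>v v) = 0\<^sub>v N")
    case True
    have "conjg ?f (conjg g X) = conjg (g * ?f) X" by (rule conjg_mult[OF gl U_D(1)[OF f(1)] Xc, symmetric])
    moreover have "b (defl (N - 2) (conjg (frame N (U N) (g * ?f *\<^sub>v e0 N)) X)) = b (defl (N - 2) (conjg (g * ?f) X))"
      by (rule descend_eq[OF X U_mult[OF g f(1)]]) (simp only: gf True)
    ultimately show ?thesis unfolding kerterm_def zero using True by (simp add: gf)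
  qed (simp add: kerterm_def zero)
qed

lemma lead_set_isotropic:
  assumes "p < N" "v \<in> lead_set k N p"
  shows "v \<in> isotropic N"
proof -
  have "v $ p = 1" using assms by (auto simp: lead_set_def)
  then have "v \<noteq> 0\<^sub>v N" using assms(1) by auto
  then show ?thesis using assms(2) by (simp add: lead_set_def isotropic_def)
qed

lemma upper_mult_vec_zero:
  assumes g: "g \<in> carrier_mat N N" "upper k N g" and x: "x \<in> carrier_vec N"
    and z: "\<And>i. i < N \<Longrightarrow> c \<le> lev k N i \<Longrightarrow> x $ i = 0" and i: "i < N" "c \<le> lev k N i"
  shows "(g *\<^sub>v x) $ i = (0 :: 'a)"
proof -
  have "(g *\<^sub>v x) $ i = (\<Sum>r\<in>{0..<N}. g $$ (i, r) * x $ r)" using g i x by (simp add: scalar_prod_def)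
  also have "\<dots> = 0"
  proof (rule sum.neutral, rule ballI)
    fix r assume "r \<in> {0..<N}"
    then show "g $$ (i, r) * x $ r = 0"
      using upperD[OF g(2) i(1), of r] z[of r] i(2) by (cases "lev k N r < lev k N i") auto
  qed
  finally show ?thesis .
qed

text \<open>A block upper triangular matrix respects agreement of vectors from a given level
  upwards. So \<open>g\<close> carries the base cell to the cell whose leading coordinates are those
  of the image of the basis vector \<open>p\<close>.\<close>

lemma translate_lead_set:
  assumes N: "2 * k \<le> N" and p: "p < N" and g: "g \<in> U N" "upper k N g"
  shows "bij_betw ((*\<^sub>v) g) (lead_set k N p)
    {v \<in> carrier_vec N. (\<forall>i<N. lev k N p \<le> lev k N i \<longrightarrow> v $ i = (g *\<^sub>v unit_vec N p) $ i) \<and> form N v v = 0}"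
    (is "bij_betw _ _ ?T")
proof -
  note gl = U_D(1)[OF g(1)] and gc = U_D(2)[OF g(1)]
  have mc: "minv g \<in> carrier_mat N N" and mU: "minv g \<in> U N" using GL_minv(1)[OF gl] U_minv[OF g(1)] .
  have mu: "upper k N (minv g)" unfolding U_D(3)[OF g(1)] by (rule upper_adj[OF N g(2)])
  have agree: "(h *\<^sub>v v) $ i = (h *\<^sub>v w) $ i"
    if h: "h \<in> carrier_mat N N" "upper k N h" and vw: "v \<in> carrier_vec N" "w \<in> carrier_vec N"
      and e: "\<And>i. i < N \<Longrightarrow> lev k N p \<le> lev k N i \<Longrightarrow> v $ i = w $ i" and i: "i < N" "lev k N p \<le> lev k N i"
    for h and v w :: "'a vec" and i
  proof -
    have "(h *\<^sub>v (v - w)) $ i = 0"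
      by (rule upper_mult_vec_zero[OF h _ _ i]) (use vw e in auto)
    moreover have "h *\<^sub>v (v - w) = h *\<^sub>v v - h *\<^sub>v w" by (rule mult_minus_distrib_mat_vec[OF h(1) vw])
    ultimately show ?thesis using h(1) vw i by simp
  qed
  show ?thesis
  proof (rule bij_betw_byWitness[of _ "(*\<^sub>v) (minv g)"])
    show "\<forall>a\<in>lead_set k N p. minv g *\<^sub>v (g *\<^sub>v a) = a" "\<forall>a'\<in>?T. g *\<^sub>v (minv g *\<^sub>v a') = a'"
      using cancel_minv_vec[OF gl] by (auto simp: lead_set_def)
    show "(*\<^sub>v) g ` lead_set k N p \<subseteq> ?T"
    proof (rule image_subsetI)
      fix v assume v: "v \<in> lead_set k N p"
      then have vc: "v \<in> carrier_vec N" by (simp add: lead_set_def)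
      have "(g *\<^sub>v v) $ i = (g *\<^sub>v unit_vec N p) $ i" if "i < N" "lev k N p \<le> lev k N i" for i
        by (rule agree[OF gc g(2) vc unit_vec_carrier _ that]) (use v p in \<open>auto simp: lead_set_def\<close>)
      then show "g *\<^sub>v v \<in> ?T" using v form_U[OF g(1) vc vc] mult_mat_vec_carrier[OF gc vc] by (auto simp: lead_set_def)
    qed
    show "(*\<^sub>v) (minv g) ` ?T \<subseteq> lead_set k N p"
    proof (rule image_subsetI)
      fix v assume v: "v \<in> ?T"
      then have vc: "v \<in> carrier_vec N" by simp
      have gp: "g *\<^sub>v unit_vec N p \<in> carrier_vec N" using gc by simp
      have "(minv g *\<^sub>v v) $ i = (minv g *\<^sub>v (g *\<^sub>v unit_vec N p)) $ i" if "i < N" "lev k N p \<le> lev k N i" for i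
        by (rule agree[OF mc mu vc gp _ that]) (use v in auto)
      then have "(minv g *\<^sub>v v) $ i = (if i = p then 1 else 0)" if "i < N" "lev k N p \<le> lev k N i" for i
        using that p cancel_minv_vec(1)[OF gl unit_vec_carrier, of p] by simp
      then show "minv g *\<^sub>v v \<in> lead_set k N p"
        using v form_U[OF mU vc vc] mult_mat_vec_carrier[OF mc vc] by (auto simp: lead_set_def)
    qed
  qed
qed

text \<open>All vectors of the base cell are unipotent translates of the basis vector, and
  \<open>delta_gen\<close> does not see unipotent conjugation.\<close>

lemma sum_lead_set_unipotent:
  assumes N: "even N" "0 < N" "2 * k \<le> N" and b: "b \<in> invariant_funs (U (N - 2)) (ualg (N - 2))"
    and p: "p < N" "p \<noteq> N - Suc p" and D: "D \<in> ualg N" "upper k N D"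
  shows "(\<Sum>v\<in>lead_set k N p. delta_gen k N (\<lambda>X. kerterm N b X v) D) =
    card (lead_set k N p) * delta_gen k N (\<lambda>X. kerterm N b X (unit_vec N p)) D"
proof -
  have ep: "unit_vec N p \<in> isotropic N"
    using p form_unit_left[OF p(1), of 1 "unit_vec N p"] by (simp add: isotropic_def)
  have "delta_gen k N (\<lambda>X. kerterm N b X v) D = delta_gen k N (\<lambda>X. kerterm N b X (unit_vec N p)) D"
    if v: "v \<in> lead_set k N p" for v
  proof -
    obtain u where u: "u \<in> U N" "unipotent k N u" "u *\<^sub>v unit_vec N p = v"
      using lead_set_unipotent[OF N(3) p v] by blast
    have "delta_gen k N (\<lambda>X. kerterm N b X v) D =
      delta_gen k N (\<lambda>X. kerterm N b (conjg u X) (unit_vec N p)) D"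
      unfolding delta_gen_def
    proof (rule sum.cong[OF refl])
      fix Z assume "Z \<in> nil k N"
      then have "D + Z \<in> ualg N" using u_add[OF D(1)] nilD(1) by blast
      from kerterm_conjg[OF N(1,2) b u(1) this ep]
      show "kerterm N b (D + Z) v = kerterm N b (conjg u (D + Z)) (unit_vec N p)" by (simp add: u(3))
    qed
    also have "\<dots> = delta_gen k N (\<lambda>X. kerterm N b X (unit_vec N p)) D"
      by (rule delta_gen_unipotent[OF N(3) u(1,2) D])
    finally show ?thesis .
  qed
  then show ?thesis by simp
qed

text \<open>The cell of the basis vector \<open>p\<close> is fixed. The map \<open>\<iota>\<close>
  lists the \<open>N - 2\<close> indices other than \<open>p\<close> and its mirror, compatibly with
  the reflection; by the last condition the flag left on them is the one belonging to
  \<open>k'\<close>.\<close>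

context
  fixes k k' N p :: nat and \<iota> :: "nat \<Rightarrow> nat"
  assumes N: "even N" "0 < N" "2 * k \<le> N" and p: "p < N" "p \<noteq> N - Suc p"
    and \<iota>: "\<And>i. i < N - 2 \<Longrightarrow> \<iota> i < N" "inj_on \<iota> {..<N - 2}"
      "\<And>i. i < N - 2 \<Longrightarrow> \<iota> i \<noteq> p" "\<And>i. i < N - 2 \<Longrightarrow> \<iota> i \<noteq> N - Suc p"
      "\<And>i. i < N - 2 \<Longrightarrow> \<iota> (N - 2 - Suc i) = N - Suc (\<iota> i)"
      "\<And>i. i < N - 2 \<Longrightarrow> lev k' (N - 2) i = lev k N (\<iota> i)"
begin

abbreviation sel :: "'a mat \<Rightarrow> 'a mat" where
  "sel \<equiv> reindex_mat N \<iota>"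

lemma N2: "2 \<le> N"
  using N by presburger

lemma kerterm_unit_vec:
  assumes b: "b \<in> invariant_funs (U (N - 2)) (ualg (N - 2))" and X: "X \<in> ualg N"
  shows "kerterm N b X (unit_vec N p) = (if X *\<^sub>v unit_vec N p = 0\<^sub>v N then b (sel X) else 0)"
proof -
  interpret descent N "N - 2" "U N" "ualg N" b by (rule descent_U[OF N(1,2) b])
  \<comment> \<open>This permutation sends the end indices to \<open>p\<close> and its mirror and
    follows \<open>\<iota>\<close> in between. It is unitary, hence a frame of the basis vector
    \<open>p\<close>, and for this frame the compression is \<open>sel\<close>.\<close>
  define \<pi> where "\<pi> i = (if i = 0 then p else if i = N - 1 then N - Suc p else \<iota> (i - 1))" for i
  have mid: "i - 1 < N - 2" if "i < N" "i \<noteq> 0" "i \<noteq> N - 1" for i using that by simp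
  have \<pi>1: "\<pi> i < N" if "i < N" for i using that p \<iota>(1)[OF mid, of i] by (auto simp: \<pi>_def)
  have end0: "\<pi> y = p \<longleftrightarrow> y = 0" if "y < N" for y
    using p(2) \<iota>(3)[OF mid[OF that]] by (cases "y = 0"; cases "y = N - 1") (simp_all add: \<pi>_def)
  have endN: "\<pi> y = N - Suc p \<longleftrightarrow> y = N - 1" if "y < N" for y
    using p(2) N2 \<iota>(4)[OF mid[OF that]] by (cases "y = 0"; cases "y = N - 1") (simp_all add: \<pi>_def)
  have \<pi>2: "inj_on \<pi> {..<N}"
  proof (rule inj_onI)
    fix x y assume xy: "x \<in> {..<N}" "y \<in> {..<N}" "\<pi> x = \<pi> y"
    show "x = y"
    proof (cases "x = 0 \<or> x = N - 1 \<or> y = 0 \<or> y = N - 1")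
      case True
      then show ?thesis using end0[of x] end0[of y] endN[of x] endN[of y] xy by auto
    next
      case False
      then have "\<iota> (x - 1) = \<iota> (y - 1)" using xy(3) by (simp add: \<pi>_def)
      then have "x - 1 = y - 1" using inj_onD[OF \<iota>(2)] mid[of x] mid[of y] xy False by auto
      then show ?thesis using False by (metis One_nat_def Suc_pred neq0_conv)
    qed
  qed
  have \<pi>3: "\<pi> (N - Suc i) = N - Suc (\<pi> i)" if i: "i < N" for i
  proof -
    consider "i = 0" | "i = N - 1" "i \<noteq> 0" | "i \<noteq> 0" "i \<noteq> N - 1" by blast
    then show ?thesis
    proof cases
      case 1 then show ?thesis using N2 by (simp add: \<pi>_def)
    next
      case 2 then show ?thesis using N2 p by (simp add: \<pi>_def)
    next
      case 3
      have "N - Suc i \<noteq> 0" "N - Suc i \<noteq> N - 1" using 3 i by auto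
      then have "\<pi> (N - Suc i) = \<iota> (N - Suc i - 1)" by (simp add: \<pi>_def)
      also have "N - Suc i - 1 = N - 2 - Suc (i - 1)" using 3 i by simp
      also have "\<iota> \<dots> = N - Suc (\<iota> (i - 1))" by (rule \<iota>(5)[OF mid[OF i 3]])
      finally show ?thesis using 3 by (simp add: \<pi>_def)
    qed
  qed
  let ?P = "perm_mat N \<pi> :: 'a mat"
  have P: "?P \<in> U N" by (rule perm_mat_U[OF \<pi>1 \<pi>2 \<pi>3])
  have "?P *\<^sub>v unit_vec N 0 = unit_vec N (\<pi> 0)" by (rule perm_mat_unit_vec[OF \<pi>1 \<pi>2 \<pi>3 N(2)])
  then have P0: "?P *\<^sub>v e0 N = unit_vec N p" by (simp add: \<pi>_def)
  show ?thesis
  proof (cases "X *\<^sub>v unit_vec N p = 0\<^sub>v N")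
    case True
    have "defl (N - 2) (conjg ?P X) = sel X"
    proof (rule eq_matI)
      fix i j assume "i < dim_row (sel X)" "j < dim_col (sel X)"
      then have ij: "i < N - 2" "j < N - 2" by (auto simp: reindex_mat_def)
      have "conjg ?P X $$ (Suc i, Suc j) = X $$ (\<pi> (Suc i), \<pi> (Suc j))"
        by (rule conjg_perm_mat[OF \<pi>1 \<pi>2 \<pi>3 uD(1)[OF X]]) (use ij in auto)
      moreover have "\<pi> (Suc i) = \<iota> i" "\<pi> (Suc j) = \<iota> j" using ij by (auto simp: \<pi>_def)
      ultimately show "defl (N - 2) (conjg ?P X) $$ (i, j) = sel X $$ (i, j)" using ij by (simp add: reindex_mat_def)
    qed (auto simp: reindex_mat_def)
    then have "b (defl (N - 2) (conjg (frame N (U N) (unit_vec N p)) X)) = b (sel X)"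
      using descend_eq[OF X P] True unfolding P0 by simp
    then show ?thesis using True by (simp add: kerterm_def)
  qed (simp add: kerterm_def)
qed

definition nil_at :: "'a mat set" where
  "nil_at = {Z \<in> nil k N. col Z p = 0\<^sub>v N}"

lemma sel_nil:
  assumes Z: "Z \<in> nil k N"
  shows "sel Z \<in> nil k' (N - 2)"
proof -
  have "sel Z \<in> ualg (N - 2)"
  proof (rule uI)
    fix i j assume ij: "i < N - 2" "j < N - 2"
    have "Z $$ (\<iota> i, \<iota> j) = - ((Z $$ (N - Suc (\<iota> j), N - Suc (\<iota> i))) ^ q)"
      by (rule uD(3)[OF nilD(1)[OF Z] \<iota>(1)[OF ij(1)] \<iota>(1)[OF ij(2)]])
    then show "sel Z $$ (i, j) = - ((sel Z $$ (N - 2 - Suc j, N - 2 - Suc i)) ^ q)"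
      using ij \<iota>(5)[OF ij(1)] \<iota>(5)[OF ij(2)] by (simp add: reindex_mat_def)
  qed (simp add: reindex_mat_def)
  moreover have "strict k' (N - 2) (sel Z)"
    using strictD[OF nilD(2)[OF Z]] \<iota>(1,6) by (auto simp: strict_def reindex_mat_def)
  ultimately show ?thesis by (simp add: nil_def)
qed

text \<open>A preimage is obtained by extending with zeros at the two omitted indices.\<close>

lemma sel_surj:
  assumes Z: "Z \<in> nil k' (N - 2)"
  shows "\<exists>Y\<in>nil_at. sel Y = Z"
proof -
  let ?I = "\<iota> ` {..<N - 2}"
  define \<kappa> where "\<kappa> = inv_into {..<N - 2} \<iota>"
  have \<kappa>: "\<kappa> (\<iota> i) = i" if "i < N - 2" for i unfolding \<kappa>_def by (rule inv_into_f_f[OF \<iota>(2)]) (use that in simp)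
  have dual: "N - Suc i \<in> ?I \<and> \<kappa> (N - Suc i) = N - 2 - Suc (\<kappa> i)" if i: "i \<in> ?I" for i
  proof -
    obtain a where a: "a < N - 2" "i = \<iota> a" using i by auto
    have a': "N - 2 - Suc a < N - 2" using a by simp
    have "N - Suc i = \<iota> (N - 2 - Suc a)" using \<iota>(5)[OF a(1)] a(2) by simp
    then show ?thesis using \<kappa>[OF a'] \<kappa>[OF a(1)] a(2) a' by auto
  qed
  have dual': "N - Suc i \<in> ?I \<longleftrightarrow> i \<in> ?I" if "i < N" for i using dual[of i] dual[of "N - Suc i"] that by auto
  define Y where "Y = mat N N (\<lambda>(i, j). if i \<in> ?I \<and> j \<in> ?I then Z $$ (\<kappa> i, \<kappa> j) else 0)"
  have "Y \<in> ualg N"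
  proof (rule uI)
    fix i j assume ij: "i < N" "j < N"
    show "Y $$ (i, j) = - ((Y $$ (N - Suc j, N - Suc i)) ^ q)"
    proof (cases "i \<in> ?I \<and> j \<in> ?I")
      case True
      have "\<kappa> i < N - 2" "\<kappa> j < N - 2" using True \<kappa> by auto
      then have "Z $$ (\<kappa> i, \<kappa> j) = - ((Z $$ (N - 2 - Suc (\<kappa> j), N - 2 - Suc (\<kappa> i))) ^ q)"
        by (rule uD(3)[OF nilD(1)[OF Z]])
      then show ?thesis using True ij dual[of i] dual[of j] by (simp add: Y_def)
    next
      case False
      then have "\<not> (N - Suc j \<in> ?I \<and> N - Suc i \<in> ?I)" using dual'[OF ij(1)] dual'[OF ij(2)] by blast
      then show ?thesis using False ij by (auto simp: Y_def)
    qed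
  qed (simp add: Y_def)
  moreover have "strict k N Y"
    unfolding strict_def
  proof (intro allI impI)
    fix i j assume ij: "i < N" "j < N" "lev k N j \<le> lev k N i"
    show "Y $$ (i, j) = 0"
    proof (cases "i \<in> ?I \<and> j \<in> ?I")
      case True
      then obtain a c where "a < N - 2" "i = \<iota> a" "c < N - 2" "j = \<iota> c" by auto
      then show ?thesis using strictD[OF nilD(2)[OF Z], of a c] ij \<kappa> \<iota>(6) by (simp add: Y_def)
    next
      case False then show ?thesis using ij by (auto simp: Y_def)
    qed
  qed
  moreover have "col Y p = 0\<^sub>v N"
  proof -
    have "p \<notin> ?I" using \<iota>(3) by auto
    then show ?thesis using p by (intro eq_vecI) (auto simp: Y_def)
  qed
  moreover have "sel Y = Z"
    using nilD(3)[OF Z] \<kappa> \<iota>(1) by (intro eq_matI) (auto simp: reindex_mat_def Y_def)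
  ultimately show ?thesis by (auto simp: nil_at_def nil_def)
qed

lemma sel_fibres:
  assumes X: "X \<in> nil_at"
  shows "card {Y \<in> nil_at. sel Y = sel X} = card {K \<in> nil_at. sel K = 0\<^sub>m (N - 2) (N - 2)}"
proof (rule card_additive_fibre[OF _ _ _ _ X, of N N])
  have c: "Z \<in> carrier_mat N N" if "Z \<in> nil_at" for Z using that nilD(3) by (auto simp: nil_at_def)
  then show "nil_at \<subseteq> carrier_mat N N" by blast
  fix A B assume A: "A \<in> nil_at" and B: "B \<in> nil_at"
  note cc = c[OF A] c[OF B]
  have "col (A + B) p = col A p + col B p" "col (A - B) p = col A p - col B p"
    using cc p by (auto intro!: eq_vecI)
  then show "A + B \<in> nil_at" "A - B \<in> nil_at" using A B nil_add nil_minus by (auto simp: nil_at_def)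
  have "sel (A - B) = 0\<^sub>m (N - 2) (N - 2) \<longleftrightarrow> (\<forall>i<N - 2. \<forall>j<N - 2. (A - B) $$ (\<iota> i, \<iota> j) = 0)"
    by (auto simp: reindex_mat_def mat_eq_iff)
  also have "\<dots> \<longleftrightarrow> (\<forall>i<N - 2. \<forall>j<N - 2. A $$ (\<iota> i, \<iota> j) = B $$ (\<iota> i, \<iota> j))"
    using cc \<iota>(1) by auto
  also have "\<dots> \<longleftrightarrow> sel A = sel B" by (auto simp: reindex_mat_def mat_eq_iff)
  finally show "sel A = sel B \<longleftrightarrow> sel (A - B) = 0\<^sub>m (N - 2) (N - 2)" by simp
qed

text \<open>Two index formulas meet: \<open>card (nil k N)\<close> is the number of elements killing
  the basis vector times the size of the cell, and these elements map onto the smaller nilradical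
  with fibres of constant size \<open>?c\<close>. The size of the cell and \<open>?c\<close> are
  absorbed, so only the two nilradicals remain.\<close>

lemma sum_lead_set:
  assumes b: "b \<in> invariant_funs (U (N - 2)) (ualg (N - 2))" and D: "D \<in> ualg N"
    and lev: "\<And>i j. i < N \<Longrightarrow> j < N \<Longrightarrow> lev k N i \<noteq> lev k N j \<Longrightarrow> D $$ (i, j) = 0"
  shows "(\<Sum>v\<in>lead_set k N p. delta_gen k N (\<lambda>X. kerterm N b X v) D) * card (nil k' (N - 2)) =
    (if col D p = 0\<^sub>v N then card (nil k N) * delta_gen k' (N - 2) b (sel D) else 0)"
proof -
  note Dc = uD(1)[OF D]
  let ?c = "card {K \<in> nil_at. sel K = 0\<^sub>m (N - 2) (N - 2)}"
  have fin: "finite nil_at" using finite_nil by (simp add: nil_at_def)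
  have im: "sel ` nil_at = nil k' (N - 2)"
    using sel_nil sel_surj unfolding nil_at_def by blast
  have card1: "card nil_at = ?c * card (nil k' (N - 2))"
    using card_uniform_fibres[where h = sel, OF fin sel_fibres] unfolding im .
  have card2: "card (nil k N) = card nil_at * card (lead_set k N p)"
    unfolding nil_at_def by (rule card_lead_set[OF N(3) p])
  \<comment> \<open>In column \<open>p\<close> the block diagonal \<open>D\<close> and the strictly
    upper \<open>Z\<close> have disjoint supports, so they cannot cancel each other.\<close>
  have iff: "(D + Z) *\<^sub>v unit_vec N p = 0\<^sub>v N \<longleftrightarrow> col D p = 0\<^sub>v N \<and> col Z p = 0\<^sub>v N" if Z: "Z \<in> nil k N" for Z
  proof -
    note Zc = nilD(3)[OF Z]
    have DZ: "D + Z \<in> carrier_mat N N" using Dc Zc by simp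
    have "(D + Z) *\<^sub>v unit_vec N p = 0\<^sub>v N \<longleftrightarrow> (\<forall>i<N. D $$ (i, p) + Z $$ (i, p) = 0)"
      unfolding mat_unit_vec[OF DZ p(1)] using Dc Zc p by (auto simp: vec_eq_iff)
    also have "\<dots> \<longleftrightarrow> (\<forall>i<N. D $$ (i, p) = 0) \<and> (\<forall>i<N. Z $$ (i, p) = 0)"
    proof -
      have "D $$ (i, p) = 0 \<or> Z $$ (i, p) = 0" if "i < N" for i
        using lev[OF that p(1)] strictD[OF nilD(2)[OF Z] that p(1)] by (cases "lev k N i = lev k N p") auto
      then show ?thesis by (metis add.right_neutral add_0)
    qed
    also have "\<dots> \<longleftrightarrow> col D p = 0\<^sub>v N \<and> col Z p = 0\<^sub>v N" using Dc Zc p by (auto simp: vec_eq_iff)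
    finally show ?thesis .
  qed
  have Du: "upper k N D" using lev by (auto simp: upper_def)
  have "delta_gen k N (\<lambda>X. kerterm N b X (unit_vec N p)) D =
    (\<Sum>Z\<in>nil k N. if col D p = 0\<^sub>v N \<and> col Z p = 0\<^sub>v N then b (sel D + sel Z) else 0)"
    unfolding delta_gen_def
  proof (rule sum.cong[OF refl])
    fix Z assume Z: "Z \<in> nil k N"
    have "sel (D + Z) = sel D + sel Z"
      using Dc nilD(3)[OF Z] \<iota>(1) by (intro eq_matI) (auto simp: reindex_mat_def)
    then show "kerterm N b (D + Z) (unit_vec N p) =
      (if col D p = 0\<^sub>v N \<and> col Z p = 0\<^sub>v N then b (sel D + sel Z) else 0)"
      unfolding kerterm_unit_vec[OF b u_add[OF D nilD(1)[OF Z]]] iff[OF Z] by simp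
  qed
  also have "\<dots> = (if col D p = 0\<^sub>v N then \<Sum>Z\<in>nil_at. b (sel D + sel Z) else 0)"
    unfolding nil_at_def using finite_nil by (simp add: sum.inter_filter)
  also have "(\<Sum>Z\<in>nil_at. b (sel D + sel Z)) = ?c * delta_gen k' (N - 2) b (sel D)"
    using sum_uniform_fibres[where h = sel and F = "\<lambda>Y. b (sel D + Y)", OF fin sel_fibres]
    unfolding im delta_gen_def .
  finally have "delta_gen k N (\<lambda>X. kerterm N b X (unit_vec N p)) D =
    (if col D p = 0\<^sub>v N then ?c * delta_gen k' (N - 2) b (sel D) else 0)" .
  then show ?thesis
    unfolding sum_lead_set_unipotent[OF N b p D Du] card2 card1 by simp
qed

end


text \<open>One component of \<open>delta_tilde\<close>, as a function of the homogeneous part of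
  the argument on which alone it depends; see \<open>delta_tilde_Delta\<close>.\<close>

definition Delta :: "nat \<Rightarrow> nat \<Rightarrow> ('a mat \<Rightarrow> real) \<Rightarrow> 'a mat \<Rightarrow> 'a mat \<Rightarrow> real" where
  "Delta k l f A B = (if A \<in> gl k \<and> B \<in> ualg (2 * l)
     then delta_gen k (2 * (k + l)) f (levi_alg k A B) / card (nil k (2 * (k + l))) else 0)"

lemma card_nil_pos: "card (nil k N) > 0"
  using finite_nil nil_zero by (metis card_gt_0_iff empty_iff)

lemma delta_gen_Delta:
  "A \<in> carrier_mat k k \<Longrightarrow> B \<in> ualg (2 * l) \<Longrightarrow> N = 2 * (k + l) \<Longrightarrow>
    delta_gen k N f (levi_alg k A B) = card (nil k N) * Delta k l f A B"
  using card_nil_pos[of k "2 * (k + l)"] by (simp add: Delta_def gl_def)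

lemma Delta_conjg:
  assumes f: "f \<in> C_u q (k + l)" and m: "m \<in> GL k" and h: "h \<in> U (2 * l)"
    and A: "A \<in> carrier_mat k k" and B: "B \<in> ualg (2 * l)"
  shows "Delta k l f (conjg m A) (conjg h B) = Delta k l f A B"
proof -
  let ?N = "2 * (k + l)"
  have "delta_gen k ?N f (levi_alg k (conjg m A) (conjg h B)) =
    delta_gen k ?N (\<lambda>X. f (conjg (levi_grp k m h) X)) (levi_alg k A B)"
    by (rule delta_gen_levi[OF m h A B, symmetric])
  also have "\<dots> = delta_gen k ?N f (levi_alg k A B)"
    unfolding delta_gen_def
  proof (rule sum.cong[OF refl])
    fix Z assume "Z \<in> nil k ?N"
    then have "levi_alg k A B + Z \<in> ualg ?N" using u_add[OF levi_alg_u[OF A B]] nilD(1) by blast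
    then show "f (conjg (levi_grp k m h) (levi_alg k A B + Z)) = f (levi_alg k A B + Z)"
      using invariant_funs_conjg[OF f[unfolded C_u_def] mat_group_U levi_grp_GL(3)[OF m h]] by simp
  qed
  finally show ?thesis using conjg_carrier[OF m A] conjg_u[OF h B] A B by (simp add: Delta_def gl_def)
qed

lemma Delta_C_gl:
  assumes f: "f \<in> C_u q (k + l)"
  shows "(\<lambda>A. Delta k l f A B) \<in> C_gl k"
proof (rule C_glI)
  fix g X :: "'a mat" assume g: "g \<in> GL k" and X: "X \<in> carrier_mat k k"
  show "Delta k l f (conjg g X) B = Delta k l f X B"
  proof (cases "B \<in> ualg (2 * l)")
    case True
    then show ?thesis using Delta_conjg[OF f g U_one X True] conjg_one[OF uD(1)[OF True]] by simp
  qed (simp add: Delta_def)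
qed (simp add: Delta_def gl_def)

lemma C_uI:
  assumes "\<And>X. X \<notin> ualg (2 * n) \<Longrightarrow> f X = 0"
    and "\<And>g X. g \<in> U (2 * n) \<Longrightarrow> X \<in> ualg (2 * n) \<Longrightarrow> f (conjg g X) = f X"
  shows "f \<in> C_u q n"
proof -
  have "f (g * X * minv g) = f X" if "g \<in> U (2 * n)" "X \<in> ualg (2 * n)" for g X
    using assms(2)[OF U_minv[OF that(1)] that(2)] GL_minv(5)[OF U_D(1)[OF that(1)]] by (simp add: conjg_def)
  then show ?thesis using assms(1) by (auto simp: C_u_def invariant_funs_def)
qed

lemma Delta_C_u:
  assumes f: "f \<in> C_u q (k + l)"
  shows "Delta k l f A \<in> C_u q l"
proof (rule C_uI)
  fix g X assume g: "g \<in> U (2 * l)" and X: "X \<in> ualg (2 * l)"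
  show "Delta k l f A (conjg g X) = Delta k l f A X"
  proof (cases "A \<in> carrier_mat k k")
    case True
    then show ?thesis using Delta_conjg[OF f GL_one(1) g True X] conjg_one[OF True] by simp
  qed (simp add: Delta_def gl_def)
qed (simp add: Delta_def)

text \<open>A Levi element moves the base cell to the given cell; in exchange the point of
  evaluation is conjugated blockwise.\<close>

lemma sum_translate:
  assumes N: "N = 2 * (k + l)" "0 < N" and b: "b \<in> invariant_funs (U (N - 2)) (ualg (N - 2))"
    and p: "p < N" and m: "m \<in> GL k" and h: "h \<in> U (2 * l)" and A: "A \<in> carrier_mat k k" and B: "B \<in> ualg (2 * l)"
  shows "(\<Sum>v\<in>{v \<in> carrier_vec N. (\<forall>i<N. lev k N p \<le> lev k N i \<longrightarrow>
        v $ i = (levi_grp k m h *\<^sub>v unit_vec N p) $ i) \<and> form N v v = 0}.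
      delta_gen k N (\<lambda>X. kerterm N b X v) (levi_alg k A B)) =
    (\<Sum>w\<in>lead_set k N p. delta_gen k N (\<lambda>X. kerterm N b X w) (levi_alg k (conjg m A) (conjg h B)))"
    (is "(\<Sum>v\<in>?T. ?F v) = _")
proof -
  let ?g = "levi_grp k m h"
  have g: "?g \<in> U N" unfolding N(1) by (rule levi_grp_GL(3)[OF m h])
  have gu: "upper k N ?g" unfolding N(1) by (rule levi_grp_upper[OF m h])
  have D: "levi_alg k A B \<in> ualg N" unfolding N(1) by (rule levi_alg_u[OF A B])
  have ev: "even N" and k: "2 * k \<le> N" using N by auto
  have "(\<Sum>v\<in>?T. ?F v) = (\<Sum>w\<in>lead_set k N p. ?F (?g *\<^sub>v w))"
    by (rule sum.reindex_bij_betw[OF translate_lead_set[OF k p g gu], symmetric])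
  also have "\<dots> = (\<Sum>w\<in>lead_set k N p. delta_gen k N (\<lambda>X. kerterm N b X w) (levi_alg k (conjg m A) (conjg h B)))"
  proof (rule sum.cong[OF refl])
    fix w assume w: "w \<in> lead_set k N p"
    have "?F (?g *\<^sub>v w) = delta_gen k N (\<lambda>X. kerterm N b (conjg ?g X) w) (levi_alg k A B)"
      unfolding delta_gen_def
    proof (rule sum.cong[OF refl])
      fix Z assume "Z \<in> nil k N"
      then have "levi_alg k A B + Z \<in> ualg N" using u_add[OF D] nilD(1) by blast
      from kerterm_conjg[OF ev N(2) b g this lead_set_isotropic[OF p w]]
      show "kerterm N b (levi_alg k A B + Z) (?g *\<^sub>v w) = kerterm N b (conjg ?g (levi_alg k A B + Z)) w" by simp
    qed
    also have "\<dots> = delta_gen k N (\<lambda>X. kerterm N b X w) (levi_alg k (conjg m A) (conjg h B))"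
      unfolding N(1) by (rule delta_gen_levi[OF m h A B])
    finally show "?F (?g *\<^sub>v w) = delta_gen k N (\<lambda>X. kerterm N b X w) (levi_alg k (conjg m A) (conjg h B))" .
  qed
  finally show ?thesis .
qed

lemma levi_alg_index:
  assumes "A \<in> carrier_mat k k" "B \<in> carrier_mat (2 * l) (2 * l)" "N = 2 * (k + l)" "i < N" "j < N"
  shows "levi_alg k A B $$ (i, j) =
    (if i < k then if j < k then A $$ (i, j) else 0
     else if i < k + 2 * l then if k \<le> j \<and> j < k + 2 * l then B $$ (i - k, j - k) else 0
     else if k + 2 * l \<le> j then - ((A $$ (N - Suc j, N - Suc i)) ^ q) else 0)"
proof -
  have c: "- adj k A \<in> carrier_mat k k" by simp
  have "(- adj k A) $$ (i - (k + 2 * l), j - (k + 2 * l)) = - ((A $$ (N - Suc j, N - Suc i)) ^ q)"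
    if "k + 2 * l \<le> i" "k + 2 * l \<le> j"
  proof -
    define a c where "a = i - (k + 2 * l)" and "c = j - (k + 2 * l)"
    have i: "i = k + 2 * l + a" and j: "j = k + 2 * l + c" using that by (simp_all add: a_def c_def)
    have ac: "a < k" "c < k" using assms(3-5) i j by simp_all
    have "N - Suc j = k - Suc c" "N - Suc i = k - Suc a" unfolding assms(3) i j by simp_all
    then show ?thesis using ac by (simp flip: a_def c_def)
  qed
  then show ?thesis
    using diag3_index[OF assms(1,2) c assms(4,5)[unfolded assms(3)]] by (simp add: levi_alg_def)
qed

text \<open>The cell computation as the three positions of a vector use it: for an arbitrary cell,
  in normalised form, and with the compressed Levi element recognised as
  \<open>levi_alg k' A' B'\<close>.\<close>

lemma sum_lead_set_levi:
  assumes N: "N = 2 * (k + l)" "0 < N" and b: "b \<in> invariant_funs (U (N - 2)) (ualg (N - 2))"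
    and p: "p < N" "p \<noteq> N - Suc p" and m: "m \<in> GL k" and h: "h \<in> U (2 * l)"
    and A: "A \<in> carrier_mat k k" and B: "B \<in> ualg (2 * l)"
    and \<iota>: "\<And>i. i < N - 2 \<Longrightarrow> \<iota> i < N" "inj_on \<iota> {..<N - 2}"
      "\<And>i. i < N - 2 \<Longrightarrow> \<iota> i \<noteq> p" "\<And>i. i < N - 2 \<Longrightarrow> \<iota> i \<noteq> N - Suc p"
      "\<And>i. i < N - 2 \<Longrightarrow> \<iota> (N - 2 - Suc i) = N - Suc (\<iota> i)"
      "\<And>i. i < N - 2 \<Longrightarrow> lev k' (N - 2) i = lev k N (\<iota> i)"
    and N': "N - 2 = 2 * (k' + l')"
    and sel: "reindex_mat N \<iota> (levi_alg k (conjg m A) (conjg h B)) = levi_alg k' A' B'"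
    and A': "A' \<in> carrier_mat k' k'" and B': "B' \<in> ualg (2 * l')"
  shows "(\<Sum>v\<in>{v \<in> carrier_vec N. (\<forall>i<N. lev k N p \<le> lev k N i \<longrightarrow>
        v $ i = (levi_grp k m h *\<^sub>v unit_vec N p) $ i) \<and> form N v v = 0}.
      delta_gen k N (\<lambda>X. kerterm N b X v) (levi_alg k A B)) =
    (if col (levi_alg k (conjg m A) (conjg h B)) p = 0\<^sub>v N then card (nil k N) * Delta k' l' b A' B' else 0)"
proof -
  let ?D = "levi_alg k (conjg m A) (conjg h B)"
  have D: "?D \<in> ualg N" unfolding N(1) by (rule levi_alg_u[OF conjg_carrier[OF m A] conjg_u[OF h B]])
  have ev: "even N" and k: "2 * k \<le> N" using N by auto
  have lev: "?D $$ (i, j) = 0" if "i < N" "j < N" "lev k N i \<noteq> lev k N j" for i j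
    using levi_alg_lev[OF conjg_carrier[OF m A] uD(1)[OF conjg_u[OF h B]]] that unfolding N(1) by blast
  have "(\<Sum>w\<in>lead_set k N p. delta_gen k N (\<lambda>X. kerterm N b X w) ?D) * card (nil k' (N - 2)) =
    (if col ?D p = 0\<^sub>v N then card (nil k N) * delta_gen k' (N - 2) b (reindex_mat N \<iota> ?D) else 0)"
    by (rule sum_lead_set[OF ev N(2) k p \<iota> b D lev])
  also have "delta_gen k' (N - 2) b (reindex_mat N \<iota> ?D) = card (nil k' (N - 2)) * Delta k' l' b A' B'"
    unfolding sel by (rule delta_gen_Delta[OF A' B' N'])
  finally show ?thesis
    unfolding sum_translate[OF N b p(1) m h A B] using card_nil_pos[of k' "N - 2"]
    by (auto split: if_splits)
qed

text \<open>Dropping the indices 0 and \<open>N - 1\<close> removes the leading row and column of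
  the first block and, by mirror symmetry, the final ones of the last block.\<close>

lemma defl_levi_alg:
  assumes k: "0 < k" and A: "A \<in> carrier_mat k k" and B: "B \<in> carrier_mat (2 * l) (2 * l)" and N: "N = 2 * (k + l)"
  shows "reindex_mat N Suc (levi_alg k A B) = levi_alg (k - 1) (defl (k - 1) A) B"
proof (rule eq_matI)
  have N': "N - 2 = 2 * (k - 1 + l)" using k N by simp
  have c: "- adj (k - 1) (defl (k - 1) A) \<in> carrier_mat (k - 1) (k - 1)" by simp
  have R: "levi_alg (k - 1) (defl (k - 1) A) B \<in> carrier_mat (N - 2) (N - 2)"
    unfolding N' levi_alg_def by (rule diag3_carrier[OF defl_carrier B c])
  then show "dim_row (reindex_mat N Suc (levi_alg k A B)) = dim_row (levi_alg (k - 1) (defl (k - 1) A) B)"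
    "dim_col (reindex_mat N Suc (levi_alg k A B)) = dim_col (levi_alg (k - 1) (defl (k - 1) A) B)"
    by (auto simp: reindex_mat_def)
  fix i j assume "i < dim_row (levi_alg (k - 1) (defl (k - 1) A) B)" "j < dim_col (levi_alg (k - 1) (defl (k - 1) A) B)"
  then have ij: "i < N - 2" "j < N - 2" using R by auto
  obtain K where K: "k = Suc K" using k by (cases k) auto
  define M where "M = N - 2"
  have NM: "N = Suc (Suc M)" and M: "M = 2 * (K + l)" using N K by (simp_all add: M_def)
  have ijM: "i < M" "j < M" using ij by (simp_all add: M_def)
  have ij': "Suc i < N" "Suc j < N" using ijM by (simp_all add: NM)
  have a: "N - Suc (Suc i) = Suc (M - Suc i)" "N - Suc (Suc j) = Suc (M - Suc j)"
    unfolding NM using ijM by simp_all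
  have d: "defl K A $$ (M - Suc j, M - Suc i) = A $$ (Suc (M - Suc j), Suc (M - Suc i))"
    if "K + 2 * l \<le> i" "K + 2 * l \<le> j"
    using that ijM by (intro defl_index) (simp_all add: M)
  have d': "defl K A $$ (i, j) = A $$ (Suc i, Suc j)" if "i < K" "j < K" using that by simp
  have L: "levi_alg K (defl K A) B $$ (i, j) = (if i < K then if j < K then defl K A $$ (i, j) else 0
     else if i < K + 2 * l then if K \<le> j \<and> j < K + 2 * l then B $$ (i - K, j - K) else 0
     else if K + 2 * l \<le> j then - ((defl K A $$ (M - Suc j, M - Suc i)) ^ q) else 0)"
    by (rule levi_alg_index[OF defl_carrier B M ijM])
  have "reindex_mat N Suc (levi_alg k A B) $$ (i, j) = levi_alg k A B $$ (Suc i, Suc j)"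
    using ij by (simp add: reindex_mat_def)
  also have "\<dots> = levi_alg K (defl K A) B $$ (i, j)"
    unfolding L levi_alg_index[OF A B N ij'] a using d d' by (simp add: K)
  finally show "reindex_mat N Suc (levi_alg k A B) $$ (i, j) = levi_alg (k - 1) (defl (k - 1) A) B $$ (i, j)"
    by (simp add: K)
qed

text \<open>Omits \<open>k\<close> and its mirror \<open>N - Suc k\<close>, the two end indices of
  the middle block.\<close>

definition skip :: "nat \<Rightarrow> nat \<Rightarrow> nat \<Rightarrow> nat" where
  "skip k N i = (if i < k then i else if i < N - 2 - k then Suc i else Suc (Suc i))"

lemma skip_levi_alg:
  assumes l: "0 < l" and A: "A \<in> carrier_mat k k" and B: "B \<in> carrier_mat (2 * l) (2 * l)" and N: "N = 2 * (k + l)"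
  shows "reindex_mat N (skip k N) (levi_alg k A B) = levi_alg k A (defl (2 * l - 2) B)"
proof (rule eq_matI)
  have N': "N - 2 = 2 * (k + (l - 1))" and l2: "2 * l - 2 = 2 * (l - 1)" using l N by auto
  have B': "defl (2 * l - 2) B \<in> carrier_mat (2 * (l - 1)) (2 * (l - 1))" unfolding l2 by simp
  have c: "- adj k A \<in> carrier_mat k k" by simp
  have R: "levi_alg k A (defl (2 * l - 2) B) \<in> carrier_mat (N - 2) (N - 2)"
    unfolding N' levi_alg_def by (rule diag3_carrier[OF A B' c])
  then show "dim_row (reindex_mat N (skip k N) (levi_alg k A B)) = dim_row (levi_alg k A (defl (2 * l - 2) B))"
    "dim_col (reindex_mat N (skip k N) (levi_alg k A B)) = dim_col (levi_alg k A (defl (2 * l - 2) B))"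
    by (auto simp: reindex_mat_def)
  fix i j assume "i < dim_row (levi_alg k A (defl (2 * l - 2) B))" "j < dim_col (levi_alg k A (defl (2 * l - 2) B))"
  then have ij: "i < N - 2" "j < N - 2" using R by auto
  have s: "skip k N x < N" "skip k N x < k \<longleftrightarrow> x < k" "skip k N x < k + 2 * l \<longleftrightarrow> x < k + 2 * (l - 1)"
    "k \<le> skip k N x \<longleftrightarrow> k \<le> x" "k + 2 * l \<le> skip k N x \<longleftrightarrow> k + 2 * (l - 1) \<le> x"
    "x < k \<longrightarrow> skip k N x = x" "k \<le> x \<and> x < k + 2 * (l - 1) \<longrightarrow> skip k N x - k = Suc (x - k) \<and> x - k < 2 * l - 2"
    "k + 2 * (l - 1) \<le> x \<longrightarrow> N - Suc (skip k N x) = N - 2 - Suc x" if "x < N - 2" for x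
    using that N l unfolding skip_def by auto
  note si = s[OF ij(1)] and sj = s[OF ij(2)]
  have "reindex_mat N (skip k N) (levi_alg k A B) $$ (i, j) = levi_alg k A B $$ (skip k N i, skip k N j)"
    using ij by (simp add: reindex_mat_def)
  also have "\<dots> = levi_alg k A (defl (2 * l - 2) B) $$ (i, j)"
    unfolding levi_alg_index[OF A B' N' ij] levi_alg_index[OF A B N si(1) sj(1)]
    using si sj by auto
  finally show "reindex_mat N (skip k N) (levi_alg k A B) $$ (i, j) = levi_alg k A (defl (2 * l - 2) B) $$ (i, j)" .
qed

lemma Suc_reindex:
  assumes "0 < k" "N = 2 * (k + l)" "i < N - 2"
  shows "Suc i < N" "Suc i \<noteq> 0" "Suc i \<noteq> N - 1" "Suc (N - 2 - Suc i) = N - Suc (Suc i)"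
    "lev (k - 1) (N - 2) i = lev k N (Suc i)"
  using assms by (auto simp: lev_def)

lemma skip_reindex:
  assumes "0 < l" "N = 2 * (k + l)" "i < N - 2"
  shows "skip k N i < N" "skip k N i \<noteq> k" "skip k N i \<noteq> N - Suc k"
    "skip k N (N - 2 - Suc i) = N - Suc (skip k N i)" "lev k (N - 2) i = lev k N (skip k N i)"
proof -
  show "skip k N i < N" "skip k N i \<noteq> k" "skip k N i \<noteq> N - Suc k" "lev k (N - 2) i = lev k N (skip k N i)"
    using assms by (auto simp: lev_def skip_def)
  consider "i < k" | "k \<le> i" "i < N - 2 - k" | "N - 2 - k \<le> i" by linarith
  then show "skip k N (N - 2 - Suc i) = N - Suc (skip k N i)"
  proof cases
    case 1
    then have "\<not> N - 2 - Suc i < k" "\<not> N - 2 - Suc i < N - 2 - k" using assms by auto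
    then show ?thesis using 1 assms by (simp add: skip_def)
  next
    case 2
    then have "\<not> N - 2 - Suc i < k" "N - 2 - Suc i < N - 2 - k" using assms by auto
    then show ?thesis using 2 assms by (simp add: skip_def)
  next
    case 3
    then have "N - 2 - Suc i < k" "\<not> i < k" using assms by auto
    then show ?thesis using 3 assms by (simp add: skip_def)
  qed
qed

lemma inj_skip: "inj_on (skip k N) S"
  by (auto simp: inj_on_def skip_def split: if_splits)

lemma levi_grp_unit_vec:
  assumes m: "m \<in> GL k" and h: "h \<in> U (2 * l)" and N: "N = 2 * (k + l)" and ip: "i < N" "p < N"
  shows "(levi_grp k m h *\<^sub>v unit_vec N p) $ i =
    (if i < k then if p < k then m $$ (i, p) else 0
     else if i < k + 2 * l then if k \<le> p \<and> p < k + 2 * l then h $$ (i - k, p - k) else 0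
     else if k + 2 * l \<le> p then adj k (minv m) $$ (i - (k + 2 * l), p - (k + 2 * l)) else 0)"
proof -
  have g: "levi_grp k m h \<in> carrier_mat N N" unfolding N by (rule GL_carrier[OF levi_grp_GL(1)[OF m h]])
  have "(levi_grp k m h *\<^sub>v unit_vec N p) $ i = levi_grp k m h $$ (i, p)"
    unfolding mat_unit_vec[OF g ip(2)] using g ip by simp
  then show ?thesis
    using diag3_index[OF GL_carrier[OF m] U_D(2)[OF h] adj_carrier ip[unfolded N]] by (simp add: levi_grp_def)
qed

section \<open>The three positions of an isotropic vector relative to W\<close>

context
  fixes k l N :: nat and b :: "'a mat \<Rightarrow> real" and A B :: "'a mat"
  assumes N: "N = 2 * (k + l)" "0 < N" and b: "b \<in> C_u q (k + l - 1)"
    and A: "A \<in> carrier_mat k k" and B: "B \<in> ualg (2 * l)"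
begin

abbreviation term_sum :: "'a vec \<Rightarrow> real" where
  "term_sum v \<equiv> delta_gen k N (\<lambda>X. kerterm N b X v) (levi_alg k A B)"

lemma b_inv: "b \<in> invariant_funs (U (N - 2)) (ualg (N - 2))"
proof -
  have "2 * (k + l - 1) = N - 2" using N by simp
  then show ?thesis using b by (simp add: C_u_def)
qed

text \<open>Vectors of W are automatically isotropic and correspond to the vectors of the natural
  module of \<open>GL k\<close>; each cell consists of a single vector.\<close>

lemma sum_isotropic_0:
  assumes k: "0 < k"
  shows "(\<Sum>v\<in>{v \<in> isotropic N. \<forall>i<N. k \<le> i \<longrightarrow> v $ i = 0}. term_sum v) =
    card (nil k N) * kerGL k (\<lambda>A'. Delta (k - 1) l b A' B) A"
proof -
  let ?V = "{v \<in> isotropic N. \<forall>i<N. k \<le> i \<longrightarrow> v $ i = 0}"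
  define ld where "ld v = vec k (\<lambda>i. v $ i)" for v :: "'a vec"
  have fin: "finite ?V" "finite (vec_orbit k (GL k :: 'a mat set))"
    using finite_isotropic mat_group_finite[OF mat_group_GL] by (auto simp: vec_orbit_def)
  have N': "N - 2 = 2 * (k - 1 + l)" using N k by simp
  have im: "ld ` ?V \<subseteq> vec_orbit k (GL k)"
  proof (rule image_subsetI)
    fix v assume v: "v \<in> ?V"
    then obtain i where "i < N" "v $ i \<noteq> 0" by (auto simp: isotropic_def vec_eq_iff)
    moreover from this v have "i < k" by (metis (mono_tags, lifting) mem_Collect_eq not_less)
    ultimately show "ld v \<in> vec_orbit k (GL k)" by (auto simp: vec_orbit_GL[OF k] ld_def vec_eq_iff)
  qed
  have "(\<Sum>v\<in>?V. term_sum v) = (\<Sum>y\<in>vec_orbit k (GL k). \<Sum>v\<in>{v \<in> ?V. ld v = y}. term_sum v)"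
    by (rule sum.group[symmetric, OF fin im])
  also have "\<dots> = (\<Sum>y\<in>vec_orbit k (GL k). if A *\<^sub>v y = 0\<^sub>v k
      then card (nil k N) * Delta (k - 1) l b (defl (k - 1) (conjg (frame k (GL k) y) A)) B else 0)"
  proof (rule sum.cong[OF refl])
    fix y :: "'a vec" assume y: "y \<in> vec_orbit k (GL k)"
    then have yc: "y \<in> carrier_vec k" "y \<noteq> 0\<^sub>v k" by (auto simp: vec_orbit_GL[OF k])
    let ?m = "frame k (GL k) y"
    have m: "?m \<in> GL k" "?m *\<^sub>v e0 k = y" using frame[OF y] by auto
    have mi: "?m $$ (i, 0) = y $ i" if "i < k" for i
      using arg_cong[OF m(2)[unfolded mat_unit_vec[OF GL_carrier[OF m(1)] k]], of "\<lambda>x. x $ i"] that GL_carrier[OF m(1)] k by simp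
    let ?g = "levi_grp k ?m (1\<^sub>m (2 * l))"
    have gi: "(?g *\<^sub>v unit_vec N 0) $ i = (if i < k then y $ i else 0)" if "i < N" for i
      using levi_grp_unit_vec[OF m(1) U_one N(1) that N(2)] mi k by simp
    \<comment> \<open>Level 0 is the lowest one, so every coordinate of the vector is
      prescribed.\<close>
    have lev0: "lev k N 0 \<le> lev k N i" for i using k by (simp add: lev_def)
    have set: "{v \<in> ?V. ld v = y} = {v \<in> carrier_vec N. (\<forall>i<N. lev k N 0 \<le> lev k N i \<longrightarrow>
        v $ i = (?g *\<^sub>v unit_vec N 0) $ i) \<and> form N v v = 0}" (is "?L = ?R")
    proof (intro equalityI subsetI)
      fix v assume v: "v \<in> ?L"
      have "y $ i = v $ i" if "i < k" for i using v that by (auto simp: ld_def)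
      then show "v \<in> ?R" using v gi by (auto simp: isotropic_def)
    next
      fix v assume v: "v \<in> ?R"
      then have vi: "v $ i = (if i < k then y $ i else 0)" if "i < N" for i using gi[OF that] lev0 that by simp
      have kN: "k \<le> N" using N by simp
      have ly: "ld v = y" using vi yc kN by (intro eq_vecI) (auto simp: ld_def)
      obtain j where "j < k" "y $ j \<noteq> 0" using yc by (auto simp: vec_eq_iff)
      then have "v $ j \<noteq> 0" "j < N" using vi[of j] kN by auto
      then have "v \<noteq> 0\<^sub>v N" by auto
      then show "v \<in> ?L" using v vi ly by (auto simp: isotropic_def)
    qed
    let ?A = "conjg ?m A"
    have Ac: "?A \<in> carrier_mat k k" by (rule conjg_carrier[OF m(1) A])
    have col: "col (levi_alg k ?A B) 0 = 0\<^sub>v N \<longleftrightarrow> A *\<^sub>v y = 0\<^sub>v k"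
    proof -
      have Dc: "levi_alg k ?A B \<in> carrier_mat N N" unfolding N(1) by (rule uD(1)[OF levi_alg_u[OF Ac B]])
      have "col (levi_alg k ?A B) 0 = 0\<^sub>v N \<longleftrightarrow> (\<forall>i<N. levi_alg k ?A B $$ (i, 0) = 0)"
        using Dc N(2) by (auto simp: vec_eq_iff)
      also have "\<dots> \<longleftrightarrow> (\<forall>i<k. ?A $$ (i, 0) = 0)"
        using levi_alg_index[OF Ac uD(1)[OF B] N(1) _ N(2)] k N by auto
      also have "\<dots> \<longleftrightarrow> ?A *\<^sub>v e0 k = 0\<^sub>v k" by (rule mult_e0_zero_iff[OF Ac k, symmetric])
      finally show ?thesis using conjg_vec_zero[OF m(1) A, of "e0 k"] m(2) by simp
    qed
    have "(\<Sum>v\<in>{v \<in> ?V. ld v = y}. term_sum v) = (if col (levi_alg k ?A (conjg (1\<^sub>m (2 * l)) B)) 0 = 0\<^sub>v N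
        then card (nil k N) * Delta (k - 1) l b (defl (k - 1) ?A) B else 0)"
      unfolding set
    proof (rule sum_lead_set_levi[where \<iota> = Suc, OF N b_inv N(2) _ m(1) U_one A B _ _ _ _ _ _ N' _ _ B])
      show "reindex_mat N Suc (levi_alg k ?A (conjg (1\<^sub>m (2 * l)) B)) = levi_alg (k - 1) (defl (k - 1) ?A) B"
        unfolding conjg_one[OF uD(1)[OF B]] by (rule defl_levi_alg[OF k Ac uD(1)[OF B] N(1)])
    qed (use Suc_reindex[OF k N(1)] N k in auto)
    then show "(\<Sum>v\<in>{v \<in> ?V. ld v = y}. term_sum v) = (if A *\<^sub>v y = 0\<^sub>v k
        then card (nil k N) * Delta (k - 1) l b (defl (k - 1) ?A) B else 0)"
      unfolding conjg_one[OF uD(1)[OF B]] col .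
  qed
  also have "\<dots> = card (nil k N) * kerGL k (\<lambda>A'. Delta (k - 1) l b A' B) A"
    unfolding ker_sum_def sum_distrib_left using fin by (simp add: sum.inter_filter del: One_nat_def)
  finally show ?thesis .
qed

text \<open>Vectors of W^perp outside W project to isotropic vectors of W^perp / W, on which
  \<open>U (2 * l)\<close> acts transitively; a cell consists of the lifts of one such
  vector.\<close>

lemma sum_isotropic_1:
  assumes l: "0 < l"
  shows "(\<Sum>v\<in>{v \<in> isotropic N. (\<forall>i<N. k + 2 * l \<le> i \<longrightarrow> v $ i = 0) \<and>
      (\<exists>i. k \<le> i \<and> i < k + 2 * l \<and> v $ i \<noteq> 0)}. term_sum v) =
    card (nil k N) * kerU (2 * l) (Delta k (l - 1) b A) B"
proof -
  let ?V = "{v \<in> isotropic N. (\<forall>i<N. k + 2 * l \<le> i \<longrightarrow> v $ i = 0) \<and>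
    (\<exists>i. k \<le> i \<and> i < k + 2 * l \<and> v $ i \<noteq> 0)}"
  define ld where "ld v = vec (2 * l) (\<lambda>i. v $ (k + i))" for v :: "'a vec"
  have l2: "even (2 * l)" "0 < 2 * l" using l by auto
  note orb = vec_orbit_U[OF l2]
  have fin: "finite ?V" "finite (isotropic (2 * l))" using finite_isotropic by auto
  have N': "N - 2 = 2 * (k + (l - 1))" and l2': "2 * l - 2 = 2 * (l - 1)" using N l by auto
  have kN: "k < N" "k \<noteq> N - Suc k" using N l by auto
  \<comment> \<open>Coordinates of level 0 are paired with coordinates of level 2, which vanish
    here, so the form sees the middle block alone.\<close>
  have form: "form N v v = form (2 * l) (ld v) (ld v)" if v: "\<forall>i<N. k + 2 * l \<le> i \<longrightarrow> v $ i = 0" for v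
  proof -
    have "form N v v = (\<Sum>r\<in>{k..<k + 2 * l}. (v $ r) ^ q * v $ (N - Suc r))"
      unfolding form_def
    proof (rule sum.mono_neutral_right)
      show "\<forall>i\<in>{..<N} - {k..<k + 2 * l}. (v $ i) ^ q * v $ (N - Suc i) = 0"
      proof
        fix i assume i: "i \<in> {..<N} - {k..<k + 2 * l}"
        show "(v $ i) ^ q * v $ (N - Suc i) = 0"
        proof (cases "i < k")
          case True
          then have "k + 2 * l \<le> N - Suc i" "N - Suc i < N" using N by auto
          then show ?thesis using v by simp
        qed (use v i in auto)
      qed
    qed (use N in auto)
    also have "\<dots> = (\<Sum>r\<in>{0..<2 * l}. (v $ (r + k)) ^ q * v $ (N - Suc (r + k)))"
      using sum.shift_bounds_nat_ivl[of "\<lambda>r. (v $ r) ^ q * v $ (N - Suc r)" 0 k "2 * l"] by (simp add: add.commute)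
    also have "\<dots> = form (2 * l) (ld v) (ld v)"
      unfolding form_def atLeast0LessThan
    proof (rule sum.cong[OF refl])
      fix r assume r: "r \<in> {..<2 * l}"
      then have "N - Suc (r + k) = k + (2 * l - Suc r)" using N by auto
      then show "(v $ (r + k)) ^ q * v $ (N - Suc (r + k)) = (ld v $ r) ^ q * ld v $ (2 * l - Suc r)"
        using r by (simp add: ld_def add.commute)
    qed
    finally show ?thesis .
  qed
  have im: "ld ` ?V \<subseteq> isotropic (2 * l)"
  proof (rule image_subsetI)
    fix v assume v: "v \<in> ?V"
    then obtain i where i: "k \<le> i" "i < k + 2 * l" "v $ i \<noteq> 0" by auto
    then have "ld v $ (i - k) \<noteq> 0" "i - k < 2 * l" by (auto simp: ld_def)
    then have "ld v \<noteq> 0\<^sub>v (2 * l)" by auto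
    moreover have "form (2 * l) (ld v) (ld v) = 0" using form[of v] v by (auto simp: isotropic_def)
    ultimately show "ld v \<in> isotropic (2 * l)" by (simp add: isotropic_def ld_def)
  qed
  have "(\<Sum>v\<in>?V. term_sum v) = (\<Sum>y\<in>isotropic (2 * l). \<Sum>v\<in>{v \<in> ?V. ld v = y}. term_sum v)"
    by (rule sum.group[symmetric, OF fin im])
  also have "\<dots> = (\<Sum>y\<in>isotropic (2 * l). if B *\<^sub>v y = 0\<^sub>v (2 * l)
      then card (nil k N) * Delta k (l - 1) b A (defl (2 * l - 2) (conjg (frame (2 * l) (U (2 * l)) y) B)) else 0)"
  proof (rule sum.cong[OF refl])
    fix y :: "'a vec" assume y: "y \<in> isotropic (2 * l)"
    then have yc: "y \<in> carrier_vec (2 * l)" "y \<noteq> 0\<^sub>v (2 * l)" "form (2 * l) y y = 0" by (auto simp: isotropic_def)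
    let ?h = "frame (2 * l) (U (2 * l)) y"
    have h: "?h \<in> U (2 * l)" "?h *\<^sub>v e0 (2 * l) = y" using frame[OF y[folded orb]] by auto
    have hi: "?h $$ (i, 0) = y $ i" if "i < 2 * l" for i
      using arg_cong[OF h(2)[unfolded mat_unit_vec[OF U_D(2)[OF h(1)] l2(2)]], of "\<lambda>x. x $ i"] that U_D(2)[OF h(1)] l2 by simp
    let ?g = "levi_grp k (1\<^sub>m k) ?h"
    have gi: "(?g *\<^sub>v unit_vec N k) $ i = (if i < k + 2 * l then y $ (i - k) else 0)" if "i < N" "k \<le> i" for i
      using levi_grp_unit_vec[OF GL_one(1) h(1) N(1) that(1) kN(1)] hi[of "i - k"] that l by simp
    have lev: "lev k N k \<le> lev k N i \<longleftrightarrow> k \<le> i" for i using l N by (auto simp: lev_def)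
    have set: "{v \<in> ?V. ld v = y} = {v \<in> carrier_vec N. (\<forall>i<N. lev k N k \<le> lev k N i \<longrightarrow>
        v $ i = (?g *\<^sub>v unit_vec N k) $ i) \<and> form N v v = 0}" (is "?L = ?R")
    proof (intro equalityI subsetI)
      fix v assume v: "v \<in> ?L"
      have "y $ (i - k) = v $ i" if "k \<le> i" "i < k + 2 * l" for i
      proof -
        have "ld v $ (i - k) = v $ (k + (i - k))" unfolding ld_def using that by (intro index_vec) simp
        moreover have "k + (i - k) = i" using that by simp
        ultimately show ?thesis using v by simp
      qed
      then show "v \<in> ?R" using v gi unfolding lev by (auto simp: isotropic_def)
    next
      fix v assume v: "v \<in> ?R"
      then have vi: "v $ i = (if i < k + 2 * l then y $ (i - k) else 0)" if "i < N" "k \<le> i" for i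
        using gi[OF that] lev that by simp
      have ly: "ld v = y" using vi yc N by (intro eq_vecI) (auto simp: ld_def)
      obtain j where j: "j < 2 * l" "y $ j \<noteq> 0" using yc by (auto simp: vec_eq_iff)
      then have vj: "v $ (k + j) \<noteq> 0" "k + j < N" using vi[of "k + j"] N by auto
      then have "v \<noteq> 0\<^sub>v N" by auto
      moreover have "\<exists>i. k \<le> i \<and> i < k + 2 * l \<and> v $ i \<noteq> 0" using vj j by (intro exI[of _ "k + j"]) auto
      ultimately show "v \<in> ?L" using v vi ly by (auto simp: isotropic_def)
    qed
    let ?B = "conjg ?h B"
    have Bu: "?B \<in> ualg (2 * l)" by (rule conjg_u[OF h(1) B])
    have col: "col (levi_alg k A ?B) k = 0\<^sub>v N \<longleftrightarrow> B *\<^sub>v y = 0\<^sub>v (2 * l)"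
    proof -
      have Dc: "levi_alg k A ?B \<in> carrier_mat N N" unfolding N(1) by (rule uD(1)[OF levi_alg_u[OF A Bu]])
      have "col (levi_alg k A ?B) k = 0\<^sub>v N \<longleftrightarrow> (\<forall>i<N. levi_alg k A ?B $$ (i, k) = 0)"
        using Dc kN(1) by (auto simp: vec_eq_iff)
      also have "\<dots> \<longleftrightarrow> (\<forall>i<2 * l. ?B $$ (i, 0) = 0)"
      proof
        assume z: "\<forall>i<N. levi_alg k A ?B $$ (i, k) = 0"
        show "\<forall>i<2 * l. ?B $$ (i, 0) = 0"
        proof (intro allI impI)
          fix i assume i: "i < 2 * l"
          then have "k + i < N" using N by simp
          then show "?B $$ (i, 0) = 0"
            using z levi_alg_index[OF A uD(1)[OF Bu] N(1) \<open>k + i < N\<close> kN(1)] i l by simp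
        qed
      next
        assume z: "\<forall>i<2 * l. ?B $$ (i, 0) = 0"
        show "\<forall>i<N. levi_alg k A ?B $$ (i, k) = 0"
          using levi_alg_index[OF A uD(1)[OF Bu] N(1) _ kN(1)] z l by auto
      qed
      also have "\<dots> \<longleftrightarrow> ?B *\<^sub>v e0 (2 * l) = 0\<^sub>v (2 * l)" by (rule mult_e0_zero_iff[OF uD(1)[OF Bu] l2(2), symmetric])
      finally show ?thesis using conjg_vec_zero[OF U_D(1)[OF h(1)] uD(1)[OF B], of "e0 (2 * l)"] h(2) by simp
    qed
    have B': "defl (2 * l - 2) ?B \<in> ualg (2 * (l - 1))"
      using defl_u[of "2 * l", OF _ Bu] l unfolding l2' by simp
    have "(\<Sum>v\<in>{v \<in> ?V. ld v = y}. term_sum v) = (if col (levi_alg k (conjg (1\<^sub>m k) A) ?B) k = 0\<^sub>v N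
        then card (nil k N) * Delta k (l - 1) b A (defl (2 * l - 2) ?B) else 0)"
      unfolding set
    proof (rule sum_lead_set_levi[where \<iota> = "skip k N", OF N b_inv kN GL_one(1) h(1) A B _ inj_skip _ _ _ _ N' _ A B'])
      show "reindex_mat N (skip k N) (levi_alg k (conjg (1\<^sub>m k) A) ?B) = levi_alg k A (defl (2 * l - 2) ?B)"
        unfolding conjg_one[OF A] by (rule skip_levi_alg[OF l A uD(1)[OF Bu] N(1)])
    qed (rule skip_reindex[OF l N(1)]; assumption)+
    then show "(\<Sum>v\<in>{v \<in> ?V. ld v = y}. term_sum v) = (if B *\<^sub>v y = 0\<^sub>v (2 * l)
        then card (nil k N) * Delta k (l - 1) b A (defl (2 * l - 2) ?B) else 0)"
      unfolding conjg_one[OF A] col .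
  qed
  also have "\<dots> = card (nil k N) * kerU (2 * l) (Delta k (l - 1) b A) B"
    unfolding ker_sum_def orb sum_distrib_left using fin by (simp add: sum.inter_filter del: One_nat_def)
  finally show ?thesis .
qed

text \<open>For vectors outside W^perp the last \<open>k\<close> coordinates amount to a functional
  on W. So \<open>GL k\<close> acts through the contragredient, and the kernel condition concerns
  the transpose of \<open>A\<close>.\<close>

lemma sum_isotropic_2:
  assumes k: "0 < k"
  shows "(\<Sum>v\<in>{v \<in> isotropic N. \<exists>i. k + 2 * l \<le> i \<and> i < N \<and> v $ i \<noteq> 0}. term_sum v) =
    card (nil k N) * kerGL k (\<lambda>A'. Delta (k - 1) l b A' B) A"
proof -
  let ?V = "{v \<in> isotropic N. \<exists>i. k + 2 * l \<le> i \<and> i < N \<and> v $ i \<noteq> 0}"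
  let ?At = "transpose_mat A"
  define ld where "ld v = vec k (\<lambda>i. v $ (k + 2 * l + i))" for v :: "'a vec"
  \<comment> \<open>Reversal with conjugation is how the form identifies V / W^perp with the
    conjugate dual of W.\<close>
  define dual where "dual y = vec k (\<lambda>j. (y $ (k - Suc j)) ^ q)" for y :: "'a vec"
  have At: "?At \<in> carrier_mat k k" using A by simp
  have fin: "finite ?V" "finite (vec_orbit k (GL k :: 'a mat set))"
    using finite_isotropic mat_group_finite[OF mat_group_GL] by (auto simp: vec_orbit_def)
  have N': "N - 2 = 2 * (k - 1 + l)" using N k by simp
  have last: "N - 1 < N" "N - 1 \<noteq> N - Suc (N - 1)" using N k by auto
  have im: "ld ` ?V \<subseteq> vec_orbit k (GL k)"
  proof (rule image_subsetI)
    fix v assume v: "v \<in> ?V"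
    then obtain i where i: "k + 2 * l \<le> i" "i < N" "v $ i \<noteq> 0" by auto
    then have "ld v $ (i - (k + 2 * l)) \<noteq> 0" "i - (k + 2 * l) < k" using N by (auto simp: ld_def)
    then have "ld v \<noteq> 0\<^sub>v k" by auto
    then show "ld v \<in> vec_orbit k (GL k)" by (simp add: vec_orbit_GL[OF k] ld_def)
  qed
  have dual: "dual y \<in> vec_orbit k (GL k)" "dual (dual y) = y" if "y \<in> vec_orbit k (GL k)" for y
  proof -
    have yc: "y \<in> carrier_vec k" "y \<noteq> 0\<^sub>v k" using that by (auto simp: vec_orbit_GL[OF k])
    show dd: "dual (dual y) = y" using yc by (intro eq_vecI) (auto simp: dual_def cj_cj)
    have "dual (0\<^sub>v k) = 0\<^sub>v k" by (intro eq_vecI) (auto simp: dual_def)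
    then have "dual y \<noteq> 0\<^sub>v k" using dd yc(2) by metis
    then show "dual y \<in> vec_orbit k (GL k)" by (simp add: vec_orbit_GL[OF k] dual_def)
  qed
  let ?H = "\<lambda>\<eta>. if ?At *\<^sub>v \<eta> = 0\<^sub>v k then card (nil k N) *
      Delta (k - 1) l b (transpose_mat (defl (k - 1) (conjg (frame k (GL k) \<eta>) ?At))) B else 0"
  have "(\<Sum>v\<in>?V. term_sum v) = (\<Sum>y\<in>vec_orbit k (GL k). \<Sum>v\<in>{v \<in> ?V. ld v = y}. term_sum v)"
    by (rule sum.group[symmetric, OF fin im])
  also have "\<dots> = (\<Sum>y\<in>vec_orbit k (GL k). ?H (dual y))"
  proof (rule sum.cong[OF refl])
    fix y :: "'a vec" assume y: "y \<in> vec_orbit k (GL k)"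
    then have yc: "y \<in> carrier_vec k" "y \<noteq> 0\<^sub>v k" by (auto simp: vec_orbit_GL[OF k])
    let ?m' = "frame k (GL k) (dual y)"
    have m': "?m' \<in> GL k" "?m' *\<^sub>v e0 k = dual y" using frame[OF dual(1)[OF y]] by auto
    have mi: "?m' $$ (i, 0) = dual y $ i" if "i < k" for i
      using arg_cong[OF m'(2)[unfolded mat_unit_vec[OF GL_carrier[OF m'(1)] k]], of "\<lambda>x. x $ i"] that GL_carrier[OF m'(1)] k by simp
    \<comment> \<open>The contragredient of the frame \<open>?m'\<close>: it gives the last block
      \<open>adj k (minv ?m)\<close> of the Levi element the last column \<open>y\<close>.\<close>
    let ?m = "transpose_mat (minv ?m')"
    have m: "?m \<in> GL k" "minv ?m = transpose_mat ?m'"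
      using transpose_GL[OF GL_minv(4)[OF m'(1)]] GL_minv(5)[OF m'(1)] by auto
    let ?g = "levi_grp k ?m (1\<^sub>m (2 * l))"
    have gi: "(?g *\<^sub>v unit_vec N (N - 1)) $ i = y $ (i - (k + 2 * l))" if i: "i < N" "k + 2 * l \<le> i" for i
    proof -
      define a where "a = i - (k + 2 * l)"
      have a: "a < k" using i N by (simp add: a_def)
      have "N - 1 - (k + 2 * l) = k - 1" using N by simp
      then have "(?g *\<^sub>v unit_vec N (N - 1)) $ i = adj k (minv ?m) $$ (a, k - 1)"
        using levi_grp_unit_vec[OF m(1) U_one N(1) i(1) last(1)] i N k by (simp add: a_def)
      also have "\<dots> = (transpose_mat ?m' $$ (0, k - Suc a)) ^ q" unfolding m(2) using a k by simp
      also have "transpose_mat ?m' $$ (0, k - Suc a) = ?m' $$ (k - Suc a, 0)"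
        using GL_carrier[OF m'(1)] a k by simp
      also have "\<dots> = dual y $ (k - Suc a)" by (rule mi) (use a in simp)
      also have "(dual y $ (k - Suc a)) ^ q = y $ a" using a by (simp add: dual_def cj_cj)
      finally show ?thesis by (simp add: a_def)
    qed
    have lev: "lev k N (N - 1) \<le> lev k N i \<longleftrightarrow> k + 2 * l \<le> i" if "i < N" for i
      using that k N by (auto simp: lev_def)
    have set: "{v \<in> ?V. ld v = y} = {v \<in> carrier_vec N. (\<forall>i<N. lev k N (N - 1) \<le> lev k N i \<longrightarrow>
        v $ i = (?g *\<^sub>v unit_vec N (N - 1)) $ i) \<and> form N v v = 0}" (is "?L = ?R")
    proof (intro equalityI subsetI)
      fix v assume v: "v \<in> ?L"
      have "v $ i = (?g *\<^sub>v unit_vec N (N - 1)) $ i" if i: "i < N" "lev k N (N - 1) \<le> lev k N i" for i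
      proof -
        have i': "k + 2 * l \<le> i" using i lev by simp
        then have "ld v $ (i - (k + 2 * l)) = v $ (k + 2 * l + (i - (k + 2 * l)))"
          unfolding ld_def using i N by (intro index_vec) simp
        moreover have "k + 2 * l + (i - (k + 2 * l)) = i" using i' by simp
        moreover have "ld v = y" using v by simp
        ultimately show ?thesis unfolding gi[OF i(1) i'] by simp
      qed
      then show "v \<in> ?R" using v by (auto simp: isotropic_def)
    next
      fix v assume v: "v \<in> ?R"
      then have vi: "v $ i = y $ (i - (k + 2 * l))" if "i < N" "k + 2 * l \<le> i" for i
        using gi[OF that] lev[OF that(1)] that by simp
      have ly: "ld v = y" using vi yc N by (intro eq_vecI) (auto simp: ld_def)
      obtain j where j: "j < k" "y $ j \<noteq> 0" using yc by (auto simp: vec_eq_iff)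
      then have vj: "v $ (k + 2 * l + j) \<noteq> 0" "k + 2 * l + j < N" using vi[of "k + 2 * l + j"] N by auto
      then have "v \<noteq> 0\<^sub>v N" by auto
      moreover have "\<exists>i. k + 2 * l \<le> i \<and> i < N \<and> v $ i \<noteq> 0" using vj by (intro exI[of _ "k + 2 * l + j"]) auto
      ultimately show "v \<in> ?L" using v ly by (simp add: isotropic_def)
    qed
    let ?A = "conjg ?m A" and ?A' = "conjg ?m' ?At"
    have Ac: "?A \<in> carrier_mat k k" by (rule conjg_carrier[OF m(1) A])
    have A'c: "?A' \<in> carrier_mat k k" by (rule conjg_carrier[OF m'(1) At])
    have AA': "?A = transpose_mat ?A'" using conjg_transpose[OF m'(1) At] by simp
    have dA: "defl (k - 1) ?A = transpose_mat (defl (k - 1) ?A')"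
      unfolding AA' using A'c by (intro eq_matI) auto
    \<comment> \<open>Killing the last basis vector is a condition on the first row of
      \<open>?A\<close>, that is, on the first column of its transpose \<open>?A'\<close>.\<close>
    have col: "col (levi_alg k ?A B) (N - 1) = 0\<^sub>v N \<longleftrightarrow> ?At *\<^sub>v dual y = 0\<^sub>v k"
    proof -
      have Dc: "levi_alg k ?A B \<in> carrier_mat N N" unfolding N(1) by (rule uD(1)[OF levi_alg_u[OF Ac B]])
      have ent: "levi_alg k ?A B $$ (i, N - 1) = (if k + 2 * l \<le> i then - ((?A' $$ (N - Suc i, 0)) ^ q) else 0)"
        if i: "i < N" for i
      proof -
        have "?A $$ (0, N - Suc i) = ?A' $$ (N - Suc i, 0)" if "k + 2 * l \<le> i"
          unfolding AA' using that i A'c N k by (intro index_transpose_mat(1)) auto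
        then show ?thesis
          using levi_alg_index[OF Ac uD(1)[OF B] N(1) i last(1)] k N by auto
      qed
      have "col (levi_alg k ?A B) (N - 1) = 0\<^sub>v N \<longleftrightarrow> (\<forall>i<N. levi_alg k ?A B $$ (i, N - 1) = 0)"
        using Dc last(1) by (auto simp: vec_eq_iff)
      also have "\<dots> \<longleftrightarrow> (\<forall>j<k. ?A' $$ (j, 0) = 0)"
      proof
        assume z: "\<forall>i<N. levi_alg k ?A B $$ (i, N - 1) = 0"
        show "\<forall>j<k. ?A' $$ (j, 0) = 0"
        proof (intro allI impI)
          fix j assume j: "j < k"
          have i: "N - Suc j < N" "k + 2 * l \<le> N - Suc j" "N - Suc (N - Suc j) = j" using j N by auto
          have "levi_alg k ?A B $$ (N - Suc j, N - 1) = 0" using z i(1) by blast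
          then show "?A' $$ (j, 0) = 0" unfolding ent[OF i(1)] i(3) using i(2) by simp
        qed
      next
        assume z: "\<forall>j<k. ?A' $$ (j, 0) = 0"
        have "N - Suc i < k" if "i < N" "k + 2 * l \<le> i" for i using that N by auto
        then show "\<forall>i<N. levi_alg k ?A B $$ (i, N - 1) = 0" using ent z by simp
      qed
      also have "\<dots> \<longleftrightarrow> ?A' *\<^sub>v e0 k = 0\<^sub>v k" by (rule mult_e0_zero_iff[OF A'c k, symmetric])
      finally show ?thesis using conjg_vec_zero[OF m'(1) At, of "e0 k"] m'(2) by simp
    qed
    have "(\<Sum>v\<in>{v \<in> ?V. ld v = y}. term_sum v) = (if col (levi_alg k ?A (conjg (1\<^sub>m (2 * l)) B)) (N - 1) = 0\<^sub>v N
        then card (nil k N) * Delta (k - 1) l b (defl (k - 1) ?A) B else 0)"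
      unfolding set
    proof (rule sum_lead_set_levi[where \<iota> = Suc, OF N b_inv last m(1) U_one A B _ _ _ _ _ _ N' _ _ B])
      show "reindex_mat N Suc (levi_alg k ?A (conjg (1\<^sub>m (2 * l)) B)) = levi_alg (k - 1) (defl (k - 1) ?A) B"
        unfolding conjg_one[OF uD(1)[OF B]] by (rule defl_levi_alg[OF k Ac uD(1)[OF B] N(1)])
    qed (use Suc_reindex[OF k N(1)] N k in auto)
    then show "(\<Sum>v\<in>{v \<in> ?V. ld v = y}. term_sum v) = ?H (dual y)"
      unfolding conjg_one[OF uD(1)[OF B]] col dA .
  qed
  also have "\<dots> = (\<Sum>\<eta>\<in>vec_orbit k (GL k). ?H \<eta>)"
    by (rule sum.reindex_bij_witness[of _ dual dual]) (use dual in auto)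
  also have "\<dots> = card (nil k N) * kerGL k (\<lambda>X. Delta (k - 1) l b (transpose_mat X) B) ?At"
    unfolding ker_sum_def sum_distrib_left using fin by (simp add: sum.inter_filter del: One_nat_def)
  \<comment> \<open>Here hyperplanes of W are traded for lines.\<close>
  also have "kerGL k (\<lambda>X. Delta (k - 1) l b (transpose_mat X) B) ?At = kerGL k (\<lambda>A'. Delta (k - 1) l b A' B) A"
  proof (rule kerGL_transpose[OF k A Delta_C_gl])
    have "k - 1 + l = k + l - 1" using k by simp
    then show "b \<in> C_u q (k - 1 + l)" using b by simp
  qed
  finally show ?thesis .
qed

text \<open>The positions inside W and outside W^perp contribute equal amounts, whence the
  coefficient 2. Positions that are impossible for \<open>k = 0\<close> or \<open>l = 0\<close>
  contribute empty sums.\<close>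

lemma sum_isotropic:
  "(\<Sum>v\<in>isotropic N. term_sum v) = card (nil k N) *
    ((if 0 < k then 2 * kerGL k (\<lambda>A'. Delta (k - 1) l b A' B) A else 0) +
     (if 0 < l then kerU (2 * l) (Delta k (l - 1) b A) B else 0))"
proof -
  let ?V0 = "{v \<in> isotropic N. \<forall>i<N. k \<le> i \<longrightarrow> v $ i = 0}"
  let ?V1 = "{v \<in> isotropic N. (\<forall>i<N. k + 2 * l \<le> i \<longrightarrow> v $ i = 0) \<and> (\<exists>i. k \<le> i \<and> i < k + 2 * l \<and> v $ i \<noteq> 0)}"
  let ?V2 = "{v \<in> isotropic N. \<exists>i. k + 2 * l \<le> i \<and> i < N \<and> v $ i \<noteq> 0}"
  have fin: "finite ?V0" "finite ?V1" "finite ?V2" using finite_isotropic by auto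
  have un: "isotropic N = (?V0 \<union> ?V1) \<union> ?V2"
  proof (intro equalityI subsetI)
    fix v assume v: "v \<in> isotropic N"
    show "v \<in> (?V0 \<union> ?V1) \<union> ?V2"
    proof (cases "v \<in> ?V0 \<or> v \<in> ?V2")
      case False
      then have z: "\<forall>i<N. k + 2 * l \<le> i \<longrightarrow> v $ i = 0" using v by auto
      obtain i where i: "i < N" "k \<le> i" "v $ i \<noteq> 0" using False v by auto
      then have "i < k + 2 * l" using z by (meson not_less)
      then show ?thesis using i z v by auto
    qed auto
  qed auto
  have disj: "(?V0 \<union> ?V1) \<inter> ?V2 = {}" by auto
  have disj': "?V0 \<inter> ?V1 = {}"
  proof -
    have "i < N" if "i < k + 2 * l" for i using that N by simp
    then show ?thesis by auto
  qed
  have "(\<Sum>v\<in>isotropic N. term_sum v) = (\<Sum>v\<in>(?V0 \<union> ?V1) \<union> ?V2. term_sum v)"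
    by (rule sum.cong[OF un refl])
  also have "\<dots> = (\<Sum>v\<in>?V0. term_sum v) + (\<Sum>v\<in>?V1. term_sum v) + (\<Sum>v\<in>?V2. term_sum v)"
    unfolding sum.union_disjoint[OF finite_UnI[OF fin(1,2)] fin(3) disj]
      sum.union_disjoint[OF fin(1,2) disj'] by (rule refl)
  finally have "(\<Sum>v\<in>isotropic N. term_sum v) = (\<Sum>v\<in>?V0. term_sum v) + (\<Sum>v\<in>?V1. term_sum v) + (\<Sum>v\<in>?V2. term_sum v)" .
  moreover have "(\<Sum>v\<in>?V1. term_sum v) = card (nil k N) * (if 0 < l then kerU (2 * l) (Delta k (l - 1) b A) B else 0)"
  proof (cases "0 < l")
    case False
    then have e: "?V1 = {}" by auto
    show ?thesis unfolding e using False by simp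
  qed (use sum_isotropic_1 in simp)
  moreover have "(\<Sum>v\<in>?V0. term_sum v) = card (nil k N) * (if 0 < k then kerGL k (\<lambda>A'. Delta (k - 1) l b A' B) A else 0)"
  proof (cases "0 < k")
    case False
    have "v = 0\<^sub>v N" if "v \<in> ?V0" for v using that False by (auto simp: isotropic_def vec_eq_iff)
    then have e: "?V0 = {}" by (auto simp: isotropic_def)
    show ?thesis unfolding e using False by simp
  qed (use sum_isotropic_0 in simp)
  moreover have "(\<Sum>v\<in>?V2. term_sum v) = card (nil k N) * (if 0 < k then kerGL k (\<lambda>A'. Delta (k - 1) l b A' B) A else 0)"
  proof (cases "0 < k")
    case False
    then have e: "?V2 = {}" using N by auto
    show ?thesis unfolding e using False by simp
  qed (use sum_isotropic_2 in simp)
  ultimately show ?thesis by (simp add: distrib_left)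
qed

end

lemma strictly_block_upper_iff:
  assumes "Z \<in> carrier_mat N N" "N = 2 * (k + l)"
  shows "strictly_block_upper [k, 2 * l, k] Z \<longleftrightarrow> strict k N Z"
proof -
  have "strictly_block_upper [k, 2 * l, k] Z \<longleftrightarrow> (\<forall>r<N. \<forall>c<N.
    (c < k \<longrightarrow> Z $$ (r, c) = 0) \<and> (k \<le> r \<and> c < k + 2 * l \<longrightarrow> Z $$ (r, c) = 0) \<and>
    (k + 2 * l \<le> r \<longrightarrow> Z $$ (r, c) = 0))"
    using assms by (auto simp: strictly_block_upper_def less_Suc_eq numeral_3_eq_3)
  also have "\<dots> \<longleftrightarrow> strict k N Z"
    unfolding strict_def
  proof (intro iffI allI impI conjI)
    fix r c assume *: "\<forall>r<N. \<forall>c<N. (c < k \<longrightarrow> Z $$ (r, c) = 0) \<and> (k \<le> r \<and> c < k + 2 * l \<longrightarrow> Z $$ (r, c) = 0) \<and>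
      (k + 2 * l \<le> r \<longrightarrow> Z $$ (r, c) = 0)" and rc: "r < N" "c < N" "lev k N c \<le> lev k N r"
    have "c < k \<or> (k \<le> r \<and> c < k + 2 * l) \<or> k + 2 * l \<le> r"
      using rc assms(2) by (auto simp: lev_def split: if_splits)
    then show "Z $$ (r, c) = 0" using * rc by blast
  next
    fix r c assume *: "\<forall>i<N. \<forall>j<N. lev k N j \<le> lev k N i \<longrightarrow> Z $$ (i, j) = 0" and rc: "r < N" "c < N"
    show "Z $$ (r, c) = 0" if "c < k" using * rc that by (simp add: lev_def)
    show "Z $$ (r, c) = 0" if "k \<le> r \<and> c < k + 2 * l"
    proof -
      have "lev k N c \<le> lev k N r" using that assms(2) by (simp add: lev_def)
      then show ?thesis using * rc by blast
    qed
    show "Z $$ (r, c) = 0" if "k + 2 * l \<le> r"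
    proof -
      have "lev k N c \<le> lev k N r" using that assms(2) by (simp add: lev_def)
      then show ?thesis using * rc by blast
    qed
  qed
  finally show ?thesis .
qed

lemma delta_tilde_Delta: "delta_tilde q b k l A B = Delta k l (b (k + l)) A B"
proof (cases "A \<in> gl k \<and> B \<in> ualg (2 * l)")
  case True
  then have A: "A \<in> carrier_mat k k" and B: "B \<in> ualg (2 * l)" by (auto simp: gl_def)
  let ?N = "2 * (k + l)"
  have n: "{Z \<in> ualg ?N. strictly_block_upper [k, 2 * l, k] Z} = nil k ?N"
    using strictly_block_upper_iff[OF uD(1) refl] by (auto simp: nil_def)
  have c: "- adj k A \<in> carrier_mat k k" by simp
  have e: "four_block_mat (- adj k A) (0\<^sub>m k 0) (0\<^sub>m 0 k) (0\<^sub>m 0 0) = - adj k A"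
    by (rule eq_matI) auto
  have "diag_block_mat [A, B, - (antidiag k * conj_transpose q A * antidiag k)] = levi_alg k A B"
    unfolding adj_conj_transpose[OF A] using A uD(1)[OF B] e by (simp add: levi_alg_def diag2_def Let_def)
  then show ?thesis
    using True unfolding delta_tilde_def Delta_def Let_def n delta_gen_def by simp
qed (auto simp: delta_tilde_def Delta_def)

text \<open>The Mackey formula \<open>\<Delta>(x\<^sub>1 b) = 2 (x\<^sub>1 \<otimes> 1) \<Delta>(b) + (1 \<otimes> x\<^sub>1) \<Delta>(b)\<close>. The isotropic lines on
  which the induction is supported are in three positions relative to the isotropic subspace \<open>W\<close> defining
  the restriction: inside \<open>W\<close>, inside \<open>W\<^sup>\<bottom>\<close> but not \<open>W\<close>, and outside \<open>W\<^sup>\<bottom>\<close>. The last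
  case gives hyperplanes of \<open>W\<close> instead of lines, so it needs the commutativity \<open>kerGL_transpose\<close>.\<close>
lemma mackey:
  fixes b :: "'a graded"
  assumes b: "\<And>n. b n \<in> C_u q n"
  shows "delta_tilde q (nabla_tilde q (tensor x1_tilde b)) k l A B =
    2 * nabla (tensor x1_tilde (\<lambda>i X. delta_tilde q b i l X B)) k A +
    nabla_tilde q (tensor x1_tilde (\<lambda>j Y. delta_tilde q b k j A Y)) l B"
proof -
  \<comment> \<open>Lines are counted over the same field in \<open>nabla\<close> and in
    \<open>nabla_tilde\<close>, so one normalising constant serves all three terms.\<close>
  let ?c = "real (card (UNIV :: 'a set)) - 1" and ?N = "2 * (k + l)"
  let ?b = "b (k + l - 1)"
  have gl: "nabla (tensor x1_tilde (\<lambda>i X. delta_tilde q b i l X B)) k A =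
    (if 0 < k \<and> A \<in> gl k then kerGL k (\<lambda>A'. Delta (k - 1) l ?b A' B) A / ?c else 0)"
  proof -
    have "k - 1 + l = k + l - 1" if "0 < k" using that by simp
    then show ?thesis
      using nabla_x1[of "\<lambda>i X. delta_tilde q b i l X B" k A] Delta_C_gl[OF b]
      unfolding delta_tilde_Delta by (auto simp del: One_nat_def)
  qed
  have un: "nabla_tilde q (tensor x1_tilde (\<lambda>j Y. delta_tilde q b k j A Y)) l B =
    (if 0 < l \<and> B \<in> ualg (2 * l) then kerU (2 * l) (Delta k (l - 1) ?b A) B / ?c else 0)"
  proof -
    have "k + (l - 1) = k + l - 1" if "0 < l" using that by simp
    then show ?thesis
      using nabla_tilde_x1[of "\<lambda>j Y. delta_tilde q b k j A Y" l B] Delta_C_u[OF b]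
      unfolding delta_tilde_Delta by (auto simp del: One_nat_def)
  qed
  consider "A \<notin> gl k" | "A \<in> gl k" "B \<notin> ualg (2 * l)" | "A \<in> gl k" "B \<in> ualg (2 * l)" "k + l = 0"
    | "A \<in> gl k" "B \<in> ualg (2 * l)" "0 < k + l" using neq0_conv[of "k + l"] by blast
  then show ?thesis
  proof cases
    case 1
    then have "Delta k (l - 1) ?b A = (\<lambda>_. 0)" by (auto simp: Delta_def)
    then show ?thesis unfolding gl un unfolding delta_tilde_Delta using 1 by (simp add: Delta_def ker_sum_def)
  next
    case 2
    then have "(\<lambda>A'. Delta (k - 1) l ?b A' B) = (\<lambda>_. 0)" by (auto simp: Delta_def)
    then show ?thesis unfolding gl un unfolding delta_tilde_Delta using 2 by (simp add: Delta_def ker_sum_def del: One_nat_def)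
  next
    case 3
    then show ?thesis unfolding gl un unfolding delta_tilde_Delta
      using nabla_tilde_x1[of b 0, OF b] by (simp add: Delta_def delta_gen_def)
  next
    case 4
    then have A: "A \<in> carrier_mat k k" and B: "B \<in> ualg (2 * l)" and N: "0 < ?N" "even ?N" by (auto simp: gl_def)
    let ?D = "levi_alg k A B"
    have "delta_gen k ?N (nabla_tilde q (tensor x1_tilde b) (k + l)) ?D = delta_gen k ?N (\<lambda>X. kerU ?N ?b X / ?c) ?D"
      unfolding delta_gen_def
    proof (rule sum.cong[OF refl])
      fix Z assume "Z \<in> nil k ?N"
      then have "?D + Z \<in> ualg ?N" using u_add[OF levi_alg_u[OF A B]] nilD(1) by blast
      then show "nabla_tilde q (tensor x1_tilde b) (k + l) (?D + Z) = kerU ?N ?b (?D + Z) / ?c"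
        using nabla_tilde_x1[of b "k + l", OF b] 4(3) by simp
    qed
    also have "\<dots> = (\<Sum>v\<in>isotropic ?N. delta_gen k ?N (\<lambda>X. kerterm ?N ?b X v) ?D) / ?c"
      unfolding delta_gen_def kerU_kerterm[OF N(2,1)] sum_divide_distrib[symmetric]
      by (subst sum.swap) (rule refl)
    also have "\<dots> = card (nil k ?N) *
      ((if 0 < k then 2 * kerGL k (\<lambda>A'. Delta (k - 1) l ?b A' B) A else 0) +
       (if 0 < l then kerU (2 * l) (Delta k (l - 1) ?b A) B else 0)) / ?c"
      by (simp only: sum_isotropic[OF refl N(1) b A B])
    finally show ?thesis
      unfolding gl un unfolding delta_tilde_Delta using 4 card_nil_pos[of k ?N]
      by (simp add: Delta_def add_divide_distrib del: One_nat_def)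
  qed
qed

end

section \<open>Nilpotent elements of parabolic subalgebras\<close>

lemma pow_mat_add:
  fixes A :: "'a::semiring_1 mat"
  assumes "A \<in> carrier_mat n n"
  shows "A ^\<^sub>m (a + b) = A ^\<^sub>m a * A ^\<^sub>m b"
proof (induction b)
  case 0
  then show ?case using assms pow_carrier_mat[OF assms, of a] by simp
next
  case (Suc b)
  have "A ^\<^sub>m (a + Suc b) = A ^\<^sub>m a * A ^\<^sub>m b * A" using Suc by simp
  also have "\<dots> = A ^\<^sub>m a * (A ^\<^sub>m b * A)" by (rule sq_assoc) (use assms in auto)
  finally show ?case by simp
qed

lemma nilpotent_mat_pow_ge:
  fixes A :: "'a::field mat"
  assumes A: "A \<in> carrier_mat n n" and nil: "nilpotent_mat A"
  shows "\<exists>k. \<forall>j\<ge>k. A ^\<^sub>m j = 0\<^sub>m n n"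
proof -
  obtain k where k: "A ^\<^sub>m k = 0\<^sub>m n n" using nil A by (auto simp: nilpotent_mat_def)
  have "A ^\<^sub>m j = 0\<^sub>m n n" if "k \<le> j" for j
  proof -
    have "A ^\<^sub>m j = A ^\<^sub>m k * A ^\<^sub>m (j - k)" using pow_mat_add[OF A, of k "j - k"] that by simp
    then show ?thesis using k left_mult_zero_mat[OF pow_carrier_mat[OF A, of "j - k"]] by simp
  qed
  then show ?thesis by blast
qed

lemma diag2_pow:
  fixes A :: "'a::semiring_1 mat"
  assumes "A \<in> carrier_mat n n" "B \<in> carrier_mat m m"
  shows "diag2 A B ^\<^sub>m k = diag2 (A ^\<^sub>m k) (B ^\<^sub>m k)"
  unfolding diag2_eq[OF assms] diag2_eq[OF pow_carrier_mat[OF assms(1)] pow_carrier_mat[OF assms(2)]]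
  by (rule pow_four_block_mat[OF assms])

lemma uminus_pow_mat:
  fixes A :: "'a::ring_1 mat"
  assumes A: "A \<in> carrier_mat n n"
  shows "(- A) ^\<^sub>m k = A ^\<^sub>m k \<or> (- A) ^\<^sub>m k = - (A ^\<^sub>m k)"
proof (induction k)
  case (Suc k)
  have Ak: "A ^\<^sub>m k \<in> carrier_mat n n" using A by (rule pow_carrier_mat)
  have "A ^\<^sub>m k * (- A) = - (A ^\<^sub>m k * A)" using A Ak by simp
  moreover have "- (A ^\<^sub>m k) * (- A) = A ^\<^sub>m k * A" using A Ak by simp
  ultimately show ?case using Suc by auto
qed (use A in simp)

text \<open>On and below the diagonal blocks, a product of block upper triangular matrices depends
  only on the diagonal blocks of the factors.\<close>

lemma upper_pow_lev:
  fixes Y D :: "'a::semiring_1 mat"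
  assumes Y: "Y \<in> carrier_mat N N" "upper k N Y" and D: "D \<in> carrier_mat N N"
    and lev: "\<And>i j. i < N \<Longrightarrow> j < N \<Longrightarrow> lev k N i \<noteq> lev k N j \<Longrightarrow> D $$ (i, j) = 0"
    and eq: "\<And>i j. i < N \<Longrightarrow> j < N \<Longrightarrow> lev k N j \<le> lev k N i \<Longrightarrow> Y $$ (i, j) = D $$ (i, j)"
  shows "upper k N (Y ^\<^sub>m e) \<and> (\<forall>i<N. \<forall>j<N. lev k N j \<le> lev k N i \<longrightarrow> (Y ^\<^sub>m e) $$ (i, j) = (D ^\<^sub>m e) $$ (i, j))"
proof (induction e)
  case 0
  then show ?case using Y(1) D by (auto simp: upper_def)
next
  case (Suc e)
  have Ye: "Y ^\<^sub>m e \<in> carrier_mat N N" "D ^\<^sub>m e \<in> carrier_mat N N" using Y(1) D by auto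
  have up: "upper k N (Y ^\<^sub>m e)" using Suc by blast
  have "(Y ^\<^sub>m Suc e) $$ (i, j) = (D ^\<^sub>m Suc e) $$ (i, j)" if ij: "i < N" "j < N" "lev k N j \<le> lev k N i" for i j
  proof -
    have "(Y ^\<^sub>m Suc e) $$ (i, j) = (\<Sum>r<N. (Y ^\<^sub>m e) $$ (i, r) * Y $$ (r, j))"
      using mult_index_sum[OF Ye(1) Y(1) ij(1,2)] by simp
    also have "\<dots> = (\<Sum>r<N. (D ^\<^sub>m e) $$ (i, r) * D $$ (r, j))"
    proof (rule sum.cong[OF refl])
      fix r assume "r \<in> {..<N}"
      then have r: "r < N" by simp
      consider "lev k N r < lev k N i" | "lev k N j < lev k N r" | "lev k N r = lev k N i" "lev k N r = lev k N j"
        using ij(3) by linarith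
      then show "(Y ^\<^sub>m e) $$ (i, r) * Y $$ (r, j) = (D ^\<^sub>m e) $$ (i, r) * D $$ (r, j)"
      proof cases
        case 1
        then have "(Y ^\<^sub>m e) $$ (i, r) = 0" using upperD[OF up ij(1) r] by simp
        moreover have "(Y ^\<^sub>m e) $$ (i, r) = (D ^\<^sub>m e) $$ (i, r)" using Suc ij(1) r 1 by simp
        ultimately show ?thesis by simp
      next
        case 2
        then have "Y $$ (r, j) = 0" using upperD[OF Y(2) r ij(2)] by simp
        moreover have "D $$ (r, j) = 0" using lev[OF r ij(2)] 2 by simp
        ultimately show ?thesis by simp
      next
        case 3
        then have "(Y ^\<^sub>m e) $$ (i, r) = (D ^\<^sub>m e) $$ (i, r)" using Suc ij(1) r by simp
        moreover have "Y $$ (r, j) = D $$ (r, j)" using eq[OF r ij(2)] 3 by simp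
        ultimately show ?thesis by simp
      qed
    qed
    also have "\<dots> = (D ^\<^sub>m Suc e) $$ (i, j)" using mult_index_sum[OF Ye(2) D ij(1,2)] by simp
    finally show ?thesis .
  qed
  moreover have "upper k N (Y ^\<^sub>m Suc e)" using upper_mult[OF Ye(1) up Y] by simp
  ultimately show ?case by blast
qed

context hermitian
begin

lemma adj_pow:
  assumes A: "A \<in> carrier_mat k k"
  shows "adj k A ^\<^sub>m e = adj k (A ^\<^sub>m e)"
proof (induction e)
  case 0
  then show ?case using A adj_one by simp
next
  case (Suc e)
  have Ae: "A ^\<^sub>m e \<in> carrier_mat k k" using A by (rule pow_carrier_mat)
  have "A ^\<^sub>m Suc e = A ^\<^sub>m (1 + e)" by simp
  also have "\<dots> = A * A ^\<^sub>m e" using pow_mat_add[OF A, of 1 e] A by simp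
  finally have "adj k (A ^\<^sub>m Suc e) = adj k (A ^\<^sub>m e) * adj k A" using adj_mult[OF A Ae] by simp
  then show ?case using Suc by simp
qed

text \<open>Some power of the block diagonal part vanishes. The same power of the whole element is
  then strict, and its cube is 0.\<close>

lemma nilpotent_parabolic:
  assumes A: "A \<in> carrier_mat k k" "nilpotent_mat A" and B: "B \<in> ualg (2 * l)" "nilpotent_mat B"
    and Z: "Z \<in> nil k (2 * (k + l))"
  shows "nilpotent_mat (levi_alg k A B + Z)"
proof -
  let ?N = "2 * (k + l)" and ?D = "levi_alg k A B"
  note Bc = uD(1)[OF B(1)] and Zc = nilD(3)[OF Z]
  have Dc: "?D \<in> carrier_mat ?N ?N" by (rule uD(1)[OF levi_alg_u[OF A(1) B(1)]])
  obtain a where a: "\<forall>j\<ge>a. A ^\<^sub>m j = 0\<^sub>m k k" using nilpotent_mat_pow_ge[OF A] by blast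
  obtain b where b: "\<forall>j\<ge>b. B ^\<^sub>m j = 0\<^sub>m (2 * l) (2 * l)" using nilpotent_mat_pow_ge[OF Bc B(2)] by blast
  define e where "e = max a b"
  have Ae: "A ^\<^sub>m e = 0\<^sub>m k k" and Be: "B ^\<^sub>m e = 0\<^sub>m (2 * l) (2 * l)" using a b by (auto simp: e_def)
  have Ce: "(- adj k A) ^\<^sub>m e = 0\<^sub>m k k"
  proof -
    have "adj k (0\<^sub>m k k) = 0\<^sub>m k k" by (rule eq_matI) auto
    then have z: "adj k A ^\<^sub>m e = 0\<^sub>m k k" using adj_pow[OF A(1), of e] Ae by simp
    have "- 0\<^sub>m k k = (0\<^sub>m k k :: 'a mat)" by (rule eq_matI) auto
    then show ?thesis using uminus_pow_mat[OF adj_carrier[of k A], of e] z by auto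
  qed
  have c: "- adj k A \<in> carrier_mat k k" by simp
  have De: "(?D ^\<^sub>m e) $$ (i, j) = 0" if "i < ?N" "j < ?N" for i j
    unfolding levi_alg_def diag2_pow[OF A(1) diag2_carrier[OF Bc c]] diag2_pow[OF Bc c] Ae Be Ce
    by (subst diag3_index[OF zero_carrier_mat zero_carrier_mat zero_carrier_mat that]) (use that in auto)
  let ?Y = "?D + Z"
  have Y: "?Y \<in> carrier_mat ?N ?N" using Dc Zc by simp
  have lev: "?D $$ (i, j) = 0" if "i < ?N" "j < ?N" "lev k ?N i \<noteq> lev k ?N j" for i j
    by (rule levi_alg_lev[OF A(1) Bc that])
  have up: "upper k ?N ?Y"
    unfolding upper_def
  proof (intro allI impI)
    fix i j assume ij: "i < ?N" "j < ?N" "lev k ?N j < lev k ?N i"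
    then have "?D $$ (i, j) = 0" "Z $$ (i, j) = 0" using lev strictD[OF nilD(2)[OF Z]] by auto
    then show "?Y $$ (i, j) = 0" using ij Dc Zc by simp
  qed
  have eq: "?Y $$ (i, j) = ?D $$ (i, j)" if "i < ?N" "j < ?N" "lev k ?N j \<le> lev k ?N i" for i j
    using strictD[OF nilD(2)[OF Z] that] that Dc Zc by simp
  have Ye: "?Y ^\<^sub>m e \<in> carrier_mat ?N ?N" using Y by (rule pow_carrier_mat)
  have "strict k ?N (?Y ^\<^sub>m e)"
    using upper_pow_lev[OF Y up Dc lev eq, of e] De by (auto simp: strict_def)
  from strict_cube[OF Ye this] have "?Y ^\<^sub>m (e + e + e) = 0\<^sub>m ?N ?N"
    by (simp add: pow_mat_add[OF Y])
  moreover have "dim_row ?Y = ?N" using Y by (rule carrier_matD(1))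
  ultimately show ?thesis unfolding nilpotent_mat_def by metis
qed

end

section \<open>Functionals on graded spaces of invariant functions\<close>

lemma linear_functional_zero:
  assumes "linear_functional_on V \<phi>" "a \<in> V"
  shows "\<phi> (\<lambda>n X. 0) = 0"
  using conjunct2[OF assms(1)[unfolded linear_functional_on_def], rule_format, OF assms(2), of 0] by simp

lemma orbit_partition:
  assumes G: "mat_group n G" and L: "L \<subseteq> carrier_mat n n" and X: "X \<in> L" and Y: "Y \<in> orbit G X"
  shows "orbit G Y = orbit G X"
proof -
  note GD = mat_groupD[OF G]
  have Xc: "X \<in> carrier_mat n n" using X L by auto
  have o: "orbit G W = {conjg g W | g. g \<in> G}" for W
  proof (intro equalityI subsetI)
    fix V assume "V \<in> orbit G W"
    then obtain g where "g \<in> G" "V = g * W * minv g" by (auto simp: orbit_def)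
    then have "V = conjg (minv g) W" "minv g \<in> G"
      using GD(4) GL_minv(5)[OF GD(1)] by (simp_all add: conjg_def)
    then show "V \<in> {conjg g W | g. g \<in> G}" by blast
  next
    fix V assume "V \<in> {conjg g W | g. g \<in> G}"
    then obtain g where g: "g \<in> G" "V = conjg g W" by blast
    then have "V = minv g * W * minv (minv g)" using GL_minv(5)[OF GD(1)] by (simp add: conjg_def)
    then show "V \<in> orbit G W" using GD(4)[OF g(1)] by (auto simp: orbit_def)
  qed
  obtain g where g: "g \<in> G" "Y = conjg g X" using Y unfolding o by blast
  have gl: "g \<in> GL n" using GD g by auto
  show ?thesis
  proof (intro equalityI subsetI)
    fix V assume "V \<in> orbit G Y"
    then obtain h where h: "h \<in> G" "V = conjg h Y" unfolding o by blast
    then have "V = conjg (g * h) X" using conjg_mult[OF gl GD(1)[OF h(1)] Xc] g by simp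
    then show "V \<in> orbit G X" unfolding o using GD(3)[OF g(1) h(1)] by blast
  next
    fix V assume "V \<in> orbit G X"
    then obtain h where h: "h \<in> G" "V = conjg h X" unfolding o by blast
    have "X = conjg (minv g) Y" using conjg_inverse(2)[OF gl Xc] g by simp
    then have "V = conjg (minv g * h) Y"
      using conjg_mult[OF GL_minv(4)[OF gl] GD(1)[OF h(1)], of Y] conjg_carrier[OF gl Xc] g h by simp
    then show "V \<in> orbit G Y" unfolding o using GD(3)[OF GD(4)[OF g(1)] h(1)] by blast
  qed
qed

definition conj_stable :: "nat \<Rightarrow> 'a::field mat set \<Rightarrow> 'a mat set \<Rightarrow> bool" where
  "conj_stable n G L \<longleftrightarrow> mat_group n G \<and> L \<subseteq> carrier_mat n n \<and> (\<forall>g\<in>G. \<forall>X\<in>L. conjg g X \<in> L)"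

definition orbits :: "'a::field mat set \<Rightarrow> 'a mat set \<Rightarrow> 'a mat set set" where
  "orbits G L = orbit G ` L"

definition rep :: "'a mat set \<Rightarrow> 'a mat" where
  "rep S = (SOME X. X \<in> S)"

lemma conj_stable_orbit:
  assumes "conj_stable n G L" "X \<in> L"
  shows "X \<in> orbit G X" "orbit G X \<subseteq> L"
proof -
  have G: "mat_group n G" and L: "L \<subseteq> carrier_mat n n" and c: "\<And>g X. g \<in> G \<Longrightarrow> X \<in> L \<Longrightarrow> conjg g X \<in> L"
    using assms by (auto simp: conj_stable_def)
  have "X = 1\<^sub>m n * X * minv (1\<^sub>m n)" using assms(2) L by (auto simp: GL_one)
  then show "X \<in> orbit G X" using mat_groupD(2)[OF G] by (auto simp: orbit_def)
  show "orbit G X \<subseteq> L"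
  proof
    fix V assume "V \<in> orbit G X"
    then obtain g where g: "g \<in> G" "V = g * X * minv g" by (auto simp: orbit_def)
    then have "V = conjg (minv g) X" using GL_minv(5)[OF mat_groupD(1)[OF G g(1)]] by (simp add: conjg_def)
    then show "V \<in> L" using c[OF mat_groupD(4)[OF G g(1)] assms(2)] by simp
  qed
qed

lemma rep_orbit:
  assumes "conj_stable n G L" "S \<in> orbits G L"
  shows "rep S \<in> S" "rep S \<in> L" "S = orbit G (rep S)"
proof -
  obtain X where X: "X \<in> L" "S = orbit G X" using assms(2) by (auto simp: orbits_def)
  have "X \<in> S" using conj_stable_orbit(1)[OF assms(1) X(1)] X(2) by simp
  then show r: "rep S \<in> S" unfolding rep_def by (rule someI)
  then show "rep S \<in> L" using conj_stable_orbit(2)[OF assms(1) X(1)] X(2) by auto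
  show "S = orbit G (rep S)"
    using orbit_partition[of n G L X "rep S"] assms(1) X r by (simp add: conj_stable_def)
qed

lemma indicator_orbit_invariant:
  assumes "conj_stable n G L" "X \<in> L"
  shows "indicator (orbit G X) \<in> invariant_funs G L"
proof -
  have G: "mat_group n G" and L: "L \<subseteq> carrier_mat n n" and c: "\<And>g X. g \<in> G \<Longrightarrow> X \<in> L \<Longrightarrow> conjg g X \<in> L"
    using assms by (auto simp: conj_stable_def)
  have "g * Y * minv g \<in> orbit G X \<longleftrightarrow> Y \<in> orbit G X" if g: "g \<in> G" and Y: "Y \<in> L" for g Y
  proof -
    have gY: "g * Y * minv g \<in> orbit G Y" using g by (auto simp: orbit_def)
    have "g * Y * minv g \<in> L" using conj_stable_orbit(2)[OF assms(1) Y] gY by auto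
    then show ?thesis
      using orbit_partition[OF G L Y gY] orbit_partition[OF G L assms(2)] conj_stable_orbit(1)[OF assms(1)] Y
      by metis
  qed
  moreover have "Y \<notin> orbit G X" if "Y \<notin> L" for Y using conj_stable_orbit(2)[OF assms] that by auto
  ultimately show ?thesis by (auto simp: invariant_funs_def indicator_def)
qed

text \<open>Orbits partition \<open>L\<close> and an invariant function is constant on each of them;
  outside \<open>L\<close> both sides are 0.\<close>

lemma invariant_funs_decomp:
  assumes cs: "conj_stable n G L" and fin: "finite L" and f: "f \<in> invariant_funs G L"
  shows "f X = (\<Sum>S\<in>orbits G L. f (rep S) * indicator S X)"
proof -
  have G: "mat_group n G" and L: "L \<subseteq> carrier_mat n n" using cs by (auto simp: conj_stable_def)
  have fo: "finite (orbits G L)" using fin by (simp add: orbits_def)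
  show ?thesis
  proof (cases "X \<in> L")
    case False
    have "X \<notin> S" if "S \<in> orbits G L" for S using that False conj_stable_orbit(2)[OF cs] by (auto simp: orbits_def)
    then show ?thesis using f False by (simp add: invariant_funs_def)
  next
    case True
    have X: "X \<in> orbit G X" "orbit G X \<in> orbits G L" using conj_stable_orbit(1)[OF cs True] True by (auto simp: orbits_def)
    have eq: "S = orbit G X" if "S \<in> orbits G L" "X \<in> S" for S
    proof -
      obtain Y where Y: "Y \<in> L" "S = orbit G Y" using \<open>S \<in> orbits G L\<close> by (auto simp: orbits_def)
      then show ?thesis using orbit_partition[OF G L Y(1), of X] that by simp
    qed
    have "(\<Sum>S\<in>orbits G L. f (rep S) * indicator S X) = (\<Sum>S\<in>{orbit G X}. f (rep S) * indicator S X)"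
    proof (rule sum.mono_neutral_right[OF fo])
      show "\<forall>S\<in>orbits G L - {orbit G X}. f (rep S) * indicator S X = 0"
      proof
        fix S assume "S \<in> orbits G L - {orbit G X}"
        then have "X \<notin> S" using eq[of S] by blast
        then show "f (rep S) * indicator S X = 0" by simp
      qed
    qed (use X(2) in simp)
    also have "\<dots> = f (rep (orbit G X))" using X by simp
    also have "\<dots> = f X"
    proof -
      obtain g where "g \<in> G" "rep (orbit G X) = g * X * minv g"
        using rep_orbit(1)[OF cs X(2)] by (auto simp: orbit_def)
      then show ?thesis using f True by (simp add: invariant_funs_def)
    qed
    finally show ?thesis by simp
  qed
qed

lemma direct_sum_cmult:
  assumes C: "\<And>n. \<exists>G L. C n = invariant_funs G L" and a: "a \<in> Defs.direct_sum C"
  shows "(\<lambda>n X. c * a n X) \<in> Defs.direct_sum C"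
  using direct_sum_lincomb[OF C a a, where c = "\<lambda>_. c" and d = "\<lambda>_. 0"] by simp

lemma direct_sum_add:
  assumes C: "\<And>n. \<exists>G L. C n = invariant_funs G L" and "a \<in> Defs.direct_sum C" "b \<in> Defs.direct_sum C"
  shows "(\<lambda>n X. a n X + b n X) \<in> Defs.direct_sum C"
  using direct_sum_lincomb[OF C assms(2,3), where c = "\<lambda>_. 1" and d = "\<lambda>_. 1"] by simp

lemma direct_sum_zero:
  assumes C: "\<And>n. \<exists>G L. C n = invariant_funs G L"
  shows "(\<lambda>n X. 0) \<in> Defs.direct_sum C"
  using C invariant_funs_zero by (fastforce simp: Defs.direct_sum_def)

lemma linear_functional_sum:
  assumes C: "\<And>n. \<exists>G L. C n = invariant_funs G L" and \<phi>: "linear_functional_on (Defs.direct_sum C) \<phi>"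
    and fin: "finite I" and a: "\<And>i. i \<in> I \<Longrightarrow> a i \<in> Defs.direct_sum C"
  shows "(\<lambda>n X. \<Sum>i\<in>I. c i * a i n X) \<in> Defs.direct_sum C"
    "\<phi> (\<lambda>n X. \<Sum>i\<in>I. c i * a i n X) = (\<Sum>i\<in>I. c i * \<phi> (a i))"
proof -
  have "(\<lambda>n X. \<Sum>i\<in>I. c i * a i n X) \<in> Defs.direct_sum C \<and>
    \<phi> (\<lambda>n X. \<Sum>i\<in>I. c i * a i n X) = (\<Sum>i\<in>I. c i * \<phi> (a i))"
    using fin a
  proof (induction I rule: finite_induct)
    case empty
    then show ?case using direct_sum_zero[OF C] linear_functional_zero[OF \<phi> direct_sum_zero[OF C]] by simp
  next
    case (insert i I)
    have IH: "(\<lambda>n X. \<Sum>i\<in>I. c i * a i n X) \<in> Defs.direct_sum C"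
      "\<phi> (\<lambda>n X. \<Sum>i\<in>I. c i * a i n X) = (\<Sum>i\<in>I. c i * \<phi> (a i))" using insert by auto
    have ai: "a i \<in> Defs.direct_sum C" by (rule insert.prems) simp
    have ca: "(\<lambda>n X. c i * a i n X) \<in> Defs.direct_sum C" by (rule direct_sum_cmult[OF C ai])
    have "\<phi> (\<lambda>n X. c i * a i n X + (\<Sum>i\<in>I. c i * a i n X)) = \<phi> (\<lambda>n X. c i * a i n X) + \<phi> (\<lambda>n X. \<Sum>i\<in>I. c i * a i n X)"
      using \<phi> ca IH(1) by (simp add: linear_functional_on_def)
    moreover have "\<phi> (\<lambda>n X. c i * a i n X) = c i * \<phi> (a i)"
      using \<phi> ai by (simp add: linear_functional_on_def)
    moreover have "(\<lambda>n X. c i * a i n X + (\<Sum>i\<in>I. c i * a i n X)) \<in> Defs.direct_sum C"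
      by (rule direct_sum_add[OF C ca IH(1)])
    ultimately show ?case using insert.hyps IH(2) by simp
  qed
  then show "(\<lambda>n X. \<Sum>i\<in>I. c i * a i n X) \<in> Defs.direct_sum C"
    "\<phi> (\<lambda>n X. \<Sum>i\<in>I. c i * a i n X) = (\<Sum>i\<in>I. c i * \<phi> (a i))" by auto
qed

text \<open>The orbit indicators span the graded space. The cones prescribe signs and zeros only on
  them; this formula transfers such information to arbitrary elements.\<close>

lemma linear_functional_decomp:
  assumes cs: "\<And>n. conj_stable (d n) (G n) (L n)" and fin: "\<And>n. finite (L n)"
    and \<phi>: "linear_functional_on (Defs.direct_sum (\<lambda>n. invariant_funs (G n) (L n))) \<phi>"
    and a: "a \<in> Defs.direct_sum (\<lambda>n. invariant_funs (G n) (L n))"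
  shows "\<phi> a = (\<Sum>(n, S)\<in>(SIGMA n:{n. a n \<noteq> (\<lambda>_. 0)}. orbits (G n) (L n)).
    a n (rep S) * \<phi> (in_degree n (indicator S)))"
proof -
  let ?C = "\<lambda>n. invariant_funs (G n) (L n)" and ?I = "SIGMA n:{n. a n \<noteq> (\<lambda>_. 0)}. orbits (G n) (L n)"
  have C: "\<exists>G' L'. ?C n = invariant_funs G' L'" for n by blast
  have fs: "finite {n. a n \<noteq> (\<lambda>_. 0)}" and an: "\<And>n. a n \<in> ?C n" using a by (auto simp: Defs.direct_sum_def)
  have fo: "finite (orbits (G n) (L n))" for n using fin by (simp add: orbits_def)
  have fI: "finite ?I" using fs fo by auto
  have m: "in_degree (fst p) (indicator (snd p)) \<in> Defs.direct_sum ?C" if pI: "p \<in> ?I" for p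
  proof -
    obtain n S where p: "p = (n, S)" "S \<in> orbits (G n) (L n)" using pI by (cases p) auto
    have "indicator S \<in> ?C n"
      by (subst rep_orbit(3)[OF cs p(2)]) (rule indicator_orbit_invariant[OF cs rep_orbit(2)[OF cs p(2)]])
    then show ?thesis using in_degree_direct_sum[OF C] p by simp
  qed
  have "a = (\<lambda>k X. \<Sum>p\<in>?I. (a (fst p) (rep (snd p))) * in_degree (fst p) (indicator (snd p)) k X)"
  proof (intro ext)
    fix k X
    have "(\<Sum>p\<in>?I. (a (fst p) (rep (snd p))) * in_degree (fst p) (indicator (snd p)) k X) =
      (\<Sum>n\<in>{n. a n \<noteq> (\<lambda>_. 0)}. \<Sum>S\<in>orbits (G n) (L n). a n (rep S) * in_degree n (indicator S) k X)"
      using fs fo by (subst sum.Sigma) (auto simp: case_prod_beta)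
    also have "\<dots> = (\<Sum>n\<in>{n. a n \<noteq> (\<lambda>_. 0)}. if n = k then a k X else 0)"
    proof (rule sum.cong[OF refl])
      fix n
      show "(\<Sum>S\<in>orbits (G n) (L n). a n (rep S) * in_degree n (indicator S) k X) = (if n = k then a k X else 0)"
        using invariant_funs_decomp[OF cs fin an, of n X] by (auto simp: in_degree_def)
    qed
    also have "\<dots> = a k X" using fs by auto
    finally show "a k X = (\<Sum>p\<in>?I. (a (fst p) (rep (snd p))) * in_degree (fst p) (indicator (snd p)) k X)" by simp
  qed
  then have "\<phi> a = \<phi> (\<lambda>k X. \<Sum>p\<in>?I. (a (fst p) (rep (snd p))) * in_degree (fst p) (indicator (snd p)) k X)"
    by (rule arg_cong)
  also have "\<dots> = (\<Sum>p\<in>?I. a (fst p) (rep (snd p)) * \<phi> (in_degree (fst p) (indicator (snd p))))"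
    by (rule linear_functional_sum(2)[OF C \<phi> fI m])
  finally show ?thesis by (simp add: case_prod_beta)
qed

lemma indicator_orbits_invariant:
  assumes "conj_stable n G L" "S \<in> orbits G L"
  shows "indicator S \<in> invariant_funs G L"
  by (subst rep_orbit(3)[OF assms]) (rule indicator_orbit_invariant[OF assms(1) rep_orbit(2)[OF assms]])

lemma linear_functional_nonneg:
  assumes cs: "\<And>n. conj_stable (d n) (G n) (L n)" and fin: "\<And>n. finite (L n)"
    and \<phi>: "linear_functional_on (Defs.direct_sum (\<lambda>n. invariant_funs (G n) (L n))) \<phi>"
    and a: "a \<in> Defs.direct_sum (\<lambda>n. invariant_funs (G n) (L n))"
    and pos: "\<And>n X. X \<in> L n \<Longrightarrow> 0 \<le> \<phi> (in_degree n (indicator (orbit (G n) X)))"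
    and nonneg: "\<And>n X. 0 \<le> a n X"
  shows "0 \<le> \<phi> a"
  unfolding linear_functional_decomp[OF cs fin \<phi> a]
proof (rule sum_nonneg, clarify)
  fix n S assume S: "S \<in> orbits (G n) (L n)"
  have "0 \<le> \<phi> (in_degree n (indicator S))"
    by (subst rep_orbit(3)[OF cs S]) (rule pos[OF rep_orbit(2)[OF cs S]])
  then show "0 \<le> a n (rep S) * \<phi> (in_degree n (indicator S))" using nonneg by simp
qed

text \<open>Orbits whose representative satisfies \<open>P\<close> are annihilated by the
  coefficient, all others by the functional.\<close>

lemma linear_functional_vanish:
  assumes cs: "\<And>n. conj_stable (d n) (G n) (L n)" and fin: "\<And>n. finite (L n)"
    and \<phi>: "linear_functional_on (Defs.direct_sum (\<lambda>n. invariant_funs (G n) (L n))) \<phi>"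
    and a: "a \<in> Defs.direct_sum (\<lambda>n. invariant_funs (G n) (L n))"
    and \<phi>0: "\<And>n X. X \<in> L n \<Longrightarrow> \<not> P X \<Longrightarrow> \<phi> (in_degree n (indicator (orbit (G n) X))) = 0"
    and a0: "\<And>n X. X \<in> L n \<Longrightarrow> P X \<Longrightarrow> a n X = 0"
  shows "\<phi> a = 0"
  unfolding linear_functional_decomp[OF cs fin \<phi> a]
proof (rule sum.neutral, clarify)
  fix n S assume S: "S \<in> orbits (G n) (L n)"
  show "a n (rep S) * \<phi> (in_degree n (indicator S)) = 0"
  proof (cases "P (rep S)")
    case True
    then show ?thesis using a0[OF rep_orbit(2)[OF cs S]] by simp
  next
    case False
    have "\<phi> (in_degree n (indicator S)) = 0"
      by (subst rep_orbit(3)[OF cs S]) (rule \<phi>0[OF rep_orbit(2)[OF cs S] False])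
    then show ?thesis by simp
  qed
qed

section \<open>Mixing preserves positivity and harmonicity\<close>

lemma conj_stable_GL: "conj_stable n (GL n) (gl n)"
  by (auto simp: conj_stable_def gl_def mat_group_GL conjg_carrier)

lemma finite_gl: "finite (gl n :: 'a::{field,finite} mat set)"
  by (simp add: gl_def finite_carrier_mat)

lemma A_space_eq: "A_space = Defs.direct_sum (\<lambda>n. invariant_funs (GL n) (gl n))"
  by (simp add: A_space_def C_gl_def[abs_def])

lemma invariant_funs_cmult: "f \<in> invariant_funs G L \<Longrightarrow> (\<lambda>X. c * f X) \<in> invariant_funs G L"
  by (simp add: invariant_funs_def)

lemma ker_sum_cmult: "ker_sum n m G (\<lambda>X. c * f X) X = c * ker_sum n m G f X"
  by (simp add: ker_sum_def sum_distrib_left)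

lemma ker_sum_zero: "ker_sum n m G (\<lambda>X. 0) X = 0"
  by (simp add: ker_sum_def)

text \<open>Linearity and harmonicity of functionals are available only on \<open>A_space\<close>,
  so membership must be tracked. Induction raises degrees by one, which keeps the support
  finite.\<close>

lemma nabla_x1_A_space:
  assumes a: "a \<in> A_space"
  shows "nabla (tensor x1_tilde a) \<in> (A_space :: 'a::{field,finite} graded set)"
proof -
  have an: "a n \<in> C_gl n" for n using a by (simp add: A_space_def Defs.direct_sum_def)
  note nab = nabla_x1[of a, OF an]
  have "nabla (tensor x1_tilde a) n \<in> C_gl n" for n
  proof (rule C_glI)
    fix X :: "'a mat" assume "X \<notin> carrier_mat n n"
    then show "nabla (tensor x1_tilde a) n X = 0" by (simp add: nab gl_def)
  next
    fix g X :: "'a mat" assume g: "g \<in> GL n" and X: "X \<in> carrier_mat n n"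
    show "nabla (tensor x1_tilde a) n (conjg g X) = nabla (tensor x1_tilde a) n X"
    proof (cases "0 < n")
      case True
      have "kerGL n (a (n - 1)) (conjg g X) = kerGL n (a (n - 1)) X"
        by (rule descent.ker_sum_conj[OF descent_GL[OF True an] _ g]) (simp add: gl_def X)
      then show ?thesis using X conjg_carrier[OF g X] by (simp add: nab gl_def del: One_nat_def)
    qed (simp add: nab)
  qed
  moreover have "finite {n. nabla (tensor x1_tilde a) n \<noteq> (\<lambda>_. 0)}"
  proof (rule finite_subset)
    show "{n. nabla (tensor x1_tilde a) n \<noteq> (\<lambda>_. 0)} \<subseteq> Suc ` {n. a n \<noteq> (\<lambda>_. 0)}"
    proof
      fix n assume n: "n \<in> {n. nabla (tensor x1_tilde a) n \<noteq> (\<lambda>_. 0)}"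
      then have "0 < n" by (auto simp: nab)
      moreover have "a (n - 1) \<noteq> (\<lambda>_. 0)"
      proof
        assume "a (n - 1) = (\<lambda>_. 0)"
        then have "nabla (tensor x1_tilde a) n = (\<lambda>_. 0)" by (intro ext) (simp add: nab ker_sum_zero del: One_nat_def)
        then show False using n by simp
      qed
      ultimately show "n \<in> Suc ` {n. a n \<noteq> (\<lambda>_. 0)}" by (intro image_eqI[of _ _ "n - 1"]) auto
    qed
    show "finite (Suc ` {n. a n \<noteq> (\<lambda>_. 0)})" using a by (simp add: A_space_def Defs.direct_sum_def)
  qed
  ultimately show ?thesis by (simp add: A_space_def Defs.direct_sum_def)
qed

section \<open>Existence of expansions\<close>

lemma is_expansion_append:
  "is_expansion q t es \<Longrightarrow> is_expansion q u fs \<Longrightarrow>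
    is_expansion q (\<lambda>k l X Y. t k l X Y + u k l X Y) (es @ fs)"
  by (auto simp: is_expansion_def)

text \<open>Expansions of the summands are concatenated. Existence matters because
  \<open>mix_homogeneous\<close> picks its expansion with \<open>SOME\<close>.\<close>

lemma is_expansion_sum:
  assumes "finite I" "\<And>i. i \<in> I \<Longrightarrow> is_expansion q (t i) (e i)"
  shows "\<exists>es. is_expansion q (\<lambda>k l X Y. \<Sum>i\<in>I. t i k l X Y) es \<and>
    expansion_value s \<phi> \<psi> es = (\<Sum>i\<in>I. expansion_value s \<phi> \<psi> (e i))"
  using assms
proof (induction I rule: finite_induct)
  case empty
  show ?case by (intro exI[of _ "[]"]) (simp add: is_expansion_def expansion_value_def)
next
  case (insert i I)
  then obtain es where es: "is_expansion q (\<lambda>k l X Y. \<Sum>i\<in>I. t i k l X Y) es"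
    "expansion_value s \<phi> \<psi> es = (\<Sum>i\<in>I. expansion_value s \<phi> \<psi> (e i))" by auto
  have i: "is_expansion q (t i) (e i)" by (rule insert.prems) simp
  have "is_expansion q (\<lambda>k l X Y. t i k l X Y + (\<Sum>i\<in>I. t i k l X Y)) (e i @ es)"
    by (rule is_expansion_append[OF i es(1)])
  moreover have "expansion_value s \<phi> \<psi> (e i @ es) = expansion_value s \<phi> \<psi> (e i) + expansion_value s \<phi> \<psi> es"
    by (simp add: expansion_value_def)
  ultimately show ?case using insert.hyps es(2) by (intro exI[of _ "e i @ es"]) simp
qed

context hermitian
begin

lemma conj_stable_U: "conj_stable N (U N) (ualg N)"
  using uD(1) conjg_u by (auto simp: conj_stable_def mat_group_U)

lemma B_space_eq: "B_space q = Defs.direct_sum (\<lambda>n. invariant_funs (U (2 * n)) (ualg (2 * n)))"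
  by (simp add: B_space_def C_u_def[abs_def])

lemma B_spaceD:
  assumes "b \<in> B_space q"
  shows "b n \<in> C_u q n" "finite {n. b n \<noteq> (\<lambda>_. 0)}"
  using assms by (simp_all add: B_space_def Defs.direct_sum_def)

lemma nabla_tilde_x1_B_space:
  fixes b :: "'a graded"
  assumes b: "b \<in> B_space q"
  shows "nabla_tilde q (tensor x1_tilde b) \<in> B_space q"
proof -
  note bn = B_spaceD(1)[OF b]
  note nab = nabla_tilde_x1[of b, OF bn]
  have "nabla_tilde q (tensor x1_tilde b) n \<in> C_u q n" for n
  proof (rule C_uI)
    fix X :: "'a mat" assume "X \<notin> ualg (2 * n)"
    then show "nabla_tilde q (tensor x1_tilde b) n X = 0" by (simp add: nab)
  next
    fix g X :: "'a mat" assume g: "g \<in> U (2 * n)" and X: "X \<in> ualg (2 * n)"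
    show "nabla_tilde q (tensor x1_tilde b) n (conjg g X) = nabla_tilde q (tensor x1_tilde b) n X"
    proof (cases "0 < n")
      case True
      have m: "2 * (n - 1) = 2 * n - 2" by simp
      have b': "b (n - 1) \<in> invariant_funs (U (2 * n - 2)) (ualg (2 * n - 2))"
        using bn[of "n - 1"] unfolding C_u_def m .
      have "descent (2 * n) (2 * n - 2) (U (2 * n)) (ualg (2 * n)) (b (n - 1))"
        by (rule descent_U[OF _ _ b']) (use True in simp_all)
      from descent.ker_sum_conj[OF this X g]
      show ?thesis using X conjg_u[OF g X] by (simp add: nab del: One_nat_def)
    qed (simp add: nab)
  qed
  moreover have "finite {n. nabla_tilde q (tensor x1_tilde b) n \<noteq> (\<lambda>_. 0)}"
  proof (rule finite_subset)
    show "{n. nabla_tilde q (tensor x1_tilde b) n \<noteq> (\<lambda>_. 0)} \<subseteq> Suc ` {n. b n \<noteq> (\<lambda>_. 0)}"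
    proof
      fix n assume n: "n \<in> {n. nabla_tilde q (tensor x1_tilde b) n \<noteq> (\<lambda>_. 0)}"
      then have "0 < n" by (auto simp: nab)
      moreover have "b (n - 1) \<noteq> (\<lambda>_. 0)"
      proof
        assume "b (n - 1) = (\<lambda>_. 0)"
        then have "nabla_tilde q (tensor x1_tilde b) n = (\<lambda>_. 0)"
          by (intro ext) (simp add: nab ker_sum_zero del: One_nat_def)
        then show False using n by simp
      qed
      ultimately show "n \<in> Suc ` {n. b n \<noteq> (\<lambda>_. 0)}" by (intro image_eqI[of _ _ "n - 1"]) auto
    qed
    show "finite (Suc ` {n. b n \<noteq> (\<lambda>_. 0)})" using B_spaceD(2)[OF b] by simp
  qed
  ultimately show ?thesis by (simp add: B_space_def Defs.direct_sum_def)
qed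

lemma Delta_zero: "Delta k l (\<lambda>_. 0) A B = 0"
  by (simp add: Delta_def delta_gen_def)

lemma Delta_add: "Delta k l (\<lambda>X. f X + g X) A B = Delta k l f A B + Delta k l g A B"
  by (simp add: Delta_def delta_gen_def sum.distrib add_divide_distrib)

lemma Delta_cmult: "Delta k l (\<lambda>X. c * f X) A B = c * Delta k l f A B"
  by (simp add: Delta_def delta_gen_def sum_distrib_left)

text \<open>A function of two arguments becomes a finite sum of products by decomposing it over the
  orbits in the second argument; the coefficients are invariant functions of the first.\<close>

lemma delta_component_expansion:
  assumes f: "f \<in> C_u q (k + l)"
  shows "\<exists>es. is_expansion q (\<lambda>k' l' X Y. if k' = k \<and> l' = l then Delta k l f X Y else 0) es"
proof -
  let ?O = "orbits (U (2 * l)) (ualg (2 * l))"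
  have "finite ?O" by (simp add: orbits_def finite_u)
  then obtain Ss where Ss: "set Ss = ?O" "distinct Ss" using finite_distinct_list by blast
  let ?es = "map (\<lambda>S. (k, \<lambda>X. Delta k l f X (rep S), l, indicator S)) Ss"
  have v: "(\<Sum>S\<leftarrow>Ss. Delta k l f X (rep S) * indicator S Y) = Delta k l f X Y" for X Y
    using invariant_funs_decomp[OF conj_stable_U finite_u Delta_C_u[OF f, unfolded C_u_def], of X Y]
      sum_list_distinct_conv_sum_set[OF Ss(2)] Ss(1) by simp
  have "indicator S \<in> C_u q l" if "S \<in> ?O" for S
    unfolding C_u_def by (rule indicator_orbits_invariant[OF conj_stable_U that])
  then have "\<forall>(i, f, j, g)\<in>set ?es. f \<in> C_gl i \<and> g \<in> C_u q j"
    using Delta_C_gl[OF f] Ss(1) by auto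
  moreover have "(\<lambda>k' l' X Y. if k' = k \<and> l' = l then Delta k l f X Y else 0) =
    (\<lambda>k' l' X Y. \<Sum>(i, f, j, g)\<leftarrow>?es. tensor (in_degree i f) (in_degree j g) k' l' X Y)"
  proof (intro ext)
    fix k' l' X Y
    show "(if k' = k \<and> l' = l then Delta k l f X Y else 0) =
      (\<Sum>(i, f, j, g)\<leftarrow>?es. tensor (in_degree i f) (in_degree j g) k' l' X Y)"
      by (cases "k' = k"; cases "l' = l") (simp_all add: tensor_def in_degree_def comp_def v)
  qed
  ultimately have "is_expansion q (\<lambda>k' l' X Y. if k' = k \<and> l' = l then Delta k l f X Y else 0) ?es"
    unfolding is_expansion_def by (rule conjI)
  then show ?thesis by blast
qed

lemma delta_tilde_expansion:
  fixes b :: "'a graded"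
  assumes b: "b \<in> B_space q"
  shows "\<exists>es. is_expansion q (delta_tilde q b) es"
proof -
  let ?I = "{p. b (fst p + snd p) \<noteq> (\<lambda>_. 0)}"
  let ?t = "\<lambda>p k l X Y. if k = fst p \<and> l = snd p then Delta (fst p) (snd p) (b (fst p + snd p)) X Y else 0"
  have "?I \<subseteq> (\<Union>n\<in>{n. b n \<noteq> (\<lambda>_. 0)}. {..n} \<times> {..n})"
  proof
    fix p assume "p \<in> ?I"
    then show "p \<in> (\<Union>n\<in>{n. b n \<noteq> (\<lambda>_. 0)}. {..n} \<times> {..n})"
      by (intro UN_I[of "fst p + snd p"]) (auto simp: mem_Times_iff)
  qed
  then have fin: "finite ?I" by (rule finite_subset) (use B_spaceD(2)[OF b] in auto)
  have "\<forall>p. \<exists>es. is_expansion q (?t p) es" using delta_component_expansion[OF B_spaceD(1)[OF b]] by blast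
  then obtain e where "\<forall>p. is_expansion q (?t p) (e p)" by (rule choice[THEN exE])
  then obtain es where es: "is_expansion q (\<lambda>k l X Y. \<Sum>p\<in>?I. ?t p k l X Y) es"
    using is_expansion_sum[OF fin, of q ?t e] by blast
  have "(\<lambda>k l X Y. \<Sum>p\<in>?I. ?t p k l X Y) = delta_tilde q b"
  proof (intro ext)
    fix k l X Y
    have "(\<Sum>p\<in>?I. ?t p k l X Y) = (\<Sum>p\<in>?I. if p = (k, l) then Delta k l (b (k + l)) X Y else 0)"
      by (rule sum.cong) auto
    also have "\<dots> = (if (k, l) \<in> ?I then Delta k l (b (k + l)) X Y else 0)" using fin by (rule sum.delta)
    also have "\<dots> = delta_tilde q b k l X Y" by (simp add: delta_tilde_Delta Delta_zero)
    finally show "(\<Sum>p\<in>?I. ?t p k l X Y) = delta_tilde q b k l X Y" .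
  qed
  with es show ?thesis by metis
qed

text \<open>The argument handed to \<open>\<psi>\<close> when the mixing is written as an iterated
  functional; \<open>r\<close> stands for the weight \<open>1 - 2 * s\<close> per degree of the
  second factor.\<close>

definition slice :: "real \<Rightarrow> 'a graded \<Rightarrow> nat \<Rightarrow> 'a mat \<Rightarrow> 'a graded" where
  "slice r b k X = (\<lambda>l Y. r ^ l * delta_tilde q b k l X Y)"

lemma slice_B_space:
  assumes b: "b \<in> B_space q"
  shows "slice r b k X \<in> B_space q"
proof -
  have "(\<lambda>Y. r ^ l * Delta k l (b (k + l)) X Y) \<in> C_u q l" for l
    using Delta_C_u[OF B_spaceD(1)[OF b]] unfolding C_u_def by (rule invariant_funs_cmult)
  moreover have "finite {l. (\<lambda>Y. r ^ l * Delta k l (b (k + l)) X Y) \<noteq> (\<lambda>_. 0)}"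
  proof (rule finite_subset)
    show "{l. (\<lambda>Y. r ^ l * Delta k l (b (k + l)) X Y) \<noteq> (\<lambda>_. 0)} \<subseteq> (\<lambda>n. n - k) ` {n. b n \<noteq> (\<lambda>_. 0)}"
    proof
      fix l assume l: "l \<in> {l. (\<lambda>Y. r ^ l * Delta k l (b (k + l)) X Y) \<noteq> (\<lambda>_. 0)}"
      have "b (k + l) \<noteq> (\<lambda>_. 0)"
      proof
        assume "b (k + l) = (\<lambda>_. 0)"
        then show False using l by (simp add: Delta_zero)
      qed
      then show "l \<in> (\<lambda>n. n - k) ` {n. b n \<noteq> (\<lambda>_. 0)}" by (intro image_eqI[of _ _ "k + l"]) auto
    qed
  qed (use B_spaceD(2)[OF b] in simp)
  ultimately show ?thesis by (simp add: slice_def delta_tilde_Delta B_space_def Defs.direct_sum_def)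
qed

lemma functional_slice_A_space:
  assumes b: "b \<in> B_space q" and \<psi>: "linear_functional_on (B_space q) \<psi>"
  shows "(\<lambda>k X. \<psi> (slice r b k X)) \<in> A_space"
proof -
  have \<psi>0: "\<psi> (\<lambda>n X. 0) = 0" by (rule linear_functional_zero[OF \<psi> b])
  have "(\<lambda>X. \<psi> (slice r b k X)) \<in> C_gl k" for k
  proof (rule C_glI)
    fix X :: "'a mat" assume "X \<notin> carrier_mat k k"
    then have "slice r b k X = (\<lambda>n X. 0)" by (simp add: slice_def delta_tilde_Delta Delta_def gl_def)
    then show "\<psi> (slice r b k X) = 0" using \<psi>0 by simp
  next
    fix g X :: "'a mat" assume "g \<in> GL k" "X \<in> carrier_mat k k"
    then have "slice r b k (conjg g X) = slice r b k X"
      using C_glD[OF Delta_C_gl[OF B_spaceD(1)[OF b]]] by (simp add: slice_def delta_tilde_Delta)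
    then show "\<psi> (slice r b k (conjg g X)) = \<psi> (slice r b k X)" by simp
  qed
  moreover have "finite {k. (\<lambda>X. \<psi> (slice r b k X)) \<noteq> (\<lambda>_. 0)}"
  proof (rule finite_subset)
    show "{k. (\<lambda>X. \<psi> (slice r b k X)) \<noteq> (\<lambda>_. 0)} \<subseteq> (\<Union>n\<in>{n. b n \<noteq> (\<lambda>_. 0)}. {..n})"
    proof (rule subsetI, rule ccontr)
      fix k assume k: "k \<in> {k. (\<lambda>X. \<psi> (slice r b k X)) \<noteq> (\<lambda>_. 0)}" "k \<notin> (\<Union>n\<in>{n. b n \<noteq> (\<lambda>_. 0)}. {..n})"
      have "b (k + l) = (\<lambda>_. 0)" for l
      proof (rule ccontr)
        assume "b (k + l) \<noteq> (\<lambda>_. 0)"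
        then show False using k(2) le_add1[of k l] by blast
      qed
      then have "slice r b k X = (\<lambda>n X. 0)" for X by (simp add: slice_def delta_tilde_Delta Delta_zero)
      then show False using k(1) \<psi>0 by simp
    qed
  qed (use B_spaceD(2)[OF b] in simp)
  ultimately show ?thesis by (simp add: A_space_def Defs.direct_sum_def)
qed

lemma A_space_weight:
  assumes "a \<in> A_space"
  shows "(\<lambda>k X. s ^ k * a k X) \<in> A_space"
  using direct_sum_lincomb[OF graded_A assms[unfolded A_space_def] assms[unfolded A_space_def],
      where c = "\<lambda>k. s ^ k" and d = "\<lambda>_. 0"] by (simp add: A_space_def)

text \<open>The expansions chosen degree by degree are joined into one expansion of
  \<open>delta_tilde q b\<close>, whose value \<open>expansion_value_eq\<close> expresses without
  reference to the choices. From here on expansions are replaced by the right-hand side.\<close>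

lemma mix_eq:
  fixes b :: "'a graded"
  assumes b: "b \<in> B_space q" and \<phi>: "linear_functional_on A_space \<phi>" and \<psi>: "linear_functional_on (B_space q) \<psi>"
  shows "mix q s \<phi> \<psi> b = \<phi> (\<lambda>k X. s ^ k * \<psi> (slice (1 - 2 * s) b k X))"
proof -
  let ?D = "{n. b n \<noteq> (\<lambda>_. 0)}" and ?t = "\<lambda>n. delta_tilde q (in_degree n (b n))"
  define e where "e n = (SOME es. is_expansion q (?t n) es)" for n
  have D: "finite ?D" by (rule B_spaceD(2)[OF b])
  have "is_expansion q (?t n) (e n)" for n
    unfolding e_def
  proof (rule someI_ex, rule delta_tilde_expansion)
    show "in_degree n (b n) \<in> B_space q"
      unfolding B_space_def using B_spaceD(1)[OF b, of n] by (rule in_degree_direct_sum[OF graded_B])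
  qed
  then obtain es where es: "is_expansion q (\<lambda>k l X Y. \<Sum>n\<in>?D. ?t n k l X Y) es"
    and v: "expansion_value s \<phi> \<psi> es = (\<Sum>n\<in>?D. expansion_value s \<phi> \<psi> (e n))"
    using is_expansion_sum[OF D, of q ?t e s \<phi> \<psi>] by blast
  have "(\<Sum>n\<in>?D. ?t n k l X Y) = delta_tilde q b k l X Y" for k l X Y
  proof -
    have "(\<Sum>n\<in>?D. ?t n k l X Y) = (\<Sum>n\<in>?D. if n = k + l then Delta k l (b (k + l)) X Y else 0)"
      by (rule sum.cong) (auto simp: delta_tilde_Delta in_degree_def Delta_zero)
    also have "\<dots> = (if k + l \<in> ?D then Delta k l (b (k + l)) X Y else 0)" using D by (rule sum.delta)
    also have "\<dots> = delta_tilde q b k l X Y" by (simp add: delta_tilde_Delta Delta_zero)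
    finally show ?thesis .
  qed
  then have "is_expansion q (delta_tilde q b) es" using es by simp
  from expansion_value_eq[OF \<phi> \<psi> this]
  show ?thesis using v by (simp add: mix_def mix_homogeneous_def e_def slice_def)
qed

lemma mix_linear:
  assumes \<phi>: "linear_functional_on A_space \<phi>" and \<psi>: "linear_functional_on (B_space q) \<psi>"
  shows "linear_functional_on (B_space q) (mix q s \<phi> (\<psi> :: 'a graded \<Rightarrow> real))"
proof -
  let ?r = "1 - 2 * s"
  have outer: "(\<lambda>k X. s ^ k * \<psi> (slice ?r b k X)) \<in> A_space" if "b \<in> B_space q" for b
    by (rule A_space_weight[OF functional_slice_A_space[OF that \<psi>]])
  show ?thesis
    unfolding linear_functional_on_def
  proof (intro conjI ballI allI)
    fix a b :: "'a graded" assume a: "a \<in> B_space q" and b: "b \<in> B_space q"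
    have ab: "(\<lambda>n X. a n X + b n X) \<in> B_space q"
      using direct_sum_add[OF graded_B a[unfolded B_space_def] b[unfolded B_space_def]] by (simp add: B_space_def)
    have "slice ?r (\<lambda>n X. a n X + b n X) k X = (\<lambda>l Y. slice ?r a k X l Y + slice ?r b k X l Y)" for k X
      by (simp add: slice_def delta_tilde_Delta Delta_add distrib_left)
    then have "\<psi> (slice ?r (\<lambda>n X. a n X + b n X) k X) = \<psi> (slice ?r a k X) + \<psi> (slice ?r b k X)" for k X
      using \<psi> slice_B_space[OF a] slice_B_space[OF b] by (simp add: linear_functional_on_def)
    then show "mix q s \<phi> \<psi> (\<lambda>n X. a n X + b n X) = mix q s \<phi> \<psi> a + mix q s \<phi> \<psi> b"
      using \<phi> outer[OF a] outer[OF b]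
      by (simp add: mix_eq[OF ab \<phi> \<psi>] mix_eq[OF a \<phi> \<psi>] mix_eq[OF b \<phi> \<psi>] linear_functional_on_def distrib_left)
  next
    fix c and a :: "'a graded" assume a: "a \<in> B_space q"
    have ca: "(\<lambda>n X. c * a n X) \<in> B_space q"
      using direct_sum_cmult[OF graded_B a[unfolded B_space_def]] by (simp add: B_space_def)
    have "slice ?r (\<lambda>n X. c * a n X) k X = (\<lambda>l Y. c * slice ?r a k X l Y)" for k X
      by (simp add: slice_def delta_tilde_Delta Delta_cmult mult.left_commute)
    then have "\<psi> (slice ?r (\<lambda>n X. c * a n X) k X) = c * \<psi> (slice ?r a k X)" for k X
      using \<psi> slice_B_space[OF a] by (simp add: linear_functional_on_def)
    then have "(\<lambda>k X. s ^ k * \<psi> (slice ?r (\<lambda>n X. c * a n X) k X)) = (\<lambda>k X. c * (s ^ k * \<psi> (slice ?r a k X)))"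
      by (simp add: mult.left_commute)
    then show "mix q s \<phi> \<psi> (\<lambda>n X. c * a n X) = c * mix q s \<phi> \<psi> a"
      using \<phi> outer[OF a] by (simp add: mix_eq[OF ca \<phi> \<psi>] mix_eq[OF a \<phi> \<psi>] linear_functional_on_def)
  qed
qed

lemma slice_nonneg:
  assumes "\<And>n X. 0 \<le> b n X" "0 \<le> r"
  shows "0 \<le> slice r b k X l Y"
  using assms by (auto simp: slice_def delta_tilde_Delta Delta_def delta_gen_def intro!: mult_nonneg_nonneg divide_nonneg_nonneg sum_nonneg)

lemma u_orbit_indicator_B_space: "X \<in> ualg (2 * n) \<Longrightarrow> u_orbit_indicator q n X \<in> B_space q"
  unfolding u_orbit_indicator_def B_space_def
  by (rule in_degree_direct_sum[OF graded_B]) (simp add: C_u_def indicator_orbit_invariant[OF conj_stable_U])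

text \<open>Nonnegativity is passed on twice: by \<open>\<psi>\<close> from each slice to its value,
  and by \<open>\<phi>\<close> from the function formed by these values.\<close>

lemma mix_nonneg:
  fixes \<phi> \<psi> :: "'a graded \<Rightarrow> real"
  assumes \<phi>: "\<phi> \<in> F_A" and \<psi>: "\<psi> \<in> F_B q" and s: "0 \<le> s" "s \<le> 1 / 2" and X: "X \<in> ualg (2 * n)"
  shows "0 \<le> mix q s \<phi> \<psi> (u_orbit_indicator q n X)"
proof -
  let ?b = "u_orbit_indicator q n X"
  have \<phi>l: "linear_functional_on A_space \<phi>" and \<psi>l: "linear_functional_on (B_space q) \<psi>"
    using \<phi> \<psi> by (simp_all add: F_A_def F_B_def)
  note b = u_orbit_indicator_B_space[OF X]
  have pos: "0 \<le> ?b m Y" for m Y by (simp add: u_orbit_indicator_def in_degree_def)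
  have "0 \<le> \<psi> (slice (1 - 2 * s) ?b k A)" for k A
  proof (rule linear_functional_nonneg[OF conj_stable_U finite_u \<psi>l[unfolded B_space_eq] slice_B_space[OF b, unfolded B_space_eq]])
    show "0 \<le> \<psi> (in_degree m (indicator (orbit (U (2 * m)) Y)))" if "Y \<in> ualg (2 * m)" for m Y
      using \<psi> that by (simp add: F_B_def u_orbit_indicator_def)
    \<comment> \<open>The bound \<open>s \<le> 1 / 2\<close> enters through the weight
      \<open>1 - 2 * s\<close>.\<close>
    show "0 \<le> slice (1 - 2 * s) ?b k A m Y" for m Y by (rule slice_nonneg) (use pos s in auto)
  qed
  then have "0 \<le> s ^ k * \<psi> (slice (1 - 2 * s) ?b k A)" for k A using s by simp
  note nn = this
  show ?thesis
    unfolding mix_eq[OF b \<phi>l \<psi>l]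
  proof (rule linear_functional_nonneg[OF conj_stable_GL finite_gl \<phi>l[unfolded A_space_eq]
        A_space_weight[OF functional_slice_A_space[OF b \<psi>l], unfolded A_space_eq] _ nn])
    show "0 \<le> \<phi> (in_degree m (indicator (orbit (GL m) Y)))" if "Y \<in> gl m" for m Y
      using \<phi> that by (simp add: F_A_def gl_orbit_indicator_def)
  qed
qed

text \<open>If both Levi components are nilpotent, every element summed over is nilpotent and misses
  the orbit of \<open>X\<close>.\<close>

lemma Delta_not_nilpotent:
  assumes X: "X \<in> ualg (2 * (k + l))" "\<not> nilpotent_mat X" and A: "nilpotent_mat A" and B: "nilpotent_mat B"
  shows "Delta k l (indicator (orbit (U (2 * (k + l))) X)) A B = 0"
proof (cases "A \<in> gl k \<and> B \<in> ualg (2 * l)")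
  case True
  then have Ac: "A \<in> carrier_mat k k" and Bc: "B \<in> ualg (2 * l)" by (auto simp: gl_def)
  let ?N = "2 * (k + l)"
  have "levi_alg k A B + Z \<notin> orbit (U ?N) X" if Z: "Z \<in> nil k ?N" for Z
  proof
    assume "levi_alg k A B + Z \<in> orbit (U ?N) X"
    then obtain g where g: "g \<in> U ?N" "levi_alg k A B + Z = g * X * minv g" by (auto simp: orbit_def)
    note gl = U_D(1)[OF g(1)]
    have Xc: "X \<in> carrier_mat ?N ?N" by (rule uD(1)[OF X(1)])
    have e: "levi_alg k A B + Z = conjg (minv g) X" using g(2) GL_minv(5)[OF gl] by (simp add: conjg_def)
    have c: "conjg (minv g) X \<in> carrier_mat ?N ?N" by (rule conjg_carrier[OF GL_minv(4)[OF gl] Xc])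
    have "nilpotent_mat (conjg (minv g) X)" using nilpotent_parabolic[OF Ac A Bc B Z] e by simp
    from nilpotent_similar[OF c conjg_similar[OF Xc GL_minv(4)[OF gl]] this] show False using X(2) by simp
  qed
  then show ?thesis by (simp add: Delta_def delta_gen_def del: mult_Suc_right distrib_left_numeral)
qed (auto simp: Delta_def)

text \<open>For nilpotent \<open>A\<close> the slice vanishes at nilpotent points, and
  \<open>\<psi>\<close> vanishes on the remaining orbits. Hence the outer function vanishes at
  nilpotent points, and the same argument applies to \<open>\<phi>\<close>.\<close>

lemma mix_vanish:
  fixes \<phi> \<psi> :: "'a graded \<Rightarrow> real"
  assumes \<phi>: "\<phi> \<in> F0_A" and \<psi>: "\<psi> \<in> F0_B q" and X: "X \<in> ualg (2 * n)" "\<not> nilpotent_mat X"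
  shows "mix q s \<phi> \<psi> (u_orbit_indicator q n X) = 0"
proof -
  let ?b = "u_orbit_indicator q n X"
  have \<phi>l: "linear_functional_on A_space \<phi>" and \<psi>l: "linear_functional_on (B_space q) \<psi>"
    using \<phi> \<psi> by (simp_all add: F_A_def F_B_def F0_A_def F0_B_def)
  note b = u_orbit_indicator_B_space[OF X(1)]
  have 0: "\<psi> (slice (1 - 2 * s) ?b k A) = 0" if A: "nilpotent_mat A" for k A
  proof (rule linear_functional_vanish[OF conj_stable_U finite_u \<psi>l[unfolded B_space_eq]
        slice_B_space[OF b, unfolded B_space_eq], where P = nilpotent_mat])
    show "\<psi> (in_degree m (indicator (orbit (U (2 * m)) Y))) = 0" if "Y \<in> ualg (2 * m)" "\<not> nilpotent_mat Y" for m Y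
      using \<psi> that by (simp add: F0_B_def u_orbit_indicator_def)
    show "slice (1 - 2 * s) ?b k A l B = 0" if B: "nilpotent_mat B" for l B
    proof (cases "n = k + l")
      case True
      then show ?thesis using Delta_not_nilpotent[of X k l A B] X A B
        by (simp add: slice_def delta_tilde_Delta u_orbit_indicator_def in_degree_def)
    qed (simp add: slice_def delta_tilde_Delta u_orbit_indicator_def in_degree_def Delta_zero)
  qed
  show ?thesis
    unfolding mix_eq[OF b \<phi>l \<psi>l]
  proof (rule linear_functional_vanish[OF conj_stable_GL finite_gl \<phi>l[unfolded A_space_eq]
        A_space_weight[OF functional_slice_A_space[OF b \<psi>l], unfolded A_space_eq], where P = nilpotent_mat])
    show "\<phi> (in_degree m (indicator (orbit (GL m) Y))) = 0" if "Y \<in> gl m" "\<not> nilpotent_mat Y" for m Y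
      using \<phi> that by (simp add: F0_A_def gl_orbit_indicator_def)
    show "s ^ m * \<psi> (slice (1 - 2 * s) ?b m Y) = 0" if "nilpotent_mat Y" for m Y using 0[OF that] by simp
  qed
qed

text \<open>Induction in the first argument is a finite linear combination of evaluations at points
  that do not depend on the second argument, so the linear \<open>\<psi>\<close> passes through
  it.\<close>

lemma functional_slice_nabla:
  assumes b: "b \<in> B_space q" and \<psi>: "linear_functional_on (B_space q) \<psi>"
  shows "(\<lambda>l Y. r ^ l * nabla (tensor x1_tilde (\<lambda>i X. delta_tilde q b i l X Y)) k A) \<in> B_space q" (is "?N \<in> _")
    "\<psi> (\<lambda>l Y. r ^ l * nabla (tensor x1_tilde (\<lambda>i X. delta_tilde q b i l X Y)) k A) =
      nabla (tensor x1_tilde (\<lambda>i X. \<psi> (slice r b i X))) k A"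
proof -
  let ?P = "\<lambda>i X. \<psi> (slice r b i X)" and ?c = "real (card (UNIV :: 'a set)) - 1"
  have P: "?P i \<in> C_gl i" for i
    using functional_slice_A_space[OF b \<psi>, of r] by (simp add: A_space_def Defs.direct_sum_def)
  have dl: "(\<lambda>X. delta_tilde q b i l X Y) \<in> C_gl i" for i l Y
    using Delta_C_gl[OF B_spaceD(1)[OF b]] by (simp add: delta_tilde_Delta)
  note nab = nabla_x1[of "\<lambda>i X. delta_tilde q b i l X Y" k A for l Y, OF dl] nabla_x1[of ?P k A, OF P]
  have "?N \<in> B_space q \<and> \<psi> ?N = nabla (tensor x1_tilde ?P) k A"
  proof (cases "0 < k \<and> A \<in> gl k")
    case True
    let ?K = "{v \<in> vec_orbit k (GL k). A *\<^sub>v v = 0\<^sub>v k}"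
    let ?X = "\<lambda>v. defl (k - 1) (conjg (frame k (GL k) v) A)"
    have K: "finite ?K" by (simp add: vec_orbit_def mat_group_finite[OF mat_group_GL])
    have N: "?N = (\<lambda>l Y. \<Sum>v\<in>?K. (1 / ?c) * slice r b (k - 1) (?X v) l Y)"
      using True by (intro ext) (simp add: nab ker_sum_def slice_def sum_distrib_left sum_divide_distrib mult.commute del: One_nat_def)
    have C: "\<exists>G L. C_u q n = invariant_funs G L" for n by (rule graded_B)
    note ls = linear_functional_sum[where c = "\<lambda>_. 1 / ?c",
        OF C \<psi>[unfolded B_space_def] K slice_B_space[OF b, unfolded B_space_def]]
    have "?N \<in> B_space q" unfolding N B_space_def by (rule ls(1))
    moreover have "\<psi> ?N = (\<Sum>v\<in>?K. (1 / ?c) * \<psi> (slice r b (k - 1) (?X v)))" unfolding N by (rule ls(2))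
    moreover have "\<dots> = nabla (tensor x1_tilde ?P) k A"
      using True by (simp add: nab ker_sum_def sum_divide_distrib del: One_nat_def)
    ultimately show ?thesis by simp
  next
    case False
    then have N: "?N = (\<lambda>l Y. 0)" and z: "nabla (tensor x1_tilde ?P) k A = 0" by (auto simp: nab)
    have "(\<lambda>l Y. 0) \<in> B_space q" using direct_sum_zero[OF graded_B] by (simp add: B_space_def)
    then show ?thesis unfolding N z using linear_functional_zero[OF \<psi> b] by simp
  qed
  then show "?N \<in> B_space q" "\<psi> ?N = nabla (tensor x1_tilde ?P) k A" by auto
qed

text \<open>The Mackey formula with weights. Its last term draws on second degree
  \<open>l - 1\<close>, which leaves one factor \<open>r\<close> over; the other term keeps
  \<open>l\<close> and therefore its weight.\<close>

lemma slice_nabla_tilde: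
  assumes b: "b \<in> B_space q"
  shows "slice r (nabla_tilde q (tensor x1_tilde b)) k A =
    (\<lambda>l Y. 2 * (r ^ l * nabla (tensor x1_tilde (\<lambda>i X. delta_tilde q b i l X Y)) k A) +
      r * nabla_tilde q (tensor x1_tilde (slice r b k A)) l Y)"
proof (intro ext)
  fix l Y
  have du: "(\<lambda>Y. delta_tilde q b k j A Y) \<in> C_u q j" for j
    using Delta_C_u[OF B_spaceD(1)[OF b]] by (simp add: delta_tilde_Delta)
  have e: "slice r b k A (l - 1) = (\<lambda>Y. r ^ (l - 1) * delta_tilde q b k (l - 1) A Y)" by (simp add: slice_def)
  have "r ^ l * nabla_tilde q (tensor x1_tilde (\<lambda>j Y. delta_tilde q b k j A Y)) l Y =
    r * nabla_tilde q (tensor x1_tilde (slice r b k A)) l Y"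
  proof (cases "0 < l")
    case True
    then have "r ^ l = r * r ^ (l - 1)" by (cases l) auto
    then show ?thesis
      by (simp add: nabla_tilde_x1[of "\<lambda>j Y. delta_tilde q b k j A Y", OF du]
          nabla_tilde_x1[of "slice r b k A", OF B_spaceD(1)[OF slice_B_space[OF b]]] e ker_sum_cmult del: One_nat_def)
  qed (simp add: nabla_tilde_x1[of "\<lambda>j Y. delta_tilde q b k j A Y", OF du]
        nabla_tilde_x1[of "slice r b k A", OF B_spaceD(1)[OF slice_B_space[OF b]]])
  then show "slice r (nabla_tilde q (tensor x1_tilde b)) k A l Y =
    2 * (r ^ l * nabla (tensor x1_tilde (\<lambda>i X. delta_tilde q b i l X Y)) k A) +
      r * nabla_tilde q (tensor x1_tilde (slice r b k A)) l Y"
    by (simp add: slice_def[of r "nabla_tilde q (tensor x1_tilde b)"] mackey[OF B_spaceD(1)[OF b]] distrib_left)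
qed

text \<open>Induction raises the degree by one, which releases one factor \<open>s\<close>.\<close>

lemma nabla_x1_weight:
  fixes a :: "'a graded"
  assumes a: "a \<in> A_space"
  shows "s ^ k * nabla (tensor x1_tilde a) k A = s * nabla (tensor x1_tilde (\<lambda>k X. s ^ k * a k X)) k A"
proof -
  have an: "a n \<in> C_gl n" for n using a by (simp add: A_space_def Defs.direct_sum_def)
  have sn: "(\<lambda>X. s ^ n * a n X) \<in> C_gl n" for n
    using A_space_weight[OF a, of s] by (simp add: A_space_def Defs.direct_sum_def)
  note nab = nabla_x1[of a, OF an] nabla_x1[of "\<lambda>k X. s ^ k * a k X", OF sn]
  show ?thesis
  proof (cases "0 < k")
    case True
    then have "s ^ k = s * s ^ (k - 1)" by (cases k) auto
    then show ?thesis by (simp add: nab ker_sum_cmult del: One_nat_def)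
  qed (simp add: nab)
qed

text \<open>Harmonicity of \<open>\<psi>\<close> removes the induction from the Mackey term with
  factor \<open>1 - 2 * s\<close>, harmonicity of \<open>\<phi>\<close> from the one with factor
  \<open>2 * s\<close>.\<close>

lemma mix_harmonic:
  fixes \<phi> \<psi> :: "'a graded \<Rightarrow> real"
  assumes \<phi>: "\<phi> \<in> F_A" and \<psi>: "\<psi> \<in> F_B q" and b: "b \<in> B_space q"
  shows "mix q s \<phi> \<psi> (nabla_tilde q (tensor x1_tilde b)) = mix q s \<phi> \<psi> b"
proof -
  have \<phi>l: "linear_functional_on A_space \<phi>" and \<psi>l: "linear_functional_on (B_space q) \<psi>"
    using \<phi> \<psi> by (simp_all add: F_A_def F_B_def)
  let ?r = "1 - 2 * s" and ?b = "nabla_tilde q (tensor x1_tilde b)"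
  let ?P = "\<lambda>k X. \<psi> (slice ?r b k X)"
  let ?a = "\<lambda>k X. s ^ k * ?P k X"
  note P = functional_slice_A_space[OF b \<psi>l, of ?r]
  note a = A_space_weight[OF P, of s]
  note na = nabla_x1_A_space[OF a]
  have e: "\<psi> (slice ?r ?b k A) = 2 * nabla (tensor x1_tilde ?P) k A + ?r * ?P k A" for k A
  proof -
    let ?N = "\<lambda>l Y. ?r ^ l * nabla (tensor x1_tilde (\<lambda>i X. delta_tilde q b i l X Y)) k A"
    let ?M = "nabla_tilde q (tensor x1_tilde (slice ?r b k A))"
    note sb = slice_B_space[OF b, of ?r k A]
    note N = functional_slice_nabla[OF b \<psi>l, of ?r k A] and M = nabla_tilde_x1_B_space[OF sb]
    have N2: "(\<lambda>l Y. 2 * ?N l Y) \<in> B_space q"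
      using direct_sum_cmult[OF graded_B N(1)[unfolded B_space_def]] unfolding B_space_def .
    have M2: "(\<lambda>l Y. ?r * ?M l Y) \<in> B_space q"
      using direct_sum_cmult[OF graded_B M[unfolded B_space_def]] unfolding B_space_def .
    have "\<psi> (slice ?r ?b k A) = \<psi> (\<lambda>l Y. 2 * ?N l Y) + \<psi> (\<lambda>l Y. ?r * ?M l Y)"
      unfolding slice_nabla_tilde[OF b] by (rule conjunct1[OF \<psi>l[unfolded linear_functional_on_def], rule_format, OF N2 M2])
    also have "\<psi> (\<lambda>l Y. 2 * ?N l Y) = 2 * \<psi> ?N"
      by (rule conjunct2[OF \<psi>l[unfolded linear_functional_on_def], rule_format, OF N(1)])
    also have "\<psi> (\<lambda>l Y. ?r * ?M l Y) = ?r * \<psi> ?M"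
      by (rule conjunct2[OF \<psi>l[unfolded linear_functional_on_def], rule_format, OF M])
    also have "\<psi> ?M = ?P k A" using \<psi> sb by (simp add: F_B_def)
    finally show ?thesis unfolding N(2) .
  qed
  have "s ^ k * \<psi> (slice ?r ?b k A) = (2 * s) * nabla (tensor x1_tilde ?a) k A + ?r * ?a k A" for k A
  proof -
    have "s ^ k * \<psi> (slice ?r ?b k A) = 2 * (s ^ k * nabla (tensor x1_tilde ?P) k A) + ?r * ?a k A"
      unfolding e by (simp only: distrib_left ac_simps)
    also have "\<dots> = (2 * s) * nabla (tensor x1_tilde ?a) k A + ?r * ?a k A"
      unfolding nabla_x1_weight[OF P, of s k A] by (simp only: ac_simps)
    finally show ?thesis .
  qed
  then have "mix q s \<phi> \<psi> ?b = \<phi> (\<lambda>k A. (2 * s) * nabla (tensor x1_tilde ?a) k A + ?r * ?a k A)"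
    by (simp only: mix_eq[OF nabla_tilde_x1_B_space[OF b] \<phi>l \<psi>l])
  also have "\<dots> = \<phi> (\<lambda>k A. (2 * s) * nabla (tensor x1_tilde ?a) k A) + \<phi> (\<lambda>k A. ?r * ?a k A)"
    by (rule conjunct1[OF \<phi>l[unfolded linear_functional_on_def], rule_format])
      (use direct_sum_cmult[OF graded_A na[unfolded A_space_def]] direct_sum_cmult[OF graded_A a[unfolded A_space_def]]
        in \<open>simp_all only: A_space_def\<close>)
  also have "\<phi> (\<lambda>k A. (2 * s) * nabla (tensor x1_tilde ?a) k A) = (2 * s) * \<phi> (nabla (tensor x1_tilde ?a))"
    by (rule conjunct2[OF \<phi>l[unfolded linear_functional_on_def], rule_format, OF na])
  also have "\<phi> (\<lambda>k A. ?r * ?a k A) = ?r * \<phi> ?a"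
    by (rule conjunct2[OF \<phi>l[unfolded linear_functional_on_def], rule_format, OF a])
  also have "\<phi> (nabla (tensor x1_tilde ?a)) = \<phi> ?a" using \<phi> a by (simp add: F_A_def)
  \<comment> \<open>The two factors add up to 1; this is what dictates the weight
    \<open>1 - 2 * s\<close> in the mixing.\<close>
  also have "2 * s * \<phi> ?a + ?r * \<phi> ?a = \<phi> ?a" by (simp add: algebra_simps)
  also have "\<phi> ?a = mix q s \<phi> \<psi> b" by (rule mix_eq[OF b \<phi>l \<psi>l, symmetric])
  finally show ?thesis .
qed

lemma mix_F_B:
  fixes \<phi> \<psi> :: "'a graded \<Rightarrow> real"
  assumes "\<phi> \<in> F_A" "\<psi> \<in> F_B q" "0 \<le> s" "s \<le> 1 / 2"
  shows "mix q s \<phi> \<psi> \<in> F_B q"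
  using mix_linear mix_nonneg[OF assms] mix_harmonic[OF assms(1,2)] assms(1,2) by (auto simp: F_B_def F_A_def)

end

theorem theorem19:
  fixes q :: nat and s :: real
    and \<phi> \<psi> :: "'a::{field,finite} graded \<Rightarrow> real"
  assumes "primepow q" and "odd q" and "card (UNIV :: 'a set) = q ^ 2"
    and "0 \<le> s" and "s \<le> 1 / 2"
    and "\<phi> \<in> F_A" and "\<psi> \<in> F_B q"
  shows "mix q s \<phi> \<psi> \<in> F_B q \<and>
    (\<phi> \<in> F0_A \<and> \<psi> \<in> F0_B q \<longrightarrow> mix q s \<phi> \<psi> \<in> F0_B q)"
proof -
  interpret hermitian q "TYPE('a)" by (rule hermitian_finite_field[OF assms(1-3)])
  have "mix q s \<phi> \<psi> \<in> F_B q" by (rule mix_F_B[OF assms(6,7,4,5)])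
  then show ?thesis using mix_vanish[of \<phi> \<psi>] by (auto simp: F0_B_def)
qed

end
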